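(* Let $\mathcal{C}$ be a graded directed category with $\mathcal{C}_0=\bigoplus_{x\in\operatorname{Ob}\mathcal{C}}\mathcal{C}(x,x)$ self-injective. Define $\mathcal{D}$ to be the subcategory of $\mathcal{C}$ obtained by replacing each endomorphism ring by $k\cdot1$, the span of the identity endomorphism. Then: (1) $\mathcal{C}$ is a Koszul category (in the generalized sense given in the context) if and only if $\mathcal{C}$ is standardly stratified for the canonical pre-order $\preccurlyeq$ and $\mathcal{D}$ is a Koszul category in the classical sense. (2) If $\mathcal{C}$ is a Koszul category, then a graded $\mathcal{C}$-module $M$ is Koszul if and only if $M$ is a projective $\mathcal{C}_0$-module and the restriction $M\downarrow^{\mathcal{C}}_{\mathcal{D}}$ is a Koszul $\mathcal{D}$-module.
   Context: $k$ is an algebraically closed field. All categories are $k$-linear, skeletal (isomorphic objects are equal), have finitely many objects, and each $\mathcal{C}(x,y)$ is a finite-dimensional $k$-vector space. $\mathcal{C}$ is directed with respect to a partial order $\leqslant$ on $\operatorname{Ob}\mathcal{C}$ if $\mathcal{C}(x,y)\neq0$ only if $x\leqslant y$. $\mathcal{C}$ is identified with its associated algebra $\bigoplus_{x,y}\mathcal{C}(x,y)$ (product $\beta\cdot\alpha=\beta\circ\alpha$ when composable, $0$ otherwise); $\mathcal{C}$-modules are left modules. A graded directed category carries a grading $\mathcal{C}=\bigoplus_{i\geqslant0}\mathcal{C}_i$ with $\mathcal{C}_i=\bigoplus_{x,y}\mathcal{C}(x,y)_i$, $\mathcal{C}_i\cdot\mathcal{C}_j=\mathcal{C}_{i+j}$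 for all $i,j\geqslant0$, and $\mathcal{C}_0=\bigoplus_x\mathcal{C}(x,x)$. An algebra is self-injective if each of its projective modules is injective. Graded modules $M=\bigoplus_iM_i$ are locally finite ($\dim_kM_i<\infty$); $M$ is generated in degree $s$ if $M=\mathcal{C}\cdot M_s$. $\mathcal{C}_0$ is a graded $\mathcal{C}$-module, as the quotient of $\mathcal{C}$ by $\bigoplus_{i\geqslant1}\mathcal{C}_i$. The zero module is regarded as projective. The subcategory $\mathcal{D}$: $\operatorname{Ob}\mathcal{D}=\operatorname{Ob}\mathcal{C}$, $\mathcal{D}(x,x)=k\cdot1_x$, and $\mathcal{D}(x,y)=\mathcal{C}(x,y)$ for $x\neq y$. It is a graded directed category with $\mathcal{D}_i=\mathcal{C}_i$ for $i\geqslant1$ and $\mathcal{D}_0=\bigoplus_xk\cdot1_x$ semisimple. $M\downarrow^{\mathcal{C}}_{\mathcal{D}}$ is $M$ regarded as a $\mathcal{D}$-module. A graded $\mathcal{C}$-module (resp. $\mathcal{D}$-module) $M$ is Koszul if it is generated in degree $0$ and has a graded projective resolution $\cdots\to P^1\to P^0\to M\to0$ with each $P^i$ generated in degree $i$. $\mathcal{C}$ is a Koszul category if $\mathcal{C}_0$ is a Koszul $\mathcal{C}$-module; $\mathcal{D}$ is Koszul in the classical sense if $\mathcal{D}_0$ (semisimple) is a Koszul $\mathcal{D}$-module. Standard stratification: for each object $x$ choose a complete set $\{e_\lambda\}_{\lambda\in\Lambda_x}$ of orthogonal primitive idempotents of $\mathcal{C}(x,x)$ with sum $1_x$; let $\Lambda=\bigsqcup_x\Lambda_x$.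 The canonical pre-order is: for $\lambda\in\Lambda_x,\mu\in\Lambda_y$, $\lambda\preccurlyeq\mu$ iff $x\leqslant y$. Put $P_\lambda=\mathcal{C}e_\lambda$ and $\Delta_\lambda=P_\lambda/\sum_{\mu\not\preccurlyeq\lambda}\operatorname{tr}_{P_\mu}(P_\lambda)$, where $\operatorname{tr}_{P_\mu}(P_\lambda)$ is the sum of the images of all homomorphisms $P_\mu\to P_\lambda$. $\mathcal{C}$ is standardly stratified for $\preccurlyeq$ if every $P_\lambda$ has a finite filtration with successive quotients isomorphic to modules $\Delta_\mu$. *)

theory Defs
  imports
    "HOL-Computational_Algebra.Polynomial"
    "HOL-Algebra.AbelCoset"
    "HOL-Algebra.Module"
    "HOL-Algebra.Generated_Groups"
begin

section \<open>Left modules over a ring\<close>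

text \<open>
  The locale \<^verbatim>\<open>module\<close> of HOL-Algebra asks for a commutative ring of scalars; the following is
  the same list of axioms over an arbitrary ring.
\<close>

locale left_module = R?: ring R + M?: abelian_group M
  for R :: "('r, 'x) ring_scheme" (structure) and M :: "('r, 'm, 'y) module_scheme" (structure) +
  assumes smult_closed:
      "\<lbrakk>a \<in> carrier R; x \<in> carrier M\<rbrakk> \<Longrightarrow> a \<odot>\<^bsub>M\<^esub> x \<in> carrier M"
    and smult_l_distr:
      "\<lbrakk>a \<in> carrier R; b \<in> carrier R; x \<in> carrier M\<rbrakk> \<Longrightarrow>
        (a \<oplus>\<^bsub>R\<^esub> b) \<odot>\<^bsub>M\<^esub> x = a \<odot>\<^bsub>M\<^esub> x \<oplus>\<^bsub>M\<^esub> b \<odot>\<^bsub>M\<^esub> x"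
    and smult_r_distr:
      "\<lbrakk>a \<in> carrier R; x \<in> carrier M; y \<in> carrier M\<rbrakk> \<Longrightarrow>
        a \<odot>\<^bsub>M\<^esub> (x \<oplus>\<^bsub>M\<^esub> y) = a \<odot>\<^bsub>M\<^esub> x \<oplus>\<^bsub>M\<^esub> a \<odot>\<^bsub>M\<^esub> y"
    and smult_assoc1:
      "\<lbrakk>a \<in> carrier R; b \<in> carrier R; x \<in> carrier M\<rbrakk> \<Longrightarrow>
        (a \<otimes>\<^bsub>R\<^esub> b) \<odot>\<^bsub>M\<^esub> x = a \<odot>\<^bsub>M\<^esub> (b \<odot>\<^bsub>M\<^esub> x)"
    and smult_one:
      "x \<in> carrier M \<Longrightarrow> \<one>\<^bsub>R\<^esub> \<odot>\<^bsub>M\<^esub> x = x"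

definition lmod_hom ::
  "('r, 'x) ring_scheme \<Rightarrow> ('r, 'm, 'y) module_scheme \<Rightarrow> ('r, 'n, 'z) module_scheme \<Rightarrow> ('m \<Rightarrow> 'n) set"
  where "lmod_hom R M N =
    {f \<in> carrier M \<rightarrow> carrier N.
      (\<forall>x\<in>carrier M. \<forall>y\<in>carrier M. f (x \<oplus>\<^bsub>M\<^esub> y) = f x \<oplus>\<^bsub>N\<^esub> f y) \<and>
      (\<forall>a\<in>carrier R. \<forall>x\<in>carrier M. f (a \<odot>\<^bsub>M\<^esub> x) = a \<odot>\<^bsub>N\<^esub> f x)}"

definition lmod_isomorphic ::
  "('r, 'x) ring_scheme \<Rightarrow> ('r, 'm, 'y) module_scheme \<Rightarrow> ('r, 'n, 'z) module_scheme \<Rightarrow> bool"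
  where "lmod_isomorphic R M N \<longleftrightarrow> (\<exists>f\<in>lmod_hom R M N. bij_betw f (carrier M) (carrier N))"

definition quotient_module ::
  "('r, 'm, 'y) module_scheme \<Rightarrow> 'm set \<Rightarrow> ('r, 'm set) module"
  where "quotient_module M N =
    \<lparr>carrier = a_rcosets\<^bsub>M\<^esub> N, mult = undefined, one = undefined,
     zero = N, add = set_add M,
     smult = (\<lambda>a X. \<Union>x\<in>X. N +>\<^bsub>M\<^esub> (a \<odot>\<^bsub>M\<^esub> x))\<rparr>"

definition regular_module :: "('r, 'x) ring_scheme \<Rightarrow> ('r, 'r) module"
  where "regular_module R =
    \<lparr>carrier = carrier R, mult = undefined, one = undefined,
     zero = \<zero>\<^bsub>R\<^esub>, add = add R, smult = mult R\<rparr>"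

definition trace_submodule ::
  "('r, 'x) ring_scheme \<Rightarrow> ('r, 'm, 'y) module_scheme \<Rightarrow> ('r, 'n, 'z) module_scheme \<Rightarrow> 'n set"
  where "trace_submodule R P M =
    generate (add_monoid M) (\<Union>f\<in>lmod_hom R P M. f ` carrier P)"

text \<open>
  HOL cannot quantify over modules on all types at once, so the test objects below live on fixed
  types that are large enough for nothing to be lost.  For projectivity of a module on a type
  \<^verbatim>\<open>'m\<close>, the free module on its carrier (finitely supported functions \<^verbatim>\<open>'m \<Rightarrow> 'r\<close>) and the module
  itself occur among the test objects, so that the lifting property makes it a direct summand of
  a free module.  For injectivity, the left ideals of \<^verbatim>\<open>R\<close> and \<^verbatim>\<open>R\<close> itself have copies on the type
  \<^verbatim>\<open>nat \<Rightarrow> 'r\<close>, which suffices by Baer's criterion.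
\<close>

definition projective_module ::
  "('r, 'x) ring_scheme \<Rightarrow> ('r, 'm, 'y) module_scheme \<Rightarrow> bool"
  where "projective_module R P \<longleftrightarrow> left_module R P \<and>
    (\<forall>(A :: ('r, 'm \<Rightarrow> 'r) module) (B :: ('r, 'm) module) p f.
      left_module R A \<and> left_module R B \<and>
      p \<in> lmod_hom R A B \<and> p ` carrier A = carrier B \<and> f \<in> lmod_hom R P B \<longrightarrow>
      (\<exists>g\<in>lmod_hom R P A. \<forall>x\<in>carrier P. p (g x) = f x))"

definition injective_module ::
  "('r, 'x) ring_scheme \<Rightarrow> ('r, 'm, 'y) module_scheme \<Rightarrow> bool"
  where "injective_module R I \<longleftrightarrow> left_module R I \<and>
    (\<forall>(A :: ('r, nat \<Rightarrow> 'r) module) (B :: ('r, nat \<Rightarrow> 'r) module) j f.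
      left_module R A \<and> left_module R B \<and>
      j \<in> lmod_hom R A B \<and> inj_on j (carrier A) \<and> f \<in> lmod_hom R A I \<longrightarrow>
      (\<exists>g\<in>lmod_hom R B I. \<forall>x\<in>carrier A. g (j x) = f x))"

text \<open>
  The type \<^verbatim>\<open>nat \<Rightarrow> 'r\<close> carries copies of all direct summands of countably generated free modules,
  in particular of all finitely generated projective modules.  Over a finite-dimensional algebra,
  every projective module is a direct sum of such modules, and direct sums of injective modules
  are injective.
\<close>

definition self_injective :: "('r, 'x) ring_scheme \<Rightarrow> bool"
  where "self_injective R \<longleftrightarrow>
    (\<forall>P :: ('r, nat \<Rightarrow> 'r) module. projective_module R P \<longrightarrow> injective_module R P)"


section \<open>Graded algebras and graded modules\<close>

text \<open>
  A \<^verbatim>\<open>'k\<close>-algebra is a ring record together with a multiplication by scalars from the type \<^verbatim>\<open>'k\<close>.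
\<close>

record ('k, 'r) graded_algebra = "('k, 'r) module" +
  degree_part :: "nat \<Rightarrow> 'r set"

record ('r, 'm) gmodule = "('r, 'm) module" +
  mdegree_part :: "int \<Rightarrow> 'm set"

definition algebra_scalar :: "('k, 'r, 'x) graded_algebra_scheme \<Rightarrow> 'k \<Rightarrow> 'r"
  where "algebra_scalar A c = c \<odot>\<^bsub>A\<^esub> \<one>\<^bsub>A\<^esub>"

text \<open>The vector space structure of a module comes from the unit of the algebra.\<close>

definition finite_dimensional_part ::
  "('k, 'r, 'x) graded_algebra_scheme \<Rightarrow> ('r, 'm, 'y) module_scheme \<Rightarrow> 'm set \<Rightarrow> bool"
  where "finite_dimensional_part A M V \<longleftrightarrow>
    (\<exists>B. finite B \<and> B \<subseteq> V \<and>
      (\<forall>v\<in>V. \<exists>c :: 'm \<Rightarrow> 'k. v = (\<Oplus>\<^bsub>M\<^esub>b\<in>B. algebra_scalar A (c b) \<odot>\<^bsub>M\<^esub> b)))"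

locale graded_left_module = left_module A M
  for A :: "('k, 'r, 'x) graded_algebra_scheme" (structure)
    and M :: "('r, 'm, 'y) gmodule_scheme" (structure) +
  assumes mdegree_subgroup: "subgroup (mdegree_part M i) (add_monoid M)"
    and mdegree_direct_sum:
      "m \<in> carrier M \<Longrightarrow>
        \<exists>!c. (\<forall>i. c i \<in> mdegree_part M i) \<and> finite {i. c i \<noteq> \<zero>\<^bsub>M\<^esub>} \<and>
             m = (\<Oplus>\<^bsub>M\<^esub>i\<in>{i. c i \<noteq> \<zero>\<^bsub>M\<^esub>}. c i)"
    and mdegree_smult:
      "\<lbrakk>a \<in> degree_part A i; m \<in> mdegree_part M j\<rbrakk> \<Longrightarrow>
        a \<odot>\<^bsub>M\<^esub> m \<in> mdegree_part M (int i + j)"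
    and locally_finite: "finite_dimensional_part A M (mdegree_part M i)"

definition generated_in_degree ::
  "('k, 'r, 'x) graded_algebra_scheme \<Rightarrow> ('r, 'm, 'y) gmodule_scheme \<Rightarrow> int \<Rightarrow> bool"
  where "generated_in_degree A M s \<longleftrightarrow>
    carrier M = generate (add_monoid M)
      {a \<odot>\<^bsub>M\<^esub> m | a m. a \<in> carrier A \<and> m \<in> mdegree_part M s}"

definition graded_hom ::
  "('k, 'r, 'x) graded_algebra_scheme \<Rightarrow> ('r, 'm, 'y) gmodule_scheme \<Rightarrow> ('r, 'n, 'z) gmodule_scheme \<Rightarrow>
    ('m \<Rightarrow> 'n) set"
  where "graded_hom A M N =
    {f \<in> lmod_hom A M N. \<forall>i. f ` mdegree_part M i \<subseteq> mdegree_part N i}"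

text \<open>
  Each term of the resolution is locally finite and generated in a single degree, hence finitely
  generated and projective, and therefore has a copy on the type \<^verbatim>\<open>nat \<Rightarrow> 'r\<close>.
\<close>

definition linear_projective_resolution ::
  "('k, 'r, 'x) graded_algebra_scheme \<Rightarrow> ('r, 'm, 'y) gmodule_scheme \<Rightarrow>
    (nat \<Rightarrow> ('r, nat \<Rightarrow> 'r) gmodule) \<Rightarrow> (nat \<Rightarrow> (nat \<Rightarrow> 'r) \<Rightarrow> (nat \<Rightarrow> 'r)) \<Rightarrow>
    ((nat \<Rightarrow> 'r) \<Rightarrow> 'm) \<Rightarrow> bool"
  where "linear_projective_resolution A M P d \<epsilon> \<longleftrightarrow>
    (\<forall>i. graded_left_module A (P i) \<and> projective_module A (P i) \<and>
         generated_in_degree A (P i) (int i)) \<and>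
    \<epsilon> \<in> graded_hom A (P 0) M \<and>
    (\<forall>i. d i \<in> graded_hom A (P (Suc i)) (P i)) \<and>
    \<epsilon> ` carrier (P 0) = carrier M \<and>
    d 0 ` carrier (P 1) = a_kernel (P 0) M \<epsilon> \<and>
    (\<forall>i. d (Suc i) ` carrier (P (Suc (Suc i))) = a_kernel (P (Suc i)) (P i) (d i))"

definition koszul_module ::
  "('k, 'r, 'x) graded_algebra_scheme \<Rightarrow> ('r, 'm, 'y) gmodule_scheme \<Rightarrow> bool"
  where "koszul_module A M \<longleftrightarrow>
    graded_left_module A M \<and> generated_in_degree A M 0 \<and>
    (\<exists>P d \<epsilon>. linear_projective_resolution A M P d \<epsilon>)"

definition positive_part :: "('k, 'r, 'x) graded_algebra_scheme \<Rightarrow> 'r set"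
  where "positive_part A = generate (add_monoid A) (\<Union>i\<in>{1..}. degree_part A i)"

definition degree_zero_module ::
  "('k, 'r, 'x) graded_algebra_scheme \<Rightarrow> ('r, 'r set) gmodule"
  where "degree_zero_module A =
    module.extend (quotient_module (regular_module A) (positive_part A))
      (gmodule.fields
        (\<lambda>i. if 0 \<le> i then (\<lambda>a. positive_part A +>\<^bsub>A\<^esub> a) ` degree_part A (nat i)
             else {positive_part A}))"

definition degree_zero_algebra ::
  "('k, 'r, 'x) graded_algebra_scheme \<Rightarrow> ('k, 'r, 'x) graded_algebra_scheme"
  where "degree_zero_algebra A = A\<lparr>carrier := degree_part A 0\<rparr>"


section \<open>Graded directed categories\<close>

text \<open>
  All hom-spaces are subspaces of one ambient vector space, the type \<^verbatim>\<open>'a\<close> with the scalar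
  multiplication \<^verbatim>\<open>cat_scale\<close>.  They may overlap, so composition is indexed by the objects:
  \<^verbatim>\<open>cat_comp C x y z g f\<close> is the composite of \<^verbatim>\<open>f\<close> from \<^verbatim>\<open>x\<close> to \<^verbatim>\<open>y\<close> with \<^verbatim>\<open>g\<close> from \<^verbatim>\<open>y\<close> to \<^verbatim>\<open>z\<close>.
\<close>

record ('k, 'o, 'a) graded_category =
  cat_obj :: "'o set"
  cat_scale :: "'k \<Rightarrow> 'a \<Rightarrow> 'a"
  cat_hom :: "'o \<Rightarrow> 'o \<Rightarrow> 'a set"
  cat_comp :: "'o \<Rightarrow> 'o \<Rightarrow> 'o \<Rightarrow> 'a \<Rightarrow> 'a \<Rightarrow> 'a"
  cat_ident :: "'o \<Rightarrow> 'a"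
  cat_degree :: "'o \<Rightarrow> 'o \<Rightarrow> nat \<Rightarrow> 'a set"

text \<open>
  An element of the associated algebra is the family of its components \<^verbatim>\<open>a x y\<close> in \<^verbatim>\<open>cat_hom x y\<close>,
  extended by zero.
\<close>

definition families ::
  "'o set \<Rightarrow> ('o \<Rightarrow> 'o \<Rightarrow> 'a::zero set) \<Rightarrow> ('o \<Rightarrow> 'o \<Rightarrow> 'a) set"
  where "families X H =
    {a. \<forall>x y. if x \<in> X \<and> y \<in> X then a x y \<in> H x y else a x y = 0}"

definition category_algebra ::
  "('k, 'o, 'a::ab_group_add) graded_category \<Rightarrow> ('k, 'o \<Rightarrow> 'o \<Rightarrow> 'a) graded_algebra"
  where "category_algebra C =
    \<lparr>carrier = families (cat_obj C) (cat_hom C),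
     mult = (\<lambda>b a x z. if x \<in> cat_obj C \<and> z \<in> cat_obj C
                       then \<Sum>y\<in>cat_obj C. cat_comp C x y z (b y z) (a x y) else 0),
     one = (\<lambda>x y. if x = y \<and> x \<in> cat_obj C then cat_ident C x else 0),
     zero = (\<lambda>x y. 0),
     add = (\<lambda>a b x y. a x y + b x y),
     smult = (\<lambda>c a x y. cat_scale C c (a x y)),
     degree_part = (\<lambda>i. families (cat_obj C) (\<lambda>x y. cat_degree C x y i))\<rparr>"

locale linear_category = V: vector_space "cat_scale C"
  for C :: "('k::field, 'o, 'a::ab_group_add) graded_category" +
  assumes finite_obj: "finite (cat_obj C)"
    and hom_subspace: "\<lbrakk>x \<in> cat_obj C; y \<in> cat_obj C\<rbrakk> \<Longrightarrow> V.subspace (cat_hom C x y)"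
    and hom_finite_dim: "\<lbrakk>x \<in> cat_obj C; y \<in> cat_obj C\<rbrakk> \<Longrightarrow> \<exists>B. finite B \<and> cat_hom C x y = V.span B"
    and ident_closed: "x \<in> cat_obj C \<Longrightarrow> cat_ident C x \<in> cat_hom C x x"
    and comp_closed:
      "\<lbrakk>x \<in> cat_obj C; y \<in> cat_obj C; z \<in> cat_obj C; f \<in> cat_hom C x y; g \<in> cat_hom C y z\<rbrakk> \<Longrightarrow>
        cat_comp C x y z g f \<in> cat_hom C x z"
    and comp_add_right:
      "\<lbrakk>x \<in> cat_obj C; y \<in> cat_obj C; z \<in> cat_obj C; f \<in> cat_hom C x y; f' \<in> cat_hom C x y; g \<in> cat_hom C y z\<rbrakk> \<Longrightarrow>
        cat_comp C x y z g (f + f') = cat_comp C x y z g f + cat_comp C x y z g f'"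
    and comp_add_left:
      "\<lbrakk>x \<in> cat_obj C; y \<in> cat_obj C; z \<in> cat_obj C; f \<in> cat_hom C x y; g \<in> cat_hom C y z; g' \<in> cat_hom C y z\<rbrakk> \<Longrightarrow>
        cat_comp C x y z (g + g') f = cat_comp C x y z g f + cat_comp C x y z g' f"
    and comp_scale_right:
      "\<lbrakk>x \<in> cat_obj C; y \<in> cat_obj C; z \<in> cat_obj C; f \<in> cat_hom C x y; g \<in> cat_hom C y z\<rbrakk> \<Longrightarrow>
        cat_comp C x y z g (cat_scale C c f) = cat_scale C c (cat_comp C x y z g f)"
    and comp_scale_left:
      "\<lbrakk>x \<in> cat_obj C; y \<in> cat_obj C; z \<in> cat_obj C; f \<in> cat_hom C x y; g \<in> cat_hom C y z\<rbrakk> \<Longrightarrow>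
        cat_comp C x y z (cat_scale C c g) f = cat_scale C c (cat_comp C x y z g f)"
    and comp_assoc:
      "\<lbrakk>w \<in> cat_obj C; x \<in> cat_obj C; y \<in> cat_obj C; z \<in> cat_obj C;
        f \<in> cat_hom C w x; g \<in> cat_hom C x y; h \<in> cat_hom C y z\<rbrakk> \<Longrightarrow>
        cat_comp C w y z h (cat_comp C w x y g f) = cat_comp C w x z (cat_comp C x y z h g) f"
    and comp_ident_right:
      "\<lbrakk>x \<in> cat_obj C; y \<in> cat_obj C; f \<in> cat_hom C x y\<rbrakk> \<Longrightarrow> cat_comp C x x y f (cat_ident C x) = f"
    and comp_ident_left:
      "\<lbrakk>x \<in> cat_obj C; y \<in> cat_obj C; f \<in> cat_hom C x y\<rbrakk> \<Longrightarrow> cat_comp C x y y (cat_ident C y) f = f"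
    and skeletal:
      "\<lbrakk>x \<in> cat_obj C; y \<in> cat_obj C; f \<in> cat_hom C x y; g \<in> cat_hom C y x;
        cat_comp C x y x g f = cat_ident C x; cat_comp C y x y f g = cat_ident C y\<rbrakk> \<Longrightarrow> x = y"

locale directed_category = linear_category C
  for C :: "('k::field, 'o, 'a::ab_group_add) graded_category" +
  fixes r :: "'o rel"
  assumes partial_order: "partial_order_on (cat_obj C) r"
    and directed:
      "\<lbrakk>x \<in> cat_obj C; y \<in> cat_obj C; cat_hom C x y \<noteq> {0}\<rbrakk> \<Longrightarrow> (x, y) \<in> r"

locale graded_directed_category = directed_category C r
  for C :: "('k::field, 'o, 'a::ab_group_add) graded_category" and r +
  assumes cat_degree_subspace:
      "\<lbrakk>x \<in> cat_obj C; y \<in> cat_obj C\<rbrakk> \<Longrightarrow>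
        V.subspace (cat_degree C x y i) \<and> cat_degree C x y i \<subseteq> cat_hom C x y"
    and cat_degree_direct_sum:
      "\<lbrakk>x \<in> cat_obj C; y \<in> cat_obj C; f \<in> cat_hom C x y\<rbrakk> \<Longrightarrow>
        \<exists>!c. (\<forall>i. c i \<in> cat_degree C x y i) \<and> finite {i. c i \<noteq> 0} \<and> f = (\<Sum>i | c i \<noteq> 0. c i)"
    and degree_part_mult:
      "generate (add_monoid (category_algebra C))
        {b \<otimes>\<^bsub>category_algebra C\<^esub> a | a b.
          b \<in> degree_part (category_algebra C) i \<and> a \<in> degree_part (category_algebra C) j}
       = degree_part (category_algebra C) (i + j)"
    and degree_part_zero:
      "degree_part (category_algebra C) 0 =
        {a \<in> carrier (category_algebra C). \<forall>x y. x \<noteq> y \<longrightarrow> a x y = 0}"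

text \<open>
  The algebra of the subcategory below, like the degree zero part of the algebra, has the same
  operations on a smaller carrier.  Hence the restriction of a module to either of them is the
  same module record, read over the smaller algebra.
\<close>

definition identity_span :: "('k, 'o, 'a) graded_category \<Rightarrow> 'o \<Rightarrow> 'a set"
  where "identity_span C x = range (\<lambda>c. cat_scale C c (cat_ident C x))"

definition scalar_endo_subcategory ::
  "('k, 'o, 'a) graded_category \<Rightarrow> ('k, 'o, 'a) graded_category"
  where "scalar_endo_subcategory C =
    C\<lparr>cat_hom := (\<lambda>x y. if x = y then identity_span C x else cat_hom C x y),
      cat_degree := (\<lambda>x y i. if x = y \<and> i = 0 then identity_span C x else cat_degree C x y i)\<rparr>"

definition koszul_category :: "('k, 'o, 'a::ab_group_add) graded_category \<Rightarrow> bool"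
  where "koszul_category C \<longleftrightarrow>
    koszul_module (category_algebra C) (degree_zero_module (category_algebra C))"


section \<open>Standard stratification\<close>

definition idempotent_endo :: "('k, 'o, 'a) graded_category \<Rightarrow> 'o \<Rightarrow> 'a \<Rightarrow> bool"
  where "idempotent_endo C x e \<longleftrightarrow> e \<in> cat_hom C x x \<and> cat_comp C x x x e e = e"

definition orthogonal_endos :: "('k, 'o, 'a::zero) graded_category \<Rightarrow> 'o \<Rightarrow> 'a \<Rightarrow> 'a \<Rightarrow> bool"
  where "orthogonal_endos C x e f \<longleftrightarrow> cat_comp C x x x e f = 0 \<and> cat_comp C x x x f e = 0"

definition primitive_idempotent ::
  "('k, 'o, 'a::ab_group_add) graded_category \<Rightarrow> 'o \<Rightarrow> 'a \<Rightarrow> bool"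
  where "primitive_idempotent C x e \<longleftrightarrow>
    idempotent_endo C x e \<and> e \<noteq> 0 \<and>
    (\<forall>f g. idempotent_endo C x f \<and> idempotent_endo C x g \<and> orthogonal_endos C x f g \<and> e = f + g
      \<longrightarrow> f = 0 \<or> g = 0)"

text \<open>
  Orthogonal primitive idempotents are pairwise distinct, so a family of them at the object \<^verbatim>\<open>x\<close> is
  given by the set \<^verbatim>\<open>E x\<close> of its members; an index is then a pair \<^verbatim>\<open>(x, e)\<close> with \<^verbatim>\<open>e \<in> E x\<close>.
\<close>

definition complete_primitive_idempotents ::
  "('k, 'o, 'a::ab_group_add) graded_category \<Rightarrow> ('o \<Rightarrow> 'a set) \<Rightarrow> bool"
  where "complete_primitive_idempotents C E \<longleftrightarrow>
    (\<forall>x\<in>cat_obj C. finite (E x) \<and> (\<forall>e\<in>E x. primitive_idempotent C x e) \<and>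
      (\<forall>e\<in>E x. \<forall>f\<in>E x. e \<noteq> f \<longrightarrow> orthogonal_endos C x e f) \<and>
      \<Sum>(E x) = cat_ident C x)"

definition strat_index ::
  "('k, 'o, 'a) graded_category \<Rightarrow> ('o \<Rightarrow> 'a set) \<Rightarrow> ('o \<times> 'a) set"
  where "strat_index C E = Sigma (cat_obj C) E"

definition canonical_le :: "'o rel \<Rightarrow> 'o \<times> 'a \<Rightarrow> 'o \<times> 'a \<Rightarrow> bool"
  where "canonical_le r l m \<longleftrightarrow> (fst l, fst m) \<in> r"

definition index_idempotent :: "'o \<times> 'a::zero \<Rightarrow> 'o \<Rightarrow> 'o \<Rightarrow> 'a"
  where "index_idempotent l = (\<lambda>x y. if x = fst l \<and> y = fst l then snd l else 0)"

definition strat_projective ::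
  "('k, 'o, 'a::ab_group_add) graded_category \<Rightarrow> 'o \<times> 'a \<Rightarrow>
    ('o \<Rightarrow> 'o \<Rightarrow> 'a, 'o \<Rightarrow> 'o \<Rightarrow> 'a) module"
  where "strat_projective C l =
    (regular_module (category_algebra C))
      \<lparr>carrier := (\<lambda>a. a \<otimes>\<^bsub>category_algebra C\<^esub> index_idempotent l) ` carrier (category_algebra C)\<rparr>"

definition standard_module ::
  "('k, 'o, 'a::ab_group_add) graded_category \<Rightarrow> 'o rel \<Rightarrow> ('o \<Rightarrow> 'a set) \<Rightarrow> 'o \<times> 'a \<Rightarrow>
    ('o \<Rightarrow> 'o \<Rightarrow> 'a, ('o \<Rightarrow> 'o \<Rightarrow> 'a) set) module"
  where "standard_module C r E l =
    quotient_module (strat_projective C l)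
      (generate (add_monoid (strat_projective C l))
        (\<Union>m\<in>{m \<in> strat_index C E. \<not> canonical_le r m l}.
          trace_submodule (category_algebra C) (strat_projective C m) (strat_projective C l)))"

definition has_standard_filtration ::
  "('k, 'o, 'a::ab_group_add) graded_category \<Rightarrow> 'o rel \<Rightarrow> ('o \<Rightarrow> 'a set) \<Rightarrow>
    ('o \<Rightarrow> 'o \<Rightarrow> 'a, 'm) module \<Rightarrow> bool"
  where "has_standard_filtration C r E M \<longleftrightarrow>
    (\<exists>(n::nat) F. F 0 = {\<zero>\<^bsub>M\<^esub>} \<and> F n = carrier M \<and>
      (\<forall>j\<le>n. submodule (F j) (category_algebra C) M) \<and>
      (\<forall>j<n. F j \<subseteq> F (Suc j) \<and>
        (\<exists>m\<in>strat_index C E.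
          lmod_isomorphic (category_algebra C)
            (quotient_module (M\<lparr>carrier := F (Suc j)\<rparr>) (F j)) (standard_module C r E m))))"

definition standardly_stratified ::
  "('k, 'o, 'a::ab_group_add) graded_category \<Rightarrow> 'o rel \<Rightarrow> ('o \<Rightarrow> 'a set) \<Rightarrow> bool"
  where "standardly_stratified C r E \<longleftrightarrow>
    (\<forall>l\<in>strat_index C E. has_standard_filtration C r E (strat_projective C l))"

end

theory Submission
  imports Defs "HOL-Library.Function_Algebras" "HOL-Library.Nat_Bijection"
begin

text \<open>
  Let \<open>S\<close> be the degree zero part of the algebra \<open>A\<close> of \<open>C\<close>, and \<open>B\<close> the algebra of \<open>D\<close>.  A module
  \<open>M\<close> generated in degree 0 with \<open>M\<^sub>0\<close> projective over \<open>S\<close> is covered by \<open>A \<otimes>\<^sub>S M\<^sub>0\<close>, and it is Koszul iff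
  iterating this construction always yields a kernel which, shifted by one, is again of this kind.
  If \<open>M\<close> is Koszul and the \<open>A\<^sub>d\<close> are projective over \<open>S\<close>, then so are the \<open>M\<^sub>d\<close>: inductively, the kernel of
  \<open>A\<^sub>d \<otimes>\<^sub>S M\<^sub>0 \<rightarrow> M\<^sub>d\<close> is projective, hence injective, and splits off.  Applied to the shifted positive part \<open>J\<close>
  of \<open>A\<close>, which is Koszul iff \<open>S\<close> is, this gives the projectivity of the \<open>A\<^sub>d\<close> themselves.  Since \<open>J\<close> is the same
  for \<open>A\<close> and \<open>B\<close>, the covers of a module over \<open>A\<close> and over \<open>B\<close> differ by direct summands of copies of \<open>J\<close>,
  and linearity can be transferred between \<open>A\<close> and \<open>B\<close> syzygy by syzygy.

  The \<open>(x, x)\<close> component identifies the standard module of an idempotent \<open>e\<close> at \<open>x\<close> with \<open>S e\<close>.  So a standard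
  filtration of \<open>A e\<close> splits over \<open>S\<close> and makes \<open>A e\<close> projective.  Conversely, let \<open>U \<subseteq> A e\<close> be an \<open>A\<close>-submodule
  that is projective over \<open>S\<close>, and \<open>y\<close> a minimal object with \<open>1\<^sub>y U \<noteq> 0\<close>.  Then \<open>1\<^sub>y U\<close> maps onto
  some \<open>S e'\<close> by Fitting's lemma, minimality of \<open>y\<close> makes \<open>U \<rightarrow> 1\<^sub>y U \<rightarrow> S e'\<close> a map of \<open>A\<close>-modules onto a standard
  module, and its kernel is again projective over \<open>S\<close>.
\<close>

text \<open>Why iterated covers decide linearity: in a linear resolution the kernel of P^0
  \<rightarrow> M is the image of a module generated in degree 1, so it vanishes in degree 0. Thus
  P^0 and M have the same degree 0 part, and P^0, being projective and generated there, must be the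
  tensor cover of M_0. No resolution has to be carried along; the sequence of kernels contains all
  information. The formal obstacle is that iterated tensor products would change their type at every
  step. A finitely generated projective M_0 is therefore presented by a dual basis, whose idempotent
  matrix cuts the cover out of a finite free module. All covers and kernels then lie on the single
  type \<open>nat \<Rightarrow> 'r\<close>, and linearity up to step n is a plain recursion on n. A
  module on another type is first replaced by a copy on this one, built from coordinates of its
  finite-dimensional components. The comparison of the two algebras also uses that S is projective
  over the degree zero part of B: that part is a product of copies of k, over which S is a family of
  vector spaces.\<close>

section \<open>Additive subgroups of a type class group and maps additive on them\<close>

definition agrp :: "'a::ab_group_add set \<Rightarrow> bool"
  where "agrp Q \<longleftrightarrow> 0 \<in> Q \<and> (\<forall>x\<in>Q. \<forall>y\<in>Q. x + y \<in> Q) \<and> (\<forall>x\<in>Q. - x \<in> Q)"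

definition additive_on :: "'a::ab_group_add set \<Rightarrow> ('a \<Rightarrow> 'b::ab_group_add) \<Rightarrow> bool"
  where "additive_on Q f \<longleftrightarrow> (\<forall>x\<in>Q. \<forall>y\<in>Q. f (x + y) = f x + f y)"

lemma agrp_zero: "agrp Q \<Longrightarrow> 0 \<in> Q"
  and agrp_add: "agrp Q \<Longrightarrow> x \<in> Q \<Longrightarrow> y \<in> Q \<Longrightarrow> x + y \<in> Q"
  and agrp_minus: "agrp Q \<Longrightarrow> x \<in> Q \<Longrightarrow> - x \<in> Q"
  by (auto simp: agrp_def)

lemma agrp_diff: "agrp Q \<Longrightarrow> x \<in> Q \<Longrightarrow> y \<in> Q \<Longrightarrow> x - y \<in> Q"
  using agrp_add[of Q x "- y"] agrp_minus[of Q y] by simp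

lemma agrp_sum: "agrp Q \<Longrightarrow> (\<And>i. i \<in> I \<Longrightarrow> g i \<in> Q) \<Longrightarrow> sum g I \<in> Q"
  by (induction I rule: infinite_finite_induct) (auto simp: agrp_def)

lemma agrp_Int: "agrp Q \<Longrightarrow> agrp R \<Longrightarrow> agrp (Q \<inter> R)"
  by (auto simp: agrp_def)

lemma additive_onD: "additive_on Q f \<Longrightarrow> x \<in> Q \<Longrightarrow> y \<in> Q \<Longrightarrow> f (x + y) = f x + f y"
  by (auto simp: additive_on_def)

lemma additive_on_zero: "agrp Q \<Longrightarrow> additive_on Q f \<Longrightarrow> f 0 = 0"
  using additive_onD[of Q f 0 0] by (simp add: agrp_zero)

lemma additive_on_minus: "agrp Q \<Longrightarrow> additive_on Q f \<Longrightarrow> x \<in> Q \<Longrightarrow> f (- x) = - f x"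
  using additive_onD[of Q f x "- x"] additive_on_zero[of Q f] agrp_minus[of Q x]
  by (simp add: eq_neg_iff_add_eq_0 add.commute)

lemma additive_on_diff:
  "agrp Q \<Longrightarrow> additive_on Q f \<Longrightarrow> x \<in> Q \<Longrightarrow> y \<in> Q \<Longrightarrow> f (x - y) = f x - f y"
  using additive_onD[of Q f x "- y"] additive_on_minus[of Q f y] agrp_minus[of Q y] by simp

lemma additive_on_sum:
  assumes "agrp Q" "additive_on Q f" "\<And>i. i \<in> I \<Longrightarrow> g i \<in> Q"
  shows "f (sum g I) = (\<Sum>i\<in>I. f (g i))"
  using assms(3)
  by (induction I rule: infinite_finite_induct)
    (auto simp: additive_on_zero[OF assms(1,2)] additive_onD[OF assms(2)] agrp_sum[OF assms(1)])

lemma agrp_image: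
  assumes "agrp Q" "additive_on Q f"
  shows "agrp (f ` Q)"
  unfolding agrp_def
proof (intro conjI ballI)
  show "0 \<in> f ` Q"
    using additive_on_zero[OF assms] agrp_zero[OF assms(1)] by (metis image_eqI)
next
  fix x y assume "x \<in> f ` Q" "y \<in> f ` Q"
  then obtain u v where "u \<in> Q" "v \<in> Q" "x = f u" "y = f v" by blast
  then show "x + y \<in> f ` Q"
    using additive_onD[OF assms(2), of u v] agrp_add[OF assms(1), of u v] by (metis image_eqI)
next
  fix x assume "x \<in> f ` Q"
  then obtain u where "u \<in> Q" "x = f u" by blast
  then show "- x \<in> f ` Q"
    using additive_on_minus[OF assms, of u] agrp_minus[OF assms(1), of u] by (metis image_eqI)
qed

lemma sum_apply: "sum g I x = (\<Sum>i\<in>I. g i x)"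
  by (induction I rule: infinite_finite_induct) auto

section \<open>Dual bases and syzygies over a graded ring\<close>

text \<open>Only homogeneous parts are given, so a ring and a subring with the same operations are
  both instances on one type. \<open>A_disjoint\<close> allows \<open>zact\<close> to recognise
  scalars of degree zero by membership in \<open>A 0\<close>.\<close>

locale gring =
  fixes A :: "nat \<Rightarrow> 'r::ab_group_add set" and mul :: "'r \<Rightarrow> 'r \<Rightarrow> 'r" and one :: 'r
  assumes A_grp: "agrp (A i)"
    and mul_closed: "a \<in> A i \<Longrightarrow> b \<in> A j \<Longrightarrow> mul a b \<in> A (i + j)"
    and mul_add_left: "a \<in> A i \<Longrightarrow> a' \<in> A i \<Longrightarrow> b \<in> A j \<Longrightarrow> mul (a + a') b = mul a b + mul a' b"
    and mul_add_right: "a \<in> A i \<Longrightarrow> b \<in> A j \<Longrightarrow> b' \<in> A j \<Longrightarrow> mul a (b + b') = mul a b + mul a b'"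
    and mul_assoc: "a \<in> A i \<Longrightarrow> b \<in> A j \<Longrightarrow> c \<in> A k \<Longrightarrow> mul (mul a b) c = mul a (mul b c)"
    and one_closed: "one \<in> A 0"
    and one_left: "a \<in> A i \<Longrightarrow> mul one a = a"
    and one_right: "a \<in> A i \<Longrightarrow> mul a one = a"
    and A_disjoint: "a \<in> A 0 \<Longrightarrow> a \<in> A (Suc i) \<Longrightarrow> a = 0"
begin

definition smod :: "'m::ab_group_add set \<Rightarrow> ('r \<Rightarrow> 'm \<Rightarrow> 'm) \<Rightarrow> bool"
  where "smod Q act \<longleftrightarrow> agrp Q \<and>
    (\<forall>a\<in>A 0. \<forall>m\<in>Q. act a m \<in> Q) \<and>
    (\<forall>a\<in>A 0. \<forall>a'\<in>A 0. \<forall>m\<in>Q. act (a + a') m = act a m + act a' m) \<and>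
    (\<forall>a\<in>A 0. \<forall>m\<in>Q. \<forall>m'\<in>Q. act a (m + m') = act a m + act a m') \<and>
    (\<forall>a\<in>A 0. \<forall>a'\<in>A 0. \<forall>m\<in>Q. act (mul a a') m = act a (act a' m)) \<and>
    (\<forall>m\<in>Q. act one m = m)"

text \<open>A graded module is its family of components with one total function \<open>act\<close>,
  constrained on homogeneous arguments only. Shifting a module is then just reindexing the
  family.\<close>

definition gm :: "(nat \<Rightarrow> 'm::ab_group_add set) \<Rightarrow> ('r \<Rightarrow> 'm \<Rightarrow> 'm) \<Rightarrow> bool"
  where "gm N act \<longleftrightarrow> (\<forall>d. agrp (N d)) \<and>
    (\<forall>i d. \<forall>a\<in>A i. \<forall>m\<in>N d. act a m \<in> N (i + d)) \<and>
    (\<forall>i d. \<forall>a\<in>A i. \<forall>a'\<in>A i. \<forall>m\<in>N d. act (a + a') m = act a m + act a' m) \<and>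
    (\<forall>i d. \<forall>a\<in>A i. \<forall>m\<in>N d. \<forall>m'\<in>N d. act a (m + m') = act a m + act a m') \<and>
    (\<forall>i j d. \<forall>a\<in>A i. \<forall>a'\<in>A j. \<forall>m\<in>N d. act (mul a a') m = act a (act a' m)) \<and>
    (\<forall>d. \<forall>m\<in>N d. act one m = m)"

definition ghom :: "(nat \<Rightarrow> 'm::ab_group_add set) \<Rightarrow> ('r \<Rightarrow> 'm \<Rightarrow> 'm) \<Rightarrow>
    (nat \<Rightarrow> 'n::ab_group_add set) \<Rightarrow> ('r \<Rightarrow> 'n \<Rightarrow> 'n) \<Rightarrow> ('m \<Rightarrow> 'n) \<Rightarrow> bool"
  where "ghom N act N' act' f \<longleftrightarrow>
    (\<forall>d. (\<forall>m\<in>N d. f m \<in> N' d) \<and> additive_on (N d) f) \<and>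
    (\<forall>i d. \<forall>a\<in>A i. \<forall>m\<in>N d. f (act a m) = act' a (f m))"

definition slin :: "'m::ab_group_add set \<Rightarrow> ('r \<Rightarrow> 'm \<Rightarrow> 'm) \<Rightarrow>
    'n::ab_group_add set \<Rightarrow> ('r \<Rightarrow> 'n \<Rightarrow> 'n) \<Rightarrow> ('m \<Rightarrow> 'n) \<Rightarrow> bool"
  where "slin Q act Q' act' f \<longleftrightarrow> (\<forall>m\<in>Q. f m \<in> Q') \<and> additive_on Q f \<and>
    (\<forall>a\<in>A 0. \<forall>m\<in>Q. f (act a m) = act' a (f m))"

text \<open>Generation in degree 0 is tested against all additive subgroups \<open>T\<close> instead
  of through a span, so that images and preimages of subgroups can be substituted for
  \<open>T\<close> directly.\<close>

definition gen :: "(nat \<Rightarrow> 'm::ab_group_add set) \<Rightarrow> ('r \<Rightarrow> 'm \<Rightarrow> 'm) \<Rightarrow> bool"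
  where "gen N act \<longleftrightarrow>
    (\<forall>d T. agrp T \<and> (\<forall>a\<in>A d. \<forall>m\<in>N 0. act a m \<in> T) \<longrightarrow> N d \<subseteq> T)"

definition dual_basis :: "'m::ab_group_add set \<Rightarrow> ('r \<Rightarrow> 'm \<Rightarrow> 'm) \<Rightarrow>
    'i set \<Rightarrow> ('i \<Rightarrow> 'm) \<Rightarrow> ('i \<Rightarrow> 'm \<Rightarrow> 'r) \<Rightarrow> bool"
  where "dual_basis Q act I b ph \<longleftrightarrow> finite I \<and>
    (\<forall>j\<in>I. b j \<in> Q \<and> slin Q act (A 0) mul (ph j)) \<and>
    (\<forall>m\<in>Q. m = (\<Sum>j\<in>I. act (ph j m) (b j)))"

text \<open>By the dual basis lemma this means finitely generated projective over
  \<open>A 0\<close>. In this form no test modules on other types are involved.\<close>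

definition sproj :: "'m::ab_group_add set \<Rightarrow> ('r \<Rightarrow> 'm \<Rightarrow> 'm) \<Rightarrow> bool"
  where "sproj Q act \<longleftrightarrow> (\<exists>(n::nat) b ph. dual_basis Q act {..<n} b ph)"

definition pact :: "'r \<Rightarrow> (nat \<Rightarrow> 'r) \<Rightarrow> nat \<Rightarrow> 'r"
  where "pact a v = (\<lambda>j. mul a (v j))"

text \<open>The degree \<open>d\<close> part of \<open>A \<otimes>\<^bsub>A\<^sub>0\<^esub> N\<^sub>0\<close>, cut out of the free module by the idempotent matrix
  of a dual basis.\<close>

definition pcar :: "nat \<Rightarrow> (nat \<Rightarrow> 'm::ab_group_add) \<Rightarrow> (nat \<Rightarrow> 'm \<Rightarrow> 'r) \<Rightarrow> nat \<Rightarrow> (nat \<Rightarrow> 'r) set"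
  where "pcar n b ph d = {v. (\<forall>j<n. v j \<in> A d \<and> (\<Sum>i<n. mul (v i) (ph j (b i))) = v j) \<and> (\<forall>j\<ge>n. v j = 0)}"

text \<open>The multiplication map from the tensor cover to the module, in the coordinates of the
  dual basis.\<close>

definition peval :: "nat \<Rightarrow> (nat \<Rightarrow> 'm::ab_group_add) \<Rightarrow> ('r \<Rightarrow> 'm \<Rightarrow> 'm) \<Rightarrow> (nat \<Rightarrow> 'r) \<Rightarrow> 'm"
  where "peval n b act v = (\<Sum>j<n. act (v j) (b j))"

definition syz :: "nat \<Rightarrow> (nat \<Rightarrow> 'm::ab_group_add) \<Rightarrow> (nat \<Rightarrow> 'm \<Rightarrow> 'r) \<Rightarrow> ('r \<Rightarrow> 'm \<Rightarrow> 'm) \<Rightarrow>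
    nat \<Rightarrow> (nat \<Rightarrow> 'r) set"
  where "syz n b ph act d = {v \<in> pcar n b ph (Suc d). peval n b act v = 0}"

text \<open>The map \<open>id \<otimes> f\<close> between covers: the row vector \<open>v\<close>
  times the matrix of \<open>f\<close> in the two dual bases. The formula mentions
  \<open>mul\<close> only, hence it is the same function for two rings that share their
  multiplication.\<close>

definition pmap :: "nat \<Rightarrow> (nat \<Rightarrow> 'm::ab_group_add) \<Rightarrow> nat \<Rightarrow> (nat \<Rightarrow> 'n \<Rightarrow> 'r) \<Rightarrow> ('m \<Rightarrow> 'n) \<Rightarrow>
    (nat \<Rightarrow> 'r) \<Rightarrow> nat \<Rightarrow> 'r"
  where "pmap n b n' ph' f v = (\<lambda>j. if j < n' then \<Sum>i<n. mul (v i) (ph' j (f (b i))) else 0)"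

lemma smod_agrp: "smod Q act \<Longrightarrow> agrp Q"
  and smod_closed: "smod Q act \<Longrightarrow> a \<in> A 0 \<Longrightarrow> m \<in> Q \<Longrightarrow> act a m \<in> Q"
  and smod_add_left: "smod Q act \<Longrightarrow> a \<in> A 0 \<Longrightarrow> a' \<in> A 0 \<Longrightarrow> m \<in> Q \<Longrightarrow> act (a + a') m = act a m + act a' m"
  and smod_add_right: "smod Q act \<Longrightarrow> a \<in> A 0 \<Longrightarrow> m \<in> Q \<Longrightarrow> m' \<in> Q \<Longrightarrow> act a (m + m') = act a m + act a m'"
  and smod_assoc: "smod Q act \<Longrightarrow> a \<in> A 0 \<Longrightarrow> a' \<in> A 0 \<Longrightarrow> m \<in> Q \<Longrightarrow> act (mul a a') m = act a (act a' m)"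
  and smod_one: "smod Q act \<Longrightarrow> m \<in> Q \<Longrightarrow> act one m = m"
  by (auto simp: smod_def)

lemma gm_agrp: "gm N act \<Longrightarrow> agrp (N d)"
  and gm_closed: "gm N act \<Longrightarrow> a \<in> A i \<Longrightarrow> m \<in> N d \<Longrightarrow> act a m \<in> N (i + d)"
  and gm_add_left: "gm N act \<Longrightarrow> a \<in> A i \<Longrightarrow> a' \<in> A i \<Longrightarrow> m \<in> N d \<Longrightarrow> act (a + a') m = act a m + act a' m"
  and gm_add_right: "gm N act \<Longrightarrow> a \<in> A i \<Longrightarrow> m \<in> N d \<Longrightarrow> m' \<in> N d \<Longrightarrow> act a (m + m') = act a m + act a m'"
  and gm_assoc: "gm N act \<Longrightarrow> a \<in> A i \<Longrightarrow> a' \<in> A j \<Longrightarrow> m \<in> N d \<Longrightarrow> act (mul a a') m = act a (act a' m)"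
  and gm_one: "gm N act \<Longrightarrow> m \<in> N d \<Longrightarrow> act one m = m"
  by (simp_all add: gm_def)

lemma gm_closed0: "gm N act \<Longrightarrow> a \<in> A i \<Longrightarrow> m \<in> N 0 \<Longrightarrow> act a m \<in> N i"
  using gm_closed[of N act a i m 0] by simp

lemma gm_A: "gm A mul"
  unfolding gm_def
  by (intro conjI allI ballI)
    (rule A_grp mul_closed mul_add_left mul_add_right mul_assoc one_left; assumption)+

lemma gm_smod: "gm N act \<Longrightarrow> smod (N d) act"
  using gm_closed[where N = N and act = act and i = 0 and d = d]
  by (auto simp: smod_def gm_agrp gm_add_left gm_add_right gm_assoc gm_one)

lemma smod_sum_right:
  assumes "smod Q act" "a \<in> A 0" "\<And>i. i \<in> I \<Longrightarrow> m i \<in> Q"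
  shows "act a (sum m I) = (\<Sum>i\<in>I. act a (m i))"
  using additive_on_sum[OF smod_agrp[OF assms(1)], of "act a" I m] assms
  by (auto simp: additive_on_def smod_add_right)

lemma gm_sum_left:
  assumes "gm N act" "m \<in> N d" "\<And>i. i \<in> I \<Longrightarrow> a i \<in> A e"
  shows "act (sum a I) m = (\<Sum>i\<in>I. act (a i) m)"
  using additive_on_sum[OF A_grp[of e], of "\<lambda>a. act a m" I a] assms
  by (auto simp: additive_on_def gm_add_left)

lemma gm_sum_right:
  assumes "gm N act" "a \<in> A e" "\<And>i. i \<in> I \<Longrightarrow> m i \<in> N d"
  shows "act a (sum m I) = (\<Sum>i\<in>I. act a (m i))"
  using additive_on_sum[OF gm_agrp[OF assms(1)], of d "act a" I m] assms
  by (auto simp: additive_on_def gm_add_right)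

lemmas mul_sum_left = gm_sum_left[OF gm_A]
lemmas mul_sum_right = gm_sum_right[OF gm_A]

lemma gm_zero_left: "gm N act \<Longrightarrow> m \<in> N d \<Longrightarrow> act 0 m = 0"
  using gm_sum_left[of N act m d "{}"] by simp

lemma gm_zero_right: "gm N act \<Longrightarrow> a \<in> A e \<Longrightarrow> act a 0 = 0"
  using gm_sum_right[of N act a e "{}"] by simp

lemmas mul_zero_left = gm_zero_left[OF gm_A]
lemmas mul_zero_right = gm_zero_right[OF gm_A]

lemma gm_minus_left: "gm N act \<Longrightarrow> a \<in> A i \<Longrightarrow> m \<in> N d \<Longrightarrow> act (- a) m = - act a m"
  using gm_add_left[of N act a i "- a" m d] gm_zero_left[of N act m d] agrp_minus[OF A_grp, of a i]
  by (simp add: eq_neg_iff_add_eq_0 add.commute)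

lemmas mul_minus_left = gm_minus_left[OF gm_A]

lemma ghom_closed: "ghom N act N' act' f \<Longrightarrow> m \<in> N d \<Longrightarrow> f m \<in> N' d"
  and ghom_additive: "ghom N act N' act' f \<Longrightarrow> additive_on (N d) f"
  and ghom_act: "ghom N act N' act' f \<Longrightarrow> a \<in> A i \<Longrightarrow> m \<in> N d \<Longrightarrow> f (act a m) = act' a (f m)"
  unfolding ghom_def by blast+

lemma slin_closed: "slin Q act Q' act' f \<Longrightarrow> m \<in> Q \<Longrightarrow> f m \<in> Q'"
  and slin_additive: "slin Q act Q' act' f \<Longrightarrow> additive_on Q f"
  and slin_act: "slin Q act Q' act' f \<Longrightarrow> a \<in> A 0 \<Longrightarrow> m \<in> Q \<Longrightarrow> f (act a m) = act' a (f m)"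
  unfolding slin_def by blast+

lemma ghom_slin: "ghom N act N' act' f \<Longrightarrow> slin (N d) act (N' d) act' f"
  unfolding ghom_def slin_def by blast

lemma slin_compose:
  "slin Q act Q' act' f \<Longrightarrow> slin Q' act' Q'' act'' g \<Longrightarrow> slin Q act Q'' act'' (\<lambda>x. g (f x))"
  unfolding slin_def additive_on_def by auto

section \<open>Finitely generated projective modules over the degree zero part\<close>

lemma dual_basis_elem: "dual_basis Q act I b ph \<Longrightarrow> j \<in> I \<Longrightarrow> b j \<in> Q"
  and dual_basis_slin: "dual_basis Q act I b ph \<Longrightarrow> j \<in> I \<Longrightarrow> slin Q act (A 0) mul (ph j)"
  and dual_basis_sum: "dual_basis Q act I b ph \<Longrightarrow> m \<in> Q \<Longrightarrow> (\<Sum>j\<in>I. act (ph j m) (b j)) = m"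
  unfolding dual_basis_def by auto

lemma dual_basis_closed: "dual_basis Q act I b ph \<Longrightarrow> j \<in> I \<Longrightarrow> m \<in> Q \<Longrightarrow> ph j m \<in> A 0"
  using dual_basis_slin slin_closed by metis

text \<open>Renumbering by an initial segment of the naturals is what keeps index types out of the
  definition of \<open>sproj\<close>.\<close>

lemma sprojI:
  assumes "dual_basis Q act I b ph"
  shows "sproj Q act"
proof -
  have "finite I" using assms by (simp add: dual_basis_def)
  then obtain h where h: "bij_betw h {..<card I} I"
    using ex_bij_betw_nat_finite[of I] by (auto simp: lessThan_atLeast0)
  then have hI: "h j \<in> I" if "j < card I" for j
    using that by (auto simp: bij_betw_def)
  have e: "(\<Sum>j<card I. act (ph (h j) m) (b (h j))) = (\<Sum>j\<in>I. act (ph j m) (b j))" for m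
    by (rule sum.reindex_bij_betw[OF h])
  have "dual_basis Q act {..<card I} (\<lambda>j. b (h j)) (\<lambda>j. ph (h j))"
    using assms hI e by (simp add: dual_basis_def)
  then show ?thesis unfolding sproj_def by blast
qed

text \<open>The maps present \<open>Q\<close> as a direct summand of the finite direct sum of the
  \<open>X t\<close>, without forming that sum. A dual basis of \<open>Q\<close> consists of the
  elements \<open>i t (b t j)\<close> with the functionals \<open>ph t j\<close> after
  \<open>p t\<close>. Direct sums, summands and split extensions are all instances.\<close>

lemma sproj_sum_retract:
  assumes T: "finite T" and Q: "smod Q act"
    and X: "\<And>t. t \<in> T \<Longrightarrow> smod (X t) (ax t)" "\<And>t. t \<in> T \<Longrightarrow> sproj (X t) (ax t)"
    and p: "\<And>t. t \<in> T \<Longrightarrow> slin Q act (X t) (ax t) (p t)"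
    and i: "\<And>t. t \<in> T \<Longrightarrow> slin (X t) (ax t) Q act (i t)"
    and id: "\<And>m. m \<in> Q \<Longrightarrow> m = (\<Sum>t\<in>T. i t (p t m))"
  shows "sproj Q act"
proof -
  have "\<forall>t\<in>T. \<exists>(n::nat) b ph. dual_basis (X t) (ax t) {..<n} b ph"
    using X by (simp add: sproj_def)
  then obtain n :: "_ \<Rightarrow> nat" and b ph where D: "\<And>t. t \<in> T \<Longrightarrow> dual_basis (X t) (ax t) {..<n t} (b t) (ph t)"
    by metis
  let ?I = "Sigma T (\<lambda>t. {..<n t})"
  have "dual_basis Q act ?I (\<lambda>(t, j). i t (b t j)) (\<lambda>(t, j) m. ph t j (p t m))"
    unfolding dual_basis_def
  proof (intro conjI ballI, goal_cases)
    case 1 then show ?case using T by auto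
  next
    case (2 q) then show ?case using dual_basis_elem[OF D] slin_closed[OF i] by auto
  next
    case (3 q) then show ?case using slin_compose[OF p dual_basis_slin[OF D]] by auto
  next
    case (4 m)
    have "m = (\<Sum>t\<in>T. i t (p t m))" using id 4 by simp
    also have "\<dots> = (\<Sum>t\<in>T. \<Sum>j<n t. act (ph t j (p t m)) (i t (b t j)))"
    proof (rule sum.cong[OF refl])
      fix t assume t: "t \<in> T"
      note d = D[OF t] and pm = slin_closed[OF p[OF t] 4]
      have "i t (p t m) = i t (\<Sum>j<n t. ax t (ph t j (p t m)) (b t j))"
        using dual_basis_sum[OF d pm] by simp
      also have "\<dots> = (\<Sum>j<n t. i t (ax t (ph t j (p t m)) (b t j)))"
        using smod_closed[OF X(1)[OF t]] dual_basis_closed[OF d _ pm] dual_basis_elem[OF d]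
        by (intro additive_on_sum[OF smod_agrp[OF X(1)[OF t]] slin_additive[OF i[OF t]]]) auto
      also have "\<dots> = (\<Sum>j<n t. act (ph t j (p t m)) (i t (b t j)))"
        using slin_act[OF i[OF t]] dual_basis_closed[OF d _ pm] dual_basis_elem[OF d] by auto
      finally show "i t (p t m) = (\<Sum>j<n t. act (ph t j (p t m)) (i t (b t j)))" .
    qed
    finally show ?case using T by (simp add: sum.Sigma case_prod_beta)
  qed
  then show ?thesis by (rule sprojI)
qed

lemma sproj_retract:
  assumes "smod Q act" "smod X ax" "sproj X ax" "slin Q act X ax p" "slin X ax Q act i"
    and "\<And>m. m \<in> Q \<Longrightarrow> i (p m) = m"
  shows "sproj Q act"
  by (rule sproj_sum_retract[where T = "{()}" and X = "\<lambda>_. X" and ax = "\<lambda>_. ax"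
      and p = "\<lambda>_. p" and i = "\<lambda>_. i"]) (use assms in auto)

text \<open>Choose preimages \<open>w j\<close> of the basis elements and send \<open>m\<close> to
  the combination of the \<open>w j\<close> with the coordinates of \<open>m\<close>; linearity of
  the coordinates makes this a section.\<close>

lemma sproj_lift:
  assumes Q: "smod Q act" "sproj Q act" and V: "smod V av"
    and e: "slin V av Q act e" and surj: "\<And>m. m \<in> Q \<Longrightarrow> \<exists>v\<in>V. e v = m"
  shows "\<exists>\<sigma>. slin Q act V av \<sigma> \<and> (\<forall>m\<in>Q. e (\<sigma> m) = m)"
proof -
  obtain n :: nat and b ph where D: "dual_basis Q act {..<n} b ph" using Q by (auto simp: sproj_def)
  have "\<forall>j\<in>{..<n}. \<exists>v\<in>V. e v = b j" using surj dual_basis_elem[OF D] by blast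
  then obtain w where w: "\<And>j. j < n \<Longrightarrow> w j \<in> V" "\<And>j. j < n \<Longrightarrow> e (w j) = b j" by (metis lessThan_iff)
  let ?s = "\<lambda>m. \<Sum>j<n. av (ph j m) (w j)"
  have c: "ph j m \<in> A 0" if "j < n" "m \<in> Q" for j m using dual_basis_closed[OF D] that by simp
  have l: "slin Q act (A 0) mul (ph j)" if "j < n" for j using dual_basis_slin[OF D] that by simp
  have "slin Q act V av ?s"
    unfolding slin_def additive_on_def
  proof (intro conjI ballI)
    fix m assume "m \<in> Q"
    then show "?s m \<in> V" by (intro agrp_sum[OF smod_agrp[OF V]] smod_closed[OF V]) (auto simp: c w)
  next
    fix x y assume "x \<in> Q" "y \<in> Q"
    then show "?s (x + y) = ?s x + ?s y"
      by (simp add: sum.distrib[symmetric] additive_onD[OF slin_additive[OF l]] smod_add_left[OF V] c w)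
  next
    fix a m assume am: "a \<in> A 0" "m \<in> Q"
    then have "?s (act a m) = (\<Sum>j<n. av a (av (ph j m) (w j)))"
      by (intro sum.cong) (auto simp: slin_act[OF l] smod_assoc[OF V] c w)
    also have "\<dots> = av a (?s m)"
      by (intro smod_sum_right[OF V, symmetric]) (auto simp: am c w smod_closed[OF V])
    finally show "?s (act a m) = av a (?s m)" .
  qed
  moreover have "e (?s m) = m" if m: "m \<in> Q" for m
  proof -
    have "e (?s m) = (\<Sum>j<n. e (av (ph j m) (w j)))"
      by (intro additive_on_sum[OF smod_agrp[OF V] slin_additive[OF e]]) (auto simp: m c w smod_closed[OF V])
    also have "\<dots> = (\<Sum>j<n. act (ph j m) (b j))"
      by (intro sum.cong) (auto simp: slin_act[OF e] c m w)
    finally show ?thesis using dual_basis_sum[OF D m] by simp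
  qed
  ultimately show ?thesis by blast
qed


section \<open>The tensor cover of a module and its evaluation map\<close>

text \<open>Covers and syzygies are submodules of this product of copies of the ring, so they
  inherit the module axioms through \<open>gm_sub\<close>.\<close>

lemma gm_pointwise: "gm (\<lambda>d. {v. \<forall>j. v j \<in> A d}) pact"
  unfolding gm_def pact_def agrp_def
  by (auto simp: fun_eq_iff A_grp agrp_zero agrp_add agrp_minus mul_closed
      intro: mul_add_left mul_add_right mul_assoc one_left)

lemma gm_sub:
  assumes N: "gm N act" and sub: "\<And>d. N' d \<subseteq> N d" "\<And>d. agrp (N' d)"
    and cl: "\<And>i d a m. a \<in> A i \<Longrightarrow> m \<in> N' d \<Longrightarrow> act a m \<in> N' (i + d)"
  shows "gm N' act"
proof -
  have s: "m \<in> N' d \<Longrightarrow> m \<in> N d" for m d using sub(1) by blast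
  show ?thesis unfolding gm_def
  proof (intro conjI allI ballI)
    show "agrp (N' d)" for d by fact
  qed (simp_all add: cl gm_add_left[OF N _ _ s] gm_add_right[OF N _ s s] gm_assoc[OF N _ _ s] gm_one[OF N s])
qed

lemma pcar_closed: "v \<in> pcar n b ph d \<Longrightarrow> v j \<in> A d"
  by (cases "j < n") (auto simp: pcar_def agrp_zero[OF A_grp])

lemma pcar_beyond: "v \<in> pcar n b ph d \<Longrightarrow> n \<le> j \<Longrightarrow> v j = 0"
  by (auto simp: pcar_def)

lemma pcar_eq: "v \<in> pcar n b ph d \<Longrightarrow> j < n \<Longrightarrow> (\<Sum>i<n. mul (v i) (ph j (b i))) = v j"
  by (auto simp: pcar_def)

lemma pcarI: "(\<And>j. j < n \<Longrightarrow> v j \<in> A d) \<Longrightarrow> (\<And>j. j < n \<Longrightarrow> (\<Sum>i<n. mul (v i) (ph j (b i))) = v j)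
    \<Longrightarrow> (\<And>j. n \<le> j \<Longrightarrow> v j = 0) \<Longrightarrow> v \<in> pcar n b ph d"
  by (auto simp: pcar_def)

context
  fixes Q :: "'m::ab_group_add set" and act and n :: nat and b ph
  assumes D: "dual_basis Q act {..<n} b ph"
begin

lemma db_closed: "i < n \<Longrightarrow> m \<in> Q \<Longrightarrow> ph i m \<in> A 0"
  using dual_basis_closed[OF D] by simp

lemma db_elem: "i < n \<Longrightarrow> b i \<in> Q"
  using dual_basis_elem[OF D] by simp

lemma db_slin: "i < n \<Longrightarrow> slin Q act (A 0) mul (ph i)"
  using dual_basis_slin[OF D] by simp

lemma agrp_pcar: "agrp (pcar n b ph d)"
  unfolding agrp_def
proof (intro conjI ballI)
  show "0 \<in> pcar n b ph d"
    by (intro pcarI) (auto simp: agrp_zero[OF A_grp] mul_zero_left[OF db_closed] db_elem)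
next
  fix x y assume x: "x \<in> pcar n b ph d" and y: "y \<in> pcar n b ph d"
  show "x + y \<in> pcar n b ph d"
    using x y by (intro pcarI) (auto simp: pcar_closed agrp_add[OF A_grp] pcar_beyond
      mul_add_left[OF pcar_closed[OF x] pcar_closed[OF y] db_closed] db_elem sum.distrib pcar_eq)
next
  fix x assume x: "x \<in> pcar n b ph d"
  then show "- x \<in> pcar n b ph d"
    by (intro pcarI) (auto simp: pcar_closed agrp_minus[OF A_grp] pcar_beyond
      mul_minus_left[OF pcar_closed[OF x] db_closed] db_elem sum_negf pcar_eq)
qed

lemma gm_pcar: "gm (pcar n b ph) pact"
proof (rule gm_sub[OF gm_pointwise])
  fix i d a v assume a: "a \<in> A i" and v: "v \<in> pcar n b ph d"
  show "pact a v \<in> pcar n b ph (i + d)"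
  proof (rule pcarI)
    fix j assume j: "j < n"
    show "pact a v j \<in> A (i + d)" using a v by (simp add: pact_def mul_closed pcar_closed)
    have "(\<Sum>l<n. mul (pact a v l) (ph j (b l))) = (\<Sum>l<n. mul a (mul (v l) (ph j (b l))))"
      using a v j by (intro sum.cong) (auto simp: pact_def mul_assoc[OF _ pcar_closed db_closed] db_elem)
    also have "\<dots> = mul a (\<Sum>l<n. mul (v l) (ph j (b l)))"
      using mul_closed[OF pcar_closed[OF v] db_closed[OF j db_elem]]
      by (intro mul_sum_right[OF a, symmetric]) auto
    finally show "(\<Sum>l<n. mul (pact a v l) (ph j (b l))) = pact a v j"
      using pcar_eq[OF v j] by (simp add: pact_def)
  next
    fix j assume "n \<le> j" then show "pact a v j = 0"
      using pcar_beyond[OF v] mul_zero_right[OF a] by (simp add: pact_def)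
  qed
qed (auto simp: agrp_pcar pcar_closed)

text \<open>Apply \<open>f\<close> to the expansion of \<open>m\<close> in the dual basis. For
  \<open>f = ph j\<close> this is the idempotence of the matrix \<open>ph j (b i)\<close>; for a
  composite it is multiplicativity of the coordinate matrices.\<close>

lemma db_compose:
  assumes m: "m \<in> Q" and S: "smod Q act" and f: "slin Q act V mul f"
  shows "(\<Sum>i<n. mul (ph i m) (f (b i))) = f m"
proof -
  have "f m = f (\<Sum>i<n. act (ph i m) (b i))" using dual_basis_sum[OF D m] by simp
  also have "\<dots> = (\<Sum>i<n. f (act (ph i m) (b i)))"
    by (intro additive_on_sum[OF smod_agrp[OF S] slin_additive[OF f]])
      (auto intro!: smod_closed[OF S] db_closed db_elem m)
  also have "\<dots> = (\<Sum>i<n. mul (ph i m) (f (b i)))"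
    by (intro sum.cong) (auto simp: slin_act[OF f] db_closed db_elem m)
  finally show ?thesis by simp
qed

text \<open>These vectors are the pure tensors of \<open>a\<close> and \<open>m\<close>. They are
  fixed by the idempotent matrix because of \<open>db_compose\<close> for the functional
  \<open>ph j\<close>.\<close>

lemma pcar_tensor:
  assumes m: "m \<in> Q" and S: "smod Q act" and a: "a \<in> A d"
  shows "(\<lambda>j. if j < n then mul a (ph j m) else 0) \<in> pcar n b ph d"
proof (rule pcarI)
  fix j assume j: "j < n"
  show "(if j < n then mul a (ph j m) else 0) \<in> A d"
    using mul_closed[OF a db_closed[OF j m]] j by simp
  have "(\<Sum>i<n. mul (mul a (ph i m)) (ph j (b i))) = (\<Sum>i<n. mul a (mul (ph i m) (ph j (b i))))"
    by (intro sum.cong) (auto simp: mul_assoc[OF a db_closed db_closed] m j db_elem)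
  also have "\<dots> = mul a (\<Sum>i<n. mul (ph i m) (ph j (b i)))"
    using mul_closed[OF db_closed[OF _ m] db_closed[OF j db_elem]]
    by (intro mul_sum_right[OF a, symmetric]) auto
  finally show "(\<Sum>i<n. mul (if i < n then mul a (ph i m) else 0) (ph j (b i))) =
      (if j < n then mul a (ph j m) else 0)"
    using db_compose[OF m S db_slin[OF j]] j by simp
qed auto

text \<open>The cover in degree \<open>d\<close> is a summand of \<open>n\<close> copies of
  \<open>A d\<close>: project to the coordinates, and map back by tensoring with the basis elements
  \<open>b t\<close>.\<close>

lemma sproj_pcar:
  assumes S: "smod Q act" and Ad: "sproj (A d) mul"
  shows "sproj (pcar n b ph d) pact"
proof (rule sproj_sum_retract[where T = "{..<n}" and X = "\<lambda>_. A d" and ax = "\<lambda>_. mul"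
      and p = "\<lambda>t v. v t" and i = "\<lambda>t a j. if j < n then mul a (ph j (b t)) else 0"])
  show "smod (pcar n b ph d) pact" by (rule gm_smod[OF gm_pcar])
  show "smod (A d) mul" by (rule gm_smod[OF gm_A])
  show "sproj (A d) mul" by fact
  show "slin (pcar n b ph d) pact (A d) mul (\<lambda>v. v t)" for t
    by (auto simp: slin_def additive_on_def pcar_closed pact_def)
  show "slin (A d) mul (pcar n b ph d) pact (\<lambda>a j. if j < n then mul a (ph j (b t)) else 0)"
    if t: "t \<in> {..<n}" for t
    unfolding slin_def additive_on_def
  proof (intro conjI ballI)
    fix a assume "a \<in> A d"
    then show "(\<lambda>j. if j < n then mul a (ph j (b t)) else 0) \<in> pcar n b ph d"
      using pcar_tensor[OF db_elem S] t by simp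
  qed (use t in \<open>auto simp: fun_eq_iff pact_def mul_add_left[OF _ _ db_closed] db_elem
         mul_assoc[OF _ _ db_closed] mul_zero_right\<close>)
  show "v = (\<Sum>t<n. (\<lambda>j. if j < n then mul (v t) (ph j (b t)) else 0))" if v: "v \<in> pcar n b ph d" for v
  proof
    fix x show "v x = (\<Sum>t<n. (\<lambda>j. if j < n then mul (v t) (ph j (b t)) else 0)) x"
      using pcar_eq[OF v, of x] pcar_beyond[OF v, of x] by (cases "x < n") (auto simp: sum_apply)
  qed
qed auto

end

lemma peval_ghom:
  assumes N: "gm N act" and D: "dual_basis (N 0) act {..<n} b ph"
  shows "ghom (pcar n b ph) pact N act (peval n b act)"
proof -
  note e = db_elem[OF D]
  show ?thesis
    unfolding ghom_def additive_on_def
  proof (intro conjI allI ballI)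
    fix d v assume v: "v \<in> pcar n b ph d"
    then show "peval n b act v \<in> N d"
      unfolding peval_def by (intro agrp_sum[OF gm_agrp[OF N]]) (auto simp: gm_closed0[OF N pcar_closed e])
  next
    fix d v w assume "v \<in> pcar n b ph d" "w \<in> pcar n b ph d"
    then show "peval n b act (v + w) = peval n b act v + peval n b act w"
      unfolding peval_def by (simp add: sum.distrib[symmetric] gm_add_left[OF N pcar_closed pcar_closed e])
  next
    fix i d a v assume a: "a \<in> A i" and v: "v \<in> pcar n b ph d"
    have "peval n b act (pact a v) = (\<Sum>j<n. act a (act (v j) (b j)))"
      unfolding peval_def pact_def by (intro sum.cong) (auto simp: gm_assoc[OF N a pcar_closed[OF v] e])
    also have "\<dots> = act a (peval n b act v)" unfolding peval_def
      using gm_closed0[OF N pcar_closed[OF v] e] by (intro gm_sum_right[OF N a, symmetric]) auto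
    finally show "peval n b act (pact a v) = act a (peval n b act v)" .
  qed
qed

text \<open>The image is an additive subgroup, and \<open>act a m\<close> is the value at the pure
  tensor of \<open>a\<close> and \<open>m\<close>; generation in degree 0 gives the rest.\<close>

lemma peval_surj:
  assumes N: "gm N act" and G: "gen N act" and D: "dual_basis (N 0) act {..<n} b ph" and m: "m \<in> N d"
  shows "\<exists>v\<in>pcar n b ph d. peval n b act v = m"
proof -
  note h = peval_ghom[OF N D]
  let ?T = "peval n b act ` pcar n b ph d"
  note g = agrp_pcar[OF D, of d]
  have "agrp ?T" by (rule agrp_image[OF g ghom_additive[OF h]])
  moreover have "act a m \<in> ?T" if a: "a \<in> A d" and m: "m \<in> N 0" for a m
  proof -
    have "peval n b act (\<lambda>j. if j < n then mul a (ph j m) else 0) = (\<Sum>j<n. act a (act (ph j m) (b j)))"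
      unfolding peval_def by (intro sum.cong) (auto simp: gm_assoc[OF N a db_closed[OF D] db_elem[OF D]] m)
    also have "\<dots> = act a (\<Sum>j<n. act (ph j m) (b j))"
      by (intro gm_sum_right[OF N a, symmetric]) (auto intro!: gm_closed0[OF N] db_closed[OF D] db_elem[OF D] m)
    finally have "act a m = peval n b act (\<lambda>j. if j < n then mul a (ph j m) else 0)"
      using dual_basis_sum[OF D m] by simp
    then show ?thesis using pcar_tensor[OF D m gm_smod[OF N] a] by (rule image_eqI)
  qed
  ultimately show ?thesis using G m unfolding gen_def by blast
qed

text \<open>In degree 0 the functionals recover a vector from its value: \<open>v j\<close> is
  \<open>ph j\<close> applied to \<open>peval n b act v\<close>. Hence kernels begin in degree 1,
  which is the reason for the shift in \<open>syz\<close>.\<close>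

lemma peval_inj0:
  assumes N: "gm N act" and D: "dual_basis (N 0) act {..<n} b ph"
    and v: "v \<in> pcar n b ph 0" "peval n b act v = 0"
  shows "v = 0"
proof (rule ext)
  fix j show "v j = 0 j"
  proof (cases "j < n")
    case True
    note f = db_slin[OF D True]
    have "v j = (\<Sum>i<n. mul (v i) (ph j (b i)))" using pcar_eq[OF v(1) True] by simp
    also have "\<dots> = (\<Sum>i<n. ph j (act (v i) (b i)))"
      by (intro sum.cong) (auto simp: slin_act[OF f pcar_closed[OF v(1)]] db_elem[OF D])
    also have "\<dots> = ph j (peval n b act v)" unfolding peval_def
      using gm_closed0[OF N pcar_closed[OF v(1)] db_elem[OF D]]
      by (intro additive_on_sum[OF gm_agrp[OF N] slin_additive[OF f], symmetric]) auto
    finally show ?thesis using v(2) additive_on_zero[OF gm_agrp[OF N] slin_additive[OF f]] by simp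
  next
    case False then show ?thesis using pcar_beyond[OF v(1)] by simp
  qed
qed

lemma syz_pcar: "v \<in> syz n b ph act d \<Longrightarrow> v \<in> pcar n b ph (Suc d)"
  by (simp add: syz_def)

lemma gm_shift:
  assumes N: "gm N act"
  shows "gm (\<lambda>d. N (Suc d)) act"
  unfolding gm_def
proof (intro conjI allI ballI)
  show "act a m \<in> N (Suc (i + d))" if "a \<in> A i" "m \<in> N (Suc d)" for i d a m
    using gm_closed[OF N that] by simp
qed (simp_all add: gm_agrp[OF N] gm_add_left[OF N] gm_add_right[OF N] gm_assoc[OF N] gm_one[OF N])

lemma gm_syz:
  assumes N: "gm N act" and D: "dual_basis (N 0) act {..<n} b ph"
  shows "gm (syz n b ph act) pact"
proof (rule gm_sub[OF gm_shift[OF gm_pcar[OF D]]])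
  note h = peval_ghom[OF N D] and g = agrp_pcar[OF D]
  show "syz n b ph act d \<subseteq> pcar n b ph (Suc d)" for d by (auto simp: syz_def)
  show "agrp (syz n b ph act d)" for d
    using g[of "Suc d"] additive_on_zero[OF g ghom_additive[OF h, of "Suc d"]]
      additive_onD[OF ghom_additive[OF h, of "Suc d"]] additive_on_minus[OF g ghom_additive[OF h, of "Suc d"]]
    by (auto simp: syz_def agrp_def)
  show "pact a v \<in> syz n b ph act (i + d)" if "a \<in> A i" "v \<in> syz n b ph act d" for i d a v
    using that gm_closed[OF gm_pcar[OF D] that(1), of v "Suc d"] ghom_act[OF h that(1), of v "Suc d"]
      gm_zero_right[OF N that(1)] by (auto simp: syz_def)
qed

section \<open>Functoriality of covers and syzygies\<close>

context
  fixes N' :: "nat \<Rightarrow> 'n::ab_group_add set" and act' and n' :: nat and b' ph'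
    and f :: "'m::ab_group_add \<Rightarrow> 'n" and n :: nat and b
  assumes N': "gm N' act'" and D': "dual_basis (N' 0) act' {..<n'} b' ph'"
    and fb: "\<And>i. i < n \<Longrightarrow> f (b i) \<in> N' 0"
begin

text \<open>The vector is the sum of the pure tensors of \<open>v i\<close> with
  \<open>f (b i)\<close>. Only the values \<open>f (b i)\<close> enter, not linearity of
  \<open>f\<close> or any dual basis on the source side; this later permits a change of the ring
  with \<open>f\<close> the identity.\<close>

lemma pmap_closed:
  assumes v: "\<And>j. v j \<in> A d"
  shows "pmap n b n' ph' f v \<in> pcar n' b' ph' d"
proof -
  have eq: "pmap n b n' ph' f v = (\<Sum>i<n. (\<lambda>j. if j < n' then mul (v i) (ph' j (f (b i))) else 0))"
    by (auto simp: pmap_def fun_eq_iff sum_apply)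
  show ?thesis
    unfolding eq using pcar_tensor[OF D' fb gm_smod[OF N'] v]
    by (intro agrp_sum[OF agrp_pcar[OF D']]) auto
qed

lemma pmap_add:
  assumes v: "\<And>j. v j \<in> A d" and w: "\<And>j. w j \<in> A d"
  shows "pmap n b n' ph' f (v + w) = pmap n b n' ph' f v + pmap n b n' ph' f w"
  by (auto simp: pmap_def fun_eq_iff sum.distrib[symmetric]
      intro!: sum.cong mul_add_left[OF v w db_closed[OF D' _ fb]])

lemma pmap_pact:
  assumes a: "a \<in> A i" and v: "\<And>j. v j \<in> A d"
  shows "pmap n b n' ph' f (pact a v) = pact a (pmap n b n' ph' f v)"
proof
  fix j
  note c' = db_closed[OF D']
  have "(\<Sum>l<n. mul (mul a (v l)) (ph' j (f (b l)))) = mul a (\<Sum>l<n. mul (v l) (ph' j (f (b l))))" if j: "j < n'"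
  proof -
    have "(\<Sum>l<n. mul (mul a (v l)) (ph' j (f (b l)))) = (\<Sum>l<n. mul a (mul (v l) (ph' j (f (b l)))))"
      by (intro sum.cong) (auto simp: mul_assoc[OF a v c'[OF j fb]])
    also have "\<dots> = mul a (\<Sum>l<n. mul (v l) (ph' j (f (b l))))"
      using mul_closed[OF v c'[OF j fb]] by (intro mul_sum_right[OF a, symmetric]) auto
    finally show ?thesis .
  qed
  then show "pmap n b n' ph' f (pact a v) j = pact a (pmap n b n' ph' f v) j"
    by (simp add: pmap_def pact_def mul_zero_right[OF a])
qed

text \<open>Both sides are the value of the sum of the tensors of \<open>v i\<close> with
  \<open>f (b i)\<close>: exchange the two sums and contract the expansion of each
  \<open>f (b i)\<close> in the target dual basis.\<close>

lemma peval_pmap: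
  assumes v: "\<And>j. v j \<in> A d"
  shows "peval n' b' act' (pmap n b n' ph' f v) = (\<Sum>i<n. act' (v i) (f (b i)))"
proof -
  note e' = db_elem[OF D'] and c' = db_closed[OF D']
  have "peval n' b' act' (pmap n b n' ph' f v) = (\<Sum>j<n'. \<Sum>i<n. act' (v i) (act' (ph' j (f (b i))) (b' j)))"
    unfolding peval_def
  proof (intro sum.cong[OF refl])
    fix j assume "j \<in> {..<n'}"
    then have j: "j < n'" by simp
    have "act' (pmap n b n' ph' f v j) (b' j) = (\<Sum>i<n. act' (mul (v i) (ph' j (f (b i)))) (b' j))"
      using mul_closed[OF v c'[OF j fb]] j unfolding pmap_def
      by simp (intro gm_sum_left[OF N' e'[OF j]], auto)
    also have "\<dots> = (\<Sum>i<n. act' (v i) (act' (ph' j (f (b i))) (b' j)))"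
      by (intro sum.cong) (auto simp: gm_assoc[OF N' v c'[OF j fb] e'[OF j]])
    finally show "act' (pmap n b n' ph' f v j) (b' j) = \<dots>" .
  qed
  also have "\<dots> = (\<Sum>i<n. \<Sum>j<n'. act' (v i) (act' (ph' j (f (b i))) (b' j)))" by (rule sum.swap)
  also have "\<dots> = (\<Sum>i<n. act' (v i) (f (b i)))"
  proof (intro sum.cong[OF refl])
    fix i assume "i \<in> {..<n}"
    then have i: "i < n" by simp
    have "(\<Sum>j<n'. act' (v i) (act' (ph' j (f (b i))) (b' j))) = act' (v i) (\<Sum>j<n'. act' (ph' j (f (b i))) (b' j))"
      by (intro gm_sum_right[OF N' v, symmetric]) (auto intro!: gm_closed0[OF N'] c' fb i e')
    then show "(\<Sum>j<n'. act' (v i) (act' (ph' j (f (b i))) (b' j))) = act' (v i) (f (b i))"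
      using dual_basis_sum[OF D' fb[OF i]] by simp
  qed
  finally show ?thesis .
qed

end

lemma pmap_pcar:
  assumes N: "gm N act" and N': "gm N' act'" and f: "ghom N act N' act' f"
    and D: "dual_basis (N 0) act {..<n} b ph" and D': "dual_basis (N' 0) act' {..<n'} b' ph'"
  shows "ghom (pcar n b ph) pact (pcar n' b' ph') pact (pmap n b n' ph' f)"
    and "v \<in> pcar n b ph d \<Longrightarrow> peval n' b' act' (pmap n b n' ph' f v) = f (peval n b act v)"
proof -
  note e = db_elem[OF D]
  have fb: "f (b i) \<in> N' 0" if "i < n" for i using ghom_closed[OF f e[OF that]] .
  note P = pmap_closed[where f = f and b = b, OF N' D' fb] pmap_add[where f = f and b = b, OF N' D' fb]
    pmap_pact[where f = f and b = b, OF N' D' fb] peval_pmap[where f = f and b = b, OF N' D' fb]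
  show "ghom (pcar n b ph) pact (pcar n' b' ph') pact (pmap n b n' ph' f)"
    unfolding ghom_def additive_on_def
  proof (intro conjI allI ballI)
    show "pmap n b n' ph' f v \<in> pcar n' b' ph' d" if "v \<in> pcar n b ph d" for d v
      by (rule P(1)[OF _ pcar_closed[OF that]])
    show "pmap n b n' ph' f (v + w) = pmap n b n' ph' f v + pmap n b n' ph' f w"
      if "v \<in> pcar n b ph d" "w \<in> pcar n b ph d" for d v w
      by (rule P(2)[OF _ pcar_closed[OF that(1)] pcar_closed[OF that(2)]])
    show "pmap n b n' ph' f (pact a v) = pact a (pmap n b n' ph' f v)"
      if "a \<in> A i" "v \<in> pcar n b ph d" for i d a v
      by (rule P(3)[OF _ that(1) pcar_closed[OF that(2)]])
  qed
  assume v: "v \<in> pcar n b ph d"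
  have "peval n' b' act' (pmap n b n' ph' f v) = (\<Sum>i<n. act' (v i) (f (b i)))"
    by (rule P(4)[OF _ pcar_closed[OF v]])
  also have "\<dots> = (\<Sum>i<n. f (act (v i) (b i)))"
    by (intro sum.cong) (auto simp: ghom_act[OF f pcar_closed[OF v] e])
  also have "\<dots> = f (peval n b act v)" unfolding peval_def
    using gm_closed0[OF N pcar_closed[OF v] e]
    by (intro additive_on_sum[OF gm_agrp[OF N] ghom_additive[OF f], symmetric]) auto
  finally show "peval n' b' act' (pmap n b n' ph' f v) = f (peval n b act v)" .
qed

lemma pmap_syz:
  assumes N: "gm N act" and N': "gm N' act'" and f: "ghom N act N' act' f"
    and D: "dual_basis (N 0) act {..<n} b ph" and D': "dual_basis (N' 0) act' {..<n'} b' ph'"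
  shows "ghom (syz n b ph act) pact (syz n' b' ph' act') pact (pmap n b n' ph' f)"
proof -
  note h = pmap_pcar[OF assms]
  have z: "f 0 = 0" using additive_on_zero[OF gm_agrp[OF N] ghom_additive[OF f]] .
  show ?thesis
    unfolding ghom_def
  proof (intro conjI allI ballI)
    show "pmap n b n' ph' f v \<in> syz n' b' ph' act' d" if "v \<in> syz n b ph act d" for v d
      using that ghom_closed[OF h(1), of v "Suc d"] h(2)[of v "Suc d"] z by (simp add: syz_def)
    show "additive_on (syz n b ph act d) (pmap n b n' ph' f)" for d
      using ghom_additive[OF h(1), of "Suc d"] by (auto simp: additive_on_def syz_def)
    show "pmap n b n' ph' f (pact a v) = pact a (pmap n b n' ph' f v)"
      if "a \<in> A i" "v \<in> syz n b ph act d" for i d a v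
      using ghom_act[OF h(1) that(1) syz_pcar[OF that(2)]] .
  qed
qed

text \<open>A product of matrices, with the entrywise identity \<open>comp\<close> as hypothesis
  instead of module structures. In this form it also applies when the middle dual basis belongs to
  the smaller ring of a pair.\<close>

lemma pmap_pmap:
  assumes v: "\<And>k. v k \<in> A d"
    and c': "\<And>l k. l < n' \<Longrightarrow> k < n \<Longrightarrow> ph' l (p (b k)) \<in> A 0"
    and c'': "\<And>j l. j < n'' \<Longrightarrow> l < n' \<Longrightarrow> ph'' j (i (b' l)) \<in> A 0"
    and comp: "\<And>j k. j < n'' \<Longrightarrow> k < n \<Longrightarrow>
        (\<Sum>l<n'. mul (ph' l (p (b k))) (ph'' j (i (b' l)))) = ph'' j (i (p (b k)))"
  shows "pmap n' b' n'' ph'' i (pmap n b n' ph' p v) = pmap n b n'' ph'' (\<lambda>m. i (p m)) v"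
proof
  fix j
  have "(\<Sum>l<n'. mul (\<Sum>k<n. mul (v k) (ph' l (p (b k)))) (ph'' j (i (b' l)))) =
      (\<Sum>k<n. mul (v k) (ph'' j (i (p (b k)))))" if j: "j < n''"
  proof -
    have "(\<Sum>l<n'. mul (\<Sum>k<n. mul (v k) (ph' l (p (b k)))) (ph'' j (i (b' l)))) =
        (\<Sum>l<n'. \<Sum>k<n. mul (mul (v k) (ph' l (p (b k)))) (ph'' j (i (b' l))))"
      using mul_closed[OF v c']
      by (intro sum.cong refl mul_sum_left) (auto intro!: c''[OF j])
    also have "\<dots> = (\<Sum>k<n. \<Sum>l<n'. mul (mul (v k) (ph' l (p (b k)))) (ph'' j (i (b' l))))"
      by (rule sum.swap)
    also have "\<dots> = (\<Sum>k<n. mul (v k) (\<Sum>l<n'. mul (ph' l (p (b k))) (ph'' j (i (b' l)))))"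
    proof (intro sum.cong[OF refl])
      fix k assume "k \<in> {..<n}"
      then have k: "k < n" by simp
      have "(\<Sum>l<n'. mul (mul (v k) (ph' l (p (b k)))) (ph'' j (i (b' l)))) =
          (\<Sum>l<n'. mul (v k) (mul (ph' l (p (b k))) (ph'' j (i (b' l)))))"
        by (intro sum.cong) (auto simp: mul_assoc[OF v c' c''[OF j]] k)
      also have "\<dots> = mul (v k) (\<Sum>l<n'. mul (ph' l (p (b k))) (ph'' j (i (b' l))))"
        using mul_closed[OF c' c''[OF j]] k
        by (intro mul_sum_right[OF v, symmetric]) auto
      finally show "(\<Sum>l<n'. mul (mul (v k) (ph' l (p (b k)))) (ph'' j (i (b' l)))) = \<dots>" .
    qed
    also have "\<dots> = (\<Sum>k<n. mul (v k) (ph'' j (i (p (b k)))))"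
      using comp[OF j] by (intro sum.cong) auto
    finally show ?thesis .
  qed
  then show "pmap n' b' n'' ph'' i (pmap n b n' ph' p v) j = pmap n b n'' ph'' (\<lambda>m. i (p m)) v j"
    by (simp add: pmap_def)
qed

lemma pmap_pmap_ghom:
  assumes X: "gm X ax" and p: "ghom N act X ax p" and i: "ghom X ax N' act' i"
    and D: "dual_basis (N 0) act {..<n} b ph" and D': "dual_basis (X 0) ax {..<n'} b' ph'"
    and D'': "dual_basis (N' 0) act' {..<n''} b'' ph''"
    and v: "v \<in> pcar n b ph d"
  shows "pmap n' b' n'' ph'' i (pmap n b n' ph' p v) = pmap n b n'' ph'' (\<lambda>m. i (p m)) v"
proof (rule pmap_pmap)
  have pb: "p (b k) \<in> X 0" if "k < n" for k using ghom_closed[OF p db_elem[OF D that]] .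
  show "v k \<in> A d" for k by (rule pcar_closed[OF v])
  show "ph' l (p (b k)) \<in> A 0" if "l < n'" "k < n" for l k by (rule db_closed[OF D' that(1) pb[OF that(2)]])
  show "ph'' j (i (b' l)) \<in> A 0" if "j < n''" "l < n'" for j l
    by (rule db_closed[OF D'' that(1) ghom_closed[OF i db_elem[OF D' that(2)]]])
  show "(\<Sum>l<n'. mul (ph' l (p (b k))) (ph'' j (i (b' l)))) = ph'' j (i (p (b k)))" if "j < n''" "k < n" for j k
    by (rule db_compose[OF D' pb[OF that(2)] gm_smod[OF X] slin_compose[OF ghom_slin[OF i] db_slin[OF D'' that(1)]]])
qed

text \<open>Tensoring is additive in the map, so a decomposition of the identity of
  \<open>N 0\<close> induces one of the identity of the cover. It carries retraction data from a
  module to its syzygies.\<close>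

lemma pmap_sum_id:
  assumes N: "gm N act" and D: "dual_basis (N 0) act {..<n} b ph" and v: "v \<in> pcar n b ph d"
    and f: "\<And>t m. t \<in> T \<Longrightarrow> m \<in> N 0 \<Longrightarrow> f t m \<in> N 0"
    and id: "\<And>m. m \<in> N 0 \<Longrightarrow> (\<Sum>t\<in>T. f t m) = m"
  shows "(\<Sum>t\<in>T. pmap n b n ph (f t) v) = v"
proof
  fix j
  note e = db_elem[OF D] and c = db_closed[OF D]
  have "(\<Sum>t\<in>T. \<Sum>i<n. mul (v i) (ph j (f t (b i)))) = v j" if j: "j < n"
  proof -
    have "(\<Sum>t\<in>T. \<Sum>i<n. mul (v i) (ph j (f t (b i)))) = (\<Sum>i<n. \<Sum>t\<in>T. mul (v i) (ph j (f t (b i))))"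
      by (rule sum.swap)
    also have "\<dots> = (\<Sum>i<n. mul (v i) (ph j (b i)))"
    proof (intro sum.cong[OF refl])
      fix i assume "i \<in> {..<n}"
      then have i: "i < n" by simp
      have "(\<Sum>t\<in>T. mul (v i) (ph j (f t (b i)))) = mul (v i) (\<Sum>t\<in>T. ph j (f t (b i)))"
        by (intro mul_sum_right[OF pcar_closed[OF v], symmetric]) (auto intro!: c j f e i)
      also have "(\<Sum>t\<in>T. ph j (f t (b i))) = ph j (\<Sum>t\<in>T. f t (b i))"
        by (intro additive_on_sum[OF gm_agrp[OF N] slin_additive[OF db_slin[OF D j]], symmetric]) (auto intro!: f e i)
      finally show "(\<Sum>t\<in>T. mul (v i) (ph j (f t (b i)))) = mul (v i) (ph j (b i))"
        using id[OF e[OF i]] by simp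
    qed
    finally show ?thesis using pcar_eq[OF v j] by simp
  qed
  then show "(\<Sum>t\<in>T. pmap n b n ph (f t) v) j = v j"
    using pcar_beyond[OF v, of j] by (cases "j < n") (auto simp: sum_apply pmap_def)
qed

text \<open>\<open>lin n\<close>: the minimal resolution is linear for the first \<open>n\<close> steps.  Syzygies are shifted so as
  to be generated in degree 0 again.\<close>

fun lin :: "nat \<Rightarrow> (nat \<Rightarrow> (nat \<Rightarrow> 'r) set) \<Rightarrow> ('r \<Rightarrow> (nat \<Rightarrow> 'r) \<Rightarrow> nat \<Rightarrow> 'r) \<Rightarrow> bool"
  where "lin 0 N act \<longleftrightarrow> gm N act \<and> gen N act"
  | "lin (Suc n) N act \<longleftrightarrow> gm N act \<and> gen N act \<and> sproj (N 0) act \<and>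
      (\<forall>l b ph. dual_basis (N 0) act {..<l} b ph \<longrightarrow> lin n (syz l b ph act) pact)"

definition koszul :: "(nat \<Rightarrow> (nat \<Rightarrow> 'r) set) \<Rightarrow> ('r \<Rightarrow> (nat \<Rightarrow> 'r) \<Rightarrow> nat \<Rightarrow> 'r) \<Rightarrow> bool"
  where "koszul N act \<longleftrightarrow> (\<forall>n. lin n N act)"

section \<open>Linearity under direct sums and summands\<close>

lemma lin_gm: "lin n N act \<Longrightarrow> gm N act"
  and lin_gen: "lin n N act \<Longrightarrow> gen N act"
  by (cases n; simp)+

lemma koszulD:
  assumes "koszul N act"
  shows "gm N act" "gen N act" "sproj (N 0) act"
    and "dual_basis (N 0) act {..<l} b ph \<Longrightarrow> koszul (syz l b ph act) pact"
proof -
  have k: "lin (Suc n) N act" for n using assms unfolding koszul_def by blast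
  show "gm N act" "gen N act" "sproj (N 0) act" using k[of 0] by simp_all
  show "dual_basis (N 0) act {..<l} b ph \<Longrightarrow> koszul (syz l b ph act) pact"
    using k unfolding koszul_def by simp
qed

text \<open>The preimage of a test subgroup under \<open>i t\<close> is a test subgroup for
  \<open>X t\<close>, hence everything; so all \<open>i t (p t m)\<close> lie in the subgroup, and
  with them their sum \<open>m\<close>.\<close>

lemma gen_sum_retract:
  assumes X: "\<And>t. t \<in> T \<Longrightarrow> gm (X t) (ax t)" "\<And>t. t \<in> T \<Longrightarrow> gen (X t) (ax t)"
    and p: "\<And>t. t \<in> T \<Longrightarrow> ghom N act (X t) (ax t) (p t)"
    and i: "\<And>t. t \<in> T \<Longrightarrow> ghom (X t) (ax t) N act (i t)"
    and id: "\<And>d m. m \<in> N d \<Longrightarrow> (\<Sum>t\<in>T. i t (p t m)) = m"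
  shows "gen N act"
  unfolding gen_def
proof (intro allI impI subsetI)
  fix d U m assume U: "agrp U \<and> (\<forall>a\<in>A d. \<forall>m\<in>N 0. act a m \<in> U)" and m: "m \<in> N d"
  have "i t (p t m) \<in> U" if t: "t \<in> T" for t
  proof -
    note h = i[OF t] and g = gm_agrp[OF X(1)[OF t]]
    let ?V = "{x \<in> X t d. i t x \<in> U}"
    have "agrp ?V"
      using g[of d] U additive_on_zero[OF g ghom_additive[OF h, of d]]
        additive_onD[OF ghom_additive[OF h, of d]] additive_on_minus[OF g ghom_additive[OF h, of d]]
      by (auto simp: agrp_def)
    moreover have "\<forall>a\<in>A d. \<forall>x\<in>X t 0. ax t a x \<in> ?V"
    proof (intro ballI)
      fix a x assume ax: "a \<in> A d" "x \<in> X t 0"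
      show "ax t a x \<in> ?V"
        using gm_closed0[OF X(1)[OF t] ax] ghom_act[OF h ax] ghom_closed[OF h ax(2)] U ax by auto
    qed
    ultimately have "X t d \<subseteq> ?V" using X(2)[OF t] unfolding gen_def by blast
    then show ?thesis using ghom_closed[OF p[OF t] m] by blast
  qed
  then have "(\<Sum>t\<in>T. i t (p t m)) \<in> U" using U by (intro agrp_sum) auto
  then show "m \<in> U" using id[OF m] by simp
qed

text \<open>Induction on the number of steps. Choosing dual bases, \<open>pmap\<close> turns the
  maps \<open>p t\<close> and \<open>i t\<close> into maps between the syzygies, and these again
  decompose the identity by \<open>pmap_pmap_ghom\<close> and \<open>pmap_sum_id\<close>.\<close>

lemma lin_sum_retract:
  assumes "finite T" "gm N act" "\<And>t. t \<in> T \<Longrightarrow> lin n (X t) (ax t)"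
    and "\<And>t. t \<in> T \<Longrightarrow> ghom N act (X t) (ax t) (p t)"
    and "\<And>t. t \<in> T \<Longrightarrow> ghom (X t) (ax t) N act (i t)"
    and "\<And>d m. m \<in> N d \<Longrightarrow> (\<Sum>t\<in>T. i t (p t m)) = m"
  shows "lin n N act"
  using assms
proof (induction n arbitrary: N act X ax p i)
  case 0
  then show ?case using gen_sum_retract[where T = T and X = X and ax = ax and p = p and i = i and N = N and act = act] by simp
next
  case (Suc n)
  note T = Suc.prems(1) and N = Suc.prems(2) and X = Suc.prems(3) and p = Suc.prems(4)
    and i = Suc.prems(5) and id = Suc.prems(6)
  note Xg = lin_gm[OF X]
  have g: "gen N act"
    by (rule gen_sum_retract[where T = T and X = X and ax = ax, OF Xg lin_gen[OF X] p i id])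
  have sp: "sproj (N 0) act"
    by (rule sproj_sum_retract[where T = T and X = "\<lambda>t. X t 0" and ax = ax and p = p and i = i])
      (use T X gm_smod[OF N] gm_smod[OF Xg] ghom_slin[OF p] ghom_slin[OF i] id in auto)
  have "lin n (syz l b ph act) pact" if D: "dual_basis (N 0) act {..<l} b ph" for l b ph
  proof -
    have "\<forall>t\<in>T. \<exists>(l::nat) b ph. dual_basis (X t 0) (ax t) {..<l} b ph" using X by (auto simp: sproj_def)
    then obtain l' :: "_ \<Rightarrow> nat" and b' ph' where
      D': "\<And>t. t \<in> T \<Longrightarrow> dual_basis (X t 0) (ax t) {..<l' t} (b' t) (ph' t)" by metis
    show ?thesis
    proof (rule Suc.IH[of "syz l b ph act" pact "\<lambda>t. syz (l' t) (b' t) (ph' t) (ax t)" "\<lambda>t. pact"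
            "\<lambda>t. pmap l b (l' t) (ph' t) (p t)" "\<lambda>t. pmap (l' t) (b' t) l ph (i t)", OF T gm_syz[OF N D]])
      fix t assume t: "t \<in> T"
      show "lin n (syz (l' t) (b' t) (ph' t) (ax t)) pact" using X[OF t] D'[OF t] by simp
      show "ghom (syz l b ph act) pact (syz (l' t) (b' t) (ph' t) (ax t)) pact (pmap l b (l' t) (ph' t) (p t))"
        by (rule pmap_syz[OF N Xg[OF t] p[OF t] D D'[OF t]])
      show "ghom (syz (l' t) (b' t) (ph' t) (ax t)) pact (syz l b ph act) pact (pmap (l' t) (b' t) l ph (i t))"
        by (rule pmap_syz[OF Xg[OF t] N i[OF t] D'[OF t] D])
    next
      fix d v assume v: "v \<in> syz l b ph act d"
      have "(\<Sum>t\<in>T. pmap (l' t) (b' t) l ph (i t) (pmap l b (l' t) (ph' t) (p t) v)) =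
          (\<Sum>t\<in>T. pmap l b l ph (\<lambda>m. i t (p t m)) v)"
        by (intro sum.cong refl pmap_pmap_ghom[OF Xg p i D D' D syz_pcar[OF v]])
      also have "\<dots> = v"
        by (rule pmap_sum_id[OF N D syz_pcar[OF v] _ id]) (rule ghom_closed[OF i ghom_closed[OF p]])
      finally show "(\<Sum>t\<in>T. pmap (l' t) (b' t) l ph (i t) (pmap l b (l' t) (ph' t) (p t) v)) = v" .
    qed
  qed
  then show ?case using N g sp by simp
qed

text \<open>A one-sided inverse is enough, so this covers retracts as well as isomorphic
  copies.\<close>

lemma lin_iso:
  assumes "lin n X ax" "gm N act" "ghom N act X ax p" "ghom X ax N act i" "\<And>d m. m \<in> N d \<Longrightarrow> i (p m) = m"
  shows "lin n N act"
  by (rule lin_sum_retract[where T = "{0::nat}" and X = "\<lambda>_. X" and ax = "\<lambda>_. ax" and p = "\<lambda>_. p" and i = "\<lambda>_. i"])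
    (use assms in auto)

lemma ghom_id: "ghom N act N act (\<lambda>m. m)"
  by (simp add: ghom_def additive_on_def)

text \<open>Schanuel's lemma in its simplest case: the syzygies for two dual bases of
  \<open>N 0\<close> are identified by the matrices of the identity, so linearity for one choice
  gives it for all choices that \<open>lin\<close> quantifies over.\<close>

lemma lin_SucI:
  assumes N: "gm N act" and G: "gen N act" and D: "dual_basis (N 0) act {..<l} b ph"
    and L: "lin n (syz l b ph act) pact"
  shows "lin (Suc n) N act"
proof -
  have "lin n (syz l' b' ph' act) pact" if D': "dual_basis (N 0) act {..<l'} b' ph'" for l' b' ph'
  proof (rule lin_iso[OF L gm_syz[OF N D'] pmap_syz[OF N N ghom_id D' D] pmap_syz[OF N N ghom_id D D']])
    fix d v assume v: "v \<in> syz l' b' ph' act d"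
    have "pmap l b l' ph' (\<lambda>m. m) (pmap l' b' l ph (\<lambda>m. m) v) = pmap l' b' l' ph' (\<lambda>m. m) v"
      by (rule pmap_pmap_ghom[OF N ghom_id ghom_id D' D D' syz_pcar[OF v]])
    also have "\<dots> = v"
      using pmap_sum_id[OF N D' syz_pcar[OF v], of "{()}" "\<lambda>_ m. m"] by simp
    finally show "pmap l b l' ph' (\<lambda>m. m) (pmap l' b' l ph (\<lambda>m. m) v) = v" .
  qed
  then show ?thesis using assms by (auto simp: sproj_def)
qed

section \<open>Self-injectivity and projectivity of the components of Koszul modules\<close>

text \<open>What self-injectivity contributes: an inclusion of finitely generated projective modules
  splits. The modules are taken on \<open>nat \<Rightarrow> 'r\<close>, where the kernels and covers
  to which it is applied live.\<close>

definition sinj :: bool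
  where "sinj \<longleftrightarrow> (\<forall>(U :: (nat \<Rightarrow> 'r) set) V act. smod U act \<and> smod V act \<and> U \<subseteq> V \<and> sproj U act \<and> sproj V act
    \<longrightarrow> (\<exists>\<rho>. slin V act U act \<rho> \<and> (\<forall>u\<in>U. \<rho> u = u)))"

text \<open>Degree \<open>j\<close> of the syzygy sits in degree \<open>Suc j\<close> of the cover,
  so the induction has to range over all Koszul modules. Projectivity of \<open>A t\<close> is asked
  for \<open>t \<le> j\<close> only, so that the result can feed the strong induction in
  \<open>koszul_jmod_sproj\<close>.\<close>

lemma koszul_sproj:
  assumes I: sinj
  shows "(\<And>t. t \<le> j \<Longrightarrow> sproj (A t) mul) \<Longrightarrow> koszul N act \<Longrightarrow> sproj (N j) act"
proof (induction j arbitrary: N act)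
  case 0
  then show ?case using koszulD(3) by blast
next
  case (Suc j)
  note K = koszulD[OF Suc.prems(2)]
  note N = K(1) and G = K(2)
  from K(3) obtain l :: nat and b ph where D: "dual_basis (N 0) act {..<l} b ph" by (auto simp: sproj_def)
  have 1: "sproj (syz l b ph act j) pact" using Suc.IH[OF _ K(4)[OF D]] Suc.prems by simp
  let ?U = "syz l b ph act j" and ?V = "pcar l b ph (Suc j)" and ?e = "peval l b act"
  have 2: "sproj ?V pact" using sproj_pcar[OF D gm_smod[OF N]] Suc.prems by simp
  have U: "smod ?U pact" and V: "smod ?V pact" using gm_smod[OF gm_syz[OF N D]] gm_smod[OF gm_pcar[OF D]] .
  obtain \<rho> where \<rho>: "slin ?V pact ?U pact \<rho>" "\<And>u. u \<in> ?U \<Longrightarrow> \<rho> u = u"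
    using I[unfolded sinj_def, rule_format, of ?U pact ?V] U V 1 2 syz_pcar[of _ l b ph act j] by blast
  note h = peval_ghom[OF N D]
  note ev = ghom_slin[OF h, of "Suc j"]
  \<comment> \<open>An arbitrary choice of preimages, not assumed additive. Subtracting its image
    under the retraction onto the kernel removes the dependence on the choice.\<close>
  define \<tau> where "\<tau> m = (SOME v. v \<in> ?V \<and> ?e v = m)" for m
  have \<tau>: "\<tau> m \<in> ?V" "?e (\<tau> m) = m" if "m \<in> N (Suc j)" for m
    using someI_ex[of "\<lambda>v. v \<in> ?V \<and> ?e v = m"] peval_surj[OF N G D that] by (auto simp: \<tau>_def)
  define \<sigma> where "\<sigma> m = \<tau> m - \<rho> (\<tau> m)" for m
  have Vg: "agrp ?V" using smod_agrp[OF V] .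
  have \<rho>V: "\<rho> v \<in> ?V" "?e (\<rho> v) = 0" if "v \<in> ?V" for v
    using slin_closed[OF \<rho>(1) that] by (auto simp: syz_def)
  \<comment> \<open>Two preimages of the same element differ by an element of the kernel, which
    \<open>\<rho>\<close> fixes; so \<open>v - \<rho> v\<close> depends on \<open>?e v\<close>
    alone. Linearity of \<open>\<sigma>\<close> follows by evaluating at suitable preimages.\<close>
  have k: "v - \<rho> v = \<sigma> (?e v)" if v: "v \<in> ?V" for v
  proof -
    have m: "?e v \<in> N (Suc j)" using slin_closed[OF ev v] .
    have d: "v - \<tau> (?e v) \<in> ?U"
      using v \<tau>[OF m] agrp_diff[OF Vg v] additive_on_diff[OF Vg slin_additive[OF ev] v] by (simp add: syz_def)
    then have "\<rho> v - \<rho> (\<tau> (?e v)) = v - \<tau> (?e v)"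
      using \<rho>(2)[OF d] additive_on_diff[OF Vg slin_additive[OF \<rho>(1)] v \<tau>(1)[OF m]] by simp
    then show ?thesis by (simp add: \<sigma>_def algebra_simps)
  qed
  show ?case
  proof (rule sproj_retract[OF gm_smod[OF N] V 2 _ ev, where p = \<sigma>])
    show "slin (N (Suc j)) act ?V pact \<sigma>"
      unfolding slin_def additive_on_def
    proof (intro conjI ballI)
      fix m assume m: "m \<in> N (Suc j)"
      then show "\<sigma> m \<in> ?V" using agrp_diff[OF Vg \<tau>(1) \<rho>V(1)[OF \<tau>(1)]] by (simp add: \<sigma>_def)
    next
      fix x y assume xy: "x \<in> N (Suc j)" "y \<in> N (Suc j)"
      note t = \<tau>(1)[OF xy(1)] \<tau>(1)[OF xy(2)]
      have "?e (\<tau> x + \<tau> y) = x + y" using additive_onD[OF slin_additive[OF ev] t] \<tau>(2) xy by simp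
      then have "\<sigma> (x + y) = \<tau> x + \<tau> y - \<rho> (\<tau> x + \<tau> y)" using k[OF agrp_add[OF Vg t]] by simp
      then show "\<sigma> (x + y) = \<sigma> x + \<sigma> y"
        using additive_onD[OF slin_additive[OF \<rho>(1)] t] by (simp add: \<sigma>_def)
    next
      fix a m assume a: "a \<in> A 0" and m: "m \<in> N (Suc j)"
      note t = \<tau>(1)[OF m]
      have "?e (pact a (\<tau> m)) = act a m" using slin_act[OF ev a t] \<tau>(2)[OF m] by simp
      then have "\<sigma> (act a m) = pact a (\<tau> m) - \<rho> (pact a (\<tau> m))" using k[OF smod_closed[OF V a t]] by simp
      also have "\<dots> = pact a (\<tau> m) - pact a (\<rho> (\<tau> m))" using slin_act[OF \<rho>(1) a t] by simp
      also have "\<dots> = pact a (\<sigma> m)"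
        using additive_on_diff[OF Vg _ t \<rho>V(1)[OF t], of "pact a"] smod_add_right[OF V a]
        by (simp add: additive_on_def \<sigma>_def)
      finally show "\<sigma> (act a m) = pact a (\<sigma> m)" .
    qed
    show "?e (\<sigma> m) = m" if m: "m \<in> N (Suc j)" for m
      using additive_on_diff[OF Vg slin_additive[OF ev] \<tau>(1)[OF m] \<rho>V(1)[OF \<tau>(1)[OF m]]] \<rho>V(2)[OF \<tau>(1)[OF m]] \<tau>(2)[OF m]
      by (simp add: \<sigma>_def)
  qed
qed


section \<open>The degree zero part and the positive part as graded modules\<close>

text \<open>Places a ring element in coordinate 0, since \<open>lin\<close> speaks of modules on the
  type \<open>nat \<Rightarrow> 'r\<close>.\<close>

definition emb :: "'r \<Rightarrow> nat \<Rightarrow> 'r"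
  where "emb a = (\<lambda>j. if j = 0 then a else 0)"

definition zmod :: "nat \<Rightarrow> (nat \<Rightarrow> 'r) set"
  where "zmod d = (if d = 0 then emb ` A 0 else {0})"

text \<open>The quotient of the ring by its positive part: scalars of positive degree must act as
  zero. A scalar of positive degree that passes the test is zero by
  \<open>A_disjoint\<close>.\<close>

definition zact :: "'r \<Rightarrow> (nat \<Rightarrow> 'r) \<Rightarrow> nat \<Rightarrow> 'r"
  where "zact a v = (if a \<in> A 0 then pact a v else 0)"

definition jmod :: "nat \<Rightarrow> (nat \<Rightarrow> 'r) set"
  where "jmod d = emb ` A (Suc d)"

lemma emb_0 [simp]: "emb a 0 = a"
  by (simp add: emb_def)

lemma emb_zero [simp]: "emb 0 = 0"
  by (auto simp: emb_def)

lemma emb_add: "emb (a + b) = emb a + emb b"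
  by (auto simp: emb_def)

lemma pact_emb: "a \<in> A i \<Longrightarrow> pact a (emb t) = emb (mul a t)"
  by (auto simp: pact_def emb_def mul_zero_right)

lemma additive_emb: "additive_on Q emb"
  by (simp add: additive_on_def emb_add)

lemma gm_jmod: "gm jmod pact"
proof (rule gm_sub[OF gm_shift[OF gm_pointwise]])
  show "jmod d \<subseteq> {v. \<forall>j. v j \<in> A (Suc d)}" for d by (auto simp: jmod_def emb_def agrp_zero[OF A_grp])
  show "agrp (jmod d)" for d unfolding jmod_def by (rule agrp_image[OF A_grp additive_emb])
  show "pact a v \<in> jmod (i + d)" if "a \<in> A i" "v \<in> jmod d" for i d a v
    using that mul_closed[OF that(1), of _ "Suc d"] by (auto simp: jmod_def pact_emb)
qed

lemma zact_pos: "a \<in> A (Suc i) \<Longrightarrow> v \<in> zmod d \<Longrightarrow> zact a v = 0"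
  using A_disjoint[of a i]
  by (auto simp: zact_def zmod_def pact_emb[of 0 0] agrp_zero[OF A_grp] mul_zero_left split: if_splits)
    (auto simp: pact_def mul_zero_right[OF agrp_zero[OF A_grp]])

lemma zact_emb: "a \<in> A 0 \<Longrightarrow> zact a (emb t) = emb (mul a t)"
  by (simp add: zact_def pact_emb)

lemma zact_zero: "zact a 0 = 0"
  by (auto simp: zact_def pact_def mul_zero_right)

lemma gm_zmod: "gm zmod zact"
  unfolding gm_def
proof (intro conjI allI ballI)
  show "agrp (zmod d)" for d
    using agrp_image[OF A_grp additive_emb, of 0] by (auto simp: zmod_def agrp_def)
  show "zact a m \<in> zmod (i + d)" if "a \<in> A i" "m \<in> zmod d" for i d a m
  proof (cases i)
    case 0 then show ?thesis using that mul_closed[of a 0 _ 0] by (auto simp: zmod_def zact_emb zact_zero split: if_splits)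
  next
    case (Suc j) then show ?thesis using that zact_pos[of a j m d] by (simp add: zmod_def)
  qed
  show "zact (a + a') m = zact a m + zact a' m" if "a \<in> A i" "a' \<in> A i" "m \<in> zmod d" for i d a a' m
  proof (cases i)
    case 0 then show ?thesis using that agrp_add[OF A_grp[of 0], of a a']
      by (auto simp: zmod_def zact_emb zact_zero emb_add mul_add_left[of a 0 a' _ 0] split: if_splits)
  next
    case (Suc j) then show ?thesis using that zact_pos[of _ j m d] agrp_add[OF A_grp] by simp
  qed
  show "zact a (m + m') = zact a m + zact a m'" if "a \<in> A i" "m \<in> zmod d" "m' \<in> zmod d" for i d a m m'
  proof (cases i)
    case 0 then show ?thesis using that
      by (auto simp: zmod_def zact_emb zact_zero emb_add[symmetric] mul_add_right[of a 0 _ 0] split: if_splits)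
  next
    case (Suc j) then show ?thesis using that zact_pos[of _ j _ d] \<open>\<And>d. agrp (zmod d)\<close> by (simp add: agrp_add)
  qed
  show "zact (mul a a') m = zact a (zact a' m)" if "a \<in> A i" "a' \<in> A j" "m \<in> zmod d" for i j d a a' m
  proof (cases j)
    case (Suc l)
    then have "mul a a' \<in> A (Suc (i + l))" using mul_closed that(1,2) by fastforce
    then show ?thesis using that zact_pos[of a' l m d] zact_pos[of "mul a a'" "i + l" m d] Suc by (simp add: zact_zero)
  next
    case j: 0
    show ?thesis
    proof (cases i)
      case 0 then show ?thesis using that j mul_closed[of a 0 a' 0]
        by (auto simp: zmod_def zact_emb zact_zero mul_assoc[of a 0 a' 0 _ 0] split: if_splits)
    next
      case (Suc l)
      then have "mul a a' \<in> A (Suc l)" using mul_closed[OF that(1,2)] j by simp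
      moreover have "zact a' m \<in> zmod d" using \<open>\<And>i d a m. a \<in> A i \<Longrightarrow> m \<in> zmod d \<Longrightarrow> zact a m \<in> zmod (i + d)\<close>[OF that(2,3)] j by simp
      ultimately show ?thesis using that zact_pos[of _ l _ d] Suc by simp
    qed
  qed
  show "zact one m = m" if "m \<in> zmod d" for d m
    using that one_closed by (auto simp: zmod_def zact_emb zact_zero one_left split: if_splits)
qed

lemma gen_zmod: "gen zmod zact"
  unfolding gen_def
proof (intro allI impI subsetI)
  fix d T m assume T: "agrp T \<and> (\<forall>a\<in>A d. \<forall>m\<in>zmod 0. zact a m \<in> T)" and m: "m \<in> zmod d"
  show "m \<in> T"
  proof (cases d)
    case 0 then show ?thesis using T m one_closed gm_one[OF gm_zmod m] by metis
  next
    case (Suc e) then show ?thesis using T m by (simp add: zmod_def agrp_zero)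
  qed
qed

lemma dual_basis_zmod: "dual_basis (zmod 0) zact {..<Suc 0} (\<lambda>_. emb one) (\<lambda>_ v. v 0)"
  unfolding dual_basis_def slin_def additive_on_def
  by (auto simp: zmod_def one_closed zact_emb one_right)

text \<open>The degree zero part is free on \<open>one\<close>, so its cover is the ring itself, and
  the kernel of the projection is the positive part, shifted.\<close>

lemma syz_zmod: "syz (Suc 0) (\<lambda>_. emb one) (\<lambda>_ v. v 0) zact = jmod"
proof -
  have "v \<in> syz (Suc 0) (\<lambda>_. emb one) (\<lambda>_ v. v 0) zact d \<longleftrightarrow> v \<in> jmod d" for d v
  proof -
  have "v \<in> jmod d \<longleftrightarrow> v 0 \<in> A (Suc d) \<and> (\<forall>j\<ge>Suc 0. v j = 0)"
  proof
    assume "v 0 \<in> A (Suc d) \<and> (\<forall>j\<ge>Suc 0. v j = 0)"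
    then have "v = emb (v 0)" "v 0 \<in> A (Suc d)" by (auto simp: emb_def fun_eq_iff)
    then show "v \<in> jmod d" unfolding jmod_def by (rule image_eqI)
  qed (auto simp: jmod_def emb_def)
  moreover have "emb one \<in> zmod 0" by (simp add: zmod_def one_closed)
  ultimately show "v \<in> syz (Suc 0) (\<lambda>_. emb one) (\<lambda>_ v. v 0) zact d \<longleftrightarrow> v \<in> jmod d"
    by (auto simp: syz_def pcar_def peval_def one_right zact_pos)
  qed
  then show ?thesis by (intro ext) blast
qed

lemma koszul_zmod_iff: "koszul zmod zact \<longleftrightarrow> koszul jmod pact"
proof
  assume "koszul zmod zact"
  then show "koszul jmod pact" 
    using koszulD(4)[of zmod zact "Suc 0" "\<lambda>_. emb one" "\<lambda>_ v. v 0"] dual_basis_zmod by (simp add: syz_zmod)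
next
  assume K: "koszul jmod pact"
  have "lin n zmod zact" for n
    by (cases n) (use gm_zmod gen_zmod lin_SucI[OF gm_zmod gen_zmod dual_basis_zmod] K in
        \<open>auto simp: syz_zmod koszul_def simp del: lin.simps(2)\<close>)
  then show "koszul zmod zact" by (simp add: koszul_def)
qed

lemma sproj_A0: "sproj (A 0) mul"
  by (rule sprojI[of _ _ "{()}" "\<lambda>_. one" "\<lambda>_ a. a"])
    (auto simp: dual_basis_def slin_def additive_on_def one_closed one_right)

text \<open>Degree \<open>i\<close> of \<open>jmod\<close> is \<open>A (Suc i)\<close>, while
  \<open>koszul_sproj\<close> at \<open>i\<close> needs only the parts of degree at most
  \<open>i\<close>; so the projectivity of the ring parts climbs by strong induction.\<close>

lemma koszul_jmod_sproj:
  assumes I: sinj and K: "koszul jmod pact"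
  shows "sproj (A j) mul"
proof (induction j rule: less_induct)
  case (less j)
  show ?case
  proof (cases j)
    case 0 then show ?thesis using sproj_A0 by simp
  next
    case (Suc i)
    have "sproj (jmod i) pact" using koszul_sproj[OF I _ K, of i] less Suc by simp
    then show ?thesis
      by (rule sproj_retract[where p = emb and i = "\<lambda>v. v 0", rotated 2, OF _ _ _ _ gm_smod[OF gm_A] gm_smod[OF gm_jmod]])
        (auto simp: slin_def jmod_def Suc pact_emb emb_add additive_on_def)
  qed
qed

lemma ghom_compose:
  "ghom N act N' act' f \<Longrightarrow> ghom N' act' N'' act'' g \<Longrightarrow> ghom N act N'' act'' (\<lambda>x. g (f x))"
  unfolding ghom_def additive_on_def by (auto; metis)

text \<open>Projectivity of \<open>Q\<close> provides a section \<open>\<sigma>\<close> of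
  \<open>e\<close>, and \<open>v - \<sigma> (e v)\<close> retracts \<open>V\<close> onto the
  kernel.\<close>

lemma sproj_kernel:
  assumes V: "smod V av" "sproj V av" and Q: "smod Q act" "sproj Q act" and e: "slin V av Q act e"
    and surj: "\<And>m. m \<in> Q \<Longrightarrow> \<exists>v\<in>V. e v = m"
  shows "sproj {v \<in> V. e v = 0} av"
proof -
  obtain \<sigma> where \<sigma>: "slin Q act V av \<sigma>" "\<And>m. m \<in> Q \<Longrightarrow> e (\<sigma> m) = m"
    using sproj_lift[OF Q V(1) e surj] by blast
  note g = smod_agrp[OF V(1)] and ea = slin_additive[OF e] and sa = slin_additive[OF \<sigma>(1)]
  let ?U = "{v \<in> V. e v = 0}" and ?p = "\<lambda>v. v - \<sigma> (e v)"
  have act0: "act a 0 = 0" if "a \<in> A 0" for a using smod_sum_right[OF Q(1) that, of "{}"] by simp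
  have sV: "\<sigma> (e v) \<in> V" if "v \<in> V" for v using slin_closed[OF \<sigma>(1) slin_closed[OF e that]] .
  have U: "smod ?U av"
    unfolding smod_def
  proof (intro conjI ballI)
    show "agrp ?U" using g additive_on_zero[OF g ea] additive_onD[OF ea] additive_on_minus[OF g ea]
      by (auto simp: agrp_def)
  qed (use act0 in \<open>auto simp: smod_closed[OF V(1)] slin_act[OF e] smod_add_left[OF V(1)] smod_add_right[OF V(1)]
       smod_assoc[OF V(1)] smod_one[OF V(1)]\<close>)
  show ?thesis
  proof (rule sproj_retract[OF U V, where p = "\<lambda>v. v" and i = ?p])
    show "slin ?U av V av (\<lambda>v. v)" by (simp add: slin_def additive_on_def)
    show "slin V av ?U av ?p"
      unfolding slin_def
    proof (intro conjI ballI)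
      show "?p v \<in> ?U" if "v \<in> V" for v
        using that additive_on_diff[OF g ea that sV[OF that]] \<sigma>(2)[OF slin_closed[OF e that]] agrp_diff[OF g that sV[OF that]] by simp
      show "additive_on V ?p"
        using additive_onD[OF ea] additive_onD[OF sa] slin_closed[OF e] by (simp add: additive_on_def)
      show "?p (av a v) = av a (?p v)" if "a \<in> A 0" "v \<in> V" for a v
        using that additive_on_diff[OF g _ that(2) sV[OF that(2)], of "av a"] smod_add_right[OF V(1) that(1)]
        by (simp add: slin_act[OF e] slin_act[OF \<sigma>(1) _ slin_closed[OF e]] additive_on_def)
    qed
    show "?p v = v" if "v \<in> ?U" for v
      using that additive_on_zero[OF smod_agrp[OF Q(1)] sa] by simp
  qed
qed

lemma sproj_syz:
  assumes N: "gm N act" and G: "gen N act" and D: "dual_basis (N 0) act {..<l} b ph"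
    and A: "sproj (A (Suc d)) mul" and s: "sproj (N (Suc d)) act"
  shows "sproj (syz l b ph act d) pact"
  unfolding syz_def
  by (rule sproj_kernel[OF gm_smod[OF gm_pcar[OF D]] sproj_pcar[OF D gm_smod[OF N] A] gm_smod[OF N] s
        ghom_slin[OF peval_ghom[OF N D]] peval_surj[OF N G D]])

end

section \<open>Two graded rings with the same positive part\<close>

text \<open>\<open>A\<close> will come from the category and \<open>B\<close> from its subcategory
  with scalar endomorphisms. The rings differ in degree zero only, and \<open>B_sproj\<close> makes
  restriction of scalars in degree zero preserve projectivity.\<close>

locale gpair = A: gring A mul one + B: gring B mul one
  for A B :: "nat \<Rightarrow> 'r::ab_group_add set" and mul one +
  assumes B_zero: "B 0 \<subseteq> A 0" and B_Suc: "B (Suc d) = A (Suc d)"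
    and B_sproj: "B.sproj (A 0) mul"
begin

lemma B_sub: "a \<in> B d \<Longrightarrow> a \<in> A d"
  using B_zero B_Suc by (cases d) auto

lemma B_gm: "A.gm N act \<Longrightarrow> B.gm N act"
  unfolding B.gm_def
  by (intro conjI allI ballI) (auto simp: B_sub A.gm_agrp intro: A.gm_closed A.gm_add_left A.gm_add_right A.gm_assoc A.gm_one B_sub)

lemma B_gen:
  assumes N: "A.gm N act" and G: "A.gen N act"
  shows "B.gen N act"
  unfolding B.gen_def
proof (intro allI impI subsetI)
  fix d T m assume T: "agrp T \<and> (\<forall>a\<in>B d. \<forall>m\<in>N 0. act a m \<in> T)" and m: "m \<in> N d"
  show "m \<in> T"
  proof (cases d)
    case 0 then show ?thesis using T m B.one_closed A.gm_one[OF N m] by metis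
  next
    case (Suc e) then show ?thesis using T m G[unfolded A.gen_def, rule_format, of T d] B_Suc by auto
  qed
qed

lemma A_gen: "B.gen N act \<Longrightarrow> A.gen N act"
  unfolding B.gen_def A.gen_def using B_sub by blast

lemma B_slin: "A.slin Q act Q' act' f \<Longrightarrow> B.slin Q act Q' act' f"
  unfolding A.slin_def B.slin_def using B_zero by blast

lemma B_smod: "A.smod Q act \<Longrightarrow> B.smod Q act"
  unfolding A.smod_def B.smod_def using B_zero by blast

text \<open>An \<open>A\<close>-dual basis makes \<open>Q\<close> a summand of copies of
  \<open>A 0\<close>, which is itself projective over \<open>B 0\<close>.\<close>

lemma B_sproj_of_A:
  assumes Q: "A.smod Q act" "A.sproj Q act"
  shows "B.sproj Q act"
proof -
  obtain n :: nat and b ph where D: "A.dual_basis Q act {..<n} b ph" using Q by (auto simp: A.sproj_def)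
  show ?thesis
  proof (rule B.sproj_sum_retract[where T = "{..<n}" and X = "\<lambda>_. A 0" and ax = "\<lambda>_. mul" and p = ph
        and i = "\<lambda>t a. act a (b t)"])
    show "B.smod (A 0) mul" by (rule B_smod[OF A.gm_smod[OF A.gm_A]])
    show "B.slin Q act (A 0) mul (ph t)" if "t \<in> {..<n}" for t using B_slin[OF A.dual_basis_slin[OF D that]] .
    show "B.slin (A 0) mul Q act (\<lambda>a. act a (b t))" if "t \<in> {..<n}" for t
      using A.dual_basis_elem[OF D that]
      by (intro B_slin) (auto simp: A.slin_def additive_on_def A.smod_closed[OF Q(1)] A.smod_add_left[OF Q(1)] A.smod_assoc[OF Q(1)])
  qed (use A.dual_basis_sum[OF D] B_smod[OF Q(1)] B_sproj in auto)
qed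

context
  fixes M :: "nat \<Rightarrow> (nat \<Rightarrow> 'r) set" and act and n m :: nat and b ph c \<chi>
  assumes M: "A.gm M act" and DA: "A.dual_basis (M 0) act {..<n} b ph" and DB: "B.dual_basis (M 0) act {..<m} c \<chi>"
begin

text \<open>In positive degrees \<open>up\<close> is the canonical map from the tensor product over
  \<open>B 0\<close> onto the one over \<open>A 0\<close>. In the other direction,
  \<open>down\<close> reads a vector as the sum of the tensors of \<open>v i\<close> with
  \<open>b i\<close> over \<open>B 0\<close>; it depends on the chosen dual basis and is linear over
  \<open>B\<close> only.\<close>

abbreviation "down \<equiv> A.pmap n b m \<chi> (\<lambda>x. x)"
abbreviation "up \<equiv> A.pmap m c n ph (\<lambda>x. x)"
abbreviation "SA \<equiv> A.syz n b ph act"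
abbreviation "SB \<equiv> B.syz m c \<chi> act"

lemma up_props:
  assumes v: "\<And>j. v j \<in> A (Suc d)"
  shows "up v \<in> A.pcar n b ph (Suc d)" "A.peval n b act (up v) = A.peval m c act v"
    "(\<And>j. w j \<in> A (Suc d)) \<Longrightarrow> up (v + w) = up v + up w" "a \<in> A i \<Longrightarrow> up (A.pact a v) = A.pact a (up v)"
proof -
  note fb = B.db_elem[OF DB]
  show "up v \<in> A.pcar n b ph (Suc d)" by (rule A.pmap_closed[where f = "\<lambda>x. x" and b = c, OF M DA fb v])
  show "A.peval n b act (up v) = A.peval m c act v"
    using A.peval_pmap[where f = "\<lambda>x. x" and b = c, OF M DA fb v] by (simp add: A.peval_def)
  show "(\<And>j. w j \<in> A (Suc d)) \<Longrightarrow> up (v + w) = up v + up w" by (rule A.pmap_add[where f = "\<lambda>x. x" and b = c, OF M DA fb v])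
  show "a \<in> A i \<Longrightarrow> up (A.pact a v) = A.pact a (up v)" by (rule A.pmap_pact[where f = "\<lambda>x. x" and b = c, OF M DA fb _ v])
qed

lemma down_props:
  assumes v: "\<And>j. v j \<in> A (Suc d)"
  shows "down v \<in> B.pcar m c \<chi> (Suc d)" "A.peval m c act (down v) = A.peval n b act v"
    "(\<And>j. w j \<in> A (Suc d)) \<Longrightarrow> down (v + w) = down v + down w" "a \<in> B i \<Longrightarrow> down (A.pact a v) = A.pact a (down v)"
proof -
  note fb = A.db_elem[OF DA] and v' = v[folded B_Suc] and M' = B_gm[OF M]
  show "down v \<in> B.pcar m c \<chi> (Suc d)" by (rule B.pmap_closed[where f = "\<lambda>x. x" and b = b, OF M' DB fb v'])
  show "A.peval m c act (down v) = A.peval n b act v"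
    using B.peval_pmap[where f = "\<lambda>x. x" and b = b, OF M' DB fb v'] by (simp add: B.peval_def)
  show "(\<And>j. w j \<in> A (Suc d)) \<Longrightarrow> down (v + w) = down v + down w"
    by (rule B.pmap_add[where f = "\<lambda>x. x" and b = b, OF M' DB fb v']) (simp_all add: B_Suc)
  show "a \<in> B i \<Longrightarrow> down (A.pact a v) = A.pact a (down v)" by (rule B.pmap_pact[where f = "\<lambda>x. x" and b = b, OF M' DB fb _ v'])
qed

lemma pcar_closedB: "v \<in> B.pcar m c \<chi> (Suc d) \<Longrightarrow> v j \<in> A (Suc d)"
  using B.pcar_closed B_Suc by metis

text \<open>The tensors of \<open>v i\<close> with \<open>b i\<close> are formed over
  \<open>B 0\<close> and then taken over \<open>A 0\<close>, which returns the expansion of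
  \<open>v\<close> itself.\<close>

lemma up_down:
  assumes v: "v \<in> A.pcar n b ph (Suc d)"
  shows "up (down v) = v"
proof -
  have "up (down v) = A.pmap n b n ph (\<lambda>x. x) v"
  proof (rule A.pmap_pmap)
    show "v k \<in> A (Suc d)" for k by (rule A.pcar_closed[OF v])
    show "\<chi> l (b k) \<in> A 0" if "l < m" "k < n" for l k
      using B.db_closed[OF DB that(1) A.db_elem[OF DA that(2)]] B_zero by blast
    show "ph j (c l) \<in> A 0" if "j < n" "l < m" for j l
      by (rule A.db_closed[OF DA that(1) B.db_elem[OF DB that(2)]])
    show "(\<Sum>l<m. mul (\<chi> l (b k)) (ph j (c l))) = ph j (b k)" if "j < n" "k < n" for j k
      by (rule B.db_compose[OF DB A.db_elem[OF DA that(2)] B.gm_smod[OF B_gm[OF M]] B_slin[OF A.db_slin[OF DA that(1)]]])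
  qed
  also have "\<dots> = v" using A.pmap_sum_id[OF M DA v, of "{()}" "\<lambda>_ m. m"] by simp
  finally show ?thesis .
qed

lemma up_ghom: "B.ghom SB A.pact SA A.pact up"
  unfolding B.ghom_def additive_on_def
proof (intro conjI allI ballI)
  fix d v assume v: "v \<in> SB d"
  then have c: "v j \<in> A (Suc d)" for j using pcar_closedB[OF B.syz_pcar] by blast
  show "up v \<in> SA d" using up_props(1,2)[OF c] v by (simp add: A.syz_def B.syz_def)
  fix w assume "w \<in> SB d"
  then have "w j \<in> A (Suc d)" for j using pcar_closedB[OF B.syz_pcar] by blast
  then show "up (v + w) = up v + up w" by (rule up_props(3)[OF c])
next
  fix i d a v assume a: "a \<in> B i" and v: "v \<in> SB d"
  then have c: "v j \<in> A (Suc d)" for j using pcar_closedB[OF B.syz_pcar] by blast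
  show "up (A.pact a v) = A.pact a (up v)" by (rule up_props(4)[OF c B_sub[OF a]])
qed

lemma down_ghom: "B.ghom SA A.pact SB A.pact down"
  unfolding B.ghom_def additive_on_def
proof (intro conjI allI ballI)
  fix d v assume v: "v \<in> SA d"
  then have c: "v j \<in> A (Suc d)" for j using A.pcar_closed[OF A.syz_pcar] by blast
  show "down v \<in> SB d" using down_props(1,2)[OF c] v by (simp add: A.syz_def B.syz_def)
  fix w assume "w \<in> SA d"
  then have "w j \<in> A (Suc d)" for j using A.pcar_closed[OF A.syz_pcar] by blast
  then show "down (v + w) = down v + down w" by (rule down_props(3)[OF c])
next
  fix i d a v assume a: "a \<in> B i" and v: "v \<in> SA d"
  then have c: "v j \<in> A (Suc d)" for j using A.pcar_closed[OF A.syz_pcar] by blast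
  show "down (A.pact a v) = A.pact a (down v)" by (rule down_props(4)[OF c a])
qed

text \<open>Over \<open>B\<close>, the syzygy for \<open>A\<close> is a retract of the syzygy for
  \<open>B\<close>, by \<open>up_down\<close>.\<close>

lemma lin_syz_restrict:
  assumes "B.lin k SB A.pact"
  shows "B.lin k SA A.pact"
  by (rule B.lin_iso[OF assms B_gm[OF A.gm_syz[OF M DA]] down_ghom up_ghom])
    (rule up_down[OF A.syz_pcar])

text \<open>The idempotent complementary to \<open>down\<close> after \<open>up\<close>. Both maps
  preserve evaluation, so the difference has value zero and lands in the syzygy, even when it is
  applied to arbitrary vectors of the cover.\<close>

lemma rest_ghom: "B.ghom (\<lambda>d. B.pcar m c \<chi> (Suc d)) A.pact SB A.pact (\<lambda>v. v - down (up v))"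
  unfolding B.ghom_def additive_on_def
proof (intro conjI allI ballI)
  note M' = B_gm[OF M] and g = B.agrp_pcar[OF DB]
  {
    fix d v assume v: "v \<in> B.pcar m c \<chi> (Suc d)"
    have c: "v j \<in> A (Suc d)" for j using pcar_closedB[OF v] .
    note u = up_props[OF c]
    have c': "up v j \<in> A (Suc d)" for j using A.pcar_closed[OF u(1)] .
    note c c' u down_props[OF c']
  } note * = this
  {
    fix d v assume v: "v \<in> B.pcar m c \<chi> (Suc d)"
    note s = *[OF v]
    show "v - down (up v) \<in> SB d"
      using agrp_diff[OF g v s(7)] s(4,8)
        additive_on_diff[OF g B.ghom_additive[OF B.peval_ghom[OF M' DB]] v s(7)]
      by (simp add: B.syz_def)
    fix w assume w: "w \<in> B.pcar m c \<chi> (Suc d)"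
    note t = *[OF w]
    show "v + w - down (up (v + w)) = v - down (up v) + (w - down (up w))"
      using s(5)[OF t(1)] s(9)[OF t(2)] by simp
  }
  fix i d a v assume a: "a \<in> B i" and v: "v \<in> B.pcar m c \<chi> (Suc d)"
  note s = *[OF v]
  note P = B.gm_shift[OF B.gm_pcar[OF DB]]
  have "A.pact a (v - down (up v)) = A.pact a v - A.pact a (down (up v))"
    using B.gm_add_right[OF P a] by (intro additive_on_diff[OF g _ v s(7)]) (simp add: additive_on_def)
  then show "A.pact a v - down (up (A.pact a v)) = A.pact a (v - down (up v))"
    using s(6)[OF B_sub[OF a]] s(10)[OF a] by simp
qed

text \<open>The converse transfer needs a complement of \<open>SA\<close> in \<open>SB\<close>. By
  \<open>rest_ghom\<close> the complement is also a summand of the cover in positive degrees, hence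
  of finitely many copies of \<open>jmod\<close>; so \<open>SB\<close> is a summand of
  \<open>SA\<close> plus copies of \<open>jmod\<close>.\<close>

lemma lin_syz_extend:
  assumes K: "B.lin k SA A.pact" and J: "B.lin k A.jmod A.pact"
  shows "B.lin k SB A.pact"
proof -
  \<comment> \<open>The pure tensor of \<open>a\<close> with the basis element
    \<open>c t\<close>.\<close>
  define e where "e t a = (\<lambda>j. if j < m then mul a (\<chi> j (c t)) else 0)" for t a
  note M' = B_gm[OF M] and g = B.agrp_pcar[OF DB]
  have JB: "A.jmod = B.jmod" by (simp add: fun_eq_iff A.jmod_def B.jmod_def B_Suc)
  have eh: "B.ghom A.jmod A.pact (\<lambda>d. B.pcar m c \<chi> (Suc d)) A.pact (\<lambda>u. e t (u 0))" if t: "t < m" for t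
    unfolding B.ghom_def additive_on_def JB
  proof (intro conjI allI ballI)
    note ce = B.db_closed[OF DB _ B.db_elem[OF DB t]]
    show "e t (u 0) \<in> B.pcar m c \<chi> (Suc d)" if "u \<in> B.jmod d" for d u
      using that B.pcar_tensor[OF DB B.db_elem[OF DB t] B.gm_smod[OF M'], of "u 0" "Suc d"]
      by (auto simp: B.jmod_def e_def)
    show "e t ((u + w) 0) = e t (u 0) + e t (w 0)" if "u \<in> B.jmod d" "w \<in> B.jmod d" for d u w
      using that by (auto simp: e_def fun_eq_iff B.jmod_def B.mul_add_left[OF _ _ ce])
    show "e t (A.pact a u 0) = A.pact a (e t (u 0))" if "a \<in> B i" "u \<in> B.jmod d" for i d a u
      using that by (auto simp: e_def fun_eq_iff B.jmod_def A.pact_def B.mul_assoc[OF _ _ ce] B.mul_zero_right)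
  qed
  show ?thesis
  \<comment> \<open>The index \<open>m\<close> stands for the summand \<open>SA\<close>, an index
    \<open>t < m\<close> for the copy of \<open>jmod\<close> that holds the coordinate
    \<open>t\<close>.\<close>
  proof (rule B.lin_sum_retract[where T = "{..m}" and X = "\<lambda>t. if t = m then SA else A.jmod" and ax = "\<lambda>_. A.pact"
        and p = "\<lambda>t. if t = m then up else (\<lambda>v. A.emb (v t))"
        and i = "\<lambda>t. if t = m then down else (\<lambda>u. e t (u 0) - down (up (e t (u 0))))"])
    show "B.gm SB A.pact" by (rule B.gm_syz[OF M' DB])
    fix t assume t: "t \<in> {..m}"
    show "B.lin k (if t = m then SA else A.jmod) A.pact" using K J by simp
    have "B.ghom SB A.pact A.jmod A.pact (\<lambda>v. A.emb (v t))"
      unfolding JB B.ghom_def additive_on_def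
      by (auto simp: B.jmod_def B.emb_add dest!: B.syz_pcar intro!: imageI B.pcar_closed)
        (simp add: B.pact_emb, simp add: B.pact_def)
    then show "B.ghom SB A.pact (if t = m then SA else A.jmod) A.pact (if t = m then up else (\<lambda>v. A.emb (v t)))"
      using up_ghom by simp
    show "B.ghom (if t = m then SA else A.jmod) A.pact SB A.pact
        (if t = m then down else (\<lambda>u. e t (u 0) - down (up (e t (u 0)))))"
      using down_ghom B.ghom_compose[OF eh rest_ghom, of t] t by auto
  next
    fix d v assume v: "v \<in> SB d"
    note vp = B.syz_pcar[OF v]
    let ?r = "\<lambda>v. v - down (up v)"
    have sum: "(\<Sum>t<m. e t (v t)) = v"
    proof
      fix j show "(\<Sum>t<m. e t (v t)) j = v j"
        using B.pcar_eq[OF vp, of j] B.pcar_beyond[OF vp, of j] by (cases "j < m") (auto simp: e_def sum_apply)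
    qed
    have "e t (v t) \<in> B.pcar m c \<chi> (Suc d)" if "t < m" for t
      using B.pcar_tensor[OF DB B.db_elem[OF DB that] B.gm_smod[OF M'] B.pcar_closed[OF vp]] by (simp add: e_def)
    then have "(\<Sum>t<m. ?r (e t (v t))) = ?r v"
      using additive_on_sum[OF g B.ghom_additive[OF rest_ghom], of "{..<m}" "\<lambda>t. e t (v t)" d] sum by simp
    moreover have "{..m} = insert m {..<m}" by auto
    ultimately show "(\<Sum>t\<le>m. (if t = m then down else (\<lambda>u. ?r (e t (u 0))))
        ((if t = m then up else (\<lambda>v. A.emb (v t))) v)) = v"
      by simp
  qed simp
qed

end

text \<open>The syzygy over \<open>A\<close> keeps both hypotheses: it is Koszul over
  \<open>B\<close> by \<open>lin_syz_restrict\<close>, and its components are projective as kernels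
  of surjections between projective modules.\<close>

lemma koszul_A_of_B:
  assumes A: "\<And>d. A.sproj (A d) mul"
  shows "A.gm M act \<Longrightarrow> (\<And>d. A.sproj (M d) act) \<Longrightarrow> B.koszul M act \<Longrightarrow> A.lin k M act"
proof (induction k arbitrary: M act)
  case 0
  then show ?case using A_gen[OF B.koszulD(2)[OF 0(3)]] by simp
next
  case (Suc k)
  note M = Suc.prems(1) and K = B.koszulD[OF Suc.prems(3)]
  note G = A_gen[OF K(2)]
  obtain m :: nat and c \<chi> where DB: "B.dual_basis (M 0) act {..<m} c \<chi>" using K(3) by (auto simp: B.sproj_def)
  have "A.lin k (A.syz n b ph act) A.pact" if D: "A.dual_basis (M 0) act {..<n} b ph" for n b ph
  proof (rule Suc.IH[OF A.gm_syz[OF M D]])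
    show "A.sproj (A.syz n b ph act d) A.pact" for d by (rule A.sproj_syz[OF M G D A Suc.prems(2)])
    show "B.koszul (A.syz n b ph act) A.pact"
      using K(4)[OF DB] lin_syz_restrict[OF M D DB] by (simp add: B.koszul_def)
  qed
  then show ?case using M G Suc.prems(2) by simp
qed

text \<open>The induction runs over all modules that are Koszul over \<open>A\<close> at once:
  besides the syzygy, the step needs \<open>k\<close> linear steps for \<open>jmod\<close>, and this
  is the induction hypothesis for \<open>jmod\<close> itself.\<close>

lemma koszul_B_of_A:
  assumes J: "A.koszul A.jmod A.pact"
  shows "A.koszul M act \<Longrightarrow> B.lin k M act"
proof (induction k arbitrary: M act)
  case 0
  note K = A.koszulD[OF 0]
  show ?case using B_gm[OF K(1)] B_gen[OF K(1,2)] by simp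
next
  case (Suc k)
  note K = A.koszulD[OF Suc.prems]
  note M = K(1)
  obtain n :: nat and b ph where DA: "A.dual_basis (M 0) act {..<n} b ph" using K(3) by (auto simp: A.sproj_def)
  obtain m :: nat and c \<chi> where DB: "B.dual_basis (M 0) act {..<m} c \<chi>"
    using B_sproj_of_A[OF A.gm_smod[OF M] K(3)] by (auto simp: B.sproj_def)
  have "B.lin k (B.syz m c \<chi> act) A.pact"
    by (rule lin_syz_extend[OF M DA DB Suc.IH[OF K(4)[OF DA]] Suc.IH[OF J]])
  then show ?case by (rule B.lin_SucI[OF B_gm[OF M] B_gen[OF M K(2)] DB])
qed

text \<open>Over \<open>B\<close> the module \<open>A 0\<close>, concentrated in degree 0, is a
  summand of copies of \<open>B 0\<close>, because it is projective over \<open>B 0\<close> and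
  positive degrees act as zero on either side.\<close>

lemma koszul_B_zmod:
  assumes K: "B.koszul B.zmod B.zact"
  shows "B.koszul A.zmod A.zact"
  unfolding B.koszul_def
proof
  fix k
  obtain l :: nat and s \<kappa> where D: "B.dual_basis (A 0) mul {..<l} s \<kappa>" using B_sproj by (auto simp: B.sproj_def)
  note sc = B.db_elem[OF D] and kl = B.db_slin[OF D]
  have gA: "agrp (A 0)" by (rule A.A_grp)
  have k0: "\<kappa> t 0 = 0" if "t < l" for t using additive_on_zero[OF gA B.slin_additive[OF kl[OF that]]] .
  have pz: "A.zact a u = 0" if "a \<in> B (Suc i)" "u \<in> A.zmod d" for a i u d
    using A.zact_pos that B_Suc by blast
  show "B.lin k A.zmod A.zact"
  \<comment> \<open>The maps are the coordinate functionals and the multiplications by the basis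
    elements of a dual basis of \<open>A 0\<close> over \<open>B 0\<close>.\<close>
  proof (rule B.lin_sum_retract[where T = "{..<l}" and X = "\<lambda>_. B.zmod" and ax = "\<lambda>_. B.zact"
        and p = "\<lambda>t u. B.emb (\<kappa> t (u 0))" and i = "\<lambda>t w. B.emb (mul (w 0) (s t))"])
    show "B.gm A.zmod A.zact" by (rule B_gm[OF A.gm_zmod])
    show "B.lin k B.zmod B.zact" using K by (simp add: B.koszul_def)
    fix t assume "t \<in> {..<l}"
    then have t: "t < l" by simp
    note kt = kl[OF t]
    have kB: "B.emb (\<kappa> t (u 0)) \<in> B.zmod d" if "u \<in> A.zmod d" for u d
      using that k0[OF t] B.slin_closed[OF kt] by (auto simp: A.zmod_def B.zmod_def split: if_splits)
    show "B.ghom A.zmod A.zact B.zmod B.zact (\<lambda>u. B.emb (\<kappa> t (u 0)))"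
      unfolding B.ghom_def additive_on_def
    proof (intro conjI allI ballI)
      show "B.emb (\<kappa> t ((u + w) 0)) = B.emb (\<kappa> t (u 0)) + B.emb (\<kappa> t (w 0))" if "u \<in> A.zmod d" "w \<in> A.zmod d" for d u w
        using that k0[OF t] additive_onD[OF B.slin_additive[OF kt]]
        by (auto simp: A.zmod_def B.emb_add split: if_splits)
      show "B.emb (\<kappa> t (A.zact a u 0)) = B.zact a (B.emb (\<kappa> t (u 0)))" if a: "a \<in> B i" and u: "u \<in> A.zmod d" for i d a u
      proof (cases i)
        case 0
        then show ?thesis using a u k0[OF t] B_sub[OF a] B.slin_act[OF kt, of a] B.mul_zero_right[of a 0]
          by (auto simp: A.zmod_def A.zact_emb B.zact_emb A.zact_zero B.zact_zero split: if_splits)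
      next
        case (Suc j)
        then show ?thesis using pz[of a j u d] B.zact_pos[of a j _ d] kB[OF u] a u k0[OF t] by simp
      qed
    qed (rule kB)
    have iA: "B.emb (mul (w 0) (s t)) \<in> A.zmod d" if "w \<in> B.zmod d" for w d
      using that A.mul_closed[of _ 0 "s t" 0] sc[OF t] B_zero A.mul_zero_left[OF sc[OF t]]
      by (auto simp: A.zmod_def B.zmod_def split: if_splits)
    show "B.ghom B.zmod B.zact A.zmod A.zact (\<lambda>w. B.emb (mul (w 0) (s t)))"
      unfolding B.ghom_def additive_on_def
    proof (intro conjI allI ballI)
      note z = A.mul_zero_left[OF sc[OF t]]
      show "B.emb (mul ((u + w) 0) (s t)) = B.emb (mul (u 0) (s t)) + B.emb (mul (w 0) (s t))"
        if "u \<in> B.zmod d" "w \<in> B.zmod d" for d u w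
        using that z A.mul_add_left[OF _ _ sc[OF t]] B_zero
        by (auto simp: B.zmod_def B.emb_add split: if_splits) (metis B.emb_add subsetD)
      show "B.emb (mul (B.zact a w 0) (s t)) = A.zact a (B.emb (mul (w 0) (s t)))" if a: "a \<in> B i" and w: "w \<in> B.zmod d" for i d a w
      proof (cases i)
        case 0
        then have a0: "a \<in> A 0" "a \<in> B 0" using a B_sub[OF a] by auto
        have "mul (mul a x) (s t) = mul a (mul x (s t))" if "x \<in> B 0" for x
          using A.mul_assoc[OF a0(1) _ sc[OF t]] that B_zero by blast
        then show ?thesis using a0 w z A.zact_emb[OF a0(1)] A.mul_zero_right[OF a0(1)]
          by (auto simp: B.zmod_def B.zact_emb A.zact_zero B.zact_zero split: if_splits)
      next
        case (Suc j)
        then show ?thesis using pz[of a j _ d] iA[OF w] B.zact_pos[of a j w d] a w z by simp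
      qed
    qed (rule iA)
  next
    fix d u assume u: "u \<in> A.zmod d"
    have "(\<Sum>t<l. B.emb (mul (\<kappa> t x) (s t))) = B.emb x" if x: "x \<in> A 0" for x
      using additive_on_sum[OF gA B.additive_emb, of "{..<l}" "\<lambda>t. mul (\<kappa> t x) (s t)"]
        B.dual_basis_sum[OF D x] A.mul_closed[of _ 0 _ 0] B.db_closed[OF D _ x] sc B_zero
      by (simp add: subset_iff)
    moreover have "u = B.emb (u 0)" "u 0 \<in> A 0"
      using u agrp_zero[OF gA] by (auto simp: A.zmod_def split: if_splits)
    ultimately show "(\<Sum>t<l. B.emb (mul (B.emb (\<kappa> t (u 0)) 0) (s t))) = u"
      by simp
  qed simp
qed

text \<open>From left to right everything passes through \<open>jmod\<close>, which is literally the
  same module for both rings; in the other direction \<open>A 0\<close> itself is transferred, its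
  components in positive degrees being zero.\<close>

theorem koszul_zmod_pair:
  assumes I: A.sinj
  shows "A.koszul A.zmod A.zact \<longleftrightarrow> (\<forall>d. A.sproj (A d) mul) \<and> B.koszul B.zmod B.zact"
proof
  assume "A.koszul A.zmod A.zact"
  then have J: "A.koszul A.jmod A.pact" by (simp add: A.koszul_zmod_iff)
  have "A.jmod = B.jmod" by (simp add: fun_eq_iff A.jmod_def B.jmod_def B_Suc)
  then have "B.koszul B.jmod B.pact" using koszul_B_of_A[OF J J] by (simp add: B.koszul_def)
  then show "(\<forall>d. A.sproj (A d) mul) \<and> B.koszul B.zmod B.zact"
    using A.koszul_jmod_sproj[OF I J] by (simp add: B.koszul_zmod_iff)
next
  assume *: "(\<forall>d. A.sproj (A d) mul) \<and> B.koszul B.zmod B.zact"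
  have "A.sproj (A.zmod d) A.zact" for d
  proof (cases "d = 0")
    case True then show ?thesis using A.dual_basis_zmod unfolding A.sproj_def by blast
  next
    case False
    then have "A.dual_basis (A.zmod d) A.zact {} (\<lambda>_::nat. 0) (\<lambda>_ _. 0)" by (simp add: A.zmod_def A.dual_basis_def)
    then show ?thesis by (rule A.sprojI)
  qed
  then show "A.koszul A.zmod A.zact"
    using koszul_A_of_B[OF _ A.gm_zmod _ koszul_B_zmod] * by (simp add: A.koszul_def)
qed

theorem koszul_module_pair:
  assumes I: A.sinj and K: "A.koszul A.zmod A.zact" and M: "A.gm M act"
  shows "A.koszul M act \<longleftrightarrow> (\<forall>d. A.sproj (M d) act) \<and> B.koszul M act"
proof -
  have J: "A.koszul A.jmod A.pact" using K by (simp add: A.koszul_zmod_iff)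
  have S: "A.sproj (A d) mul" for d using A.koszul_jmod_sproj[OF I J] .
  show ?thesis
    using A.koszul_sproj[OF I S] koszul_B_of_A[OF J] koszul_A_of_B[OF S M]
    by (auto simp: A.koszul_def B.koszul_def)
qed

end

section \<open>Module records\<close>

lemma agrp_abelian_group:
  assumes "add M = (+)" "zero M = 0" "agrp (carrier M)"
  shows "abelian_group M"
proof (rule abelian_groupI)
  fix x assume "x \<in> carrier M"
  then show "\<exists>y\<in>carrier M. y \<oplus>\<^bsub>M\<^esub> x = \<zero>\<^bsub>M\<^esub>"
    using assms by (intro bexI[of _ "- x"]) (auto simp: agrp_minus)
qed (use assms in \<open>auto simp: agrp_add agrp_zero add_ac\<close>)

lemma finsum_eq_sum:
  assumes "add M = (+)" "zero M = 0" "agrp (carrier M)" and f: "\<And>i. i \<in> I \<Longrightarrow> f i \<in> carrier M"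
  shows "finsum M f I = sum f I"
proof -
  interpret abelian_group M using assms(1-3) by (rule agrp_abelian_group)
  show ?thesis
    using f by (induction I rule: infinite_finite_induct) (auto simp: assms finsum_insert Pi_iff)
qed

lemma a_inv_eq_minus:
  assumes "add M = (+)" "zero M = 0" "agrp (carrier M)" "x \<in> carrier M"
  shows "inv\<^bsub>add_monoid M\<^esub> x = - x"
proof -
  interpret abelian_group M using assms(1-3) by (rule agrp_abelian_group)
  have "\<ominus>\<^bsub>M\<^esub> x = - x" using assms add.inv_equality[of "- x" x] by (simp add: agrp_minus)
  then show ?thesis unfolding a_inv_def .
qed

lemma subgroup_iff_agrp:
  assumes "add M = (+)" "zero M = 0" "agrp (carrier M)" "H \<subseteq> carrier M"
  shows "subgroup H (add_monoid M) \<longleftrightarrow> agrp H"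
proof
  assume "subgroup H (add_monoid M)"
  then show "agrp H"
    using assms subgroup.m_inv_closed[of H "add_monoid M"] subgroup.one_closed[of H "add_monoid M"]
      subgroup.m_closed[of H "add_monoid M"] a_inv_eq_minus[OF assms(1-3)]
    by (auto simp: agrp_def subset_iff)
next
  assume "agrp H"
  then show "subgroup H (add_monoid M)"
    using assms a_inv_eq_minus[OF assms(1-3)] by (auto simp: agrp_def subgroup_def subset_iff)
qed

lemma generate_subset_agrp:
  assumes "add M = (+)" "zero M = 0" "agrp (carrier M)" "H \<subseteq> carrier M" "agrp T" "H \<subseteq> T"
  shows "generate (add_monoid M) H \<subseteq> T"
proof
  fix x assume "x \<in> generate (add_monoid M) H"
  then show "x \<in> T"
  proof induction
    case (inv h)
    then show ?case using assms a_inv_eq_minus[OF assms(1-3), of h] by (auto simp: agrp_def subset_iff)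
  qed (use assms in \<open>auto simp: agrp_def\<close>)
qed

lemma agrp_generate:
  assumes "add M = (+)" "zero M = 0" "agrp (carrier M)" "H \<subseteq> carrier M"
  shows "agrp (generate (add_monoid M) H)" "generate (add_monoid M) H \<subseteq> carrier M" "H \<subseteq> generate (add_monoid M) H"
proof -
  interpret abelian_group M using assms(1-3) by (rule agrp_abelian_group)
  have sg: "subgroup (generate (add_monoid M) H) (add_monoid M)"
    using assms by (intro group.generate_is_subgroup[OF a_group]) simp
  then show c: "generate (add_monoid M) H \<subseteq> carrier M" using subgroup.subset by fastforce
  then show "agrp (generate (add_monoid M) H)" using sg subgroup_iff_agrp[OF assms(1-3)] by blast
  show "H \<subseteq> generate (add_monoid M) H" by (auto intro: generate.incl)
qed

text \<open>Translates record sums into type class sums along a map that is additive on a subgroup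
  only. The second conclusion, closure of the subgroup under sums, is later drawn by taking a
  constant zero map for \<open>f\<close>.\<close>

lemma (in abelian_group) finsum_image_sum:
  assumes H: "subgroup H (add_monoid G)" and f: "\<And>x y. x \<in> H \<Longrightarrow> y \<in> H \<Longrightarrow> f (x \<oplus> y) = f x + (f y :: 'c::ab_group_add)"
    and g: "\<And>i. i \<in> I \<Longrightarrow> g i \<in> H"
  shows "f (finsum G g I) = (\<Sum>i\<in>I. f (g i))" "finsum G g I \<in> H"
proof -
  have z: "\<zero> \<in> H" using subgroup.one_closed[OF H] by simp
  have z0: "f \<zero> = 0" using f[OF z z] by simp
  have sub: "x \<in> carrier G" if "x \<in> H" for x using subgroup.mem_carrier[OF H that] by simp
  have "f (finsum G g I) = (\<Sum>i\<in>I. f (g i)) \<and> finsum G g I \<in> H"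
    using g
  proof (induction I rule: infinite_finite_induct)
    case (insert i I)
    then have "finsum G g (insert i I) = g i \<oplus> finsum G g I" using sub by (intro finsum_insert) auto
    then show ?case using insert f subgroup.m_closed[OF H, of "g i" "finsum G g I"] by simp
  qed (auto simp: z z0)
  then show "f (finsum G g I) = (\<Sum>i\<in>I. f (g i))" "finsum G g I \<in> H" by auto
qed

lemma (in abelian_group) finsum_hom:
  assumes N: "abelian_group N" and f: "\<And>x. x \<in> carrier G \<Longrightarrow> f x \<in> carrier N"
    and add: "\<And>x y. x \<in> carrier G \<Longrightarrow> y \<in> carrier G \<Longrightarrow> f (x \<oplus> y) = f x \<oplus>\<^bsub>N\<^esub> f y"
    and g: "\<And>i. i \<in> I \<Longrightarrow> g i \<in> carrier G"
  shows "f (finsum G g I) = finsum N (\<lambda>i. f (g i)) I"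
proof -
  interpret N: abelian_group N by fact
  have "f \<zero> \<oplus>\<^bsub>N\<^esub> f \<zero> = f \<zero>" using add[of \<zero> \<zero>] by simp
  then have z: "f \<zero> = \<zero>\<^bsub>N\<^esub>" using f[OF zero_closed] by (simp add: N.add.l_cancel_one)
  show ?thesis
    using g
  proof (induction I rule: infinite_finite_induct)
    case (insert i I)
    then have "finsum G g (insert i I) = g i \<oplus> finsum G g I" by (intro finsum_insert) auto
    moreover have "finsum N (\<lambda>i. f (g i)) (insert i I) = f (g i) \<oplus>\<^bsub>N\<^esub> finsum N (\<lambda>i. f (g i)) I"
      using insert f by (intro N.finsum_insert) auto
    ultimately show ?case using insert add finsum_closed[of g I] by auto
  qed (auto simp: z)
qed

context left_module
begin

lemma smult_zero_right: "a \<in> carrier R \<Longrightarrow> a \<odot>\<^bsub>M\<^esub> \<zero>\<^bsub>M\<^esub> = \<zero>\<^bsub>M\<^esub>"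
  using smult_r_distr[of a "\<zero>\<^bsub>M\<^esub>" "\<zero>\<^bsub>M\<^esub>"] smult_closed[of a "\<zero>\<^bsub>M\<^esub>"] M.zero_closed
  by (simp add: M.add.l_cancel_one)

lemma smult_zero_left: "x \<in> carrier M \<Longrightarrow> \<zero>\<^bsub>R\<^esub> \<odot>\<^bsub>M\<^esub> x = \<zero>\<^bsub>M\<^esub>"
  using smult_l_distr[of "\<zero>\<^bsub>R\<^esub>" "\<zero>\<^bsub>R\<^esub>" x] smult_closed[of "\<zero>\<^bsub>R\<^esub>" x]
  by (simp add: M.add.l_cancel_one)

lemma smult_finsum_right:
  "a \<in> carrier R \<Longrightarrow> (\<And>i. i \<in> I \<Longrightarrow> g i \<in> carrier M) \<Longrightarrow>
    a \<odot>\<^bsub>M\<^esub> finsum M g I = finsum M (\<lambda>i. a \<odot>\<^bsub>M\<^esub> g i) I"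
  by (intro M.finsum_hom M.abelian_group_axioms) (auto simp: smult_closed smult_r_distr)

lemma smult_finsum_left:
  "x \<in> carrier M \<Longrightarrow> (\<And>i. i \<in> I \<Longrightarrow> c i \<in> carrier R) \<Longrightarrow>
    finsum R c I \<odot>\<^bsub>M\<^esub> x = finsum M (\<lambda>i. c i \<odot>\<^bsub>M\<^esub> x) I"
  by (intro R.finsum_hom[where f = "\<lambda>a. a \<odot>\<^bsub>M\<^esub> x"] M.abelian_group_axioms) (auto simp: smult_closed smult_l_distr)

end

section \<open>The dual basis lemma for module records\<close>

text \<open>A lifting of \<open>f\<close> sends \<open>x\<close> to the combination of chosen
  preimages of \<open>f (b i)\<close> with the coordinates of \<open>x\<close>.\<close>

lemma projective_moduleI:
  assumes P: "left_module R P"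
    and b: "\<And>i. i \<in> I \<Longrightarrow> b i \<in> carrier P"
    and c: "\<And>i x. i \<in> I \<Longrightarrow> x \<in> carrier P \<Longrightarrow> ph i x \<in> carrier R"
    and add: "\<And>i x y. i \<in> I \<Longrightarrow> x \<in> carrier P \<Longrightarrow> y \<in> carrier P \<Longrightarrow> ph i (x \<oplus>\<^bsub>P\<^esub> y) = ph i x \<oplus>\<^bsub>R\<^esub> ph i y"
    and lin: "\<And>i a x. i \<in> I \<Longrightarrow> a \<in> carrier R \<Longrightarrow> x \<in> carrier P \<Longrightarrow> ph i (a \<odot>\<^bsub>P\<^esub> x) = a \<otimes>\<^bsub>R\<^esub> ph i x"
    and id: "\<And>x. x \<in> carrier P \<Longrightarrow> finsum P (\<lambda>i. ph i x \<odot>\<^bsub>P\<^esub> b i) I = x"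
  shows "projective_module R P"
  unfolding projective_module_def
proof (intro conjI allI impI)
  interpret P: left_module R P by fact
  fix A :: "('a, 'c \<Rightarrow> 'a) module" and B :: "('a, 'c) module" and p f
  assume *: "left_module R A \<and> left_module R B \<and> p \<in> lmod_hom R A B \<and> p ` carrier A = carrier B \<and> f \<in> lmod_hom R P B"
  interpret A: left_module R A using * by simp
  interpret B: left_module R B using * by simp
  have pA: "p x \<in> carrier B" "p (x \<oplus>\<^bsub>A\<^esub> y) = p x \<oplus>\<^bsub>B\<^esub> p y" "a \<in> carrier R \<Longrightarrow> p (a \<odot>\<^bsub>A\<^esub> x) = a \<odot>\<^bsub>B\<^esub> p x"
    if "x \<in> carrier A" "y \<in> carrier A" for a x y using * that by (auto simp: lmod_hom_def)
  have fP: "f x \<in> carrier B" "f (x \<oplus>\<^bsub>P\<^esub> y) = f x \<oplus>\<^bsub>B\<^esub> f y" "a \<in> carrier R \<Longrightarrow> f (a \<odot>\<^bsub>P\<^esub> x) = a \<odot>\<^bsub>B\<^esub> f x"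
    if "x \<in> carrier P" "y \<in> carrier P" for a x y using * that by (auto simp: lmod_hom_def)
  have "\<forall>i\<in>I. \<exists>w\<in>carrier A. p w = f (b i)"
    using * fP(1)[OF b b] by (metis imageE)
  then obtain w where w: "\<And>i. i \<in> I \<Longrightarrow> w i \<in> carrier A" "\<And>i. i \<in> I \<Longrightarrow> p (w i) = f (b i)" by metis
  define g where "g x = finsum A (\<lambda>i. ph i x \<odot>\<^bsub>A\<^esub> w i) I" for x
  have t: "ph i x \<odot>\<^bsub>A\<^esub> w i \<in> carrier A" if "i \<in> I" "x \<in> carrier P" for i x
    using that A.smult_closed c w by auto
  have "g \<in> lmod_hom R P A"
    unfolding lmod_hom_def
  proof (intro CollectI conjI ballI Pi_I)
    show "g x \<in> carrier A" if "x \<in> carrier P" for x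
      unfolding g_def using that t by (intro A.M.finsum_closed) auto
    show "g (x \<oplus>\<^bsub>P\<^esub> y) = g x \<oplus>\<^bsub>A\<^esub> g y" if "x \<in> carrier P" "y \<in> carrier P" for x y
    proof -
      have "g (x \<oplus>\<^bsub>P\<^esub> y) = finsum A (\<lambda>i. ph i x \<odot>\<^bsub>A\<^esub> w i \<oplus>\<^bsub>A\<^esub> ph i y \<odot>\<^bsub>A\<^esub> w i) I"
        unfolding g_def using that t
        by (intro A.M.finsum_cong') (auto simp: add c w A.smult_l_distr)
      then show ?thesis unfolding g_def using that t by (subst (asm) A.M.finsum_addf) auto
    qed
    show "g (a \<odot>\<^bsub>P\<^esub> x) = a \<odot>\<^bsub>A\<^esub> g x" if "a \<in> carrier R" "x \<in> carrier P" for a x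
    proof -
      have "g (a \<odot>\<^bsub>P\<^esub> x) = finsum A (\<lambda>i. a \<odot>\<^bsub>A\<^esub> (ph i x \<odot>\<^bsub>A\<^esub> w i)) I"
        unfolding g_def using that t
        by (intro A.M.finsum_cong') (auto simp: lin c w A.smult_assoc1 A.smult_closed)
      then show ?thesis unfolding g_def using that t by (subst A.smult_finsum_right) auto
    qed
  qed
  moreover have "p (g x) = f x" if x: "x \<in> carrier P" for x
  proof -
    have "p (g x) = finsum B (\<lambda>i. p (ph i x \<odot>\<^bsub>A\<^esub> w i)) I"
      unfolding g_def using x t pA by (intro A.M.finsum_hom B.M.abelian_group_axioms) auto
    also have "\<dots> = finsum B (\<lambda>i. f (ph i x \<odot>\<^bsub>P\<^esub> b i)) I"
      using x by (intro B.M.finsum_cong') (auto simp: pA[OF w(1) w(1)] fP[OF b b] c w(2) fP(1)[OF P.smult_closed P.smult_closed] b B.smult_closed)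
    also have "\<dots> = f (finsum P (\<lambda>i. ph i x \<odot>\<^bsub>P\<^esub> b i) I)"
      using x fP c b P.smult_closed by (intro P.M.finsum_hom[symmetric] B.M.abelian_group_axioms) auto
    finally show ?thesis using id[OF x] by simp
  qed
  ultimately show "\<exists>g\<in>lmod_hom R P A. \<forall>x\<in>carrier P. p (g x) = f x" by blast
qed (rule P)

text \<open>Lift the identity along the free module on the generators; the components of the lifting
  are the functionals.\<close>

lemma projective_moduleD:
  fixes P :: "('r, 'm, 'y) module_scheme" and R :: "('r, 'x) ring_scheme"
  assumes P: "projective_module R P" and B: "finite B" "B \<subseteq> carrier P"
    and gen: "\<forall>x\<in>carrier P. \<exists>c. (\<forall>b\<in>B. c b \<in> carrier R) \<and> x = finsum P (\<lambda>b. c b \<odot>\<^bsub>P\<^esub> b) B"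
  shows "\<exists>ph. (\<forall>b\<in>B. \<forall>x\<in>carrier P. ph b x \<in> carrier R) \<and>
    (\<forall>b\<in>B. \<forall>x\<in>carrier P. \<forall>y\<in>carrier P. ph b (x \<oplus>\<^bsub>P\<^esub> y) = ph b x \<oplus>\<^bsub>R\<^esub> ph b y) \<and>
    (\<forall>b\<in>B. \<forall>a\<in>carrier R. \<forall>x\<in>carrier P. ph b (a \<odot>\<^bsub>P\<^esub> x) = a \<otimes>\<^bsub>R\<^esub> ph b x) \<and>
    (\<forall>x\<in>carrier P. finsum P (\<lambda>b. ph b x \<odot>\<^bsub>P\<^esub> b) B = x)"
proof -
  interpret P: left_module R P using P by (simp add: projective_module_def)
  \<comment> \<open>The free module on \<open>B\<close> as coefficient functions extended by zero,
    on exactly the type that \<open>projective_module\<close> provides for the test object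
    \<open>A\<close>.\<close>
  define F :: "('r, 'm \<Rightarrow> 'r) module" where "F =
    \<lparr>carrier = {c. (\<forall>b\<in>B. c b \<in> carrier R) \<and> (\<forall>b. b \<notin> B \<longrightarrow> c b = \<zero>\<^bsub>R\<^esub>)}, mult = undefined, one = undefined,
     zero = (\<lambda>_. \<zero>\<^bsub>R\<^esub>), add = (\<lambda>c d b. c b \<oplus>\<^bsub>R\<^esub> d b), smult = (\<lambda>a c b. a \<otimes>\<^bsub>R\<^esub> c b)\<rparr>"
  \<comment> \<open>A copy of \<open>P\<close> without the additional record fields, as the test
    object \<open>B\<close> has to be a plain \<open>module\<close>.\<close>
  define Q :: "('r, 'm) module" where "Q =
    \<lparr>carrier = carrier P, mult = undefined, one = undefined, zero = \<zero>\<^bsub>P\<^esub>, add = add P, smult = smult P\<rparr>"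
  have Fab: "abelian_group F"
  proof (rule abelian_groupI)
    fix x assume x: "x \<in> carrier F"
    have Fb: "x b \<in> carrier R" for b using x by (cases "b \<in> B"; simp add: F_def)
    from x show "\<exists>y\<in>carrier F. y \<oplus>\<^bsub>F\<^esub> x = \<zero>\<^bsub>F\<^esub>"
      by (intro bexI[of _ "\<lambda>b. \<ominus>\<^bsub>R\<^esub> x b"]) (auto simp: F_def fun_eq_iff P.R.l_neg Fb)
  next
    fix x y z assume "x \<in> carrier F" "y \<in> carrier F" "z \<in> carrier F"
    then have "x b \<in> carrier R" "y b \<in> carrier R" "z b \<in> carrier R" for b by (cases "b \<in> B"; simp add: F_def)+
    then show "x \<oplus>\<^bsub>F\<^esub> y \<oplus>\<^bsub>F\<^esub> z = x \<oplus>\<^bsub>F\<^esub> (y \<oplus>\<^bsub>F\<^esub> z)" by (simp add: F_def P.R.a_assoc)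
  next
    fix x y assume "x \<in> carrier F" "y \<in> carrier F"
    then have "x b \<in> carrier R" "y b \<in> carrier R" for b by (cases "b \<in> B"; simp add: F_def)+
    then show "x \<oplus>\<^bsub>F\<^esub> y = y \<oplus>\<^bsub>F\<^esub> x" by (simp add: F_def P.R.a_comm)
  next
    fix x assume "x \<in> carrier F"
    then have "x b \<in> carrier R" for b by (cases "b \<in> B"; simp add: F_def)+
    then show "\<zero>\<^bsub>F\<^esub> \<oplus>\<^bsub>F\<^esub> x = x" by (simp add: F_def)
  qed (auto simp: F_def)
  have Fm: "left_module R F"
  proof (intro left_module.intro left_module_axioms.intro P.R.ring_axioms Fab)
    fix a c x y assume a: "a \<in> carrier R" "c \<in> carrier R" and x: "x \<in> carrier F" and y: "y \<in> carrier F"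
    have xy: "x b \<in> carrier R" "y b \<in> carrier R" for b using x y by (cases "b \<in> B"; simp add: F_def)+
    show "a \<odot>\<^bsub>F\<^esub> (x \<oplus>\<^bsub>F\<^esub> y) = a \<odot>\<^bsub>F\<^esub> x \<oplus>\<^bsub>F\<^esub> a \<odot>\<^bsub>F\<^esub> y" using a xy by (simp add: F_def P.R.r_distr)
  next
    fix a c x assume a: "a \<in> carrier R" "c \<in> carrier R" and x: "x \<in> carrier F"
    have xb: "x b \<in> carrier R" for b using x by (cases "b \<in> B"; simp add: F_def)
    show "(a \<oplus>\<^bsub>R\<^esub> c) \<odot>\<^bsub>F\<^esub> x = a \<odot>\<^bsub>F\<^esub> x \<oplus>\<^bsub>F\<^esub> c \<odot>\<^bsub>F\<^esub> x" using a xb by (simp add: F_def P.R.l_distr)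
    show "(a \<otimes>\<^bsub>R\<^esub> c) \<odot>\<^bsub>F\<^esub> x = a \<odot>\<^bsub>F\<^esub> (c \<odot>\<^bsub>F\<^esub> x)" using a xb by (simp add: F_def P.R.m_assoc)
  next
    fix x assume x: "x \<in> carrier F"
    have xb: "x b \<in> carrier R" for b using x by (cases "b \<in> B"; simp add: F_def)
    show "\<one>\<^bsub>R\<^esub> \<odot>\<^bsub>F\<^esub> x = x" using xb by (simp add: F_def)
  qed (auto simp: F_def)
  have Qab: "abelian_group Q"
    by (rule abelian_groupI) (auto simp: Q_def P.M.a_ac intro: P.M.l_neg)
  interpret Q: abelian_group Q by (rule Qab)
  have Qm: "left_module R Q"
    by (intro left_module.intro left_module_axioms.intro P.R.ring_axioms Qab)
      (auto simp: Q_def P.smult_closed P.smult_l_distr P.smult_r_distr P.smult_assoc1 P.smult_one)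
  define ev where "ev c = finsum P (\<lambda>b. c b \<odot>\<^bsub>P\<^esub> b) B" for c
  have evh: "ev \<in> lmod_hom R F Q"
    unfolding lmod_hom_def
  proof (intro CollectI conjI ballI Pi_I)
    have Fc: "c b \<in> carrier R" if "c \<in> carrier F" "b \<in> B" for c b using that by (simp add: F_def)
    have Bc: "b \<in> carrier P" if "b \<in> B" for b using that B by blast
    have cl: "c b \<odot>\<^bsub>P\<^esub> b \<in> carrier P" if "c \<in> carrier F" "b \<in> B" for c b
      by (rule P.smult_closed[OF Fc[OF that] Bc[OF that(2)]])
    show "ev c \<in> carrier Q" if "c \<in> carrier F" for c
    proof -
      have "finsum P (\<lambda>b. c b \<odot>\<^bsub>P\<^esub> b) B \<in> carrier P" by (rule P.M.finsum_closed) (simp add: cl[OF that])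
      then show ?thesis by (simp add: ev_def Q_def)
    qed
    show "ev (c \<oplus>\<^bsub>F\<^esub> d) = ev c \<oplus>\<^bsub>Q\<^esub> ev d" if c: "c \<in> carrier F" and d: "d \<in> carrier F" for c d
    proof -
      have "ev (c \<oplus>\<^bsub>F\<^esub> d) = finsum P (\<lambda>b. c b \<odot>\<^bsub>P\<^esub> b \<oplus>\<^bsub>P\<^esub> d b \<odot>\<^bsub>P\<^esub> b) B"
        unfolding ev_def
      proof (rule P.M.finsum_cong'[OF refl])
        show "(\<lambda>b. c b \<odot>\<^bsub>P\<^esub> b \<oplus>\<^bsub>P\<^esub> d b \<odot>\<^bsub>P\<^esub> b) \<in> B \<rightarrow> carrier P"
          using cl[OF c] cl[OF d] by simp
        show "(c \<oplus>\<^bsub>F\<^esub> d) b \<odot>\<^bsub>P\<^esub> b = c b \<odot>\<^bsub>P\<^esub> b \<oplus>\<^bsub>P\<^esub> d b \<odot>\<^bsub>P\<^esub> b" if "b \<in> B" for b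
          using P.smult_l_distr[OF Fc[OF c that] Fc[OF d that] Bc[OF that]] by (simp add: F_def)
      qed
      also have "\<dots> = ev c \<oplus>\<^bsub>P\<^esub> ev d" unfolding ev_def
        by (rule P.M.finsum_addf) (simp_all add: cl[OF c] cl[OF d])
      finally show ?thesis by (simp add: Q_def)
    qed
    show "ev (a \<odot>\<^bsub>F\<^esub> c) = a \<odot>\<^bsub>Q\<^esub> ev c" if a: "a \<in> carrier R" and c: "c \<in> carrier F" for a c
    proof -
      have "ev (a \<odot>\<^bsub>F\<^esub> c) = finsum P (\<lambda>b. a \<odot>\<^bsub>P\<^esub> (c b \<odot>\<^bsub>P\<^esub> b)) B"
        unfolding ev_def
      proof (rule P.M.finsum_cong'[OF refl])
        show "(\<lambda>b. a \<odot>\<^bsub>P\<^esub> (c b \<odot>\<^bsub>P\<^esub> b)) \<in> B \<rightarrow> carrier P"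
          using P.smult_closed[OF a cl[OF c]] by simp
        show "(a \<odot>\<^bsub>F\<^esub> c) b \<odot>\<^bsub>P\<^esub> b = a \<odot>\<^bsub>P\<^esub> (c b \<odot>\<^bsub>P\<^esub> b)" if "b \<in> B" for b
          using P.smult_assoc1[OF a Fc[OF c that] Bc[OF that]] by (simp add: F_def)
      qed
      also have "\<dots> = a \<odot>\<^bsub>P\<^esub> ev c" unfolding ev_def
        by (rule P.smult_finsum_right[symmetric]) (simp_all add: a cl[OF c])
      finally show ?thesis by (simp add: Q_def)
    qed
  qed
  have surj: "ev ` carrier F = carrier Q"
  proof
    show "ev ` carrier F \<subseteq> carrier Q" using evh by (auto simp: lmod_hom_def)
    show "carrier Q \<subseteq> ev ` carrier F"
    proof
      fix x assume "x \<in> carrier Q"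
      then obtain c where c: "\<forall>b\<in>B. c b \<in> carrier R" "x = finsum P (\<lambda>b. c b \<odot>\<^bsub>P\<^esub> b) B"
        using gen by (auto simp: Q_def)
      let ?c = "\<lambda>b. if b \<in> B then c b else \<zero>\<^bsub>R\<^esub>"
      have "x = ev ?c" unfolding ev_def c(2)
        using c(1) B P.smult_closed by (intro P.M.finsum_cong') auto
      moreover have "?c \<in> carrier F" using c(1) by (simp add: F_def)
      ultimately show "x \<in> ev ` carrier F" by (rule image_eqI)
    qed
  qed
  have idh: "(\<lambda>x. x) \<in> lmod_hom R P Q" by (simp add: lmod_hom_def Q_def)
  from P Fm Qm evh surj idh obtain g where g: "g \<in> lmod_hom R P F" "\<forall>x\<in>carrier P. ev (g x) = x"
    unfolding projective_module_def by blast
  show ?thesis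
    using g by (intro exI[of _ "\<lambda>b x. g x b"]) (auto simp: lmod_hom_def F_def ev_def Pi_iff)
qed

section \<open>Homogeneous components\<close>

abbreviation mdeg :: "('r, 'm, 'y) gmodule_scheme \<Rightarrow> nat \<Rightarrow> 'm set"
  where "mdeg M i \<equiv> mdegree_part M (int i)"

text \<open>The additive axioms of \<^locale>\<open>graded_left_module\<close> only concern the components of degree \<open>int i\<close>, where
  \<open>i\<close> is a natural number; a module generated in nonnegative degree has no other components.\<close>

locale pos_module = graded_left_module A M
  for A :: "('k, 'r, 'x) graded_algebra_scheme" (structure)
    and M :: "('r, 'm, 'y) gmodule_scheme" (structure) +
  assumes zero_degree: "\<zero>\<^bsub>A\<^esub> \<in> degree_part A i"
    and decomp: "m \<in> carrier M \<Longrightarrow> \<exists>c F. (\<forall>i. c i \<in> mdeg M i) \<and> finite F \<and>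
        (\<forall>i. i \<notin> F \<longrightarrow> c i = \<zero>\<^bsub>M\<^esub>) \<and> m = finsum M c F"
begin

lemma mdeg_sub: "x \<in> mdeg M i \<Longrightarrow> x \<in> carrier M"
  using subgroup.mem_carrier[OF mdegree_subgroup] by fastforce

text \<open>Needed in negative degrees as well: a decomposition indexed by naturals becomes one
  indexed by integers only if zero belongs to every component.\<close>

lemma mdeg_zero_int: "\<zero>\<^bsub>M\<^esub> \<in> mdegree_part M j"
proof (cases "0 \<le> j")
  case True
  then show ?thesis using subgroup.one_closed[OF mdegree_subgroup[of "nat j"]] by simp
next
  case False
  obtain c where "\<forall>i. c i \<in> mdegree_part M i" using mdegree_direct_sum[OF M.zero_closed] by blast
  then have w: "c j \<in> mdegree_part M j" by blast
  \<comment> \<open>The element \<open>c j\<close> is not known to lie in the carrier. Since zero is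
    a scalar of every degree, \<open>?w\<close> lies both in degree 0, hence in the carrier, and in
    degree \<open>j\<close>; a second multiplication by zero then gives the zero of
    \<open>M\<close>.\<close>
  let ?w = "\<zero>\<^bsub>A\<^esub> \<odot>\<^bsub>M\<^esub> c j"
  have "?w \<in> mdegree_part M (int (nat (- j)) + j)" "?w \<in> mdegree_part M (int 0 + j)"
    using mdegree_smult[OF zero_degree w] by blast+
  then have x: "?w \<in> carrier M" "?w \<in> mdegree_part M j" using False mdeg_sub[of ?w 0] by auto
  have "\<zero>\<^bsub>A\<^esub> \<odot>\<^bsub>M\<^esub> ?w \<in> mdegree_part M (int 0 + j)" using mdegree_smult[OF zero_degree x(2)] by blast
  then show ?thesis using smult_zero_left[OF x(1)] by simp
qed

lemma mdeg_zero: "\<zero>\<^bsub>M\<^esub> \<in> mdeg M i"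
  by (rule mdeg_zero_int)

lemma mdeg_add: "x \<in> mdeg M i \<Longrightarrow> y \<in> mdeg M i \<Longrightarrow> x \<oplus>\<^bsub>M\<^esub> y \<in> mdeg M i"
  using subgroup.m_closed[OF mdegree_subgroup] by simp

lemma mdeg_smult: "a \<in> degree_part A e \<Longrightarrow> m \<in> mdeg M j \<Longrightarrow> a \<odot>\<^bsub>M\<^esub> m \<in> mdeg M (e + j)"
  using mdegree_smult by simp

definition mcomp :: "'m \<Rightarrow> nat \<Rightarrow> 'm"
  where "mcomp m = (SOME c. \<exists>F. (\<forall>i. c i \<in> mdeg M i) \<and> finite F \<and>
        (\<forall>i. i \<notin> F \<longrightarrow> c i = \<zero>\<^bsub>M\<^esub>) \<and> m = finsum M c F)"

lemma mcomp_ex: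
  assumes "m \<in> carrier M"
  shows "\<exists>F. (\<forall>i. mcomp m i \<in> mdeg M i) \<and> finite F \<and>
        (\<forall>i. i \<notin> F \<longrightarrow> mcomp m i = \<zero>\<^bsub>M\<^esub>) \<and> m = finsum M (mcomp m) F"
  unfolding mcomp_def by (rule someI_ex[OF decomp[OF assms]])

lemma mcomp_spec: "m \<in> carrier M \<Longrightarrow> mcomp m i \<in> mdeg M i"
  by (drule mcomp_ex) (elim exE conjE, blast)

lemma mcomp_closed: "m \<in> carrier M \<Longrightarrow> mcomp m i \<in> carrier M"
  using mdeg_sub mcomp_spec by blast

text \<open>Extension by zero to negative degrees, the shape in which the direct sum axiom states
  its uniqueness.\<close>

lemma decomp_int:
  assumes c: "\<And>i. c i \<in> mdeg M i" and F: "finite F" "\<And>i. i \<notin> F \<Longrightarrow> c i = \<zero>\<^bsub>M\<^esub>"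
  defines "e \<equiv> (\<lambda>j. if 0 \<le> j then c (nat j) else \<zero>\<^bsub>M\<^esub>)"
  shows "(\<forall>i. e i \<in> mdegree_part M i) \<and> finite {i. e i \<noteq> \<zero>\<^bsub>M\<^esub>} \<and>
             finsum M c F = (\<Oplus>\<^bsub>M\<^esub>i\<in>{i. e i \<noteq> \<zero>\<^bsub>M\<^esub>}. e i)"
proof (intro conjI allI)
  show ed: "e i \<in> mdegree_part M i" for i
    using c[of "nat i"] mdeg_zero_int[of i] by (cases "0 \<le> i") (simp_all add: e_def)
  have ec: "e i \<in> carrier M" for i using mdeg_sub[OF c] by (simp add: e_def)
  have sub: "{i. e i \<noteq> \<zero>\<^bsub>M\<^esub>} \<subseteq> int ` F"
  proof
    fix i assume "i \<in> {i. e i \<noteq> \<zero>\<^bsub>M\<^esub>}"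
    then have "0 \<le> i" "nat i \<in> F" using F(2)[of "nat i"] by (auto simp: e_def split: if_splits)
    then show "i \<in> int ` F" by (intro image_eqI[of _ _ "nat i"]) auto
  qed
  then show "finite {i. e i \<noteq> \<zero>\<^bsub>M\<^esub>}" using F(1) finite_subset by blast
  have "finsum M e (int ` F) = finsum M (\<lambda>i. e (int i)) F"
    using ec by (intro M.finsum_reindex) auto
  also have "(\<lambda>i. e (int i)) = c" by (auto simp: e_def)
  finally have "finsum M c F = finsum M e (int ` F)" by simp
  also have "\<dots> = (\<Oplus>\<^bsub>M\<^esub>i\<in>{i. e i \<noteq> \<zero>\<^bsub>M\<^esub>}. e i)"
    using F(1) sub ec by (intro M.add.finprod_mono_neutral_cong_right) auto
  finally show "finsum M c F = (\<Oplus>\<^bsub>M\<^esub>i\<in>{i. e i \<noteq> \<zero>\<^bsub>M\<^esub>}. e i)" .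
qed

text \<open>Two decompositions over the naturals extend to two over the integers, where the axiom
  says they agree. It is the standard way to compute components below.\<close>

lemma mcomp_unique:
  assumes c: "\<And>i. c i \<in> mdeg M i" and F: "finite F" "\<And>i. i \<notin> F \<Longrightarrow> c i = \<zero>\<^bsub>M\<^esub>"
    and m: "m = finsum M c F"
  shows "mcomp m = c"
proof -
  have mc: "m \<in> carrier M" unfolding m using mdeg_sub[OF c] by auto
  obtain F' where F'': "\<forall>i. mcomp m i \<in> mdeg M i" "finite F'"
    "\<forall>i. i \<notin> F' \<longrightarrow> mcomp m i = \<zero>\<^bsub>M\<^esub>" "m = finsum M (mcomp m) F'" using mcomp_ex[OF mc] by (elim exE conjE)
  note F' = F''(1)[rule_format] F''(2) F''(3)[rule_format] F''(4)
  define Pr where "Pr c \<longleftrightarrow> (\<forall>i. c i \<in> mdegree_part M i) \<and> finite {i. c i \<noteq> \<zero>\<^bsub>M\<^esub>} \<and>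
             m = (\<Oplus>\<^bsub>M\<^esub>i\<in>{i. c i \<noteq> \<zero>\<^bsub>M\<^esub>}. c i)" for c
  let ?e = "\<lambda>j. if 0 \<le> j then mcomp m (nat j) else \<zero>\<^bsub>M\<^esub>" and ?f = "\<lambda>j. if 0 \<le> j then c (nat j) else \<zero>\<^bsub>M\<^esub>"
  have "\<exists>!c. Pr c" unfolding Pr_def by (rule mdegree_direct_sum[OF mc])
  moreover have "Pr ?e" unfolding Pr_def using decomp_int[OF F'(1-3)] F'(4) by simp
  moreover have "Pr ?f" unfolding Pr_def using decomp_int[OF c F] m by simp
  ultimately have "?e = ?f" by blast
  then have "?e (int i) = ?f (int i)" for i by metis
  then show ?thesis by auto
qed

lemma mcomp_sum:
  assumes m: "m \<in> carrier M" and F: "finite F" "\<And>i. i \<notin> F \<Longrightarrow> mcomp m i = \<zero>\<^bsub>M\<^esub>"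
  shows "finsum M (mcomp m) F = m"
proof -
  obtain F' where F': "finite F'" "\<forall>i. i \<notin> F' \<longrightarrow> mcomp m i = \<zero>\<^bsub>M\<^esub>" "m = finsum M (mcomp m) F'"
    using mcomp_ex[OF m] by (elim exE conjE)
  have "finsum M (mcomp m) F = finsum M (mcomp m) F'"
    using F F' mcomp_closed[OF m] by (intro M.add.finprod_mono_neutral_cong) auto
  then show ?thesis using F'(3) by simp
qed

lemma finite_mcomp:
  assumes "m \<in> carrier M"
  shows "finite {i. mcomp m i \<noteq> \<zero>\<^bsub>M\<^esub>}"
proof -
  obtain F where F: "finite F" "\<forall>i. i \<notin> F \<longrightarrow> mcomp m i = \<zero>\<^bsub>M\<^esub>" using mcomp_ex[OF assms] by (elim exE conjE)
  then show ?thesis by (intro finite_subset[OF _ F(1)]) blast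
qed

lemma mcomp_homogeneous:
  assumes "m \<in> mdeg M i"
  shows "mcomp m = (\<lambda>j. if j = i then m else \<zero>\<^bsub>M\<^esub>)"
  by (rule mcomp_unique[of _ "{i}"]) (use assms mdeg_zero mdeg_sub in \<open>auto simp: M.finsum_insert\<close>)

lemma mcomp_add:
  assumes "x \<in> carrier M" "y \<in> carrier M"
  shows "mcomp (x \<oplus>\<^bsub>M\<^esub> y) i = mcomp x i \<oplus>\<^bsub>M\<^esub> mcomp y i"
proof -
  define F F' where "F = {i. mcomp x i \<noteq> \<zero>\<^bsub>M\<^esub>}" and "F' = {i. mcomp y i \<noteq> \<zero>\<^bsub>M\<^esub>}"
  then have F: "finite F" "\<And>i. i \<notin> F \<Longrightarrow> mcomp x i = \<zero>\<^bsub>M\<^esub>"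
    and F': "finite F'" "\<And>i. i \<notin> F' \<Longrightarrow> mcomp y i = \<zero>\<^bsub>M\<^esub>"
    using finite_mcomp assms by auto
  have "mcomp (x \<oplus>\<^bsub>M\<^esub> y) = (\<lambda>i. mcomp x i \<oplus>\<^bsub>M\<^esub> mcomp y i)"
  proof (rule mcomp_unique[of _ "F \<union> F'"])
    show "x \<oplus>\<^bsub>M\<^esub> y = finsum M (\<lambda>i. mcomp x i \<oplus>\<^bsub>M\<^esub> mcomp y i) (F \<union> F')"
      using mcomp_sum[OF assms(1), of "F \<union> F'"] mcomp_sum[OF assms(2), of "F \<union> F'"] F F'
        mcomp_closed[OF assms(1)] mcomp_closed[OF assms(2)] by (subst M.finsum_addf) auto
  qed (use F F' mdeg_add mcomp_spec assms in auto)
  then show ?thesis by simp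
qed

lemma mcomp_smult:
  assumes a: "a \<in> degree_part A e" "a \<in> carrier A" and m: "m \<in> carrier M"
  shows "mcomp (a \<odot>\<^bsub>M\<^esub> m) (e + j) = a \<odot>\<^bsub>M\<^esub> mcomp m j"
proof -
  define F where "F = {i. mcomp m i \<noteq> \<zero>\<^bsub>M\<^esub>}"
  then have F: "finite F" "\<And>i. i \<notin> F \<Longrightarrow> mcomp m i = \<zero>\<^bsub>M\<^esub>" using finite_mcomp[OF m] by auto
  let ?c = "\<lambda>i. if e \<le> i then a \<odot>\<^bsub>M\<^esub> mcomp m (i - e) else \<zero>\<^bsub>M\<^esub>"
  have "mcomp (a \<odot>\<^bsub>M\<^esub> m) = ?c"
  proof (rule mcomp_unique[of _ "(\<lambda>i. e + i) ` F"])
    show "?c i \<in> mdeg M i" for i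
      using mdeg_smult[OF a(1) mcomp_spec[OF m, of "i - e"]] mdeg_zero by (cases "e \<le> i") (simp_all flip: of_nat_add)
    show "finite ((\<lambda>i. e + i) ` F)" using F by simp
    show "?c i = \<zero>\<^bsub>M\<^esub>" if "i \<notin> (\<lambda>i. e + i) ` F" for i
    proof (cases "e \<le> i")
      case True
      then have "i - e \<notin> F" using that by (auto simp: image_iff)
      then show ?thesis using smult_zero_right[OF a(2)] F by simp
    qed simp
    have "finsum M ?c ((\<lambda>i. e + i) ` F) = finsum M (\<lambda>i. a \<odot>\<^bsub>M\<^esub> mcomp m i) F"
      using smult_closed[OF a(2)] mcomp_closed[OF m] by (subst M.finsum_reindex) (auto simp: inj_on_def)
    also have "\<dots> = a \<odot>\<^bsub>M\<^esub> m"
      using smult_finsum_right[OF a(2), of F "mcomp m"] mcomp_closed[OF m] mcomp_sum[OF m F] by simp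
    finally show "a \<odot>\<^bsub>M\<^esub> m = finsum M ?c ((\<lambda>i. e + i) ` F)" by simp
  qed
  then show ?thesis by simp
qed

end

lemma graded_hom_mcomp:
  assumes M: "pos_module A M" and N: "pos_module A N" and f: "f \<in> graded_hom A M N" and m: "m \<in> carrier M"
  shows "pos_module.mcomp N (f m) i = f (pos_module.mcomp M m i)"
proof -
  interpret M: pos_module A M by fact
  interpret N: pos_module A N by fact
  have fc: "f x \<in> carrier N" "f (x \<oplus>\<^bsub>M\<^esub> y) = f x \<oplus>\<^bsub>N\<^esub> f y" if "x \<in> carrier M" "y \<in> carrier M" for x y
    using f that by (auto simp: graded_hom_def lmod_hom_def)
  have fd: "f x \<in> mdegree_part N i" if "x \<in> mdegree_part M i" for x i
    using f that by (auto simp: graded_hom_def)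
  define F where "F = {i. M.mcomp m i \<noteq> \<zero>\<^bsub>M\<^esub>}"
  then have F: "finite F" "\<And>i. i \<notin> F \<Longrightarrow> M.mcomp m i = \<zero>\<^bsub>M\<^esub>" using M.finite_mcomp[OF m] by auto
  have "f \<zero>\<^bsub>M\<^esub> \<oplus>\<^bsub>N\<^esub> f \<zero>\<^bsub>M\<^esub> = f \<zero>\<^bsub>M\<^esub>" using fc(2)[of "\<zero>\<^bsub>M\<^esub>" "\<zero>\<^bsub>M\<^esub>"] by simp
  then have z: "f \<zero>\<^bsub>M\<^esub> = \<zero>\<^bsub>N\<^esub>" using fc(1)[of "\<zero>\<^bsub>M\<^esub>" "\<zero>\<^bsub>M\<^esub>"] by (simp add: N.M.add.l_cancel_one)
  have "N.mcomp (f m) = (\<lambda>i. f (M.mcomp m i))"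
  proof (rule N.mcomp_unique[OF _ F(1)])
    have "f m = f (finsum M (M.mcomp m) F)" using M.mcomp_sum[OF m F] by simp
    also have "\<dots> = finsum N (\<lambda>i. f (M.mcomp m i)) F"
      using fc M.mcomp_closed[OF m] by (intro M.M.finsum_hom N.M.abelian_group_axioms) auto
    finally show "f m = finsum N (\<lambda>i. f (M.mcomp m i)) F" .
  qed (use fd M.mcomp_spec[OF m] z F(2) in auto)
  then show ?thesis by simp
qed

section \<open>Linear resolutions and iterated syzygies\<close>

text \<open>Keeps \<open>mdeg P (s + d)\<close> in this shape; otherwise the degree would be
  rewritten to a sum of two integers and the rules about \<open>mdeg\<close> would no longer
  match.\<close>

declare of_nat_add [simp del]

text \<open>The common ground of the algebra of the category and that of its subcategory. The maps
  \<open>cmp\<close> are the projections to the homogeneous parts, and all degrees from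
  \<open>top\<close> on vanish, so every element is a sum over \<open>{..<top}\<close>.\<close>

locale galgebra =
  fixes R :: "('k::field, 'r::ab_group_add) graded_algebra" and cmp :: "nat \<Rightarrow> 'r \<Rightarrow> 'r" and top :: nat
  assumes ring_R: "ring R" and add_R: "add R = (+)" and zero_R: "zero R = 0"
    and deg_sub: "a \<in> degree_part R i \<Longrightarrow> a \<in> carrier R"
    and deg_grp: "agrp (degree_part R i)"
    and deg_mult: "a \<in> degree_part R i \<Longrightarrow> b \<in> degree_part R j \<Longrightarrow> a \<otimes>\<^bsub>R\<^esub> b \<in> degree_part R (i + j)"
    and one_deg: "\<one>\<^bsub>R\<^esub> \<in> degree_part R 0"
    and cmp_closed: "a \<in> carrier R \<Longrightarrow> cmp i a \<in> degree_part R i"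
    and cmp_add: "a \<in> carrier R \<Longrightarrow> b \<in> carrier R \<Longrightarrow> cmp i (a + b) = cmp i a + cmp i b"
    and cmp_deg: "a \<in> degree_part R i \<Longrightarrow> cmp j a = (if i = j then a else 0)"
    and cmp_sum: "a \<in> carrier R \<Longrightarrow> (\<Sum>i<top. cmp i a) = a"
    and scal_add: "algebra_scalar R (c + d) = algebra_scalar R c + algebra_scalar R d"
    and scal_mult: "algebra_scalar R (c * d) = algebra_scalar R c \<otimes>\<^bsub>R\<^esub> algebra_scalar R d"
    and scal_one: "algebra_scalar R 1 = \<one>\<^bsub>R\<^esub>"
    and scal_deg: "algebra_scalar R c \<in> degree_part R 0"
    and fin_dim: "\<exists>U. finite U \<and> U \<subseteq> degree_part R i \<and>
      (\<forall>a\<in>degree_part R i. \<exists>c. a = (\<Sum>u\<in>U. algebra_scalar R (c u) \<otimes>\<^bsub>R\<^esub> u))"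
begin

abbreviation "RC \<equiv> carrier R"
abbreviation "Rd \<equiv> degree_part R"
abbreviation "scal \<equiv> algebra_scalar R"

sublocale R: ring R by (rule ring_R)

lemma R_agrp: "agrp (RC)"
  unfolding agrp_def
proof (intro conjI ballI)
  show "0 \<in> RC" using R.zero_closed by (simp add: zero_R)
  show "x + y \<in> RC" if "x \<in> RC" "y \<in> RC" for x y
    using R.a_closed[OF that] by (simp add: add_R)
  show "- x \<in> RC" if "x \<in> RC" for x
  proof -
    have "(\<ominus>\<^bsub>R\<^esub> x) + x = 0" using R.l_neg[OF that] by (simp add: add_R zero_R)
    then show ?thesis using R.a_inv_closed[OF that] by (simp add: eq_neg_iff_add_eq_0[symmetric])
  qed
qed

lemma R_distrib_left: "a \<in> RC \<Longrightarrow> b \<in> RC \<Longrightarrow> c \<in> RC \<Longrightarrow>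
    (a + b) \<otimes>\<^bsub>R\<^esub> c = a \<otimes>\<^bsub>R\<^esub> c + b \<otimes>\<^bsub>R\<^esub> c"
  using R.l_distr by (simp add: add_R)

lemma R_distrib_right: "a \<in> RC \<Longrightarrow> b \<in> RC \<Longrightarrow> c \<in> RC \<Longrightarrow>
    a \<otimes>\<^bsub>R\<^esub> (b + c) = a \<otimes>\<^bsub>R\<^esub> b + a \<otimes>\<^bsub>R\<^esub> c"
  using R.r_distr by (simp add: add_R)

lemma R_sum_left: "c \<in> RC \<Longrightarrow> (\<And>i. i \<in> I \<Longrightarrow> a i \<in> RC) \<Longrightarrow>
    sum a I \<otimes>\<^bsub>R\<^esub> c = (\<Sum>i\<in>I. a i \<otimes>\<^bsub>R\<^esub> c)"
  by (rule additive_on_sum[OF R_agrp]) (auto simp: additive_on_def R_distrib_left)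

lemma R_sum_right: "c \<in> RC \<Longrightarrow> (\<And>i. i \<in> I \<Longrightarrow> a i \<in> RC) \<Longrightarrow>
    c \<otimes>\<^bsub>R\<^esub> sum a I = (\<Sum>i\<in>I. c \<otimes>\<^bsub>R\<^esub> a i)"
  by (rule additive_on_sum[OF R_agrp]) (auto simp: additive_on_def R_distrib_right)

lemma R_null [simp]: "a \<in> RC \<Longrightarrow> a \<otimes>\<^bsub>R\<^esub> 0 = 0" "a \<in> RC \<Longrightarrow> 0 \<otimes>\<^bsub>R\<^esub> a = 0"
  using R.r_null R.l_null by (simp_all add: zero_R)

sublocale gring "Rd" "mult R" "one R"
proof
  show "agrp (Rd i)" for i by (rule deg_grp)
  show "a = 0" if "a \<in> Rd 0" "a \<in> Rd (Suc i)" for a i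
    using cmp_deg[OF that(1), of 0] cmp_deg[OF that(2), of 0] by simp
qed (auto simp: deg_mult R_distrib_left R_distrib_right deg_sub R.m_assoc one_deg)

lemma additive_cmp: "additive_on (RC) (cmp i)"
  by (simp add: additive_on_def cmp_add)

lemma cmp_zero: "cmp i 0 = 0"
  using additive_on_zero[OF R_agrp additive_cmp] .

lemma deg_top: "top \<le> i \<Longrightarrow> a \<in> Rd i \<Longrightarrow> a = 0"
  using cmp_sum[OF deg_sub[of a i]] cmp_deg[of a i] by simp

lemma cmp_top: "top \<le> i \<Longrightarrow> a \<in> RC \<Longrightarrow> cmp i a = 0"
  using deg_top cmp_closed by blast

lemma cmp_mult:
  assumes a: "a \<in> Rd e" and b: "b \<in> RC"
  shows "cmp (e + d) (a \<otimes>\<^bsub>R\<^esub> b) = a \<otimes>\<^bsub>R\<^esub> cmp d b"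
proof -
  have ca: "a \<in> RC" using deg_sub[OF a] .
  have cl: "cmp i b \<in> RC" for i using deg_sub[OF cmp_closed[OF b]] .
  have "a \<otimes>\<^bsub>R\<^esub> b = (\<Sum>i<top. a \<otimes>\<^bsub>R\<^esub> cmp i b)"
    using cmp_sum[OF b] R_sum_right[OF ca, of "{..<top}" "\<lambda>i. cmp i b"] cl by simp
  then have "cmp (e + d) (a \<otimes>\<^bsub>R\<^esub> b) = (\<Sum>i<top. cmp (e + d) (a \<otimes>\<^bsub>R\<^esub> cmp i b))"
    using additive_on_sum[OF R_agrp additive_cmp, of "{..<top}" "\<lambda>i. a \<otimes>\<^bsub>R\<^esub> cmp i b"] ca cl by simp
  also have "\<dots> = (\<Sum>i<top. if i = d then a \<otimes>\<^bsub>R\<^esub> cmp d b else 0)"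
    using cmp_deg[OF deg_mult[OF a cmp_closed[OF b]]] by (intro sum.cong) auto
  also have "\<dots> = a \<otimes>\<^bsub>R\<^esub> cmp d b" using cmp_top[OF _ b, of d] ca by (cases "d < top") auto
  finally show ?thesis .
qed

lemma scal_carrier: "scal c \<in> RC"
  using deg_sub[OF scal_deg] .

section \<open>Modules generated in one degree\<close>

text \<open>Closure of \<open>T\<close> under negatives comes for free, because the inverse of a
  generator is again one: the sign moves into the scalar.\<close>

lemma generated_subset:
  assumes M: "graded_left_module R M" and G: "generated_in_degree R M (int s)"
    and T: "\<zero>\<^bsub>M\<^esub> \<in> T" "\<And>x y. x \<in> T \<Longrightarrow> y \<in> T \<Longrightarrow> x \<oplus>\<^bsub>M\<^esub> y \<in> T"
      "\<And>a x. a \<in> RC \<Longrightarrow> x \<in> mdeg M s \<Longrightarrow> a \<odot>\<^bsub>M\<^esub> x \<in> T"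
  shows "carrier M \<subseteq> T"
proof
  interpret M: graded_left_module R M by fact
  fix m assume "m \<in> carrier M"
  then have "m \<in> generate (add_monoid M) {a \<odot>\<^bsub>M\<^esub> m | a m. a \<in> RC \<and> m \<in> mdeg M s}"
    using G by (simp add: generated_in_degree_def)
  then show "m \<in> T"
  proof induction
    case (inv h)
    then obtain a x where h: "h = a \<odot>\<^bsub>M\<^esub> x" and a: "a \<in> RC" and x: "x \<in> mdeg M s" by blast
    have xc: "x \<in> carrier M" using subgroup.mem_carrier[OF M.mdegree_subgroup x] by simp
    have "(\<ominus>\<^bsub>R\<^esub> a) \<odot>\<^bsub>M\<^esub> x \<oplus>\<^bsub>M\<^esub> a \<odot>\<^bsub>M\<^esub> x = \<zero>\<^bsub>M\<^esub>"
      using M.smult_l_distr[of "\<ominus>\<^bsub>R\<^esub> a" a x] a xc M.smult_zero_left[OF xc] by (simp add: R.l_neg)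
    then have "\<ominus>\<^bsub>M\<^esub> h = (\<ominus>\<^bsub>R\<^esub> a) \<odot>\<^bsub>M\<^esub> x"
      unfolding h using M.M.minus_equality[of "(\<ominus>\<^bsub>R\<^esub> a) \<odot>\<^bsub>M\<^esub> x" "a \<odot>\<^bsub>M\<^esub> x"] M.smult_closed a xc by simp
    then show ?case using T(3)[OF _ x, of "\<ominus>\<^bsub>R\<^esub> a"] a by (simp add: a_inv_def)
  qed (use T in auto)
qed

text \<open>The homogeneous decomposition of a generator \<open>a \<odot> x\<close>, split into the
  three facts that \<open>mcomp_unique\<close> expects.\<close>

lemma smult_decomp:
  assumes M: "graded_left_module R M" and a: "a \<in> RC" and x: "x \<in> mdeg M s"
  shows "a \<odot>\<^bsub>M\<^esub> x = finsum M (\<lambda>i. if s \<le> i then cmp (i - s) a \<odot>\<^bsub>M\<^esub> x else \<zero>\<^bsub>M\<^esub>) ((\<lambda>i. s + i) ` {..<top})"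
    and "(if s \<le> i then cmp (i - s) a \<odot>\<^bsub>M\<^esub> x else \<zero>\<^bsub>M\<^esub>) \<in> mdeg M i"
    and "i \<notin> (\<lambda>i. s + i) ` {..<top} \<Longrightarrow> (if s \<le> i then cmp (i - s) a \<odot>\<^bsub>M\<^esub> x else \<zero>\<^bsub>M\<^esub>) = \<zero>\<^bsub>M\<^esub>"
proof -
  interpret M: graded_left_module R M by fact
  have xc: "x \<in> carrier M" using subgroup.mem_carrier[OF M.mdegree_subgroup x] by simp
  have cl: "cmp i a \<in> RC" for i using deg_sub[OF cmp_closed[OF a]] .
  have "a \<odot>\<^bsub>M\<^esub> x = finsum R (\<lambda>i. cmp i a) {..<top} \<odot>\<^bsub>M\<^esub> x"
    using finsum_eq_sum[OF add_R zero_R R_agrp, of "{..<top}" "\<lambda>i. cmp i a"] cl cmp_sum[OF a] by simp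
  also have "\<dots> = finsum M (\<lambda>i. cmp i a \<odot>\<^bsub>M\<^esub> x) {..<top}" by (rule M.smult_finsum_left[OF xc cl])
  also have "\<dots> = finsum M (\<lambda>i. if s \<le> i then cmp (i - s) a \<odot>\<^bsub>M\<^esub> x else \<zero>\<^bsub>M\<^esub>) ((\<lambda>i. s + i) ` {..<top})"
    using M.smult_closed[OF cl xc] by (subst M.M.finsum_reindex) auto
  finally show "a \<odot>\<^bsub>M\<^esub> x = finsum M (\<lambda>i. if s \<le> i then cmp (i - s) a \<odot>\<^bsub>M\<^esub> x else \<zero>\<^bsub>M\<^esub>) ((\<lambda>i. s + i) ` {..<top})" .
  show "(if s \<le> i then cmp (i - s) a \<odot>\<^bsub>M\<^esub> x else \<zero>\<^bsub>M\<^esub>) \<in> mdeg M i"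
    using M.mdegree_smult[OF cmp_closed[OF a] x, of "i - s"] subgroup.one_closed[OF M.mdegree_subgroup[of i]]
    by (cases "s \<le> i") (simp_all flip: of_nat_add)
  show "(if s \<le> i then cmp (i - s) a \<odot>\<^bsub>M\<^esub> x else \<zero>\<^bsub>M\<^esub>) = \<zero>\<^bsub>M\<^esub>" if "i \<notin> (\<lambda>i. s + i) ` {..<top}"
  proof (cases "s \<le> i")
    case True
    have "i - s \<notin> {..<top}"
    proof
      assume "i - s \<in> {..<top}"
      then have "i \<in> (\<lambda>i. s + i) ` {..<top}" using True by (intro image_eqI[of _ _ "i - s"]) auto
      then show False using that by blast
    qed
    then show ?thesis using cmp_top[OF _ a, of "i - s"] M.smult_zero_left[OF xc] by (simp add: zero_R)
  qed simp
qed

lemma pos_moduleI: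
  assumes M: "graded_left_module R M" and G: "generated_in_degree R M (int s)"
  shows "pos_module R M"
proof -
  interpret M: graded_left_module R M by fact
  let ?P = "\<lambda>m c F. (\<forall>i. c i \<in> mdeg M i) \<and> finite F \<and> (\<forall>i. i \<notin> F \<longrightarrow> c i = \<zero>\<^bsub>M\<^esub>) \<and> m = finsum M c F"
  let ?T = "{m. \<exists>c F. ?P m c F}"
  have sub: "x \<in> carrier M" if "x \<in> mdeg M i" for x i
    using subgroup.mem_carrier[OF M.mdegree_subgroup that] by simp
  have z: "\<zero>\<^bsub>M\<^esub> \<in> mdeg M i" for i using subgroup.one_closed[OF M.mdegree_subgroup[of i]] by simp
  have "carrier M \<subseteq> ?T"
  proof (rule generated_subset[OF M G])
    show "\<zero>\<^bsub>M\<^esub> \<in> ?T" using z by (intro CollectI exI[of _ "\<lambda>_. \<zero>\<^bsub>M\<^esub>"] exI[of _ "{}"]) simp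
  next
    fix x y assume "x \<in> ?T" "y \<in> ?T"
    then obtain c F c' F' where c: "?P x c F" and c': "?P y c' F'" by blast
    have cc: "c i \<in> carrier M" "c' i \<in> carrier M" for i using c c' sub by blast+
    have "finsum M c F = finsum M c (F \<union> F')"
      using c c' cc by (intro M.M.add.finprod_mono_neutral_cong) auto
    moreover have "finsum M c' F' = finsum M c' (F \<union> F')"
      using c c' cc by (intro M.M.add.finprod_mono_neutral_cong) auto
    moreover have "finsum M (\<lambda>i. c i \<oplus>\<^bsub>M\<^esub> c' i) (F \<union> F') = finsum M c (F \<union> F') \<oplus>\<^bsub>M\<^esub> finsum M c' (F \<union> F')"
      using cc by (intro M.M.finsum_addf) auto
    moreover have "x = finsum M c F" "y = finsum M c' F'" using c c' by blast+
    ultimately have "x \<oplus>\<^bsub>M\<^esub> y = finsum M (\<lambda>i. c i \<oplus>\<^bsub>M\<^esub> c' i) (F \<union> F')" by simp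
    moreover have "c i \<oplus>\<^bsub>M\<^esub> c' i \<in> mdeg M i" for i
      using subgroup.m_closed[OF M.mdegree_subgroup[of i], of "c i" "c' i"] c c' by simp
    ultimately have "?P (x \<oplus>\<^bsub>M\<^esub> y) (\<lambda>i. c i \<oplus>\<^bsub>M\<^esub> c' i) (F \<union> F')" using c c' by simp
    then show "x \<oplus>\<^bsub>M\<^esub> y \<in> ?T" by (intro CollectI exI[of _ "\<lambda>i. c i \<oplus>\<^bsub>M\<^esub> c' i"] exI[of _ "F \<union> F'"])
  next
    fix a x assume a: "a \<in> RC" and x: "x \<in> mdeg M s"
    have "?P (a \<odot>\<^bsub>M\<^esub> x) (\<lambda>i. if s \<le> i then cmp (i - s) a \<odot>\<^bsub>M\<^esub> x else \<zero>\<^bsub>M\<^esub>) ((\<lambda>i. s + i) ` {..<top})"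
      using smult_decomp[OF M a x] by blast
    then show "a \<odot>\<^bsub>M\<^esub> x \<in> ?T" by (rule_tac CollectI, intro exI)
  qed
  then show ?thesis
    by (intro pos_module.intro M pos_module_axioms.intro)
      (use agrp_zero[OF deg_grp] zero_R in auto)
qed

text \<open>Apply \<open>generated_subset\<close> to the elements whose component of degree
  \<open>i\<close> lies in \<open>T\<close>: a generator \<open>a \<odot> x\<close> contributes in
  degree \<open>i\<close> only through the part of \<open>a\<close> of degree
  \<open>i - s\<close>.\<close>

lemma generated_piece:
  assumes M: "graded_left_module R M" and G: "generated_in_degree R M (int s)"
    and T: "\<zero>\<^bsub>M\<^esub> \<in> T" "\<And>x y. x \<in> T \<Longrightarrow> y \<in> T \<Longrightarrow> x \<oplus>\<^bsub>M\<^esub> y \<in> T"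
      "\<And>a x. s \<le> i \<Longrightarrow> a \<in> Rd (i - s) \<Longrightarrow> x \<in> mdeg M s \<Longrightarrow> a \<odot>\<^bsub>M\<^esub> x \<in> T"
  shows "mdeg M i \<subseteq> T"
proof
  interpret M: pos_module R M by (rule pos_moduleI[OF M G])
  fix m assume m: "m \<in> mdeg M i"
  have "carrier M \<subseteq> {m \<in> carrier M. M.mcomp m i \<in> T}"
  proof (rule generated_subset[OF M G])
    show "\<zero>\<^bsub>M\<^esub> \<in> {m \<in> carrier M. M.mcomp m i \<in> T}"
      using T(1) M.mcomp_homogeneous[OF M.mdeg_zero[of i]] by simp
    show "x \<oplus>\<^bsub>M\<^esub> y \<in> {m \<in> carrier M. M.mcomp m i \<in> T}"
      if "x \<in> {m \<in> carrier M. M.mcomp m i \<in> T}" "y \<in> {m \<in> carrier M. M.mcomp m i \<in> T}" for x y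
      using that M.mcomp_add T(2) by simp
    show "a \<odot>\<^bsub>M\<^esub> x \<in> {m \<in> carrier M. M.mcomp m i \<in> T}" if a: "a \<in> RC" and x: "x \<in> mdeg M s" for a x
    proof -
      have "M.mcomp (a \<odot>\<^bsub>M\<^esub> x) = (\<lambda>i. if s \<le> i then cmp (i - s) a \<odot>\<^bsub>M\<^esub> x else \<zero>\<^bsub>M\<^esub>)"
        by (rule M.mcomp_unique[OF smult_decomp(2)[OF M a x] _ smult_decomp(3)[OF M a x] smult_decomp(1)[OF M a x]]) simp_all
      then show ?thesis using T(1,3) x cmp_closed[OF a] M.smult_closed[OF a M.mdeg_sub[OF x]] by simp
    qed
  qed
  then have "M.mcomp m i \<in> T" using M.mdeg_sub[OF m] by blast
  then show "m \<in> T" using M.mcomp_homogeneous[OF m] by simp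
qed

text \<open>Below the generating degree no generator contributes, so \<open>generated_piece\<close>
  applies with the zero subgroup.\<close>

lemma generated_below:
  assumes M: "graded_left_module R M" and G: "generated_in_degree R M (int s)" and "i < s"
    and "m \<in> mdeg M i"
  shows "m = \<zero>\<^bsub>M\<^esub>"
proof -
  interpret M: graded_left_module R M by fact
  show ?thesis using generated_piece[OF M G, of "{\<zero>\<^bsub>M\<^esub>}" i] assms by auto
qed

text \<open>The component of degree \<open>j\<close> of any preimage is a preimage. This makes
  exactness of a complex available degree by degree.\<close>

lemma graded_hom_lift:
  assumes P: "pos_module R P" and Q: "pos_module R Q" and f: "f \<in> graded_hom R P Q" and p: "p \<in> carrier P"
    and y: "f p \<in> mdeg Q j"
  shows "\<exists>p'\<in>mdeg P j. f p = f p'"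
proof -
  interpret P: pos_module R P by fact
  interpret Q: pos_module R Q by fact
  have "Q.mcomp (f p) j = f (P.mcomp p j)" by (rule graded_hom_mcomp[OF P Q f p])
  then show ?thesis using Q.mcomp_homogeneous[OF y] by (intro bexI[OF _ P.mcomp_spec[OF p]]) simp
qed

text \<open>A finite-dimensional spanning set of degree \<open>s\<close> generates, so
  \<open>projective_moduleD\<close> yields functionals. They need not respect degrees; their
  homogeneous parts do, and still form a dual basis on homogeneous elements.\<close>

lemma projective_coordinates:
  fixes P :: "('r, 'p, 'z) gmodule_scheme"
  assumes P: "graded_left_module R P" and G: "generated_in_degree R P (int s)" and pr: "projective_module R P"
  shows "\<exists>(n::nat) b ta. (\<forall>j<n. b j \<in> mdeg P s) \<and>
    (\<forall>d. \<forall>p\<in>mdeg P (s + d). (\<forall>j. ta p j \<in> Rd d) \<and> (\<forall>j\<ge>n. ta p j = 0) \<and>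
       p = finsum P (\<lambda>j. ta p j \<odot>\<^bsub>P\<^esub> b j) {..<n}) \<and>
    (\<forall>d. \<forall>p\<in>mdeg P (s + d). \<forall>q\<in>mdeg P (s + d). ta (p \<oplus>\<^bsub>P\<^esub> q) = ta p + ta q) \<and>
    (\<forall>e d. \<forall>a\<in>Rd e. \<forall>p\<in>mdeg P (s + d). ta (a \<odot>\<^bsub>P\<^esub> p) = pact a (ta p))"
proof -
  interpret P: pos_module R P by (rule pos_moduleI[OF P G])
  obtain B where B: "finite B" "B \<subseteq> mdeg P s"
    "\<forall>v\<in>mdeg P s. \<exists>c :: 'p \<Rightarrow> 'k. v = finsum P (\<lambda>b. scal (c b) \<odot>\<^bsub>P\<^esub> b) B"
    using P.locally_finite[of s] unfolding finite_dimensional_part_def by blast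
  have Bc: "b \<in> carrier P" if "b \<in> B" for b using that B(2) P.mdeg_sub by blast
  let ?T = "{x. \<exists>c. (\<forall>b\<in>B. c b \<in> RC) \<and> x = finsum P (\<lambda>b. c b \<odot>\<^bsub>P\<^esub> b) B}"
  have cl: "c b \<odot>\<^bsub>P\<^esub> b \<in> carrier P" if "\<forall>b\<in>B. c b \<in> RC" "b \<in> B" for c b
    using P.smult_closed Bc that by blast
  have "carrier P \<subseteq> ?T"
  proof (rule generated_subset[OF P G])
    have "finsum P (\<lambda>b. \<zero>\<^bsub>R\<^esub> \<odot>\<^bsub>P\<^esub> b) B = \<zero>\<^bsub>P\<^esub>"
      using P.smult_zero_left[OF Bc] by (intro P.M.add.finprod_one_eqI) auto
    then show "\<zero>\<^bsub>P\<^esub> \<in> ?T" by (intro CollectI exI[of _ "\<lambda>_. \<zero>\<^bsub>R\<^esub>"]) simp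
  next
    fix x y assume "x \<in> ?T" "y \<in> ?T"
    then obtain c d where c: "\<forall>b\<in>B. c b \<in> RC" "x = finsum P (\<lambda>b. c b \<odot>\<^bsub>P\<^esub> b) B"
      and d: "\<forall>b\<in>B. d b \<in> RC" "y = finsum P (\<lambda>b. d b \<odot>\<^bsub>P\<^esub> b) B" by blast
    have "finsum P (\<lambda>b. (c b \<oplus>\<^bsub>R\<^esub> d b) \<odot>\<^bsub>P\<^esub> b) B = finsum P (\<lambda>b. c b \<odot>\<^bsub>P\<^esub> b \<oplus>\<^bsub>P\<^esub> d b \<odot>\<^bsub>P\<^esub> b) B"
      using cl[OF c(1)] cl[OF d(1)] c(1) d(1) by (intro P.M.finsum_cong'[OF refl]) (auto simp: P.smult_l_distr Bc)
    also have "\<dots> = x \<oplus>\<^bsub>P\<^esub> y" unfolding c(2) d(2)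
      using cl[OF c(1)] cl[OF d(1)] by (intro P.M.finsum_addf) auto
    finally show "x \<oplus>\<^bsub>P\<^esub> y \<in> ?T" using c(1) d(1) by (intro CollectI exI[of _ "\<lambda>b. c b \<oplus>\<^bsub>R\<^esub> d b"]) auto
  next
    fix a x assume a: "a \<in> RC" and x: "x \<in> mdeg P s"
    obtain c :: "'p \<Rightarrow> 'k" where c: "x = finsum P (\<lambda>b. scal (c b) \<odot>\<^bsub>P\<^esub> b) B" using B(3) x by blast
    have "a \<odot>\<^bsub>P\<^esub> x = finsum P (\<lambda>b. a \<odot>\<^bsub>P\<^esub> (scal (c b) \<odot>\<^bsub>P\<^esub> b)) B"
      unfolding c by (intro P.smult_finsum_right[OF a] P.smult_closed scal_carrier Bc)
    also have "\<dots> = finsum P (\<lambda>b. (a \<otimes>\<^bsub>R\<^esub> scal (c b)) \<odot>\<^bsub>P\<^esub> b) B"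
      using a scal_carrier Bc P.smult_closed by (intro P.M.finsum_cong'[OF refl]) (auto simp: P.smult_assoc1)
    finally show "a \<odot>\<^bsub>P\<^esub> x \<in> ?T"
      using a scal_carrier by (intro CollectI exI[of _ "\<lambda>b. a \<otimes>\<^bsub>R\<^esub> scal (c b)"]) auto
  qed
  then have gen: "\<forall>x\<in>carrier P. \<exists>c. (\<forall>b\<in>B. c b \<in> RC) \<and> x = finsum P (\<lambda>b. c b \<odot>\<^bsub>P\<^esub> b) B"
    by blast
  have Bs: "B \<subseteq> carrier P" using Bc by blast
  obtain ph where ph: "\<forall>b\<in>B. \<forall>x\<in>carrier P. ph b x \<in> RC"
    "\<forall>b\<in>B. \<forall>x\<in>carrier P. \<forall>y\<in>carrier P. ph b (x \<oplus>\<^bsub>P\<^esub> y) = ph b x \<oplus>\<^bsub>R\<^esub> ph b y"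
    "\<forall>b\<in>B. \<forall>a\<in>RC. \<forall>x\<in>carrier P. ph b (a \<odot>\<^bsub>P\<^esub> x) = a \<otimes>\<^bsub>R\<^esub> ph b x"
    "\<forall>x\<in>carrier P. finsum P (\<lambda>b. ph b x \<odot>\<^bsub>P\<^esub> b) B = x"
    using projective_moduleD[OF pr B(1) Bs gen] by (elim exE conjE)
  obtain h where h: "bij_betw h {..<card B} B"
    using ex_bij_betw_nat_finite[OF B(1)] by (auto simp: lessThan_atLeast0)
  let ?n = "card B"
  have hB: "h j \<in> B" if "j < ?n" for j using h that by (auto simp: bij_betw_def)
  \<comment> \<open>On an element of degree \<open>s + d\<close> only the summand \<open>d\<close>
    survives. Summing over all degrees makes \<open>ta\<close> a single function that does not
    depend on \<open>d\<close>.\<close>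
  define ta where "ta p j = (if j < ?n then \<Sum>d<top. cmp d (ph (h j) (P.mcomp p (s + d))) else 0)" for p j
  have ph0: "ph b \<zero>\<^bsub>P\<^esub> = 0" if "b \<in> B" for b
    using ph(2)[rule_format, OF that P.M.zero_closed P.M.zero_closed] by (simp add: add_R)
  have ta: "ta p j = (if j < ?n then cmp d (ph (h j) p) else 0)" if p: "p \<in> mdeg P (s + d)" for p d j
  proof (cases "j < ?n")
    case True
    have "ta p j = (\<Sum>d'<top. if d' = d then cmp d (ph (h j) p) else 0)"
    proof -
      have "cmp e (ph (h j) (P.mcomp p (s + e))) = (if e = d then cmp d (ph (h j) p) else 0)" for e
        using P.mcomp_homogeneous[OF p] ph0[OF hB[OF True]] by (simp add: cmp_zero)
      then show ?thesis unfolding ta_def using True by simp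
    qed
    also have "\<dots> = cmp d (ph (h j) p)"
      using cmp_top[of d "ph (h j) p"] ph(1) hB[OF True] P.mdeg_sub[OF p] by (cases "d < top") auto
    finally show ?thesis using True by simp
  qed (simp add: ta_def)
  have "\<forall>j<?n. h j \<in> mdeg P s" using hB B(2) by blast
  moreover have "(\<forall>j. ta p j \<in> Rd d) \<and> (\<forall>j\<ge>?n. ta p j = 0) \<and> p = finsum P (\<lambda>j. ta p j \<odot>\<^bsub>P\<^esub> h j) {..<?n}"
    if p: "p \<in> mdeg P (s + d)" for d p
  proof (intro conjI allI impI)
    have pc: "p \<in> carrier P" by (rule P.mdeg_sub[OF p])
    show "ta p j \<in> Rd d" for j
      using ta[OF p] ph(1) hB pc cmp_closed agrp_zero[OF deg_grp] by simp
    show "ta p j = 0" if "?n \<le> j" for j using ta[OF p] that by simp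
    have cl: "ph b p \<odot>\<^bsub>P\<^esub> b \<in> carrier P" if "b \<in> B" for b using P.smult_closed ph(1) Bc pc that by blast
    have cl2: "cmp d (ph b p) \<odot>\<^bsub>P\<^esub> b \<in> carrier P" if "b \<in> B" for b
      by (rule P.smult_closed[OF deg_sub[OF cmp_closed] Bc[OF that]]) (use ph(1) pc that in blast)
    have "p = P.mcomp p (s + d)" using P.mcomp_homogeneous[OF p] by simp
    also have "\<dots> = P.mcomp (finsum P (\<lambda>b. ph b p \<odot>\<^bsub>P\<^esub> b) B) (s + d)" using ph(4) pc by simp
    also have "\<dots> = finsum P (\<lambda>b. P.mcomp (ph b p \<odot>\<^bsub>P\<^esub> b) (s + d)) B"
      by (rule P.M.finsum_hom[where f = "\<lambda>m. P.mcomp m (s + d)"])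
        (simp_all add: P.M.abelian_group_axioms P.mcomp_closed P.mcomp_add cl)
    also have "\<dots> = finsum P (\<lambda>b. cmp d (ph b p) \<odot>\<^bsub>P\<^esub> b) B"
    proof (rule P.M.finsum_cong'[OF refl])
      show "(\<lambda>b. cmp d (ph b p) \<odot>\<^bsub>P\<^esub> b) \<in> B \<rightarrow> carrier P"
        using cl2 by blast
      fix b assume b: "b \<in> B"
      have a: "ph b p \<in> RC" using ph(1) b pc by blast
      have x: "b \<in> mdeg P s" using b B(2) by blast
      have "P.mcomp (ph b p \<odot>\<^bsub>P\<^esub> b) = (\<lambda>i. if s \<le> i then cmp (i - s) (ph b p) \<odot>\<^bsub>P\<^esub> b else \<zero>\<^bsub>P\<^esub>)"
        by (rule P.mcomp_unique[OF smult_decomp(2)[OF P a x] _ smult_decomp(3)[OF P a x] smult_decomp(1)[OF P a x]]) simp_all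
      then show "P.mcomp (ph b p \<odot>\<^bsub>P\<^esub> b) (s + d) = cmp d (ph b p) \<odot>\<^bsub>P\<^esub> b" by simp
    qed
    also have "\<dots> = finsum P (\<lambda>b. cmp d (ph b p) \<odot>\<^bsub>P\<^esub> b) (h ` {..<?n})" using h by (simp add: bij_betw_def)
    also have "\<dots> = finsum P (\<lambda>j. cmp d (ph (h j) p) \<odot>\<^bsub>P\<^esub> h j) {..<?n}"
      using h cl2 hB by (intro P.M.finsum_reindex) (auto simp: bij_betw_def)
    also have "\<dots> = finsum P (\<lambda>j. ta p j \<odot>\<^bsub>P\<^esub> h j) {..<?n}"
      using cl2 hB ta[OF p] by (intro P.M.finsum_cong'[OF refl]) auto
    finally show "p = finsum P (\<lambda>j. ta p j \<odot>\<^bsub>P\<^esub> h j) {..<?n}" .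
  qed
  moreover have "ta (p \<oplus>\<^bsub>P\<^esub> q) = ta p + ta q"
    if p: "p \<in> mdeg P (s + d)" and q: "q \<in> mdeg P (s + d)" for d p q
  proof
    fix j
    show "ta (p \<oplus>\<^bsub>P\<^esub> q) j = (ta p + ta q) j"
      using ta[OF P.mdeg_add[OF p q]] ta[OF p] ta[OF q] ph(1,2) hB P.mdeg_sub[OF p] P.mdeg_sub[OF q]
      by (cases "j < ?n") (simp_all add: add_R cmp_add)
  qed
  moreover have "ta (a \<odot>\<^bsub>P\<^esub> p) = pact a (ta p)"
    if a: "a \<in> Rd e" and p: "p \<in> mdeg P (s + d)" for e d a p
  proof
    fix j
    have ap: "a \<odot>\<^bsub>P\<^esub> p \<in> mdegree_part P (int (s + (e + d)))" using P.mdeg_smult[OF a p] by (simp add: ac_simps)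
    show "ta (a \<odot>\<^bsub>P\<^esub> p) j = pact a (ta p) j"
      using ta[OF ap] ta[OF p] ph(1,3) hB P.mdeg_sub[OF p] cmp_mult[OF a] deg_sub[OF a]
      by (cases "j < ?n") (simp_all add: pact_def)
  qed
  ultimately show ?thesis by (intro exI[of _ ?n] exI[of _ h] exI[of _ ta]) blast
qed

section \<open>From linear resolutions to iterated syzygies\<close>

text \<open>Bridges the two presentations of graded modules: \<open>P\<close> is a record,
  \<open>N\<close> a family of components, and degree \<open>s + d\<close> of \<open>P\<close> maps
  onto degree \<open>d\<close> of \<open>N\<close>.\<close>

definition cover :: "nat \<Rightarrow> ('r, 'p, 'z) gmodule_scheme \<Rightarrow> ('p \<Rightarrow> 'm::ab_group_add) \<Rightarrow>
    (nat \<Rightarrow> 'm set) \<Rightarrow> ('r \<Rightarrow> 'm \<Rightarrow> 'm) \<Rightarrow> bool"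
  where "cover s P g N act \<longleftrightarrow>
    (\<forall>d. \<forall>p\<in>mdeg P (s + d). g p \<in> N d) \<and>
    (\<forall>d. \<forall>p\<in>mdeg P (s + d). \<forall>q\<in>mdeg P (s + d). g (p \<oplus>\<^bsub>P\<^esub> q) = g p + g q) \<and>
    (\<forall>e d. \<forall>a\<in>Rd e. \<forall>p\<in>mdeg P (s + d). g (a \<odot>\<^bsub>P\<^esub> p) = act a (g p)) \<and>
    (\<forall>d. \<forall>y\<in>N d. \<exists>p\<in>mdeg P (s + d). g p = y)"

lemma coverD:
  assumes "cover s P g N act"
  shows "p \<in> mdeg P (s + d) \<Longrightarrow> g p \<in> N d"
    "p \<in> mdeg P (s + d) \<Longrightarrow> q \<in> mdeg P (s + d) \<Longrightarrow> g (p \<oplus>\<^bsub>P\<^esub> q) = g p + g q"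
    "a \<in> Rd e \<Longrightarrow> p \<in> mdeg P (s + d) \<Longrightarrow> g (a \<odot>\<^bsub>P\<^esub> p) = act a (g p)"
    "y \<in> N d \<Longrightarrow> \<exists>p\<in>mdeg P (s + d). g p = y"
  using assms unfolding cover_def by blast+

lemma cover_zero:
  assumes "pos_module R P" "cover s P g N act"
  shows "g \<zero>\<^bsub>P\<^esub> = 0"
proof -
  interpret P: pos_module R P by fact
  show ?thesis using coverD(2)[OF assms(2) P.mdeg_zero P.mdeg_zero] by simp
qed

lemma cover_gen:
  assumes P: "graded_left_module R P" and G: "generated_in_degree R P (int s)"
    and c: "cover s P g N act"
  shows "gen N act"
  unfolding gen_def
proof (intro allI impI subsetI)
  interpret P: pos_module R P by (rule pos_moduleI[OF P G])
  fix d T y assume T: "agrp T \<and> (\<forall>a\<in>Rd d. \<forall>m\<in>N 0. act a m \<in> T)" and y: "y \<in> N d"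
  obtain p where p: "p \<in> mdeg P (s + d)" "g p = y" using coverD(4)[OF c y] by blast
  let ?T = "{p \<in> mdeg P (s + d). g p \<in> T}"
  have "mdeg P (s + d) \<subseteq> ?T"
  proof (rule generated_piece[OF P G])
    show "\<zero>\<^bsub>P\<^esub> \<in> ?T" using P.mdeg_zero cover_zero[OF P.pos_module_axioms c] T by (simp add: agrp_zero)
    show "x \<oplus>\<^bsub>P\<^esub> y \<in> ?T" if "x \<in> ?T" "y \<in> ?T" for x y
      using that P.mdeg_add coverD(2)[OF c, of x d y] T by (simp add: agrp_add)
    show "a \<odot>\<^bsub>P\<^esub> x \<in> ?T" if "a \<in> Rd (s + d - s)" "x \<in> mdeg P s" for a x
      using that P.mdeg_smult[of a d x s] coverD(3)[OF c, of a d x 0] coverD(1)[OF c, of x 0] T by (simp add: ac_simps)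
  qed
  then show "y \<in> T" using p by blast
qed

text \<open>If \<open>g\<close> is injective in the lowest degree, then \<open>P\<close>, being
  projective and generated there, is the tensor cover of \<open>N 0\<close>: its homogeneous
  coordinates become a dual basis of \<open>N 0\<close>, and \<open>ta\<close> identifies
  \<open>P\<close> with \<open>pcar\<close> so that \<open>g\<close> turns into evaluation.\<close>

lemma cover_dual_basis:
  assumes P: "graded_left_module R P" and G: "generated_in_degree R P (int s)" and pr: "projective_module R P"
    and N: "gm N act" and c: "cover s P g N act"
    and inj: "\<And>p. p \<in> mdeg P s \<Longrightarrow> g p = 0 \<Longrightarrow> p = \<zero>\<^bsub>P\<^esub>"
  shows "\<exists>(n::nat) b ph ta. dual_basis (N 0) act {..<n} b ph \<and> cover s P ta (pcar n b ph) pact \<and>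
    (\<forall>d. \<forall>p\<in>mdeg P (s + d). peval n b act (ta p) = g p \<and> (ta p = 0 \<longrightarrow> p = \<zero>\<^bsub>P\<^esub>))"
proof -
  interpret P: pos_module R P by (rule pos_moduleI[OF P G])
  obtain n :: nat and b ta where b: "\<forall>j<n. b j \<in> mdeg P s"
    and ta: "\<forall>d. \<forall>p\<in>mdeg P (s + d). (\<forall>j. ta p j \<in> Rd d) \<and> (\<forall>j\<ge>n. ta p j = 0) \<and>
       p = finsum P (\<lambda>j. ta p j \<odot>\<^bsub>P\<^esub> b j) {..<n}"
    and taa: "\<forall>d. \<forall>p\<in>mdeg P (s + d). \<forall>q\<in>mdeg P (s + d). ta (p \<oplus>\<^bsub>P\<^esub> q) = ta p + ta q"
    and tam: "\<forall>e d. \<forall>a\<in>Rd e. \<forall>p\<in>mdeg P (s + d). ta (a \<odot>\<^bsub>P\<^esub> p) = pact a (ta p)"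
    using projective_coordinates[OF P G pr] by (elim exE conjE)
  have b0: "b j \<in> mdeg P (s + 0)" if "j < n" for j using b that by simp
  have tc: "v j \<odot>\<^bsub>P\<^esub> b j \<in> mdeg P (s + d)" if "\<And>j. v j \<in> Rd d" "j < n" for v d j
    using P.mdeg_smult[of "v j" d "b j" s] b that by (simp add: ac_simps)
  have sub: "subgroup (mdeg P i) (add_monoid P)" for i by (rule P.mdegree_subgroup)
  have fs: "finsum P (\<lambda>j. v j \<odot>\<^bsub>P\<^esub> b j) {..<n} \<in> mdeg P (s + d)" if "\<And>j. v j \<in> Rd d" for v d
    by (rule P.M.finsum_image_sum(2)[OF sub, where f = "\<lambda>_. 0 :: int"]) (simp_all add: tc[of v d] that)
  have tas: "ta (finsum P (\<lambda>j. v j \<odot>\<^bsub>P\<^esub> b j) {..<n}) = (\<Sum>j<n. pact (v j) (ta (b j)))"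
    if v: "\<And>j. v j \<in> Rd d" for v d
  proof -
    have "ta (finsum P (\<lambda>j. v j \<odot>\<^bsub>P\<^esub> b j) {..<n}) = (\<Sum>j<n. ta (v j \<odot>\<^bsub>P\<^esub> b j))"
      using taa tc[of v d, OF v] by (intro P.M.finsum_image_sum(1)[OF sub[of "s + d"]]) auto
    also have "\<dots> = (\<Sum>j<n. pact (v j) (ta (b j)))" using tam b0 v by (intro sum.cong) blast+
    finally show ?thesis .
  qed
  have gs: "g (finsum P (\<lambda>j. v j \<odot>\<^bsub>P\<^esub> b j) {..<n}) = (\<Sum>j<n. act (v j) (g (b j)))"
    if v: "\<And>j. v j \<in> Rd d" for v d
  proof -
    have "g (finsum P (\<lambda>j. v j \<odot>\<^bsub>P\<^esub> b j) {..<n}) = (\<Sum>j<n. g (v j \<odot>\<^bsub>P\<^esub> b j))"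
      using coverD(2)[OF c] tc[of v d, OF v] by (intro P.M.finsum_image_sum(1)[OF sub[of "s + d"]]) auto
    also have "\<dots> = (\<Sum>j<n. act (v j) (g (b j)))" using coverD(3)[OF c v b0] by (intro sum.cong) auto
    finally show ?thesis .
  qed
  note taD = ta[rule_format, THEN conjunct1, rule_format] ta[rule_format, THEN conjunct2, THEN conjunct1, rule_format]
    ta[rule_format, THEN conjunct2, THEN conjunct2]
  \<comment> \<open>The inverse of \<open>g\<close> on the lowest degree, used to carry the
    coordinates of \<open>P\<close> over to \<open>N 0\<close>.\<close>
  define \<gamma> where "\<gamma> y = (SOME p. p \<in> mdeg P s \<and> g p = y)" for y
  have ginj: "p = q" if "p \<in> mdeg P s" "q \<in> mdeg P s" "g p = g q" for p q
  proof -
    have mq: "\<ominus>\<^bsub>P\<^esub> q \<in> mdeg P s"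
      using subgroup.m_inv_closed[OF sub that(2)] by (simp add: a_inv_def)
    have "g q + g (\<ominus>\<^bsub>P\<^esub> q) = 0"
      using coverD(2)[OF c, of q 0 "\<ominus>\<^bsub>P\<^esub> q"] that(2) mq cover_zero[OF P.pos_module_axioms c] P.M.r_neg[OF P.mdeg_sub[OF that(2)]] by simp
    then have "g (p \<oplus>\<^bsub>P\<^esub> \<ominus>\<^bsub>P\<^esub> q) = 0" using coverD(2)[OF c, of p 0 "\<ominus>\<^bsub>P\<^esub> q"] that mq by simp
    then have "p \<oplus>\<^bsub>P\<^esub> \<ominus>\<^bsub>P\<^esub> q = \<zero>\<^bsub>P\<^esub>" using inj[OF P.mdeg_add[OF that(1) mq]] by simp
    then show ?thesis using P.M.minus_unique[of p "\<ominus>\<^bsub>P\<^esub> q" q] P.mdeg_sub[OF that(1)] P.mdeg_sub[OF that(2)]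
      by (simp add: P.M.r_neg P.M.l_neg)
  qed
  have \<gamma>: "\<gamma> (g p) = p" if "p \<in> mdeg P s" for p
    unfolding \<gamma>_def using that ginj by (intro some_equality) auto
  define ph where "ph j y = ta (\<gamma> y) j" for j y
  have ph: "ph j (g p) = ta p j" if "p \<in> mdeg P s" for j p using \<gamma>[OF that] by (simp add: ph_def)
  let ?b = "\<lambda>j. g (b j)"
  have surj0: "\<exists>p\<in>mdeg P s. y = g p" if "y \<in> N 0" for y using coverD(4)[OF c that] by auto
  have "dual_basis (N 0) act {..<n} ?b ph"
    unfolding dual_basis_def slin_def additive_on_def
  proof (intro conjI ballI)
    fix j assume "j \<in> {..<n}"
    then have j: "j < n" by simp
    show "g (b j) \<in> N 0" by (rule coverD(1)[OF c b0[OF j]])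
    fix y assume "y \<in> N 0"
    then obtain p where p: "p \<in> mdeg P s" "y = g p" using surj0 by blast
    show "ph j y \<in> Rd 0" using taD(1)[of p 0] p ph by simp
    show "ph j (act a y) = a \<otimes>\<^bsub>R\<^esub> ph j y" if a: "a \<in> Rd 0" for a
    proof -
      have "act a y = g (a \<odot>\<^bsub>P\<^esub> p)" using coverD(3)[OF c a, of p 0] p by simp
      moreover have "a \<odot>\<^bsub>P\<^esub> p \<in> mdeg P s" using P.mdeg_smult[OF a p(1)] by simp
      moreover have "ta (a \<odot>\<^bsub>P\<^esub> p) = pact a (ta p)" using tam[rule_format, OF a, of p 0] p by simp
      ultimately show ?thesis using ph p by (simp add: pact_def)
    qed
    fix z assume "z \<in> N 0"
    then obtain q where q: "q \<in> mdeg P s" "z = g q" using surj0 by blast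
    have "y + z = g (p \<oplus>\<^bsub>P\<^esub> q)" using coverD(2)[OF c, of p 0 q] p q by simp
    moreover have "ta (p \<oplus>\<^bsub>P\<^esub> q) = ta p + ta q" using taa[rule_format, of p 0 q] p q by simp
    ultimately show "ph j (y + z) = ph j y + ph j z" using ph p q P.mdeg_add by simp
  next
    fix y assume "y \<in> N 0"
    then obtain p where p: "p \<in> mdeg P s" "y = g p" using surj0 by blast
    have p0: "p \<in> mdeg P (s + 0)" using p by simp
    have "y = g (finsum P (\<lambda>j. ta p j \<odot>\<^bsub>P\<^esub> b j) {..<n})" unfolding p(2) by (rule arg_cong[OF taD(3)[OF p0]])
    also have "\<dots> = (\<Sum>j<n. act (ta p j) (g (b j)))" by (rule gs[of "ta p" 0]) (rule taD(1)[OF p0])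
    finally show "y = (\<Sum>j<n. act (ph j y) (g (b j)))" using ph[OF p(1)] p(2) by simp
  qed simp
  moreover have "cover s P ta (pcar n ?b ph) pact"
    unfolding cover_def
  proof (intro conjI allI ballI)
    fix d p assume p: "p \<in> mdeg P (s + d)"
    \<comment> \<open>Applying \<open>ta\<close> to the expansion of \<open>p\<close> shows that the
      coordinate vector is fixed by the matrix of the dual basis, which is membership in
      \<open>pcar\<close>.\<close>
    have "ta p = ta (finsum P (\<lambda>j. ta p j \<odot>\<^bsub>P\<^esub> b j) {..<n})" by (rule arg_cong[OF taD(3)[OF p]])
    also have "\<dots> = (\<Sum>j<n. pact (ta p j) (ta (b j)))" by (rule tas[of "ta p" d]) (rule taD(1)[OF p])
    finally have "ta p l = (\<Sum>j<n. pact (ta p j) (ta (b j))) l" for l by (rule arg_cong)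
    then have e: "ta p l = (\<Sum>j<n. ta p j \<otimes>\<^bsub>R\<^esub> ta (b j) l)" for l
      unfolding sum_apply pact_def .
    show "ta p \<in> pcar n ?b ph d"
    proof (rule pcarI)
      fix l assume "l < n"
      show "ta p l \<in> Rd d" by (rule taD(1)[OF p])
      have "(\<Sum>i<n. ta p i \<otimes>\<^bsub>R\<^esub> ph l (g (b i))) = (\<Sum>j<n. ta p j \<otimes>\<^bsub>R\<^esub> ta (b j) l)"
        using ph b by (intro sum.cong) auto
      then show "(\<Sum>i<n. ta p i \<otimes>\<^bsub>R\<^esub> ph l (g (b i))) = ta p l" using e[of l] by (rule trans[OF _ sym])
    qed (rule taD(2)[OF p])
    show "ta (p \<oplus>\<^bsub>P\<^esub> q) = ta p + ta q" if "q \<in> mdeg P (s + d)" for q using taa p that by blast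
  next
    show "ta (a \<odot>\<^bsub>P\<^esub> p) = pact a (ta p)" if "a \<in> Rd e" "p \<in> mdeg P (s + d)" for e d a p
      using tam that by blast
  next
    fix d v assume v: "v \<in> pcar n ?b ph d"
    let ?p = "finsum P (\<lambda>j. v j \<odot>\<^bsub>P\<^esub> b j) {..<n}"
    have "ta ?p = v"
    proof
      fix l
      show "ta ?p l = v l"
      proof (cases "l < n")
        case True
        then show ?thesis using tas[of v d] pcar_closed[OF v] pcar_eq[OF v True] ph b by (simp add: sum_apply pact_def)
      next
        case False
        then show ?thesis using taD(2)[OF fs[of v d], of l] pcar_closed[OF v] pcar_beyond[OF v, of l] by simp
      qed
    qed
    then show "\<exists>p\<in>mdeg P (s + d). ta p = v" using fs[of v d] pcar_closed[OF v] by blast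
  qed
  moreover have "peval n ?b act (ta p) = g p \<and> (ta p = 0 \<longrightarrow> p = \<zero>\<^bsub>P\<^esub>)" if p: "p \<in> mdeg P (s + d)" for d p
  proof
    have "g p = g (finsum P (\<lambda>j. ta p j \<odot>\<^bsub>P\<^esub> b j) {..<n})" by (rule arg_cong[OF taD(3)[OF p]])
    also have "\<dots> = (\<Sum>j<n. act (ta p j) (g (b j)))" by (rule gs[of "ta p" d]) (rule taD(1)[OF p])
    finally show "peval n ?b act (ta p) = g p" by (simp only: peval_def)
    show "ta p = 0 \<longrightarrow> p = \<zero>\<^bsub>P\<^esub>"
    proof
      assume "ta p = 0"
      then have z: "ta p j = 0" for j by simp
      have "p = finsum P (\<lambda>j. 0 \<odot>\<^bsub>P\<^esub> b j) {..<n}" using taD(3)[OF p] unfolding z .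
      also have "\<dots> = \<zero>\<^bsub>P\<^esub>"
        using P.smult_zero_left[OF P.mdeg_sub[OF b0]] by (intro P.M.add.finprod_one_eqI) (auto simp: zero_R)
      finally show "p = \<zero>\<^bsub>P\<^esub>" .
    qed
  qed
  ultimately show ?thesis by (intro exI[of _ n] exI[of _ ?b] exI[of _ ph] exI[of _ ta]) blast
qed

text \<open>Induction over the length, for resolutions that start in an arbitrary degree
  \<open>s\<close>. The first term is the tensor cover, so the second term covers the syzygy, and
  the tail of the resolution is a resolution of it starting in degree \<open>Suc s\<close>. The last
  hypothesis is exactness at the first term, degree by degree.\<close>

lemma resolution_lin:
  fixes P :: "nat \<Rightarrow> ('r, nat \<Rightarrow> 'r) gmodule"
  assumes "\<And>i. graded_left_module R (P i)" "\<And>i. projective_module R (P i)"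
    "\<And>i. generated_in_degree R (P i) (int (s + i))" "\<And>i. d i \<in> graded_hom R (P (Suc i)) (P i)"
    "\<And>i. d (Suc i) ` carrier (P (Suc (Suc i))) = a_kernel (P (Suc i)) (P i) (d i)"
    "cover s (P 0) g N act" "gm N act"
    "\<And>j p. p \<in> mdeg (P 0) j \<Longrightarrow> g p = 0 \<longleftrightarrow> (\<exists>q\<in>mdegree_part (P (Suc 0)) (int j). p = d 0 q)"
  shows "lin n N act"
  using assms
proof (induction n arbitrary: P d s g N act)
  case 0
  then show ?case using cover_gen[OF 0(1)[of 0] _ 0(6)] 0(3)[of 0] by simp
next
  case (Suc n)
  note P = Suc.prems(1) and pr = Suc.prems(2) and G = Suc.prems(3) and d = Suc.prems(4) and ex = Suc.prems(5)
    and c = Suc.prems(6) and N = Suc.prems(7) and k = Suc.prems(8)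
  have pos: "pos_module R (P i)" for i by (rule pos_moduleI[OF P G])
  have G0: "generated_in_degree R (P 0) (int s)" using G[of 0] by simp
  have zero: "f \<zero>\<^bsub>P (Suc i)\<^esub> = \<zero>\<^bsub>P i\<^esub>" if "f \<in> graded_hom R (P (Suc i)) (P i)" for f i
  proof -
    interpret A: pos_module R "P (Suc i)" by (rule pos)
    interpret B: pos_module R "P i" by (rule pos)
    have f: "f x \<in> carrier (P i)" "f (x \<oplus>\<^bsub>P (Suc i)\<^esub> y) = f x \<oplus>\<^bsub>P i\<^esub> f y" if "x \<in> carrier (P (Suc i))" "y \<in> carrier (P (Suc i))" for x y
      using that \<open>f \<in> _\<close> by (auto simp: graded_hom_def lmod_hom_def)
    show ?thesis using f[OF A.M.zero_closed A.M.zero_closed] by (simp add: B.M.add.l_cancel_one)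
  qed
  \<comment> \<open>A kernel element of degree \<open>s\<close> comes from degree \<open>s\<close>
    of the next term, which is generated in degree \<open>s + 1\<close> and so vanishes
    there.\<close>
  have inj: "p = \<zero>\<^bsub>P 0\<^esub>" if p: "p \<in> mdeg (P 0) s" "g p = 0" for p
  proof -
    obtain q where q: "q \<in> mdegree_part (P (Suc 0)) (int s)" "p = d 0 q" using k[OF p(1)] p(2) by blast
    have "q = \<zero>\<^bsub>P (Suc 0)\<^esub>" by (rule generated_below[OF P G _ q(1)]) simp
    then show ?thesis using q(2) zero[OF d[of 0]] by simp
  qed
  obtain l :: nat and b ph ta where D: "dual_basis (N 0) act {..<l} b ph" and ta: "cover s (P 0) ta (pcar l b ph) pact"
    and ta': "\<forall>d. \<forall>p\<in>mdeg (P 0) (s + d). peval l b act (ta p) = g p \<and> (ta p = 0 \<longrightarrow> p = \<zero>\<^bsub>P 0\<^esub>)"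
    using cover_dual_basis[OF P[of 0] G0 pr[of 0] N c inj] by blast
  have dd: "d 0 q \<in> mdegree_part (P 0) j" if "q \<in> mdegree_part (P (Suc 0)) j" for q j
    using d[of 0] that by (auto simp: graded_hom_def)
  interpret P1: pos_module R "P (Suc 0)" by (rule pos)
  interpret P0: pos_module R "P 0" by (rule pos)
  have "lin n (syz l b ph act) pact"
  proof (rule Suc.IH[of "\<lambda>i. P (Suc i)" "Suc s" "\<lambda>i. d (Suc i)" "\<lambda>q. ta (d 0 q)"])
    show "generated_in_degree R (P (Suc i)) (int (Suc s + i))" for i using G[of "Suc i"] by simp
    show "gm (syz l b ph act) pact" by (rule gm_syz[OF N D])
    show "cover (Suc s) (P (Suc 0)) (\<lambda>q. ta (d 0 q)) (syz l b ph act) pact"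
      unfolding cover_def
    proof (intro conjI allI ballI)
      fix e q assume q: "q \<in> mdegree_part (P (Suc 0)) (int (Suc s + e))"
      have dq: "d 0 q \<in> mdeg (P 0) (s + Suc e)" using dd[OF q] by simp
      have "g (d 0 q) = 0" using k[OF dd[OF q]] q by blast
      then show "ta (d 0 q) \<in> syz l b ph act e" using coverD(1)[OF ta dq] ta'[rule_format, OF dq] by (simp add: syz_def)
      fix q' assume q': "q' \<in> mdegree_part (P (Suc 0)) (int (Suc s + e))"
      have dq': "d 0 q' \<in> mdeg (P 0) (s + Suc e)" using dd[OF q'] by simp
      have "d 0 (q \<oplus>\<^bsub>P (Suc 0)\<^esub> q') = d 0 q \<oplus>\<^bsub>P 0\<^esub> d 0 q'"
        using d[of 0] P1.mdeg_sub[OF q] P1.mdeg_sub[OF q'] by (auto simp: graded_hom_def lmod_hom_def)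
      then show "ta (d 0 (q \<oplus>\<^bsub>P (Suc 0)\<^esub> q')) = ta (d 0 q) + ta (d 0 q')" using coverD(2)[OF ta dq dq'] by simp
    next
      fix e e' a q assume a: "a \<in> Rd e" and q: "q \<in> mdegree_part (P (Suc 0)) (int (Suc s + e'))"
      have dq: "d 0 q \<in> mdeg (P 0) (s + Suc e')" using dd[OF q] by simp
      have "d 0 (a \<odot>\<^bsub>P (Suc 0)\<^esub> q) = a \<odot>\<^bsub>P 0\<^esub> d 0 q"
        using d[of 0] P1.mdeg_sub[OF q] deg_sub[OF a] by (auto simp: graded_hom_def lmod_hom_def)
      then show "ta (d 0 (a \<odot>\<^bsub>P (Suc 0)\<^esub> q)) = pact a (ta (d 0 q))" using coverD(3)[OF ta a dq] by simp
    next
      fix e y assume y: "y \<in> syz l b ph act e"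
      obtain p where p: "p \<in> mdeg (P 0) (s + Suc e)" "ta p = y"
        using coverD(4)[OF ta syz_pcar[OF y]] by blast
      have "g p = 0" using ta'[rule_format, OF p(1)] p(2) y by (simp add: syz_def)
      then obtain q where "q \<in> mdegree_part (P (Suc 0)) (int (s + Suc e))" "p = d 0 q" using k[OF p(1)] by blast
      then show "\<exists>q\<in>mdegree_part (P (Suc 0)) (int (Suc s + e)). ta (d 0 q) = y" using p(2) by auto
    qed
    fix j p assume p: "p \<in> mdegree_part (P (Suc 0)) (int j)"
    have pc: "p \<in> carrier (P (Suc 0))" by (rule P1.mdeg_sub[OF p])
    have "ta (d 0 p) = 0 \<longleftrightarrow> d 0 p = \<zero>\<^bsub>P 0\<^esub>"
    proof
      assume z: "ta (d 0 p) = 0"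
      show "d 0 p = \<zero>\<^bsub>P 0\<^esub>"
      \<comment> \<open>Injectivity of \<open>ta\<close> is available in degrees from
        \<open>s\<close> on only; in lower degrees, and in degree \<open>s\<close>, already
        \<open>p\<close> is zero.\<close>
      proof (cases "j < Suc s")
        case True
        then have "p = \<zero>\<^bsub>P (Suc 0)\<^esub>" using generated_below[OF P G _ p] by simp
        then show ?thesis using zero[OF d[of 0]] by simp
      next
        case False
        then have "d 0 p \<in> mdegree_part (P 0) (int (s + (j - s)))" using dd[OF p] by simp
        then show ?thesis using ta' z by blast
      qed
    next
      assume "d 0 p = \<zero>\<^bsub>P 0\<^esub>"
      then show "ta (d 0 p) = 0" using cover_zero[OF pos ta] by simp
    qed
    also have "\<dots> \<longleftrightarrow> p \<in> a_kernel (P (Suc 0)) (P 0) (d 0)" using pc by (simp add: a_kernel_def')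
    also have "\<dots> \<longleftrightarrow> (\<exists>q\<in>carrier (P (Suc (Suc 0))). p = d (Suc 0) q)" using ex[of 0] by blast
    also have "\<dots> \<longleftrightarrow> (\<exists>q\<in>mdegree_part (P (Suc (Suc 0))) (int j). p = d (Suc 0) q)"
    proof
      assume "\<exists>q\<in>carrier (P (Suc (Suc 0))). p = d (Suc 0) q"
      then obtain q where "q \<in> carrier (P (Suc (Suc 0)))" "p = d (Suc 0) q" by blast
      then show "\<exists>q\<in>mdegree_part (P (Suc (Suc 0))) (int j). p = d (Suc 0) q"
        using graded_hom_lift[OF pos pos d[of "Suc 0"], of q j] p by simp
    next
      interpret P2: pos_module R "P (Suc (Suc 0))" by (rule pos)
      show "\<exists>q\<in>mdegree_part (P (Suc (Suc 0))) (int j). p = d (Suc 0) q \<Longrightarrow> \<exists>q\<in>carrier (P (Suc (Suc 0))). p = d (Suc 0) q"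
        using P2.mdeg_sub by blast
    qed
    finally show "ta (d 0 p) = 0 \<longleftrightarrow> (\<exists>q\<in>mdegree_part (P (Suc (Suc 0))) (int j). p = d (Suc 0) q)" .
  qed (use P pr d ex in auto)
  then show ?case by (rule lin_SucI[OF N cover_gen[OF P[of 0] G0 c] D])
qed

text \<open>An isomorphic copy of \<open>M\<close> in the form of a family of components, where
  \<open>lin\<close> and \<open>koszul\<close> make sense.\<close>

definition model :: "('r, 'q, 'z) gmodule_scheme \<Rightarrow> ('q \<Rightarrow> 'm::ab_group_add) \<Rightarrow> (nat \<Rightarrow> 'm set) \<Rightarrow> ('r \<Rightarrow> 'm \<Rightarrow> 'm) \<Rightarrow> bool"
  where "model M h N act \<longleftrightarrow> cover 0 M h N act \<and>
    (\<forall>d. \<forall>m\<in>mdeg M d. h m = 0 \<longrightarrow> m = \<zero>\<^bsub>M\<^esub>)"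

text \<open>Compose the augmentation with \<open>h\<close>; homogeneous preimages turn exactness of
  the resolution into the degreewise condition of \<open>resolution_lin\<close>.\<close>

lemma koszul_module_model:
  assumes K: "koszul_module R M" and m: "model M h N act" and N: "gm N act"
  shows "koszul N act"
  unfolding koszul_def
proof
  fix n
  obtain P d \<epsilon> where r: "linear_projective_resolution R M P d \<epsilon>" and M: "graded_left_module R M"
    and GM: "generated_in_degree R M (int 0)" using K by (auto simp: koszul_module_def)
  have P: "graded_left_module R (P i)" "projective_module R (P i)" "generated_in_degree R (P i) (int (0 + i))" for i
    using r by (simp_all add: linear_projective_resolution_def)
  have d: "d i \<in> graded_hom R (P (Suc i)) (P i)" "d (Suc i) ` carrier (P (Suc (Suc i))) = a_kernel (P (Suc i)) (P i) (d i)" for i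
    using r by (simp_all add: linear_projective_resolution_def)
  have e: "\<epsilon> \<in> graded_hom R (P 0) M" "\<epsilon> ` carrier (P 0) = carrier M" "d 0 ` carrier (P (Suc 0)) = a_kernel (P 0) M \<epsilon>"
    using r by (simp_all add: linear_projective_resolution_def)
  have pos: "pos_module R (P i)" for i by (rule pos_moduleI[OF P(1) P(3)])
  interpret M: pos_module R M by (rule pos_moduleI[OF M GM])
  interpret P0: pos_module R "P 0" by (rule pos)
  interpret P1: pos_module R "P (Suc 0)" by (rule pos)
  have c: "cover 0 M h N act" and hz: "\<And>d m. m \<in> mdeg M d \<Longrightarrow> h m = 0 \<Longrightarrow> m = \<zero>\<^bsub>M\<^esub>"
    using m by (auto simp: model_def)
  have eh: "\<epsilon> (p \<oplus>\<^bsub>P 0\<^esub> q) = \<epsilon> p \<oplus>\<^bsub>M\<^esub> \<epsilon> q" "a \<in> RC \<Longrightarrow> \<epsilon> (a \<odot>\<^bsub>P 0\<^esub> p) = a \<odot>\<^bsub>M\<^esub> \<epsilon> p" "\<epsilon> p \<in> carrier M"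
    if "p \<in> carrier (P 0)" "q \<in> carrier (P 0)" for p q a using e(1) that by (auto simp: graded_hom_def lmod_hom_def)
  have ed: "\<epsilon> p \<in> mdegree_part M j" if "p \<in> mdegree_part (P 0) j" for p j using e(1) that by (auto simp: graded_hom_def)
  show "lin n N act"
  proof (rule resolution_lin[where s = 0 and P = P and d = d and g = "\<lambda>p. h (\<epsilon> p)", OF P d _ N])
    show "cover 0 (P 0) (\<lambda>p. h (\<epsilon> p)) N act"
      unfolding cover_def
    proof (intro conjI allI ballI)
      show "h (\<epsilon> p) \<in> N d" if "p \<in> mdeg (P 0) (0 + d)" for d p
        by (rule coverD(1)[OF c ed[OF that]])
      show "h (\<epsilon> (p \<oplus>\<^bsub>P 0\<^esub> q)) = h (\<epsilon> p) + h (\<epsilon> q)"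
        if "p \<in> mdeg (P 0) (0 + d)" "q \<in> mdeg (P 0) (0 + d)" for d p q
        using coverD(2)[OF c ed[OF that(1)] ed[OF that(2)]] eh(1)[OF P0.mdeg_sub[OF that(1)] P0.mdeg_sub[OF that(2)]] by simp
      show "h (\<epsilon> (a \<odot>\<^bsub>P 0\<^esub> p)) = act a (h (\<epsilon> p))"
        if "a \<in> Rd e" "p \<in> mdeg (P 0) (0 + d)" for e d a p
        using coverD(3)[OF c that(1) ed[OF that(2)]] eh(2)[OF P0.mdeg_sub[OF that(2)] P0.mdeg_sub[OF that(2)] deg_sub[OF that(1)]] by simp
      show "\<exists>p\<in>mdeg (P 0) (0 + d). h (\<epsilon> p) = y" if y: "y \<in> N d" for d y
      proof -
        obtain m where m: "m \<in> mdeg M d" "h m = y" using coverD(4)[OF c y] by auto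
        have "m \<in> \<epsilon> ` carrier (P 0)" unfolding e(2) by (rule M.mdeg_sub[OF m(1)])
        then obtain p where p: "p \<in> carrier (P 0)" "m = \<epsilon> p" by blast
        then obtain p' where "p' \<in> mdeg (P 0) d" "\<epsilon> p = \<epsilon> p'"
          using graded_hom_lift[OF pos M.pos_module_axioms e(1), of p d] m by blast
        then show ?thesis using m p by (intro bexI[of _ p']) simp_all
      qed
    qed
    fix j p assume p: "p \<in> mdeg (P 0) j"
    have "h (\<epsilon> p) = 0 \<longleftrightarrow> \<epsilon> p = \<zero>\<^bsub>M\<^esub>"
      using hz[OF ed[OF p]] cover_zero[OF M.pos_module_axioms c] by auto
    also have "\<dots> \<longleftrightarrow> (\<exists>q\<in>carrier (P (Suc 0)). p = d 0 q)"
    proof -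
      have "\<epsilon> p = \<zero>\<^bsub>M\<^esub> \<longleftrightarrow> p \<in> a_kernel (P 0) M \<epsilon>" using P0.mdeg_sub[OF p] by (simp add: a_kernel_def')
      then show ?thesis unfolding e(3)[symmetric] image_iff .
    qed
    also have "\<dots> \<longleftrightarrow> (\<exists>q\<in>mdegree_part (P (Suc 0)) (int j). p = d 0 q)"
    proof
      assume "\<exists>q\<in>carrier (P (Suc 0)). p = d 0 q"
      then obtain q where "q \<in> carrier (P (Suc 0))" "p = d 0 q" by blast
      then show "\<exists>q\<in>mdegree_part (P (Suc 0)) (int j). p = d 0 q"
        using graded_hom_lift[OF pos pos d(1)[of 0], of q j] p by simp
    qed (use P1.mdeg_sub in blast)
    finally show "h (\<epsilon> p) = 0 \<longleftrightarrow> (\<exists>q\<in>mdegree_part (P (Suc 0)) (int j). p = d 0 q)" .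
  qed
qed


section \<open>From iterated syzygies to linear resolutions\<close>

text \<open>The total module with homogeneous parts \<open>pcar\<close>: the same fixed vectors of
  the idempotent matrix, now with arbitrary ring elements as entries.\<close>

definition ptot :: "nat \<Rightarrow> (nat \<Rightarrow> 'm::ab_group_add) \<Rightarrow> (nat \<Rightarrow> 'm \<Rightarrow> 'r) \<Rightarrow> (nat \<Rightarrow> 'r) set"
  where "ptot n b ph = {v. (\<forall>j. v j \<in> RC) \<and> (\<forall>j\<ge>n. v j = 0) \<and>
    (\<forall>j<n. (\<Sum>i<n. v i \<otimes>\<^bsub>R\<^esub> ph j (b i)) = v j)}"

text \<open>The cover as a module record, with degrees starting at \<open>s\<close>. This undoes the
  shifts by which the iterated syzygies were moved back to degree 0.\<close>

definition prec :: "nat \<Rightarrow> nat \<Rightarrow> (nat \<Rightarrow> 'm::ab_group_add) \<Rightarrow> (nat \<Rightarrow> 'm \<Rightarrow> 'r) \<Rightarrow> ('r, nat \<Rightarrow> 'r) gmodule"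
  where "prec s n b ph = \<lparr>carrier = ptot n b ph, mult = undefined, one = undefined, zero = 0, add = (+), smult = pact,
    mdegree_part = (\<lambda>k. if int s \<le> k then pcar n b ph (nat (k - int s)) else {0})\<rparr>"

definition vcmp :: "nat \<Rightarrow> (nat \<Rightarrow> 'r) \<Rightarrow> nat \<Rightarrow> 'r"
  where "vcmp d v = (\<lambda>j. cmp d (v j))"

lemma prec_simps [simp]:
  "carrier (prec s n b ph) = ptot n b ph" "zero (prec s n b ph) = 0" "add (prec s n b ph) = (+)" "smult (prec s n b ph) = pact"
  "mdegree_part (prec s n b ph) k = (if int s \<le> k then pcar n b ph (nat (k - int s)) else {0})"
  by (simp_all add: prec_def)

lemma cmp_mult_right:
  assumes a: "a \<in> RC" and b: "b \<in> Rd f"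
  shows "cmp e (a \<otimes>\<^bsub>R\<^esub> b) = (if f \<le> e then cmp (e - f) a \<otimes>\<^bsub>R\<^esub> b else 0)"
proof -
  have cb: "b \<in> RC" using deg_sub[OF b] .
  have cl: "cmp i a \<in> RC" for i using deg_sub[OF cmp_closed[OF a]] .
  have "a \<otimes>\<^bsub>R\<^esub> b = (\<Sum>i<top. cmp i a \<otimes>\<^bsub>R\<^esub> b)"
    using cmp_sum[OF a] R_sum_left[OF cb, of "{..<top}" "\<lambda>i. cmp i a"] cl by simp
  then have "cmp e (a \<otimes>\<^bsub>R\<^esub> b) = (\<Sum>i<top. cmp e (cmp i a \<otimes>\<^bsub>R\<^esub> b))"
    using additive_on_sum[OF R_agrp additive_cmp, of "{..<top}" "\<lambda>i. cmp i a \<otimes>\<^bsub>R\<^esub> b"] cb cl by simp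
  also have "\<dots> = (\<Sum>i<top. if i + f = e then cmp i a \<otimes>\<^bsub>R\<^esub> b else 0)"
    using cmp_deg[OF deg_mult[OF cmp_closed[OF a] b]] by (intro sum.cong) auto
  also have "\<dots> = (\<Sum>i<top. if i = e - f then if f \<le> e then cmp (e - f) a \<otimes>\<^bsub>R\<^esub> b else 0 else 0)"
    by (intro sum.cong) auto
  also have "\<dots> = (if f \<le> e then cmp (e - f) a \<otimes>\<^bsub>R\<^esub> b else 0)"
    using cmp_top[OF _ a, of "e - f"] cb by (cases "e - f < top") auto
  finally show ?thesis .
qed

text \<open>Passes from an indexed spanning family, in which vectors may repeat, to the spanning set
  that the definition asks for.\<close>

lemma finite_dimensional_partI:
  fixes M :: "('r, 'q::ab_group_add, 'z) module_scheme"
  assumes M: "left_module R M" "add M = (+)" "zero M = 0" and I: "finite I"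
    and w: "\<And>i. i \<in> I \<Longrightarrow> w i \<in> V" and V: "V \<subseteq> carrier M"
    and span: "\<And>v. v \<in> V \<Longrightarrow> \<exists>c. v = (\<Sum>i\<in>I. scal (c i) \<odot>\<^bsub>M\<^esub> w i)"
  shows "finite_dimensional_part R M V"
  unfolding finite_dimensional_part_def
proof (intro exI[of _ "w ` I"] conjI ballI)
  interpret M: left_module R M by fact
  show "finite (w ` I)" "w ` I \<subseteq> V" using I w by auto
  fix v assume "v \<in> V"
  then obtain c where c: "v = (\<Sum>i\<in>I. scal (c i) \<odot>\<^bsub>M\<^esub> w i)" using span by blast
  have wc: "w i \<in> carrier M" if "i \<in> I" for i using w[OF that] V by blast
  \<comment> \<open>Coefficients of equal vectors are added up.\<close>
  let ?c = "\<lambda>x. \<Sum>i\<in>{i \<in> I. w i = x}. c i"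
  have Mg: "agrp (carrier M)"
    unfolding agrp_def
  proof (intro conjI ballI)
    show "0 \<in> carrier M" using M.M.zero_closed M(3) by simp
    show "x + y \<in> carrier M" if "x \<in> carrier M" "y \<in> carrier M" for x y using M.M.a_closed[OF that] M(2) by simp
    show "- x \<in> carrier M" if "x \<in> carrier M" for x
    proof -
      have "(\<ominus>\<^bsub>M\<^esub> x) + x = 0" using M.M.l_neg[OF that] M(2,3) by simp
      then show ?thesis using M.M.a_inv_closed[OF that] by (simp add: eq_neg_iff_add_eq_0[symmetric])
    qed
  qed
  have sc: "scal (sum c J) \<odot>\<^bsub>M\<^esub> x = (\<Sum>i\<in>J. scal (c i) \<odot>\<^bsub>M\<^esub> x)" if x: "x \<in> carrier M" for J x
  proof (induction J rule: infinite_finite_induct)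
    have "scal 0 \<odot>\<^bsub>M\<^esub> x = 0"
      using scal_add[of 0 0] M.smult_zero_left[OF x] by (simp add: zero_R M(3))
    then show "scal (sum c {}) \<odot>\<^bsub>M\<^esub> x = (\<Sum>i\<in>{}. scal (c i) \<odot>\<^bsub>M\<^esub> x)"
      and "\<And>J. infinite J \<Longrightarrow> scal (sum c J) \<odot>\<^bsub>M\<^esub> x = (\<Sum>i\<in>J. scal (c i) \<odot>\<^bsub>M\<^esub> x)" by simp_all
  next
    case (insert i J)
    then show ?case using M.smult_l_distr[OF scal_carrier scal_carrier x, of "c i" "sum c J"] by (simp add: scal_add add_R M(2))
  qed
  have "v = (\<Sum>x\<in>w ` I. \<Sum>i\<in>{i \<in> I. w i = x}. scal (c i) \<odot>\<^bsub>M\<^esub> w i)"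
    unfolding c by (rule sum.image_gen[OF I])
  also have "\<dots> = (\<Sum>x\<in>w ` I. scal (?c x) \<odot>\<^bsub>M\<^esub> x)"
  proof (rule sum.cong[OF refl])
    fix x assume "x \<in> w ` I"
    then have "x \<in> carrier M" using wc by blast
    then show "(\<Sum>i\<in>{i \<in> I. w i = x}. scal (c i) \<odot>\<^bsub>M\<^esub> w i) = scal (?c x) \<odot>\<^bsub>M\<^esub> x"
      by (simp add: sc)
  qed
  also have "\<dots> = finsum M (\<lambda>x. scal (?c x) \<odot>\<^bsub>M\<^esub> x) (w ` I)"
    using M.smult_closed[OF scal_carrier] wc by (intro finsum_eq_sum[OF M(2,3) Mg, symmetric]) auto
  finally show "\<exists>c. v = finsum M (\<lambda>x. scal (c x) \<odot>\<^bsub>M\<^esub> x) (w ` I)" by (intro exI[of _ ?c])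
qed

context
  fixes Q :: "'m::ab_group_add set" and act and n :: nat and b ph
  assumes D: "dual_basis Q act {..<n} b ph"
begin

lemma ent_deg: "i < n \<Longrightarrow> j < n \<Longrightarrow> ph j (b i) \<in> Rd 0"
  by (rule db_closed[OF D _ db_elem[OF D]])

lemma ent_carrier: "i < n \<Longrightarrow> j < n \<Longrightarrow> ph j (b i) \<in> RC"
  using deg_sub[OF ent_deg] .

lemma ptotI: "(\<And>j. j < n \<Longrightarrow> v j \<in> RC) \<Longrightarrow> (\<And>j. n \<le> j \<Longrightarrow> v j = 0) \<Longrightarrow>
    (\<And>j. j < n \<Longrightarrow> (\<Sum>i<n. v i \<otimes>\<^bsub>R\<^esub> ph j (b i)) = v j) \<Longrightarrow> v \<in> ptot n b ph"
  unfolding ptot_def using agrp_zero[OF R_agrp] by (auto, metis not_le)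

lemma ptot_closed: "v \<in> ptot n b ph \<Longrightarrow> v j \<in> RC"
  and ptot_beyond: "v \<in> ptot n b ph \<Longrightarrow> n \<le> j \<Longrightarrow> v j = 0"
  and ptot_eq: "v \<in> ptot n b ph \<Longrightarrow> j < n \<Longrightarrow> (\<Sum>i<n. v i \<otimes>\<^bsub>R\<^esub> ph j (b i)) = v j"
  by (auto simp: ptot_def)

lemma pcar_ptot: "v \<in> pcar n b ph d \<Longrightarrow> v \<in> ptot n b ph"
  by (intro ptotI) (auto simp: pcar_eq pcar_beyond intro: deg_sub pcar_closed)

lemma agrp_ptot: "agrp (ptot n b ph)"
  unfolding agrp_def
proof (intro conjI ballI)
  show "0 \<in> ptot n b ph" using pcar_ptot[OF agrp_zero[OF agrp_pcar[OF D]]] .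
next
  fix x y assume x: "x \<in> ptot n b ph" and y: "y \<in> ptot n b ph"
  show "x + y \<in> ptot n b ph"
    using x y by (intro ptotI) (auto simp: ptot_closed agrp_add[OF R_agrp] ptot_beyond
      R_distrib_left[OF ptot_closed[OF x] ptot_closed[OF y] ent_carrier] sum.distrib ptot_eq)
next
  fix x assume x: "x \<in> ptot n b ph"
  have m: "(- a) \<otimes>\<^bsub>R\<^esub> c = - (a \<otimes>\<^bsub>R\<^esub> c)" if "a \<in> RC" "c \<in> RC" for a c
    using R_distrib_left[OF that(1) agrp_minus[OF R_agrp that(1)] that(2)] that by (simp add: eq_neg_iff_add_eq_0 add.commute)
  show "- x \<in> ptot n b ph"
    using x by (intro ptotI) (auto simp: ptot_closed agrp_minus[OF R_agrp] ptot_beyond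
      m[OF ptot_closed[OF x] ent_carrier] sum_negf ptot_eq)
qed

lemma pact_ptot:
  assumes a: "a \<in> RC" and v: "v \<in> ptot n b ph"
  shows "pact a v \<in> ptot n b ph"
proof (rule ptotI)
  fix j assume j: "j < n"
  show "pact a v j \<in> RC" using a ptot_closed[OF v] by (simp add: pact_def)
  have "(\<Sum>i<n. pact a v i \<otimes>\<^bsub>R\<^esub> ph j (b i)) = (\<Sum>i<n. a \<otimes>\<^bsub>R\<^esub> (v i \<otimes>\<^bsub>R\<^esub> ph j (b i)))"
    using a ptot_closed[OF v] ent_carrier j by (intro sum.cong) (auto simp: pact_def R.m_assoc)
  also have "\<dots> = a \<otimes>\<^bsub>R\<^esub> (\<Sum>i<n. v i \<otimes>\<^bsub>R\<^esub> ph j (b i))"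
    using ptot_closed[OF v] ent_carrier j by (intro R_sum_right[OF a, symmetric]) auto
  finally show "(\<Sum>i<n. pact a v i \<otimes>\<^bsub>R\<^esub> ph j (b i)) = pact a v j" using ptot_eq[OF v j] by (simp add: pact_def)
next
  show "pact a v j = 0" if "n \<le> j" for j using ptot_beyond[OF v that] a by (simp add: pact_def)
qed

lemma prec_left_module: "left_module R (prec s n b ph)"
proof (intro left_module.intro left_module_axioms.intro ring_R)
  show "abelian_group (prec s n b ph)" by (rule agrp_abelian_group) (simp_all add: agrp_ptot)
  show "a \<odot>\<^bsub>prec s n b ph\<^esub> x \<in> carrier (prec s n b ph)" if "a \<in> RC" "x \<in> carrier (prec s n b ph)" for a x
    using that by (simp add: pact_ptot)
qed (auto simp: pact_ptot add_R pact_def fun_eq_iff R_distrib_left R_distrib_right ptot_closed R.m_assoc)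

lemma vcmp_pcar: "v \<in> ptot n b ph \<Longrightarrow> vcmp d v \<in> pcar n b ph d"
proof (rule pcarI)
  assume v: "v \<in> ptot n b ph"
  fix j assume j: "j < n"
  show "vcmp d v j \<in> Rd d" using cmp_closed[OF ptot_closed[OF v]] by (simp add: vcmp_def)
  have "vcmp d v j = cmp d (\<Sum>i<n. v i \<otimes>\<^bsub>R\<^esub> ph j (b i))" using ptot_eq[OF v j] by (simp add: vcmp_def)
  also have "\<dots> = (\<Sum>i<n. cmp d (v i \<otimes>\<^bsub>R\<^esub> ph j (b i)))"
    using ptot_closed[OF v] ent_carrier j by (intro additive_on_sum[OF R_agrp additive_cmp]) auto
  also have "\<dots> = (\<Sum>i<n. vcmp d v i \<otimes>\<^bsub>R\<^esub> ph j (b i))"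
    using cmp_mult_right[OF ptot_closed[OF v] ent_deg[OF _ j]] by (intro sum.cong) (auto simp: vcmp_def)
  finally show "(\<Sum>i<n. vcmp d v i \<otimes>\<^bsub>R\<^esub> ph j (b i)) = vcmp d v j" by simp
next
  fix j assume "v \<in> ptot n b ph" "n \<le> j"
  then show "vcmp d v j = 0" by (simp add: vcmp_def ptot_beyond cmp_zero)
qed

lemma vcmp_sum: "v \<in> ptot n b ph \<Longrightarrow> (\<Sum>d<top. vcmp d v) = v"
  using cmp_sum[OF ptot_closed] by (auto simp: fun_eq_iff sum_apply vcmp_def)

lemma vcmp_add: "v \<in> ptot n b ph \<Longrightarrow> w \<in> ptot n b ph \<Longrightarrow> vcmp d (v + w) = vcmp d v + vcmp d w"
  by (auto simp: vcmp_def fun_eq_iff cmp_add ptot_closed)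

lemma vcmp_homogeneous: "v \<in> pcar n b ph d \<Longrightarrow> vcmp e v = (if e = d then v else 0)"
  using cmp_deg[OF pcar_closed[of v n b ph d]] by (auto simp: vcmp_def fun_eq_iff)

context
  assumes Sm: "smod Q act"
begin

lemma row_pcar: "i < n \<Longrightarrow> (\<lambda>j. if j < n then ph j (b i) else 0) \<in> pcar n b ph 0"
proof -
  assume i: "i < n"
  have "(\<lambda>j. if j < n then \<one>\<^bsub>R\<^esub> \<otimes>\<^bsub>R\<^esub> ph j (b i) else 0) = (\<lambda>j. if j < n then ph j (b i) else 0)"
    using ent_carrier[OF i] by auto
  then show ?thesis using pcar_tensor[OF D db_elem[OF D i] Sm one_deg] by simp
qed

text \<open>The rows of the idempotent matrix, which represent the tensors of 1 with
  \<open>b i\<close>, generate the cover, the coordinates of \<open>v\<close> being the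
  coefficients. So rows and coordinate functionals form a dual basis of it.\<close>

lemma row_sum:
  assumes v: "v \<in> ptot n b ph"
  shows "(\<Sum>i<n. pact (v i) (\<lambda>j. if j < n then ph j (b i) else 0)) = v"
proof
  fix j
  show "(\<Sum>i<n. pact (v i) (\<lambda>j. if j < n then ph j (b i) else 0)) j = v j"
    using ptot_eq[OF v, of j] ptot_beyond[OF v, of j] ptot_closed[OF v]
    by (cases "j < n") (simp_all add: sum_apply pact_def)
qed

lemma prec_projective: "projective_module R (prec s n b ph)"
proof (rule projective_moduleI[OF prec_left_module, where I = "{..<n}" and b = "\<lambda>i j. if j < n then ph j (b i) else 0" and ph = "\<lambda>i v. v i"])
  fix v assume "v \<in> carrier (prec s n b ph)"
  then have v: "v \<in> ptot n b ph" by simp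
  have "finsum (prec s n b ph) (\<lambda>i. v i \<odot>\<^bsub>prec s n b ph\<^esub> (\<lambda>j. if j < n then ph j (b i) else 0)) {..<n} =
      (\<Sum>i<n. v i \<odot>\<^bsub>prec s n b ph\<^esub> (\<lambda>j. if j < n then ph j (b i) else 0))"
    using pact_ptot[OF ptot_closed[OF v] pcar_ptot[OF row_pcar]]
    by (intro finsum_eq_sum) (simp_all add: agrp_ptot)
  then show "finsum (prec s n b ph) (\<lambda>i. v i \<odot>\<^bsub>prec s n b ph\<^esub> (\<lambda>j. if j < n then ph j (b i) else 0)) {..<n} = v"
    using row_sum[OF v] by simp
qed (auto simp: pcar_ptot[OF row_pcar] ptot_closed add_R pact_def)

lemma prec_generated: "generated_in_degree R (prec s n b ph) (int s)"
  unfolding generated_in_degree_def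
proof
  let ?H = "{a \<odot>\<^bsub>prec s n b ph\<^esub> m |a m. a \<in> RC \<and> m \<in> mdeg (prec s n b ph) s}"
  have H: "?H \<subseteq> carrier (prec s n b ph)" using pact_ptot pcar_ptot by auto
  note g = agrp_generate[of "prec s n b ph", OF _ _ _ H]
  show "generate (add_monoid (prec s n b ph)) ?H \<subseteq> carrier (prec s n b ph)" by (rule g(2)) (simp_all add: agrp_ptot)
  show "carrier (prec s n b ph) \<subseteq> generate (add_monoid (prec s n b ph)) ?H"
  proof
    fix v assume "v \<in> carrier (prec s n b ph)"
    then have v: "v \<in> ptot n b ph" by simp
    have "pact (v i) (\<lambda>j. if j < n then ph j (b i) else 0) \<in> generate (add_monoid (prec s n b ph)) ?H" if "i < n" for i
      using row_pcar[OF that] ptot_closed[OF v] by (intro generate.incl) auto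
    then have "(\<Sum>i<n. pact (v i) (\<lambda>j. if j < n then ph j (b i) else 0)) \<in> generate (add_monoid (prec s n b ph)) ?H"
      by (intro agrp_sum[OF g(1)]) (simp_all add: agrp_ptot)
    then show "v \<in> generate (add_monoid (prec s n b ph)) ?H" using row_sum[OF v] by simp
  qed
qed

text \<open>A spanning family in each degree is given by the products of a finite spanning set of
  that degree of the ring with the rows.\<close>

lemma prec_finite_dim: "finite_dimensional_part R (prec s n b ph) (mdeg (prec s n b ph) k)"
proof (cases "s \<le> k")
  case False
  then have "mdeg (prec s n b ph) k = {0}" by simp
  moreover have "finsum (prec s n b ph) f {} = 0" for f :: "(nat \<Rightarrow> 'r) \<Rightarrow> nat \<Rightarrow> 'r"
    using finsum_eq_sum[of "prec s n b ph" "{}" f] by (simp add: agrp_ptot)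
  ultimately show ?thesis
    unfolding finite_dimensional_part_def by (intro exI[of _ "{}"]) simp
next
  case True
  define d where "d = nat (int k - int s)"
  have eq: "mdeg (prec s n b ph) k = pcar n b ph d" using True by (simp add: d_def)
  obtain U where U: "finite U" "U \<subseteq> Rd d"
    "\<forall>a\<in>Rd d. \<exists>c. a = (\<Sum>u\<in>U. scal (c u) \<otimes>\<^bsub>R\<^esub> u)" using fin_dim[of d] by (elim exE conjE)
  let ?row = "\<lambda>i j. if j < n then ph j (b i) else 0"
  let ?w = "\<lambda>(i, u). pact u (?row i)"
  show ?thesis unfolding eq
  proof (rule finite_dimensional_partI[OF prec_left_module, where I = "{..<n} \<times> U" and w = ?w])
    show "?w x \<in> pcar n b ph d" if "x \<in> {..<n} \<times> U" for x
      using that U(2) gm_closed[OF gm_pcar[OF D] _ row_pcar, of _ d] by auto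
    show "pcar n b ph d \<subseteq> carrier (prec s n b ph)" using pcar_ptot by auto
    fix v assume v: "v \<in> pcar n b ph d"
    have "\<forall>i. \<exists>c. v i = (\<Sum>u\<in>U. scal (c u) \<otimes>\<^bsub>R\<^esub> u)" using U(3)[rule_format, OF pcar_closed[OF v]] by (rule allI)
    then obtain c where c: "\<And>i. v i = (\<Sum>u\<in>U. scal (c i u) \<otimes>\<^bsub>R\<^esub> u)" by metis
    have uc: "u \<in> RC" if "u \<in> U" for u using that U(2) deg_sub by blast
    have "v = (\<Sum>i<n. pact (v i) (?row i))" using row_sum[OF pcar_ptot[OF v]] by simp
    also have "\<dots> = (\<Sum>i<n. \<Sum>u\<in>U. pact (scal (c i u)) (pact u (?row i)))"
    proof (rule sum.cong[OF refl], rule ext)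
      fix i j assume "i \<in> {..<n}"
      then have rc: "?row i j \<in> RC" using ent_carrier agrp_zero[OF R_agrp] by simp
      have "v i \<otimes>\<^bsub>R\<^esub> ?row i j = (\<Sum>u\<in>U. (scal (c i u) \<otimes>\<^bsub>R\<^esub> u) \<otimes>\<^bsub>R\<^esub> ?row i j)"
        unfolding c[of i] using scal_carrier uc by (intro R_sum_left[OF rc]) auto
      also have "\<dots> = (\<Sum>u\<in>U. scal (c i u) \<otimes>\<^bsub>R\<^esub> (u \<otimes>\<^bsub>R\<^esub> ?row i j))"
        by (intro sum.cong refl R.m_assoc scal_carrier uc rc)
      finally show "pact (v i) (?row i) j = (\<Sum>u\<in>U. pact (scal (c i u)) (pact u (?row i))) j"
        by (simp only: pact_def sum_apply)
    qed
    also have "\<dots> = (\<Sum>x\<in>{..<n} \<times> U. scal (case x of (i, u) \<Rightarrow> c i u) \<odot>\<^bsub>prec s n b ph\<^esub> ?w x)"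
      by (simp add: sum.cartesian_product case_prod_beta)
    finally show "\<exists>c. v = (\<Sum>x\<in>{..<n} \<times> U. scal (c x) \<odot>\<^bsub>prec s n b ph\<^esub> ?w x)" by blast
  qed (use U(1) in simp_all)
qed

lemma prec_graded: "graded_left_module R (prec s n b ph)"
proof (intro graded_left_module.intro graded_left_module_axioms.intro prec_left_module)
  let ?M = "prec s n b ph"
  have sub: "mdegree_part ?M k \<subseteq> carrier ?M" for k using pcar_ptot agrp_zero[OF agrp_ptot] by auto
  have ag: "agrp (mdegree_part ?M k)" for k using agrp_pcar[OF D] by (simp add: agrp_def)
  show "subgroup (mdegree_part ?M (int i)) (add_monoid ?M)" for i
  proof (rule iffD2[OF subgroup_iff_agrp ag])
    show "mdegree_part ?M (int i) \<subseteq> carrier ?M" by (rule sub)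
  qed (simp_all add: agrp_ptot)
  show "finite_dimensional_part R ?M (mdegree_part ?M (int i))" for i by (rule prec_finite_dim)
  show "a \<odot>\<^bsub>?M\<^esub> m \<in> mdegree_part ?M (int i + j)" if a: "a \<in> Rd i" and m: "m \<in> mdegree_part ?M j" for a i m j
  proof (cases "int s \<le> j")
    case True
    then have "nat (int i + j - int s) = i + nat (j - int s)" by simp
    then show ?thesis using True m gm_closed[OF gm_pcar[OF D] a, of m "nat (j - int s)"] by simp
  next
    case False
    then have "m = 0" using m by simp
    then have "a \<odot>\<^bsub>?M\<^esub> m = 0" using deg_sub[OF a] by (simp add: pact_def fun_eq_iff)
    then show ?thesis using agrp_zero[OF ag] by simp
  qed
  fix v assume "v \<in> carrier ?M"
  then have v: "v \<in> ptot n b ph" by simp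
  let ?c = "\<lambda>k. if int s \<le> k then vcmp (nat (k - int s)) v else 0"
  let ?Pr = "\<lambda>c. (\<forall>i. c i \<in> mdegree_part ?M i) \<and> finite {i. c i \<noteq> \<zero>\<^bsub>?M\<^esub>} \<and> v = finsum ?M c {i. c i \<noteq> \<zero>\<^bsub>?M\<^esub>}"
  have fe: "finsum ?M c F = sum c F" if "\<forall>i. c i \<in> mdegree_part ?M i" for c F
    using that sub by (intro finsum_eq_sum) (auto simp: agrp_ptot simp del: prec_simps(5))
  show "\<exists>!c. ?Pr c"
  proof (rule ex1I[of _ ?c])
    have cd: "\<forall>i. ?c i \<in> mdegree_part ?M i" using vcmp_pcar[OF v] by simp
    let ?F = "(\<lambda>d. int (s + d)) ` {..<top}"
    have subF: "{i. ?c i \<noteq> 0} \<subseteq> ?F"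
    proof
      fix k assume "k \<in> {i. ?c i \<noteq> 0}"
      then have k: "int s \<le> k" "vcmp (nat (k - int s)) v \<noteq> 0" by (auto split: if_splits)
      have "nat (k - int s) < top"
      proof (rule ccontr)
        assume "\<not> nat (k - int s) < top"
        then have "vcmp (nat (k - int s)) v = 0" using cmp_top[OF _ ptot_closed[OF v]] by (simp add: vcmp_def fun_eq_iff)
        then show False using k by blast
      qed
      then show "k \<in> ?F" using k(1) by (intro image_eqI[of _ _ "nat (k - int s)"]) (simp_all add: of_nat_add)
    qed
    have "v = (\<Sum>d<top. vcmp d v)" using vcmp_sum[OF v] by simp
    also have "\<dots> = sum ?c ?F" by (subst sum.reindex) (auto simp: inj_on_def of_nat_add)
    also have "\<dots> = sum ?c {i. ?c i \<noteq> 0}" using subF by (intro sum.mono_neutral_right) auto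
    finally have "v = finsum ?M ?c {i. ?c i \<noteq> 0}" unfolding fe[OF cd] .
    moreover have "finite {i. ?c i \<noteq> 0}" using subF finite_subset by blast
    ultimately show "?Pr ?c" using cd by simp
  next
    fix c assume "?Pr c"
    then have c: "\<forall>i. c i \<in> mdegree_part ?M i" and fin: "finite {i. c i \<noteq> 0}" and vs: "v = finsum ?M c {i. c i \<noteq> 0}" by auto
    have vs: "v = sum c {i. c i \<noteq> 0}" using vs unfolding fe[OF c] .
    have "c k = ?c k" for k
    proof (cases "int s \<le> k")
      case True
      have ct: "c i \<in> ptot n b ph" for i using c sub by auto
      have "vcmp (nat (k - int s)) v = (\<Sum>i\<in>{i. c i \<noteq> 0}. vcmp (nat (k - int s)) (c i))"
        unfolding vs by (rule additive_on_sum[OF agrp_ptot]) (use ct in \<open>auto simp: additive_on_def vcmp_add\<close>)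
      also have "\<dots> = (\<Sum>i\<in>{i. c i \<noteq> 0}. if i = k then c k else 0)"
      proof (rule sum.cong[OF refl])
        fix i assume i: "i \<in> {i. c i \<noteq> 0}"
        have si: "int s \<le> i"
        proof (rule ccontr)
          assume "\<not> int s \<le> i"
          then show False using c[rule_format, of i] i by simp
        qed
        have ci: "c i \<in> pcar n b ph (nat (i - int s))" using c[rule_format, of i] si by simp
        have "nat (k - int s) = nat (i - int s) \<longleftrightarrow> i = k" using True si by auto
        then show "vcmp (nat (k - int s)) (c i) = (if i = k then c k else 0)" using vcmp_homogeneous[OF ci, of "nat (k - int s)"] by auto
      qed
      also have "\<dots> = c k" using fin by simp
      finally show ?thesis using True by simp
    next
      case False then show ?thesis using c[rule_format, of k] by simp
    qed
    then show "c = ?c" by blast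
  qed
qed

end

end

text \<open>The differential of the resolution to be built. Its generators \<open>b'\<close> lie in
  degree 0 of the shifted syzygy, that is in degree 1 of the cover, so it raises the internal degree
  by one.\<close>

lemma additive_peval_ptot:
  assumes D: "dual_basis (N 0) act {..<n} b ph" and N: "gm N act"
    and D': "dual_basis (syz n b ph act 0) pact {..<n'} b' ph'" and v: "v \<in> ptot n' b' ph'" and w: "w \<in> ptot n' b' ph'"
  shows "peval n' b' pact (v + w) = peval n' b' pact v + peval n' b' pact w"
    and "a \<in> RC \<Longrightarrow> peval n' b' pact (pact a v) = pact a (peval n' b' pact v)"
    and "peval n' b' pact v \<in> ptot n b ph"
    and "vcmp e (peval n' b' pact v) = (case e of 0 \<Rightarrow> 0 | Suc d \<Rightarrow> peval n' b' pact (vcmp d v))"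
proof -
  note S' = gm_smod[OF gm_syz[OF N D], of 0]
  have b1: "b' j \<in> pcar n b ph (Suc 0)" if "j < n'" for j using db_elem[OF D' that] by (simp add: syz_def)
  have bd: "b' j l \<in> Rd (Suc 0)" if "j < n'" for j l using pcar_closed[OF b1[OF that]] .
  have bc: "b' j l \<in> RC" if "j < n'" for j l using deg_sub[OF bd[OF that]] .
  have vc: "v j \<in> RC" "w j \<in> RC" for j using ptot_closed[OF D' v] ptot_closed[OF D' w] by auto
  have pe: "peval n' b' pact x l = (\<Sum>j<n'. x j \<otimes>\<^bsub>R\<^esub> b' j l)" for x l by (simp add: peval_def sum_apply pact_def)
  show "peval n' b' pact (v + w) = peval n' b' pact v + peval n' b' pact w"
    using vc bc by (auto simp: fun_eq_iff pe sum.distrib[symmetric] R_distrib_left intro!: sum.cong)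
  show "peval n' b' pact (pact a v) = pact a (peval n' b' pact v)" if a: "a \<in> RC"
  proof
    fix l
    have "(\<Sum>j<n'. (a \<otimes>\<^bsub>R\<^esub> v j) \<otimes>\<^bsub>R\<^esub> b' j l) = (\<Sum>j<n'. a \<otimes>\<^bsub>R\<^esub> (v j \<otimes>\<^bsub>R\<^esub> b' j l))"
      using a vc bc by (intro sum.cong) (auto simp: R.m_assoc)
    also have "\<dots> = a \<otimes>\<^bsub>R\<^esub> (\<Sum>j<n'. v j \<otimes>\<^bsub>R\<^esub> b' j l)" using vc bc by (intro R_sum_right[OF a, symmetric]) auto
    finally show "peval n' b' pact (pact a v) l = pact a (peval n' b' pact v) l" unfolding pe pact_def .
  qed
  show "peval n' b' pact v \<in> ptot n b ph" unfolding peval_def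
    using pact_ptot[OF D vc(1) pcar_ptot[OF D b1]] by (intro agrp_sum[OF agrp_ptot[OF D]]) auto
  show "vcmp e (peval n' b' pact v) = (case e of 0 \<Rightarrow> 0 | Suc d \<Rightarrow> peval n' b' pact (vcmp d v))"
  proof
    fix l
    have "vcmp e (peval n' b' pact v) l = cmp e (\<Sum>j<n'. v j \<otimes>\<^bsub>R\<^esub> b' j l)" by (simp add: vcmp_def pe)
    also have "\<dots> = (\<Sum>j<n'. cmp e (v j \<otimes>\<^bsub>R\<^esub> b' j l))"
      using vc bc by (intro additive_on_sum[OF R_agrp additive_cmp]) auto
    also have "\<dots> = (\<Sum>j<n'. if Suc 0 \<le> e then cmp (e - Suc 0) (v j) \<otimes>\<^bsub>R\<^esub> b' j l else 0)"
      by (intro sum.cong refl cmp_mult_right vc bd) simp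
    also have "\<dots> = (case e of 0 \<Rightarrow> 0 | Suc d \<Rightarrow> peval n' b' pact (vcmp d v)) l"
      by (cases e) (simp_all add: pe vcmp_def)
    finally show "vcmp e (peval n' b' pact v) l = (case e of 0 \<Rightarrow> 0 | Suc d \<Rightarrow> peval n' b' pact (vcmp d v)) l" .
  qed
qed

text \<open>Kernel elements are treated component by component: the one of degree 0 vanishes by
  \<open>peval_inj0\<close>, the others lie in the syzygy, which is generated in degree 0 and hence
  reached by evaluation.\<close>

lemma syz_exact:
  assumes D: "dual_basis (N 0) act {..<n} b ph" and N: "gm N act"
    and D': "dual_basis (syz n b ph act 0) pact {..<n'} b' ph'" and G: "gen (syz n b ph act) pact"
  shows "peval n' b' pact ` ptot n' b' ph' = {v \<in> ptot n b ph. \<forall>d. peval n b act (vcmp d v) = 0}"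
proof (intro equalityI subsetI)
  note S = gm_syz[OF N D]
  note S0 = gm_smod[OF N, of 0] and S0' = gm_smod[OF S, of 0]
  note ad = additive_peval_ptot[OF D N D']
  have agr: "agrp (ptot n' b' ph')" by (rule agrp_ptot[OF D'])
  {
    fix x assume "x \<in> peval n' b' pact ` ptot n' b' ph'"
    then obtain v where v: "v \<in> ptot n' b' ph'" and x: "x = peval n' b' pact v" by blast
    have "peval n b act (vcmp e x) = 0" for e
    proof (cases e)
      case 0
      then have "vcmp e x = 0" using ad(4)[OF v v, of e] x by simp
      then show ?thesis
        using additive_on_zero[OF agrp_pcar[OF D] ghom_additive[OF peval_ghom[OF N D], of 0]] by simp
    next
      case (Suc d)
      have "peval n' b' pact (vcmp d v) \<in> syz n b ph act d"
        by (rule ghom_closed[OF peval_ghom[OF S D'] vcmp_pcar[OF D' v]])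
      then show ?thesis using ad(4)[OF v v, of e] x Suc by (simp add: syz_def)
    qed
    then show "x \<in> {v \<in> ptot n b ph. \<forall>d. peval n b act (vcmp d v) = 0}" using ad(3)[OF v v] x by simp
  }
  fix v assume "v \<in> {v \<in> ptot n b ph. \<forall>d. peval n b act (vcmp d v) = 0}"
  then have v: "v \<in> ptot n b ph" and z: "\<And>d. peval n b act (vcmp d v) = 0" by auto
  have v0: "vcmp 0 v = 0" by (rule peval_inj0[OF N D vcmp_pcar[OF D v] z])
  have "\<exists>w\<in>pcar n' b' ph' d. peval n' b' pact w = vcmp (Suc d) v" for d
    using vcmp_pcar[OF D v] z by (intro peval_surj[OF S G D']) (simp add: syz_def)
  then obtain w where w: "\<And>d. w d \<in> pcar n' b' ph' d" "\<And>d. peval n' b' pact (w d) = vcmp (Suc d) v" by metis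
  have wt: "w d \<in> ptot n' b' ph'" for d using pcar_ptot[OF D' w(1)] .
  \<comment> \<open>Adding the vanishing component of degree \<open>top\<close> lets the sum be
    shifted by one, to the components of degree \<open>Suc d\<close> for
    \<open>d < top\<close>.\<close>
  have "vcmp top v = 0" using cmp_top[OF _ ptot_closed[OF D v]] by (simp add: vcmp_def fun_eq_iff)
  then have "v = (\<Sum>d<Suc top. vcmp d v)" using vcmp_sum[OF D v] by simp
  also have "\<dots> = (\<Sum>d<top. vcmp (Suc d) v)" by (subst sum.lessThan_Suc_shift) (simp add: v0)
  also have "\<dots> = (\<Sum>d<top. peval n' b' pact (w d))" by (simp add: w(2))
  also have "\<dots> = peval n' b' pact (\<Sum>d<top. w d)"
    using wt ad(1) by (intro additive_on_sum[OF agr, symmetric]) (auto simp: additive_on_def)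
  finally have "v = peval n' b' pact (\<Sum>d<top. w d)" .
  moreover have "(\<Sum>d<top. w d) \<in> ptot n' b' ph'" using wt by (intro agrp_sum[OF agr])
  ultimately show "v \<in> peval n' b' pact ` ptot n' b' ph'" by (rule image_eqI)
qed

text \<open>The differential shifts components by one, so its kernel is homogeneous; this joins the
  description of the image in \<open>syz_exact\<close> to that of the kernel in a
  resolution.\<close>

lemma peval_kernel:
  assumes D: "dual_basis (N 0) act {..<n} b ph" and N: "gm N act"
    and D': "dual_basis (syz n b ph act 0) pact {..<n'} b' ph'" and v: "v \<in> ptot n' b' ph'"
  shows "peval n' b' pact v = 0 \<longleftrightarrow> (\<forall>d. peval n' b' pact (vcmp d v) = 0)"
proof
  note S = gm_syz[OF N D]
  note S0' = gm_smod[OF S, of 0]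
  note ad = additive_peval_ptot[OF D N D']
  {
    assume z: "peval n' b' pact v = 0"
    show "\<forall>d. peval n' b' pact (vcmp d v) = 0"
    proof
      fix d
      have "peval n' b' pact (vcmp d v) = vcmp (Suc d) (peval n' b' pact v)" using ad(4)[OF v v, of "Suc d"] by simp
      also have "\<dots> = 0" unfolding z by (simp add: vcmp_def cmp_zero fun_eq_iff)
      finally show "peval n' b' pact (vcmp d v) = 0" .
    qed
  }
  assume z: "\<forall>d. peval n' b' pact (vcmp d v) = 0"
  have "peval n' b' pact v = peval n' b' pact (\<Sum>d<top. vcmp d v)" using vcmp_sum[OF D' v] by simp
  also have "\<dots> = (\<Sum>d<top. peval n' b' pact (vcmp d v))"
    using ad(1) pcar_ptot[OF D' vcmp_pcar[OF D' v]]
    by (intro additive_on_sum[OF agrp_ptot[OF D']]) (auto simp: additive_on_def)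
  finally show "peval n' b' pact v = 0" using z by simp
qed

lemma model_inj:
  assumes M: "pos_module R M" and m: "model M h N act"
    and x: "x \<in> mdeg M d" and y: "y \<in> mdeg M d" and e: "h x = h y"
  shows "x = y"
proof -
  interpret M: pos_module R M by fact
  have c: "cover 0 M h N act" and hz: "\<And>d m. m \<in> mdeg M d \<Longrightarrow> h m = 0 \<Longrightarrow> m = \<zero>\<^bsub>M\<^esub>"
    using m by (auto simp: model_def)
  have my: "\<ominus>\<^bsub>M\<^esub> y \<in> mdeg M d"
    using subgroup.m_inv_closed[OF M.mdegree_subgroup y] by (simp add: a_inv_def)
  have hh: "h (u \<oplus>\<^bsub>M\<^esub> w) = h u + h w" if "u \<in> mdeg M d" "w \<in> mdeg M d" for u w
    using coverD(2)[OF c, of u d w] that by simp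
  have "h y + h (\<ominus>\<^bsub>M\<^esub> y) = 0"
    using hh[OF y my] M.M.r_neg[OF M.mdeg_sub[OF y]] cover_zero[OF M c] by simp
  then have "h (x \<oplus>\<^bsub>M\<^esub> \<ominus>\<^bsub>M\<^esub> y) = 0" using hh[OF x my] e by simp
  then have "x \<oplus>\<^bsub>M\<^esub> \<ominus>\<^bsub>M\<^esub> y = \<zero>\<^bsub>M\<^esub>" using hz[OF M.mdeg_add[OF x my]] by simp
  then show ?thesis using M.M.minus_unique[of x "\<ominus>\<^bsub>M\<^esub> y" y] M.mdeg_sub[OF x] M.mdeg_sub[OF y]
    by (simp add: M.M.r_neg M.M.l_neg)
qed

context
  fixes M :: "('r, 'q, 'z) gmodule_scheme" and h :: "'q \<Rightarrow> nat \<Rightarrow> 'r" and N act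
  assumes M: "pos_module R M" and m: "model M h N act" and K: "koszul N act"
begin

interpretation M: pos_module R M by (rule M)

text \<open>The augmentation has to reach \<open>M\<close> itself and not its model. It sends
  \<open>v\<close> to the combination of elements of \<open>M\<close> that correspond under
  \<open>h\<close> to the basis \<open>b\<close>; after \<open>h\<close> it becomes evaluation,
  which identifies its kernel.\<close>

lemma koszul_first_step:
  assumes D: "dual_basis (N 0) act {..<n} b ph"
  shows "\<exists>\<epsilon>\<in>graded_hom R (prec 0 n b ph) M. \<epsilon> ` carrier (prec 0 n b ph) = carrier M \<and>
    (\<forall>v\<in>ptot n b ph. \<epsilon> v = \<zero>\<^bsub>M\<^esub> \<longleftrightarrow> (\<forall>d. peval n b act (vcmp d v) = 0)) \<and> generated_in_degree R M 0"
proof -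
  note N = koszulD(1)[OF K] and GN = koszulD(2)[OF K]
  note S0 = gm_smod[OF N, of 0]
  have c: "cover 0 M h N act" and hz: "\<And>d m. m \<in> mdeg M d \<Longrightarrow> h m = 0 \<Longrightarrow> m = \<zero>\<^bsub>M\<^esub>"
    using m by (auto simp: model_def)
  have "\<forall>j\<in>{..<n}. \<exists>x\<in>mdeg M 0. h x = b j"
    using coverD(4)[OF c db_elem[OF D]] by simp
  then obtain x where x: "\<And>j. j < n \<Longrightarrow> x j \<in> mdeg M 0" "\<And>j. j < n \<Longrightarrow> h (x j) = b j" by (metis lessThan_iff)
  have xc: "x j \<in> carrier M" if "j < n" for j using M.mdeg_sub[OF x(1)[OF that]] .
  define \<epsilon> where "\<epsilon> v = finsum M (\<lambda>j. v j \<odot>\<^bsub>M\<^esub> x j) {..<n}" for v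
  have tc: "v j \<odot>\<^bsub>M\<^esub> x j \<in> carrier M" if "v \<in> ptot n b ph" "j < n" for v j
    by (rule M.smult_closed[OF ptot_closed[OF D that(1)] xc[OF that(2)]])
  have ec: "\<epsilon> v \<in> carrier M" if "v \<in> ptot n b ph" for v
    unfolding \<epsilon>_def using tc[OF that] by (intro M.M.finsum_closed) simp
  have eadd: "\<epsilon> (v + w) = \<epsilon> v \<oplus>\<^bsub>M\<^esub> \<epsilon> w" if v: "v \<in> ptot n b ph" and w: "w \<in> ptot n b ph" for v w
  proof -
    have "\<epsilon> (v + w) = finsum M (\<lambda>j. v j \<odot>\<^bsub>M\<^esub> x j \<oplus>\<^bsub>M\<^esub> w j \<odot>\<^bsub>M\<^esub> x j) {..<n}" unfolding \<epsilon>_def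
    proof (rule M.M.finsum_cong'[OF refl])
      show "(\<lambda>j. v j \<odot>\<^bsub>M\<^esub> x j \<oplus>\<^bsub>M\<^esub> w j \<odot>\<^bsub>M\<^esub> x j) \<in> {..<n} \<rightarrow> carrier M" using tc[OF v] tc[OF w] by simp
      show "(v + w) j \<odot>\<^bsub>M\<^esub> x j = v j \<odot>\<^bsub>M\<^esub> x j \<oplus>\<^bsub>M\<^esub> w j \<odot>\<^bsub>M\<^esub> x j" if "j \<in> {..<n}" for j
        using M.smult_l_distr[OF ptot_closed[OF D v] ptot_closed[OF D w] xc, of j] that by (simp add: add_R)
    qed
    also have "\<dots> = \<epsilon> v \<oplus>\<^bsub>M\<^esub> \<epsilon> w" unfolding \<epsilon>_def
      by (rule M.M.finsum_addf) (simp_all add: tc[OF v] tc[OF w])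
    finally show ?thesis .
  qed
  have esm: "\<epsilon> (pact a v) = a \<odot>\<^bsub>M\<^esub> \<epsilon> v" if a: "a \<in> RC" and v: "v \<in> ptot n b ph" for a v
  proof -
    have "\<epsilon> (pact a v) = finsum M (\<lambda>j. a \<odot>\<^bsub>M\<^esub> (v j \<odot>\<^bsub>M\<^esub> x j)) {..<n}" unfolding \<epsilon>_def
    proof (rule M.M.finsum_cong'[OF refl])
      show "(\<lambda>j. a \<odot>\<^bsub>M\<^esub> (v j \<odot>\<^bsub>M\<^esub> x j)) \<in> {..<n} \<rightarrow> carrier M" using M.smult_closed[OF a tc[OF v]] by simp
      show "pact a v j \<odot>\<^bsub>M\<^esub> x j = a \<odot>\<^bsub>M\<^esub> (v j \<odot>\<^bsub>M\<^esub> x j)" if "j \<in> {..<n}" for j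
        using M.smult_assoc1[OF a ptot_closed[OF D v] xc, of j] that by (simp add: pact_def)
    qed
    also have "\<dots> = a \<odot>\<^bsub>M\<^esub> \<epsilon> v" unfolding \<epsilon>_def by (rule M.smult_finsum_right[symmetric]) (simp_all add: a tc[OF v])
    finally show ?thesis .
  qed
  have td: "v j \<odot>\<^bsub>M\<^esub> x j \<in> mdeg M d" if "v \<in> pcar n b ph d" "j < n" for v d j
    using M.mdeg_smult[OF pcar_closed[OF that(1)] x(1)[OF that(2)]] by simp
  have ed: "\<epsilon> v \<in> mdeg M d" if "v \<in> pcar n b ph d" for v d
    unfolding \<epsilon>_def by (rule M.M.finsum_image_sum(2)[OF M.mdegree_subgroup, where f = "\<lambda>_. 0 :: int"]) (simp_all add: td[OF that])
  have eh: "h (\<epsilon> v) = peval n b act v" if v: "v \<in> pcar n b ph d" for v d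
  proof -
    have "h (\<epsilon> v) = (\<Sum>j<n. h (v j \<odot>\<^bsub>M\<^esub> x j))" unfolding \<epsilon>_def
      using coverD(2)[OF c, of _ d] td[OF v] by (intro M.M.finsum_image_sum(1)[OF M.mdegree_subgroup[of d]]) auto
    also have "\<dots> = (\<Sum>j<n. act (v j) (b j))"
      using coverD(3)[OF c pcar_closed[OF v], of _ 0] x by (intro sum.cong) auto
    finally show ?thesis by (simp add: peval_def)
  qed
  have ecmp: "M.mcomp (\<epsilon> v) d = \<epsilon> (vcmp d v)" if v: "v \<in> ptot n b ph" for v d
  proof -
    have "M.mcomp (\<epsilon> v) d = finsum M (\<lambda>j. M.mcomp (v j \<odot>\<^bsub>M\<^esub> x j) d) {..<n}" unfolding \<epsilon>_def
      by (rule M.M.finsum_hom[where f = "\<lambda>m. M.mcomp m d"])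
        (simp_all add: M.M.abelian_group_axioms M.mcomp_closed M.mcomp_add tc[OF v])
    also have "\<dots> = finsum M (\<lambda>j. vcmp d v j \<odot>\<^bsub>M\<^esub> x j) {..<n}"
    proof (rule M.M.finsum_cong'[OF refl])
      show "(\<lambda>j. vcmp d v j \<odot>\<^bsub>M\<^esub> x j) \<in> {..<n} \<rightarrow> carrier M"
        using tc[OF pcar_ptot[OF D vcmp_pcar[OF D v]]] by simp
      fix j assume "j \<in> {..<n}"
      then have j: "j < n" by simp
      note sd = smult_decomp[OF M.graded_left_module_axioms ptot_closed[OF D v] x(1)[OF j]]
      have "M.mcomp (v j \<odot>\<^bsub>M\<^esub> x j) = (\<lambda>i. if 0 \<le> i then cmp (i - 0) (v j) \<odot>\<^bsub>M\<^esub> x j else \<zero>\<^bsub>M\<^esub>)"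
        by (rule M.mcomp_unique[OF sd(2) _ sd(3) sd(1)]) simp_all
      then show "M.mcomp (v j \<odot>\<^bsub>M\<^esub> x j) d = vcmp d v j \<odot>\<^bsub>M\<^esub> x j" by (simp add: vcmp_def)
    qed
    finally show ?thesis by (simp add: \<epsilon>_def)
  qed
  have ker: "\<epsilon> v = \<zero>\<^bsub>M\<^esub> \<longleftrightarrow> (\<forall>d. peval n b act (vcmp d v) = 0)" if v: "v \<in> ptot n b ph" for v
  proof
    assume z: "\<epsilon> v = \<zero>\<^bsub>M\<^esub>"
    show "\<forall>d. peval n b act (vcmp d v) = 0"
    proof
      fix d
      have "\<epsilon> (vcmp d v) = \<zero>\<^bsub>M\<^esub>" using ecmp[OF v, of d] M.mcomp_homogeneous[OF M.mdeg_zero[of 0]] z by simp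
      then show "peval n b act (vcmp d v) = 0" using eh[OF vcmp_pcar[OF D v]] cover_zero[OF M c] by metis
    qed
  next
    assume "\<forall>d. peval n b act (vcmp d v) = 0"
    then have "M.mcomp (\<epsilon> v) d = \<zero>\<^bsub>M\<^esub>" for d
      using ecmp[OF v, of d] eh[OF vcmp_pcar[OF D v], of d] hz[OF ed[OF vcmp_pcar[OF D v]], of d] by simp
    then show "\<epsilon> v = \<zero>\<^bsub>M\<^esub>" using M.mcomp_sum[OF ec[OF v], of "{}"] by simp
  qed
  interpret P: left_module R "prec 0 n b ph" by (rule prec_left_module[OF D])
  have surj: "\<exists>v\<in>ptot n b ph. \<epsilon> v = y" if y: "y \<in> carrier M" for y
  proof -
    have "\<exists>v\<in>pcar n b ph d. \<epsilon> v = M.mcomp y d" for d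
    proof -
      have yd: "M.mcomp y d \<in> mdeg M d" by (rule M.mcomp_spec[OF y])
      then obtain v where v: "v \<in> pcar n b ph d" "peval n b act v = h (M.mcomp y d)"
        using peval_surj[OF N GN D] coverD(1)[OF c, of "M.mcomp y d" d] by force
      then have "\<epsilon> v = M.mcomp y d" using model_inj[OF M m ed[OF v(1)] yd] eh[OF v(1)] by simp
      then show ?thesis using v(1) by blast
    qed
    then obtain v where v: "\<And>d. v d \<in> pcar n b ph d" "\<And>d. \<epsilon> (v d) = M.mcomp y d" by metis
    have vt: "v d \<in> ptot n b ph" for d using pcar_ptot[OF D v(1)] .
    let ?F = "{d. M.mcomp y d \<noteq> \<zero>\<^bsub>M\<^esub>}"
    have "\<epsilon> (finsum (prec 0 n b ph) v ?F) = finsum M (\<lambda>d. \<epsilon> (v d)) ?F"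
    proof (rule P.M.finsum_hom[OF M.M.abelian_group_axioms])
      show "\<epsilon> (u \<oplus>\<^bsub>prec 0 n b ph\<^esub> w) = \<epsilon> u \<oplus>\<^bsub>M\<^esub> \<epsilon> w"
        if "u \<in> carrier (prec 0 n b ph)" "w \<in> carrier (prec 0 n b ph)" for u w
        using eadd[of u w] that unfolding prec_simps .
    qed (simp_all add: ec vt)
    also have "\<dots> = y" using M.mcomp_sum[OF y M.finite_mcomp[OF y]] by (simp add: v(2))
    finally have "\<epsilon> (finsum (prec 0 n b ph) v ?F) = y" .
    moreover have "finsum (prec 0 n b ph) v ?F \<in> carrier (prec 0 n b ph)" using vt by (intro P.M.finsum_closed) simp
    ultimately show ?thesis by auto
  qed
  have "\<epsilon> \<in> graded_hom R (prec 0 n b ph) M"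
    unfolding graded_hom_def lmod_hom_def
  proof (intro CollectI conjI ballI allI Pi_I subsetI)
    fix i y assume "y \<in> \<epsilon> ` mdegree_part (prec 0 n b ph) i"
    then obtain v where v: "v \<in> mdegree_part (prec 0 n b ph) i" "y = \<epsilon> v" by blast
    show "y \<in> mdegree_part M i"
    proof (cases "0 \<le> i")
      case True then show ?thesis using v ed[of v "nat i"] by simp
    next
      case False
      then have "v = 0" using v by simp
      then have "y = \<zero>\<^bsub>M\<^esub>" using v(2) eadd[OF agrp_zero[OF agrp_ptot[OF D]] agrp_zero[OF agrp_ptot[OF D]]] ec[OF agrp_zero[OF agrp_ptot[OF D]]]
        by (simp add: M.M.add.l_cancel_one)
      then show ?thesis by (simp add: M.mdeg_zero_int)
    qed
  qed (simp_all add: ec eadd esm)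
  moreover have "\<epsilon> ` carrier (prec 0 n b ph) = carrier M" using surj ec by (auto simp: image_iff)
  moreover have "generated_in_degree R M 0"
    unfolding generated_in_degree_def
  proof
    let ?H = "{a \<odot>\<^bsub>M\<^esub> m |a m. a \<in> RC \<and> m \<in> mdegree_part M 0}"
    have H: "?H \<subseteq> carrier (add_monoid M)" using M.smult_closed M.mdeg_sub[of _ 0] by auto
    have sg: "subgroup (generate (add_monoid M) ?H) (add_monoid M)" by (rule group.generate_is_subgroup[OF M.M.a_group H])
    show "generate (add_monoid M) ?H \<subseteq> carrier M" using subgroup.subset[OF sg] by simp
    show "carrier M \<subseteq> generate (add_monoid M) ?H"
    proof
      fix y assume "y \<in> carrier M"
      then obtain v where v: "v \<in> ptot n b ph" "\<epsilon> v = y" using surj by blast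
      have "v j \<odot>\<^bsub>M\<^esub> x j \<in> generate (add_monoid M) ?H" if "j < n" for j
        using ptot_closed[OF D v(1)] x(1)[OF that] by (intro generate.incl) auto
      then have "\<epsilon> v \<in> generate (add_monoid M) ?H" unfolding \<epsilon>_def
        by (intro M.M.finsum_image_sum(2)[OF sg, where f = "\<lambda>_. 0 :: int"]) simp_all
      then show "y \<in> generate (add_monoid M) ?H" using v(2) by simp
    qed
  qed
  ultimately show ?thesis using ker by (intro bexI[of _ \<epsilon>]) auto
qed

text \<open>The resolution consists of the covers of the iterated syzygies. At each step a dual
  basis is chosen, and the next module depends on that choice, hence dependent choice on tuples of
  module, action, size, basis and functionals.\<close>

lemma koszul_module_of_model: "koszul_module R M"
proof -
  define ok where "ok x \<longleftrightarrow> koszul (fst x) (fst (snd x)) \<and>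
    dual_basis (fst x 0) (fst (snd x)) {..<fst (snd (snd x)) :: nat} (fst (snd (snd (snd x)))) (snd (snd (snd (snd x))))" for x
  define nx where "nx x = syz (fst (snd (snd x))) (fst (snd (snd (snd x)))) (snd (snd (snd (snd x)))) (fst (snd x))"
    for x :: "(nat \<Rightarrow> (nat \<Rightarrow> 'r) set) \<times> ('r \<Rightarrow> (nat \<Rightarrow> 'r) \<Rightarrow> nat \<Rightarrow> 'r) \<times> nat \<times> (nat \<Rightarrow> nat \<Rightarrow> 'r) \<times> (nat \<Rightarrow> (nat \<Rightarrow> 'r) \<Rightarrow> 'r)"
  have ext: "\<exists>y. ok y \<and> fst y = N' \<and> fst (snd y) = act'" if K': "koszul N' act'" for N' act'
  proof -
    obtain n :: nat and b ph where "dual_basis (N' 0) act' {..<n} b ph" using koszulD(3)[OF K'] by (auto simp: sproj_def)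
    then show ?thesis using K' by (intro exI[of _ "(N', act', n, b, ph)"]) (simp add: ok_def)
  qed
  \<comment> \<open>The initial condition is built into the invariant for \<open>i = 0\<close>,
    because the rule for dependent choice does not fix the starting value.\<close>
  have "\<exists>f. \<forall>i. (ok (f i) \<and> (i = 0 \<longrightarrow> fst (f i) = N \<and> fst (snd (f i)) = act)) \<and>
      (fst (f (Suc i)) = nx (f i) \<and> fst (snd (f (Suc i))) = pact)"
  proof (rule dependent_nat_choice)
    show "\<exists>x. ok x \<and> (0 = 0 \<longrightarrow> fst x = N \<and> fst (snd x) = act)" using ext[OF K] by simp
    fix x and i :: nat assume "ok x \<and> (i = 0 \<longrightarrow> fst x = N \<and> fst (snd x) = act)"
    then have "koszul (nx x) pact" unfolding nx_def ok_def
      using koszulD(4)[of "fst x" "fst (snd x)" "fst (snd (snd x))" "fst (snd (snd (snd x)))" "snd (snd (snd (snd x)))"] by blast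
    then show "\<exists>y. (ok y \<and> (Suc i = 0 \<longrightarrow> fst y = N \<and> fst (snd y) = act)) \<and> fst y = nx x \<and> fst (snd y) = pact"
      using ext by simp
  qed
  then obtain f where f: "\<And>i. ok (f i)" "fst (f 0) = N" "fst (snd (f 0)) = act"
    "\<And>i. fst (f (Suc i)) = nx (f i)" "\<And>i. fst (snd (f (Suc i))) = pact" by auto
  define Ns acts ns bs phs where "Ns i = fst (f i)" and "acts i = fst (snd (f i))" and "ns i = fst (snd (snd (f i)))"
    and "bs i = fst (snd (snd (snd (f i))))" and "phs i = snd (snd (snd (snd (f i))))" for i
  note defs = Ns_def acts_def ns_def bs_def phs_def
  have Ks: "koszul (Ns i) (acts i)" and D: "dual_basis (Ns i 0) (acts i) {..<ns i} (bs i) (phs i)" for i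
    using f(1)[of i] unfolding ok_def defs by blast+
  have N0: "Ns 0 = N" "acts 0 = act" using f(2,3) by (simp_all add: defs)
  have NS: "Ns (Suc i) = syz (ns i) (bs i) (phs i) (acts i)" "acts (Suc i) = pact" for i
    using f(4,5)[of i] by (simp_all add: defs nx_def)
  note Ng = koszulD(1)[OF Ks] and Nn = koszulD(2)[OF Ks]
  define P where "P i = prec i (ns i) (bs i) (phs i)" for i
  define d where "d i = peval (ns (Suc i)) (bs (Suc i)) pact" for i
  have Sm: "smod (Ns i 0) (acts i)" for i by (rule gm_smod[OF Ng])
  have D': "dual_basis (syz (ns i) (bs i) (phs i) (acts i) 0) pact {..<ns (Suc i)} (bs (Suc i)) (phs (Suc i))" for i
    using D[of "Suc i"] by (simp add: NS)
  have G': "gen (syz (ns i) (bs i) (phs i) (acts i)) pact" for i using Nn[of "Suc i"] by (simp add: NS)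
  note ad = additive_peval_ptot[OF D Ng D']
  obtain \<epsilon> where e: "\<epsilon> \<in> graded_hom R (P 0) M" "\<epsilon> ` carrier (P 0) = carrier M" "generated_in_degree R M 0"
    "\<forall>v\<in>ptot (ns 0) (bs 0) (phs 0). \<epsilon> v = \<zero>\<^bsub>M\<^esub> \<longleftrightarrow> (\<forall>d. peval (ns 0) (bs 0) act (vcmp d v) = 0)"
    using koszul_first_step[of "ns 0" "bs 0" "phs 0"] D[of 0] unfolding N0 P_def by blast
  have img: "d i ` carrier (P (Suc i)) = {v \<in> ptot (ns i) (bs i) (phs i). \<forall>e. peval (ns i) (bs i) (acts i) (vcmp e v) = 0}" for i
    unfolding d_def P_def using syz_exact[OF D Ng D' G'] by simp
  have "linear_projective_resolution R M P d \<epsilon>"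
    unfolding linear_projective_resolution_def
  proof (intro conjI allI)
    fix i
    show "graded_left_module R (P i)" unfolding P_def by (rule prec_graded[OF D Sm])
    show "projective_module R (P i)" unfolding P_def by (rule prec_projective[OF D Sm])
    show "generated_in_degree R (P i) (int i)" unfolding P_def by (rule prec_generated[OF D Sm])
    show "d i \<in> graded_hom R (P (Suc i)) (P i)"
      unfolding graded_hom_def lmod_hom_def
    proof (intro CollectI conjI ballI allI Pi_I subsetI)
      fix k y assume "y \<in> d i ` mdegree_part (P (Suc i)) k"
      then obtain v where v: "v \<in> mdegree_part (P (Suc i)) k" "y = d i v" by blast
      have gh: "ghom (pcar (ns (Suc i)) (bs (Suc i)) (phs (Suc i))) pact (syz (ns i) (bs i) (phs i) (acts i)) pact (d i)"
        using peval_ghom[OF Ng[of "Suc i"] D] by (simp add: NS d_def)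
      show "y \<in> mdegree_part (P i) k"
      proof (cases "int (Suc i) \<le> k")
        case True
        then have "y \<in> syz (ns i) (bs i) (phs i) (acts i) (nat (k - int (Suc i)))"
          using v ghom_closed[OF gh, of v] by (simp add: P_def)
        moreover have "Suc (nat (k - int (Suc i))) = nat (k - int i)" using True by simp
        ultimately show ?thesis using True by (simp add: P_def syz_def)
      next
        case False
        then have "v = 0" using v by (simp add: P_def)
        then have "y = 0" using v(2) additive_on_zero[OF agrp_pcar[OF D] ghom_additive[OF gh, of 0]] by simp
        then show ?thesis using agrp_zero[OF agrp_pcar[OF D[of i]]] by (simp add: P_def)
      qed
    next
      show "d i x \<in> carrier (P i)" if "x \<in> carrier (P (Suc i))" for x
        using ad(3)[of x] that by (simp add: P_def d_def)
      show "d i (x \<oplus>\<^bsub>P (Suc i)\<^esub> y) = d i x \<oplus>\<^bsub>P i\<^esub> d i y" if "x \<in> carrier (P (Suc i))" "y \<in> carrier (P (Suc i))" for x y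
        using ad(1)[of x i y] that by (simp add: P_def d_def)
      show "d i (a \<odot>\<^bsub>P (Suc i)\<^esub> x) = a \<odot>\<^bsub>P i\<^esub> d i x" if "a \<in> RC" "x \<in> carrier (P (Suc i))" for a x
        using ad(2)[of x i x a] that by (simp add: P_def d_def)
    qed
    show "d (Suc i) ` carrier (P (Suc (Suc i))) = a_kernel (P (Suc i)) (P i) (d i)"
      unfolding img using peval_kernel[OF D Ng D'] by (auto simp: a_kernel_def' NS P_def d_def)
  next
    show "d 0 ` carrier (P 1) = a_kernel (P 0) M \<epsilon>"
      using img[of 0] e(4) by (auto simp: a_kernel_def' N0 P_def)
  qed (use e in auto)
  then show ?thesis unfolding koszul_module_def using M.graded_left_module_axioms e(3) by blast
qed

end

section \<open>Models of modules\<close>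

lemma scal_zero: "scal 0 = 0"
  using scal_add[of 0 0] by simp

text \<open>A spanning set of least cardinality is independent, so coefficients are additive. They
  are recorded as ring elements \<open>scal c\<close>; uniqueness is claimed for these and not for
  \<open>c\<close>, as \<open>scal\<close> is not injective when the algebra is zero.\<close>

lemma finite_dim_coordinates:
  fixes M :: "('r, 'm, 'y) module_scheme"
  assumes M: "left_module R M" and V: "finite_dimensional_part R M V" "V \<subseteq> carrier M"
    and Va: "\<And>x y. x \<in> V \<Longrightarrow> y \<in> V \<Longrightarrow> x \<oplus>\<^bsub>M\<^esub> y \<in> V"
  shows "\<exists>\<chi> :: 'm \<Rightarrow> nat \<Rightarrow> 'r. (\<forall>x\<in>V. \<forall>y\<in>V. \<chi> (x \<oplus>\<^bsub>M\<^esub> y) = \<chi> x + \<chi> y) \<and> (\<forall>x\<in>V. \<chi> x = 0 \<longrightarrow> x = \<zero>\<^bsub>M\<^esub>)"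
proof -
  interpret M: left_module R M by fact
  define lc where "lc B c = finsum M (\<lambda>b. scal (c b) \<odot>\<^bsub>M\<^esub> b) B" for B and c :: "'m \<Rightarrow> 'k"
  define sp where "sp B \<longleftrightarrow> finite B \<and> B \<subseteq> V \<and> (\<forall>v\<in>V. \<exists>c. v = lc B c)" for B
  have "\<exists>B. sp B" using V(1) by (simp add: finite_dimensional_part_def sp_def lc_def)
  then obtain B where B: "sp B" and min: "\<And>B'. sp B' \<Longrightarrow> card B \<le> card B'"
    using ex_has_least_nat[of sp _ card] by blast
  have fB: "finite B" and BV: "B \<subseteq> V" and span: "\<And>v. v \<in> V \<Longrightarrow> \<exists>c. v = lc B c" using B by (auto simp: sp_def)
  have bc: "b \<in> carrier M" if "b \<in> B" for b using that BV V(2) by blast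
  have tc: "scal t \<odot>\<^bsub>M\<^esub> b \<in> carrier M" if "b \<in> B" for t b by (rule M.smult_closed[OF scal_carrier bc[OF that]])
  have lcc: "lc B c \<in> carrier M" for c unfolding lc_def using tc by (intro M.M.finsum_closed) simp
  have lin: "lc B (\<lambda>b. c b + t * e b) = lc B c \<oplus>\<^bsub>M\<^esub> scal t \<odot>\<^bsub>M\<^esub> lc B e" for c e t
  proof -
    have "lc B (\<lambda>b. c b + t * e b) =
        finsum M (\<lambda>b. scal (c b) \<odot>\<^bsub>M\<^esub> b \<oplus>\<^bsub>M\<^esub> scal t \<odot>\<^bsub>M\<^esub> (scal (e b) \<odot>\<^bsub>M\<^esub> b)) B"
      unfolding lc_def
    proof (rule M.M.finsum_cong'[OF refl])
      show "(\<lambda>b. scal (c b) \<odot>\<^bsub>M\<^esub> b \<oplus>\<^bsub>M\<^esub> scal t \<odot>\<^bsub>M\<^esub> (scal (e b) \<odot>\<^bsub>M\<^esub> b)) \<in> B \<rightarrow> carrier M"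
        using tc M.smult_closed[OF scal_carrier tc] by simp
      show "scal (c b + t * e b) \<odot>\<^bsub>M\<^esub> b =
          scal (c b) \<odot>\<^bsub>M\<^esub> b \<oplus>\<^bsub>M\<^esub> scal t \<odot>\<^bsub>M\<^esub> (scal (e b) \<odot>\<^bsub>M\<^esub> b)" if "b \<in> B" for b
        using M.smult_l_distr[OF scal_carrier scal_carrier bc[OF that], of "c b" "t * e b"]
          M.smult_assoc1[OF scal_carrier scal_carrier bc[OF that], of t "e b"]
        by (simp add: scal_add scal_mult add_R)
    qed
    also have "\<dots> = lc B c \<oplus>\<^bsub>M\<^esub> finsum M (\<lambda>b. scal t \<odot>\<^bsub>M\<^esub> (scal (e b) \<odot>\<^bsub>M\<^esub> b)) B"
      unfolding lc_def using tc M.smult_closed[OF scal_carrier tc] by (intro M.M.finsum_addf) simp_all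
    also have "\<dots> = lc B c \<oplus>\<^bsub>M\<^esub> scal t \<odot>\<^bsub>M\<^esub> lc B e"
      unfolding lc_def by (subst M.smult_finsum_right[OF scal_carrier]) (simp_all add: tc)
    finally show ?thesis .
  qed
  have uniq: "scal (c b) = scal (c' b)" if e: "lc B c = lc B c'" and b0: "b \<in> B" for c c' b
  proof (rule ccontr)
    assume ne: "scal (c b) \<noteq> scal (c' b)"
    define \<delta> where "\<delta> x = c x - c' x" for x
    have d0: "\<delta> b \<noteq> 0" using ne by (auto simp: \<delta>_def)
    have "lc B c = lc B c' \<oplus>\<^bsub>M\<^esub> scal 1 \<odot>\<^bsub>M\<^esub> lc B \<delta>" using lin[of c' 1 \<delta>] by (simp add: \<delta>_def)
    then have dz: "lc B \<delta> = \<zero>\<^bsub>M\<^esub>"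
      using e M.smult_one[OF lcc] M.M.add.l_cancel_one'[OF lcc lcc] by (simp add: scal_one)
    have "sp (B - {b})"
      unfolding sp_def
    proof (intro conjI ballI)
      fix v assume "v \<in> V"
      then obtain a where a: "v = lc B a" using span by blast
      \<comment> \<open>Exchange: subtracting a multiple of the relation \<open>\<delta>\<close>
        kills the coefficient at \<open>b\<close>, so \<open>b\<close> could be left out of the
        spanning set.\<close>
      let ?a = "\<lambda>x. a x + (- (a b / \<delta> b)) * \<delta> x"
      have "v = lc B ?a"
        using lin[of a "- (a b / \<delta> b)" \<delta>] dz M.smult_zero_right[OF scal_carrier] a lcc by simp
      also have "\<dots> = lc (B - {b}) ?a"
      proof -
        have "?a b = 0" using d0 by simp
        then have "scal (?a b) \<odot>\<^bsub>M\<^esub> b = \<zero>\<^bsub>M\<^esub>"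
          using M.smult_zero_left[OF bc[OF b0]] by (simp only: scal_zero zero_R)
        then show ?thesis unfolding lc_def
          using tc fB by (intro M.M.add.finprod_mono_neutral_cong_right) auto
      qed
      finally show "\<exists>c. v = lc (B - {b}) c" by blast
    qed (use fB BV in auto)
    then have "card B \<le> card (B - {b})" by (rule min)
    then show False using b0 fB by (metis card_Diff1_less not_le)
  qed
  define cf where "cf v = (SOME c. v = lc B c)" for v
  have cf: "v = lc B (cf v)" if "v \<in> V" for v unfolding cf_def by (rule someI_ex[OF span[OF that]])
  obtain g where g: "bij_betw g {..<card B} B"
    using ex_bij_betw_nat_finite[OF fB] by (auto simp: lessThan_atLeast0)
  have gB: "g j \<in> B" if "j < card B" for j using g that by (auto simp: bij_betw_def)
  define \<chi> where "\<chi> v j = (if j < card B then scal (cf v (g j)) else 0)" for v and j :: nat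
  have "\<chi> (x \<oplus>\<^bsub>M\<^esub> y) = \<chi> x + \<chi> y" if x: "x \<in> V" and y: "y \<in> V" for x y
  proof
    fix j
    have yc: "y \<in> carrier M" using y V(2) by blast
    have "lc B (cf (x \<oplus>\<^bsub>M\<^esub> y)) = x \<oplus>\<^bsub>M\<^esub> y" by (rule cf[OF Va[OF x y], symmetric])
    also have "\<dots> = lc B (cf x) \<oplus>\<^bsub>M\<^esub> scal 1 \<odot>\<^bsub>M\<^esub> lc B (cf y)"
      using cf[OF x] cf[OF y] M.smult_one[OF yc] by (simp add: scal_one)
    also have "\<dots> = lc B (\<lambda>b. cf x b + 1 * cf y b)" by (rule lin[symmetric])
    finally have e: "lc B (cf (x \<oplus>\<^bsub>M\<^esub> y)) = lc B (\<lambda>b. cf x b + 1 * cf y b)" .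
    show "\<chi> (x \<oplus>\<^bsub>M\<^esub> y) j = (\<chi> x + \<chi> y) j"
    proof (cases "j < card B")
      case True
      have "scal (cf (x \<oplus>\<^bsub>M\<^esub> y) (g j)) = scal (cf x (g j) + 1 * cf y (g j))"
        by (rule uniq[OF e gB[OF True]])
      then show ?thesis using True by (simp add: \<chi>_def scal_add)
    qed (simp add: \<chi>_def)
  qed
  moreover have "x = \<zero>\<^bsub>M\<^esub>" if x: "x \<in> V" and z: "\<chi> x = 0" for x
  proof -
    have "scal (cf x b) \<odot>\<^bsub>M\<^esub> b = \<zero>\<^bsub>M\<^esub>" if b: "b \<in> B" for b
    proof -
      obtain j where j: "j < card B" "b = g j" using g b by (auto simp: bij_betw_def)
      have "\<chi> x j = 0" using z by simp
      then have "scal (cf x b) = 0" using j by (simp add: \<chi>_def)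
      then show ?thesis using M.smult_zero_left[OF bc[OF b]] by (simp add: zero_R)
    qed
    then have "lc B (cf x) = \<zero>\<^bsub>M\<^esub>" unfolding lc_def by (intro M.M.add.finprod_one_eqI) simp
    then show ?thesis by (rule trans[OF cf[OF x]])
  qed
  ultimately show ?thesis by blast
qed

text \<open>The coordinates of the components of different degrees are put into disjoint blocks, so that the
  action on the image does not depend on the degree.\<close>

lemma model_exists:
  fixes M :: "('r, 'm, 'y) gmodule_scheme"
  assumes M: "pos_module R M"
  shows "\<exists>(h :: 'm \<Rightarrow> nat \<Rightarrow> 'r) N act. model M h N act \<and> gm N act"
proof -
  interpret M: pos_module R M by fact
  have "\<forall>d. \<exists>\<chi> :: 'm \<Rightarrow> nat \<Rightarrow> 'r. (\<forall>x\<in>mdeg M d. \<forall>y\<in>mdeg M d. \<chi> (x \<oplus>\<^bsub>M\<^esub> y) = \<chi> x + \<chi> y) \<and>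
      (\<forall>x\<in>mdeg M d. \<chi> x = 0 \<longrightarrow> x = \<zero>\<^bsub>M\<^esub>)"
    using finite_dim_coordinates[OF M.left_module_axioms M.locally_finite] M.mdeg_sub M.mdeg_add by blast
  then obtain \<chi> :: "nat \<Rightarrow> 'm \<Rightarrow> nat \<Rightarrow> 'r" where
    \<chi>: "\<forall>d. (\<forall>x\<in>mdeg M d. \<forall>y\<in>mdeg M d. \<chi> d (x \<oplus>\<^bsub>M\<^esub> y) = \<chi> d x + \<chi> d y) \<and>
      (\<forall>x\<in>mdeg M d. \<chi> d x = 0 \<longrightarrow> x = \<zero>\<^bsub>M\<^esub>)"
    by (rule choice[THEN exE])
  have \<chi>a: "\<chi> d (x \<oplus>\<^bsub>M\<^esub> y) = \<chi> d x + \<chi> d y" if "x \<in> mdeg M d" "y \<in> mdeg M d" for d x y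
    using \<chi> that by blast
  have \<chi>i: "x = \<zero>\<^bsub>M\<^esub>" if "x \<in> mdeg M d" "\<chi> d x = 0" for d x using \<chi> that by blast
  have \<chi>0: "\<chi> d \<zero>\<^bsub>M\<^esub> = 0" for d using \<chi>a[OF M.mdeg_zero[of d] M.mdeg_zero[of d]] by simp
  \<comment> \<open>Position \<open>(e, i)\<close> holds coordinate \<open>i\<close> of the
    component of degree \<open>e\<close>.\<close>
  define h :: "'m \<Rightarrow> nat \<Rightarrow> 'r" where "h x = (\<lambda>j. \<chi> (fst (prod_decode j)) (M.mcomp x (fst (prod_decode j))) (snd (prod_decode j)))" for x
  have h: "h x (prod_encode (e, i)) = (if e = d then \<chi> d x i else 0)" if "x \<in> mdeg M d" for x d e i
    using M.mcomp_homogeneous[OF that] \<chi>0 by (simp add: h_def)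
  have h': "h x j = (if fst (prod_decode j) = d then \<chi> d x (snd (prod_decode j)) else 0)" if "x \<in> mdeg M d" for x d j
    using M.mcomp_homogeneous[OF that] \<chi>0 by (simp add: h_def)
  have hadd: "h (x \<oplus>\<^bsub>M\<^esub> y) = h x + h y" if "x \<in> mdeg M d" "y \<in> mdeg M d" for x y d
    using h'[OF M.mdeg_add[OF that]] h'[OF that(1)] h'[OF that(2)] \<chi>a[OF that] by (auto simp: fun_eq_iff)
  have hz: "x = \<zero>\<^bsub>M\<^esub>" if "x \<in> mdeg M d" "h x = 0" for x d
  proof (rule \<chi>i[OF that(1)], rule ext)
    fix i show "\<chi> d x i = 0 i" using h[OF that(1), of d i] that(2) by simp
  qed
  have h0: "h \<zero>\<^bsub>M\<^esub> = 0" using hadd[OF M.mdeg_zero[of 0] M.mdeg_zero[of 0]] by simp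
  have same: "x = y" if x: "x \<in> mdeg M d" and y: "y \<in> mdeg M d" and e: "h x = h y" for x y d
  proof -
    have my: "\<ominus>\<^bsub>M\<^esub> y \<in> mdeg M d"
      using subgroup.m_inv_closed[OF M.mdegree_subgroup y] by (simp add: a_inv_def)
    have "h y + h (\<ominus>\<^bsub>M\<^esub> y) = 0" using hadd[OF y my] M.M.r_neg[OF M.mdeg_sub[OF y]] h0 by simp
    then have "h (x \<oplus>\<^bsub>M\<^esub> \<ominus>\<^bsub>M\<^esub> y) = 0" using hadd[OF x my] e by simp
    then have "x \<oplus>\<^bsub>M\<^esub> \<ominus>\<^bsub>M\<^esub> y = \<zero>\<^bsub>M\<^esub>" using hz[OF M.mdeg_add[OF x my]] by simp
    then show ?thesis using M.M.minus_unique[of x "\<ominus>\<^bsub>M\<^esub> y" y] M.mdeg_sub[OF x] M.mdeg_sub[OF y]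
      by (simp add: M.M.r_neg M.M.l_neg)
  qed
  \<comment> \<open>The only vector shared by two different degrees is zero. Hence \<open>k\<close>
    below can be defined without reference to a degree, and so can the transported action.\<close>
  have inj: "x = y" if x: "x \<in> mdeg M d" and y: "y \<in> mdeg M e" and q: "h x = h y" for x y d e
  proof (cases "d = e")
    case True then show ?thesis using same x y q by blast
  next
    case False
    have "\<chi> d x = 0" using h[OF x, of d] h[OF y, of d] q False by (auto simp: fun_eq_iff)
    then have "x = \<zero>\<^bsub>M\<^esub>" using \<chi>i x by blast
    moreover have "h x = 0" using calculation h0 by simp
    ultimately show ?thesis using hz[OF y] q by simp
  qed
  define k where "k v = (SOME x. (\<exists>d. x \<in> mdeg M d) \<and> h x = v)" for v
  have k: "k (h x) = x" if "x \<in> mdeg M d" for x d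
    unfolding k_def using that inj by (intro some_equality) blast+
  define N where "N d = h ` mdeg M d" for d
  define act where "act a v = h (a \<odot>\<^bsub>M\<^esub> k v)" for a v
  have act: "act a (h x) = h (a \<odot>\<^bsub>M\<^esub> x)" if "x \<in> mdeg M d" for a x d using k[OF that] by (simp add: act_def)
  have "model M h N act"
    unfolding model_def cover_def using hz hadd act by (auto simp: N_def)
  moreover have "gm N act"
    unfolding gm_def
  proof (intro conjI allI ballI)
    fix d
    show "agrp (N d)"
      unfolding agrp_def N_def
    proof (intro conjI ballI)
      show "0 \<in> h ` mdeg M d" using h0 M.mdeg_zero by (metis image_eqI)
      show "u + v \<in> h ` mdeg M d" if "u \<in> h ` mdeg M d" "v \<in> h ` mdeg M d" for u v
        using that hadd[symmetric] M.mdeg_add by (auto intro!: imageI)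
      show "- u \<in> h ` mdeg M d" if u: "u \<in> h ` mdeg M d" for u
      proof -
        obtain y where y: "y \<in> mdeg M d" "u = h y" using u by blast
        have my: "\<ominus>\<^bsub>M\<^esub> y \<in> mdeg M d"
          using subgroup.m_inv_closed[OF M.mdegree_subgroup y(1)] by (simp add: a_inv_def)
        have "h y + h (\<ominus>\<^bsub>M\<^esub> y) = 0" using hadd[OF y(1) my] M.M.r_neg[OF M.mdeg_sub[OF y(1)]] h0 by simp
        then have "- u = h (\<ominus>\<^bsub>M\<^esub> y)" using y(2) by (simp add: minus_unique)
        then show ?thesis using my by blast
      qed
    qed
  next
    fix i d a v assume a: "a \<in> Rd i" and "v \<in> N d"
    then obtain x where x: "x \<in> mdeg M d" "v = h x" by (auto simp: N_def)
    show "act a v \<in> N (i + d)" using act[OF x(1)] x(2) M.mdeg_smult[OF a x(1)] by (auto simp: N_def)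
  next
    fix i d a a' v assume a: "a \<in> Rd i" and a': "a' \<in> Rd i" and "v \<in> N d"
    then obtain x where x: "x \<in> mdeg M d" "v = h x" by (auto simp: N_def)
    show "act (a + a') v = act a v + act a' v"
      using act[OF x(1)] x(2) hadd[OF M.mdeg_smult[OF a x(1)] M.mdeg_smult[OF a' x(1)]]
        M.smult_l_distr[OF deg_sub[OF a] deg_sub[OF a'] M.mdeg_sub[OF x(1)]] by (simp add: add_R)
  next
    fix i d a v w assume a: "a \<in> Rd i" and "v \<in> N d" "w \<in> N d"
    then obtain x y where x: "x \<in> mdeg M d" "v = h x" and y: "y \<in> mdeg M d" "w = h y" by (auto simp: N_def)
    show "act a (v + w) = act a v + act a w"
      using act[OF x(1)] act[OF y(1)] act[OF M.mdeg_add[OF x(1) y(1)]] x(2) y(2) hadd[OF x(1) y(1)]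
        hadd[OF M.mdeg_smult[OF a x(1)] M.mdeg_smult[OF a y(1)]]
        M.smult_r_distr[OF deg_sub[OF a] M.mdeg_sub[OF x(1)] M.mdeg_sub[OF y(1)]] by simp
  next
    fix i j d a a' v assume a: "a \<in> Rd i" and a': "a' \<in> Rd j" and "v \<in> N d"
    then obtain x where x: "x \<in> mdeg M d" "v = h x" by (auto simp: N_def)
    show "act (a \<otimes>\<^bsub>R\<^esub> a') v = act a (act a' v)"
      using act[OF x(1)] act[OF M.mdeg_smult[OF a' x(1)]] x(2) M.smult_assoc1[OF deg_sub[OF a] deg_sub[OF a'] M.mdeg_sub[OF x(1)]] by simp
  next
    fix d v assume "v \<in> N d"
    then obtain x where x: "x \<in> mdeg M d" "v = h x" by (auto simp: N_def)
    show "act \<one>\<^bsub>R\<^esub> v = v" using act[OF x(1)] x(2) M.smult_one[OF M.mdeg_sub[OF x(1)]] by simp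
  qed
  ultimately show ?thesis by blast
qed

section \<open>The degree zero module\<close>

text \<open>The coset of the positive part with degree zero component \<open>t\<close>; the cosets
  are thus labelled by the degree zero part.\<close>

definition cl :: "'r \<Rightarrow> 'r set"
  where "cl t = {a \<in> RC. cmp 0 a = t}"

lemma positive_part_eq: "positive_part R = cl 0"
proof
  let ?H = "\<Union>i\<in>{1..}. Rd i"
  have H: "?H \<subseteq> RC" using deg_sub by blast
  have cl0: "agrp (cl 0)"
    using R_agrp additive_on_zero[OF R_agrp additive_cmp, of 0] additive_on_minus[OF R_agrp additive_cmp, of _ 0]
    by (auto simp: agrp_def cl_def cmp_add)
  have "?H \<subseteq> cl 0" using cmp_deg deg_sub by (auto simp: cl_def)
  then show "positive_part R \<subseteq> cl 0"
    unfolding positive_part_def by (rule generate_subset_agrp[OF add_R zero_R R_agrp H cl0])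
  show "cl 0 \<subseteq> positive_part R"
  proof
    fix a assume a: "a \<in> cl 0"
    have "cmp i a \<in> positive_part R" for i
    proof (cases i)
      case 0
      then show ?thesis using a agrp_zero[OF agrp_generate(1)[OF add_R zero_R R_agrp H]] by (simp add: cl_def positive_part_def)
    next
      case (Suc j)
      then have "cmp i a \<in> ?H" using a cmp_closed[of a i] by (intro UN_I[of i]) (auto simp: cl_def)
      then show ?thesis unfolding positive_part_def by (rule generate.incl)
    qed
    then have "(\<Sum>i<top. cmp i a) \<in> positive_part R"
      unfolding positive_part_def by (intro agrp_sum[OF agrp_generate(1)[OF add_R zero_R R_agrp H]])
    then show "a \<in> positive_part R" using cmp_sum[of a] a by (simp add: cl_def)
  qed
qed

lemma cl_mem: "t \<in> Rd 0 \<Longrightarrow> t \<in> cl t"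
  using deg_sub cmp_deg by (simp add: cl_def)

lemma cl_inj: "t \<in> Rd 0 \<Longrightarrow> cl t = cl s \<Longrightarrow> t = s"
  using cl_mem[of t] by (auto simp: cl_def)

lemma cl_coset: "x \<in> RC \<Longrightarrow> {j + x |j. j \<in> cl 0} = cl (cmp 0 x)"
proof (intro equalityI subsetI)
  fix a assume x: "x \<in> RC" and "a \<in> cl (cmp 0 x)"
  then have a: "a \<in> RC" "cmp 0 a = cmp 0 x" by (auto simp: cl_def)
  have "a - x \<in> cl 0" using a x agrp_diff[OF R_agrp] additive_on_diff[OF R_agrp additive_cmp] by (simp add: cl_def)
  then show "a \<in> {j + x |j. j \<in> cl 0}" by force
qed (auto simp: cl_def cmp_add agrp_add[OF R_agrp])

abbreviation "Z \<equiv> degree_zero_module R"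

lemma Z_eq: "Z = \<lparr>carrier = cl ` Rd 0, mult = undefined, one = undefined, zero = cl 0,
    add = set_add (regular_module R), smult = (\<lambda>a X. \<Union>x\<in>X. positive_part R +>\<^bsub>regular_module R\<^esub> (a \<otimes>\<^bsub>R\<^esub> x)),
    mdegree_part = (\<lambda>i. if i = 0 then cl ` Rd 0 else {cl 0})\<rparr>"
proof -
  have cos: "positive_part R +>\<^bsub>regular_module R\<^esub> x = cl (cmp 0 x)" "positive_part R +>\<^bsub>R\<^esub> x = cl (cmp 0 x)" if "x \<in> RC" for x
    using cl_coset[OF that] by (auto simp: a_r_coset_def' positive_part_eq regular_module_def add_R)
  have c0: "cmp 0 ` RC = Rd 0"
    using cmp_closed cmp_deg deg_sub by (auto simp: image_iff) metis
  have car: "a_rcosets\<^bsub>regular_module R\<^esub> (positive_part R) = cl ` Rd 0"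
  proof -
    have "carrier (regular_module R) = RC" by (simp add: regular_module_def)
    then have "a_rcosets\<^bsub>regular_module R\<^esub> (positive_part R) = (\<lambda>x. positive_part R +>\<^bsub>regular_module R\<^esub> x) ` RC"
      unfolding A_RCOSETS_def' by auto
    also have "\<dots> = (\<lambda>x. cl (cmp 0 x)) ` RC" using cos(1) by (rule image_cong[OF refl])
    finally show ?thesis unfolding c0[symmetric] image_image .
  qed
  have deg: "(\<lambda>a. positive_part R +>\<^bsub>R\<^esub> a) ` Rd i = (if i = 0 then cl ` Rd 0 else {cl 0})" for i
  proof -
    have "(\<lambda>a. positive_part R +>\<^bsub>R\<^esub> a) ` Rd i = (\<lambda>a. cl (cmp 0 a)) ` Rd i"
      using cos(2)[OF deg_sub] by (intro image_cong) auto
    also have "\<dots> = (if i = 0 then cl ` Rd 0 else {cl 0})"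
      using cmp_deg[of _ i 0] agrp_zero[OF deg_grp, of i] by (auto simp: image_iff)
    finally show ?thesis .
  qed
  have sm: "smult (regular_module R) = mult R" by (simp add: regular_module_def)
  have dg: "(\<lambda>i. if 0 \<le> i then (\<lambda>a. positive_part R +>\<^bsub>R\<^esub> a) ` Rd (nat i) else {positive_part R}) =
      (\<lambda>i::int. if i = 0 then cl ` Rd 0 else {cl 0})"
    unfolding deg by (rule ext) (simp add: positive_part_eq)
  show ?thesis
    unfolding degree_zero_module_def dg
    by (simp add: quotient_module_def module.extend_def gmodule.fields_def car[unfolded positive_part_eq] sm positive_part_eq)
qed

lemma Z_simps: "carrier Z = cl ` Rd 0" "zero Z = cl 0"
  "mdegree_part Z i = (if i = 0 then cl ` Rd 0 else {cl 0})"
  by (simp_all add: Z_eq)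

lemma Z_add: "s \<in> Rd 0 \<Longrightarrow> t \<in> Rd 0 \<Longrightarrow> cl s \<oplus>\<^bsub>Z\<^esub> cl t = cl (s + t)"
proof -
  assume s: "s \<in> Rd 0" and t: "t \<in> Rd 0"
  have "cl s \<oplus>\<^bsub>Z\<^esub> cl t = {x + y |x y. x \<in> cl s \<and> y \<in> cl t}"
    by (auto simp: Z_eq set_add_def set_mult_def regular_module_def add_R)
  also have "\<dots> = cl (s + t)"
  proof (intro equalityI subsetI)
    fix a assume a: "a \<in> cl (s + t)"
    have "a - t \<in> cl s" using a t deg_sub[OF t] agrp_diff[OF R_agrp] additive_on_diff[OF R_agrp additive_cmp, of a t 0] cmp_deg[OF t, of 0]
      by (simp add: cl_def)
    then show "a \<in> {x + y |x y. x \<in> cl s \<and> y \<in> cl t}" using cl_mem[OF t] by force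
  qed (auto simp: cl_def cmp_add agrp_add[OF R_agrp])
  finally show ?thesis .
qed

text \<open>Multiplication never lowers degrees, so a product has degree zero part only from the
  degree zero parts of the factors. This is how the algebra acts on the cosets.\<close>

lemma cmp0_mult: "a \<in> RC \<Longrightarrow> x \<in> RC \<Longrightarrow> cmp 0 (a \<otimes>\<^bsub>R\<^esub> x) = cmp 0 a \<otimes>\<^bsub>R\<^esub> cmp 0 x"
proof -
  assume a: "a \<in> RC" and x: "x \<in> RC"
  have cl: "cmp i x \<in> RC" for i using deg_sub[OF cmp_closed[OF x]] .
  have "a \<otimes>\<^bsub>R\<^esub> x = (\<Sum>i<top. a \<otimes>\<^bsub>R\<^esub> cmp i x)" using cmp_sum[OF x] R_sum_right[OF a, of "{..<top}" "\<lambda>i. cmp i x"] cl by simp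
  then have "cmp 0 (a \<otimes>\<^bsub>R\<^esub> x) = (\<Sum>i<top. cmp 0 (a \<otimes>\<^bsub>R\<^esub> cmp i x))"
    using additive_on_sum[OF R_agrp additive_cmp, of "{..<top}" "\<lambda>i. a \<otimes>\<^bsub>R\<^esub> cmp i x"] a cl by simp
  also have "\<dots> = (\<Sum>i<top. if i = 0 then cmp 0 a \<otimes>\<^bsub>R\<^esub> cmp 0 x else 0)"
    using cmp_mult_right[OF a cmp_closed[OF x], of 0] by (intro sum.cong) auto
  also have "\<dots> = cmp 0 a \<otimes>\<^bsub>R\<^esub> cmp 0 x" using cmp_top[OF _ x, of 0] deg_sub[OF cmp_closed[OF a]] by (cases "0 < top") auto
  finally show ?thesis .
qed

lemma Z_smult: "a \<in> RC \<Longrightarrow> t \<in> Rd 0 \<Longrightarrow> a \<odot>\<^bsub>Z\<^esub> cl t = cl (cmp 0 a \<otimes>\<^bsub>R\<^esub> t)"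
proof -
  assume a: "a \<in> RC" and t: "t \<in> Rd 0"
  have "positive_part R +>\<^bsub>regular_module R\<^esub> (a \<otimes>\<^bsub>R\<^esub> x) = cl (cmp 0 a \<otimes>\<^bsub>R\<^esub> t)" if "x \<in> cl t" for x
    using cl_coset[of "a \<otimes>\<^bsub>R\<^esub> x"] a that cmp0_mult[OF a, of x]
    by (auto simp: a_r_coset_def' positive_part_eq regular_module_def add_R cl_def)
  then show ?thesis using cl_mem[OF t] by (auto simp: Z_eq)
qed

lemma Z_left_module: "left_module R Z"
proof (intro left_module.intro left_module_axioms.intro ring_R)
  note g = deg_grp[of 0]
  show "abelian_group Z"
  proof (rule abelian_groupI)
    fix X assume "X \<in> carrier Z"
    then obtain t where t: "t \<in> Rd 0" "X = cl t" by (auto simp: Z_simps)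
    show "\<exists>Y\<in>carrier Z. Y \<oplus>\<^bsub>Z\<^esub> X = \<zero>\<^bsub>Z\<^esub>"
      using t agrp_minus[OF g] by (intro bexI[of _ "cl (- t)"]) (auto simp: Z_simps Z_add)
  qed (auto simp: Z_simps Z_add agrp_add[OF g] agrp_zero[OF g] add_ac)
  have m: "cmp 0 a \<otimes>\<^bsub>R\<^esub> t \<in> Rd 0" if "a \<in> RC" "t \<in> Rd 0" for a t
    using deg_mult[OF cmp_closed[OF that(1), of 0] that(2)] by simp
  have c: "cmp 0 a \<in> RC" if "a \<in> RC" for a using deg_sub[OF cmp_closed[OF that]] .
  show "a \<odot>\<^bsub>Z\<^esub> X \<in> carrier Z" if "a \<in> RC" "X \<in> carrier Z" for a X
    using that m by (auto simp: Z_simps Z_smult)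
  show "(a \<oplus>\<^bsub>R\<^esub> b) \<odot>\<^bsub>Z\<^esub> X = a \<odot>\<^bsub>Z\<^esub> X \<oplus>\<^bsub>Z\<^esub> b \<odot>\<^bsub>Z\<^esub> X" if "a \<in> RC" "b \<in> RC" "X \<in> carrier Z" for a b X
    using that m c R.a_closed[of a b] by (auto simp: Z_simps Z_smult Z_add add_R cmp_add R_distrib_left deg_sub agrp_add[OF R_agrp])
  show "a \<odot>\<^bsub>Z\<^esub> (X \<oplus>\<^bsub>Z\<^esub> Y) = a \<odot>\<^bsub>Z\<^esub> X \<oplus>\<^bsub>Z\<^esub> a \<odot>\<^bsub>Z\<^esub> Y" if "a \<in> RC" "X \<in> carrier Z" "Y \<in> carrier Z" for a X Y
    using that m c by (auto simp: Z_simps Z_smult Z_add R_distrib_right deg_sub agrp_add[OF g])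
  show "(a \<otimes>\<^bsub>R\<^esub> b) \<odot>\<^bsub>Z\<^esub> X = a \<odot>\<^bsub>Z\<^esub> (b \<odot>\<^bsub>Z\<^esub> X)" if "a \<in> RC" "b \<in> RC" "X \<in> carrier Z" for a b X
    using that m c by (auto simp: Z_simps Z_smult cmp0_mult R.m_assoc deg_sub)
  show "\<one>\<^bsub>R\<^esub> \<odot>\<^bsub>Z\<^esub> X = X" if "X \<in> carrier Z" for X
    using that cmp_deg[OF one_deg, of 0] by (auto simp: Z_simps Z_smult deg_sub)
qed

lemma Z_finsum:
  assumes "\<And>i. i \<in> I \<Longrightarrow> f i \<in> Rd 0"
  shows "finsum Z (\<lambda>i. cl (f i)) I = cl (sum f I)"
proof -
  interpret Z: left_module R Z by (rule Z_left_module)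
  have "cl (sum f I) = finsum Z (\<lambda>i. cl (f i)) I"
    using assms
  proof (induction I rule: infinite_finite_induct)
    case (insert i I)
    then have "finsum Z (\<lambda>i. cl (f i)) (insert i I) = cl (f i) \<oplus>\<^bsub>Z\<^esub> finsum Z (\<lambda>i. cl (f i)) I"
      by (intro Z.M.finsum_insert) (auto simp: Z_simps)
    then show ?case using insert Z_add[of "f i" "sum f I"] agrp_sum[OF deg_grp, of I f 0] by simp
  qed (simp_all add: Z_simps)
  then show ?thesis by simp
qed

lemma Z_graded: "graded_left_module R Z"
proof (intro graded_left_module.intro graded_left_module_axioms.intro Z_left_module)
  interpret Z: left_module R Z by (rule Z_left_module)
  have full: "subgroup (carrier Z) (add_monoid Z)" using group.subgroup_self[OF Z.M.a_group] by simp
  have triv: "subgroup {\<zero>\<^bsub>Z\<^esub>} (add_monoid Z)" using group.triv_subgroup[OF Z.M.a_group] by simp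
  show "subgroup (mdeg Z i) (add_monoid Z)" for i
    using full triv by (cases "i = 0") (simp_all add: Z_simps)
  show "\<exists>!c. (\<forall>i. c i \<in> mdegree_part Z i) \<and> finite {i. c i \<noteq> \<zero>\<^bsub>Z\<^esub>} \<and> X = finsum Z c {i. c i \<noteq> \<zero>\<^bsub>Z\<^esub>}"
    if X: "X \<in> carrier Z" for X
  proof (rule ex1I[of _ "\<lambda>i. if i = 0 then X else \<zero>\<^bsub>Z\<^esub>"])
    have s: "{i::int. (if i = 0 then X else \<zero>\<^bsub>Z\<^esub>) \<noteq> \<zero>\<^bsub>Z\<^esub>} = (if X = \<zero>\<^bsub>Z\<^esub> then {} else {0})" by auto
    show "(\<forall>i. (if i = 0 then X else \<zero>\<^bsub>Z\<^esub>) \<in> mdegree_part Z i) \<and> finite {i::int. (if i = 0 then X else \<zero>\<^bsub>Z\<^esub>) \<noteq> \<zero>\<^bsub>Z\<^esub>} \<and>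
        X = finsum Z (\<lambda>i. if i = 0 then X else \<zero>\<^bsub>Z\<^esub>) {i::int. (if i = 0 then X else \<zero>\<^bsub>Z\<^esub>) \<noteq> \<zero>\<^bsub>Z\<^esub>}"
      unfolding s using X Z.M.r_zero[OF X] Z.M.zero_closed
        Z.M.finsum_insert[of "{}" "0::int" "\<lambda>i. if i = 0 then X else \<zero>\<^bsub>Z\<^esub>"] by (simp add: Z_simps)
  next
    fix c assume c: "(\<forall>i. c i \<in> mdegree_part Z i) \<and> finite {i. c i \<noteq> \<zero>\<^bsub>Z\<^esub>} \<and> X = finsum Z c {i. c i \<noteq> \<zero>\<^bsub>Z\<^esub>}"
    have z: "c i = \<zero>\<^bsub>Z\<^esub>" if "i \<noteq> 0" for i
    proof -
      have "c i \<in> mdegree_part Z i" using c by blast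
      then show ?thesis using that by (simp add: Z_simps)
    qed
    have "c i \<noteq> \<zero>\<^bsub>Z\<^esub> \<longleftrightarrow> i = 0 \<and> c 0 \<noteq> \<zero>\<^bsub>Z\<^esub>" for i using z by (cases "i = 0") simp_all
    then have "{i. c i \<noteq> \<zero>\<^bsub>Z\<^esub>} = {i. i = 0 \<and> c 0 \<noteq> \<zero>\<^bsub>Z\<^esub>}" by (rule Collect_cong)
    also have "\<dots> = (if c 0 = \<zero>\<^bsub>Z\<^esub> then {} else {0})" by simp
    finally have s: "{i. c i \<noteq> \<zero>\<^bsub>Z\<^esub>} = (if c 0 = \<zero>\<^bsub>Z\<^esub> then {} else {0})" .
    have c0: "c 0 \<in> carrier Z"
    proof -
      have "c 0 \<in> mdegree_part Z 0" using c by blast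
      then show ?thesis by (simp add: Z_simps)
    qed
    have "X = finsum Z c {i. c i \<noteq> \<zero>\<^bsub>Z\<^esub>}" using c by (elim conjE)
    then have X0: "X = c 0"
      unfolding s using Z.M.finsum_insert[of "{}" "0::int" c] c0 by (cases "c 0 = \<zero>\<^bsub>Z\<^esub>") simp_all
    show "c = (\<lambda>i. if i = 0 then X else \<zero>\<^bsub>Z\<^esub>)"
    proof (rule ext)
      fix i show "c i = (if i = 0 then X else \<zero>\<^bsub>Z\<^esub>)"
        unfolding X0 using z[of i] by (cases "i = 0") simp_all
    qed
  qed
  show "a \<odot>\<^bsub>Z\<^esub> X \<in> mdegree_part Z (int i + j)" if a: "a \<in> Rd i" and X: "X \<in> mdegree_part Z j" for a i X j
  proof -
    have "\<exists>t\<in>Rd 0. X = cl t \<and> (j \<noteq> 0 \<longrightarrow> t = 0)"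
    proof (cases "j = 0")
      case True
      then have "X \<in> cl ` Rd 0" using X by (simp add: Z_simps)
      then show ?thesis using True by (elim imageE bexI[rotated]) simp
    next
      case False
      then have "X = cl 0" using X by (simp add: Z_simps)
      then show ?thesis by (intro bexI[of _ 0]) (simp_all add: agrp_zero[OF deg_grp])
    qed
    then obtain t where t: "t \<in> Rd 0" "X = cl t" "j \<noteq> 0 \<longrightarrow> t = 0" by blast
    have e: "a \<odot>\<^bsub>Z\<^esub> X = cl (cmp 0 a \<otimes>\<^bsub>R\<^esub> t)" using Z_smult[OF deg_sub[OF a] t(1)] t(2) by simp
    have m: "cmp 0 a \<otimes>\<^bsub>R\<^esub> t \<in> Rd 0" using deg_mult[OF cmp_closed[OF deg_sub[OF a], of 0] t(1)] by simp
    show ?thesis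
    proof (cases "int i + j = 0")
      case True then show ?thesis using e m by (simp add: Z_simps)
    next
      case False
      have "cmp 0 a \<otimes>\<^bsub>R\<^esub> t = 0"
      proof (cases "j = 0")
        case True then show ?thesis using False cmp_deg[OF a, of 0] deg_sub[OF t(1)] by simp
      next
        case False then show ?thesis using t(3) deg_sub[OF cmp_closed[OF deg_sub[OF a], of 0]] by simp
      qed
      then show ?thesis using e False by (simp add: Z_simps)
    qed
  qed
  show "finite_dimensional_part R Z (mdeg Z i)" for i
  proof (cases "i = 0")
    case False
    then have "mdeg Z i = {\<zero>\<^bsub>Z\<^esub>}" by (simp add: Z_simps)
    then show ?thesis unfolding finite_dimensional_part_def
      by (intro exI[of _ "{}"]) simp
  next
    case True
    obtain U where U: "finite U" "U \<subseteq> Rd 0"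
      "\<forall>a\<in>Rd 0. \<exists>c. a = (\<Sum>u\<in>U. scal (c u) \<otimes>\<^bsub>R\<^esub> u)" using fin_dim[of 0] by (elim exE conjE)
    have inj: "inj_on cl U"
    proof (rule inj_onI)
      fix s u assume "s \<in> U" "u \<in> U" "cl s = cl u"
      then show "s = u" using cl_inj[of s u] U(2) by blast
    qed
    have "\<exists>c. X = finsum Z (\<lambda>b. scal (c b) \<odot>\<^bsub>Z\<^esub> b) (cl ` U)" if X: "X \<in> cl ` Rd 0" for X
    proof -
      from X obtain t where t: "X = cl t" "t \<in> Rd 0" by (rule imageE)
      obtain c where c: "t = (\<Sum>u\<in>U. scal (c u) \<otimes>\<^bsub>R\<^esub> u)" using U(3)[rule_format, OF t(2)] by (elim exE)
      define c' where "c' Y = c (inv_into U cl Y)" for Y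
      have c': "c' (cl u) = c u" if "u \<in> U" for u using inv_into_f_f[OF inj that] by (simp add: c'_def)
      have ud: "u \<in> Rd 0" if "u \<in> U" for u using that U(2) by blast
      have m: "scal (c u) \<otimes>\<^bsub>R\<^esub> u \<in> Rd 0" if "u \<in> U" for u
        using deg_mult[OF scal_deg ud[OF that]] by simp
      have "finsum Z (\<lambda>b. scal (c' b) \<odot>\<^bsub>Z\<^esub> b) (cl ` U) = finsum Z (\<lambda>u. scal (c' (cl u)) \<odot>\<^bsub>Z\<^esub> cl u) U"
        using Z.smult_closed[OF scal_carrier] ud by (intro Z.M.finsum_reindex[OF _ inj]) (simp add: Z_simps image_subset_iff Pi_iff)
      also have "\<dots> = finsum Z (\<lambda>u. cl (scal (c u) \<otimes>\<^bsub>R\<^esub> u)) U"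
        using m c' Z_smult[OF scal_carrier ud] cmp_deg[OF scal_deg, of 0] by (intro Z.M.finsum_cong'[OF refl]) (simp_all add: Z_simps)
      also have "\<dots> = cl (\<Sum>u\<in>U. scal (c u) \<otimes>\<^bsub>R\<^esub> u)" by (rule Z_finsum[OF m])
      also have "\<dots> = X" unfolding t(1) c[symmetric] by (rule refl)
      finally show ?thesis by (intro exI[of _ c']) simp
    qed
    moreover have "mdeg Z i = cl ` Rd 0" using True by (simp add: Z_simps)
    ultimately show ?thesis unfolding finite_dimensional_part_def using U
      by (intro exI[of _ "cl ` U"]) (simp add: image_mono)
  qed
qed

lemma Z_pos: "pos_module R Z"
proof (intro pos_module.intro pos_module_axioms.intro Z_graded)
  interpret Z: left_module R Z by (rule Z_left_module)
  show "\<zero>\<^bsub>R\<^esub> \<in> Rd i" for i using agrp_zero[OF deg_grp] by (simp add: zero_R)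
  show "\<exists>c F. (\<forall>i. c i \<in> mdeg Z i) \<and> finite F \<and> (\<forall>i. i \<notin> F \<longrightarrow> c i = \<zero>\<^bsub>Z\<^esub>) \<and> X = finsum Z c F"
    if X: "X \<in> carrier Z" for X
    using X Z.M.r_zero[OF X] Z.M.zero_closed Z.M.finsum_insert[of "{}" "0::nat" "\<lambda>i. if i = 0 then X else \<zero>\<^bsub>Z\<^esub>"]
    by (intro exI[of _ "\<lambda>i. if i = 0 then X else \<zero>\<^bsub>Z\<^esub>"] exI[of _ "{0}"]) (simp add: Z_simps)
qed

text \<open>The model is the module \<open>zmod\<close>: a coset is sent to its unique
  representative of degree zero, placed in coordinate 0.\<close>

lemma Z_model: "model Z (\<lambda>X. emb (THE t. t \<in> Rd 0 \<and> X = cl t)) zmod zact"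
proof -
  let ?h = "\<lambda>X. emb (THE t. t \<in> Rd 0 \<and> X = cl t)"
  have h: "?h (cl t) = emb t" if "t \<in> Rd 0" for t
    using that cl_inj by (intro arg_cong[where f = emb] the_equality) blast+
  have z: "?h (cl 0) = 0" using h[OF agrp_zero[OF deg_grp]] by simp
  note g = deg_grp[of 0]
  show ?thesis
    unfolding model_def cover_def
  proof (intro conjI allI ballI impI)
    show "?h X \<in> zmod d" if "X \<in> mdeg Z (0 + d)" for d X
      using that h z by (cases "d = 0") (auto simp: Z_simps zmod_def)
    show "?h (X \<oplus>\<^bsub>Z\<^esub> Y) = ?h X + ?h Y" if "X \<in> mdeg Z (0 + d)" "Y \<in> mdeg Z (0 + d)" for d X Y
    proof -
      have "X \<in> cl ` Rd 0" "Y \<in> cl ` Rd 0"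
        using that agrp_zero[OF g] by (cases "d = 0"; simp add: Z_simps)+
      then obtain s t where st: "s \<in> Rd 0" "t \<in> Rd 0" "X = cl s" "Y = cl t" by blast
      then show ?thesis using h Z_add agrp_add[OF g] by (simp add: emb_add)
    qed
    show "?h (a \<odot>\<^bsub>Z\<^esub> X) = zact a (?h X)" if a: "a \<in> Rd e" and X: "X \<in> mdeg Z (0 + d)" for e d a X
    proof -
      have "X \<in> cl ` Rd 0" using X agrp_zero[OF g] by (cases "d = 0"; simp add: Z_simps)
      then obtain t where t: "t \<in> Rd 0" "X = cl t" by blast
      have m: "cmp 0 a \<otimes>\<^bsub>R\<^esub> t \<in> Rd 0" using deg_mult[OF cmp_closed[OF deg_sub[OF a], of 0] t(1)] by simp
      have "?h (a \<odot>\<^bsub>Z\<^esub> X) = emb (cmp 0 a \<otimes>\<^bsub>R\<^esub> t)" using Z_smult[OF deg_sub[OF a] t(1)] t(2) h[OF m] by simp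
      also have "\<dots> = zact a (emb t)"
      proof (cases e)
        case 0 then show ?thesis using a cmp_deg[OF a, of 0] zact_emb[of a t] by simp
      next
        case (Suc f)
        then have "zact a (emb t) = 0" using zact_pos[of a f "emb t" 0] a t(1) by (simp add: zmod_def)
        then show ?thesis using Suc cmp_deg[OF a, of 0] deg_sub[OF t(1)] by simp
      qed
      finally show ?thesis using h[OF t(1)] t(2) by simp
    qed
    show "\<exists>X\<in>mdeg Z (0 + d). ?h X = y" if "y \<in> zmod d" for d y
      using that h z by (cases "d = 0") (auto simp: Z_simps zmod_def)
    show "X = \<zero>\<^bsub>Z\<^esub>" if "X \<in> mdeg Z d" "?h X = 0" for d X
    proof -
      have "X \<in> cl ` Rd 0" using that(1) agrp_zero[OF g] by (cases "d = 0"; simp add: Z_simps)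
      then obtain t where t: "t \<in> Rd 0" "X = cl t" by blast
      then have "emb t 0 = 0" using h[OF t(1)] that(2) by simp
      then show ?thesis using t(2) by (simp add: Z_simps)
    qed
  qed
qed

lemma koszul_degree_zero_iff: "koszul_module R Z \<longleftrightarrow> koszul zmod zact"
proof
  show "koszul zmod zact" if "koszul_module R Z" by (rule koszul_module_model[OF that Z_model gm_zmod])
  show "koszul_module R Z" if "koszul zmod zact" by (rule koszul_module_of_model[OF Z_pos Z_model that])
qed

end

section \<open>Projectivity and injectivity over the degree zero algebra\<close>

text \<open>Turns a subgroup of a type into a module record, in order to apply the definitions of
  projective and injective modules to it.\<close>

definition mrec :: "'m::ab_group_add set \<Rightarrow> ('r \<Rightarrow> 'm \<Rightarrow> 'm) \<Rightarrow> ('r, 'm) module"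
  where "mrec U act = \<lparr>carrier = U, mult = undefined, one = undefined, zero = 0, add = (+), smult = act\<rparr>"

lemma mrec_simps [simp]: "carrier (mrec U act) = U" "zero (mrec U act) = 0" "add (mrec U act) = (+)"
  "smult (mrec U act) = act" "(mrec U act)\<lparr>carrier := U'\<rparr> = mrec U' act"
  by (simp_all add: mrec_def)

context galgebra
begin

abbreviation "S \<equiv> degree_zero_algebra R"

lemma S_simps [simp]: "carrier S = Rd 0" "mult S = mult R" "one S = one R" "zero S = 0" "add S = (+)"
  by (simp_all add: degree_zero_algebra_def add_R zero_R)

lemma ring_S: "ring S"
proof (rule ringI)
  show "abelian_group S" by (rule agrp_abelian_group) (simp_all add: deg_grp)
  show "monoid S"
    using deg_mult[of _ 0 _ 0] by (intro monoidI) (auto simp: one_deg R.m_assoc deg_sub)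
qed (auto simp: R_distrib_left R_distrib_right deg_sub)

lemma left_module_S:
  assumes "left_module R M"
  shows "left_module S M"
proof -
  interpret M: left_module R M by fact
  show ?thesis
    using M.smult_l_distr by (intro left_module.intro left_module_axioms.intro ring_S M.M.abelian_group_axioms)
      (auto simp: M.smult_closed M.smult_r_distr M.smult_assoc1 M.smult_one deg_sub add_R)
qed

lemma mrec_left_module: "smod U act \<Longrightarrow> left_module S (mrec U act)"
proof (intro left_module.intro left_module_axioms.intro ring_S)
  assume U: "smod U act"
  show "abelian_group (mrec U act)" by (rule agrp_abelian_group) (simp_all add: smod_agrp[OF U])
qed (simp_all add: smod_closed smod_add_left smod_add_right smod_assoc smod_one)

lemma mrec_projective:
  assumes U: "smod U act" and sp: "sproj U act"
  shows "projective_module S (mrec U act)"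
proof -
  obtain n :: nat and b ph where D: "dual_basis U act {..<n} b ph" using sp by (auto simp: sproj_def)
  show ?thesis
  proof (rule projective_moduleI[OF mrec_left_module[OF U], where I = "{..<n}" and b = b and ph = ph])
    show "finsum (mrec U act) (\<lambda>i. ph i x \<odot>\<^bsub>mrec U act\<^esub> b i) {..<n} = x" if "x \<in> carrier (mrec U act)" for x
    proof -
      have x: "x \<in> U" using that by simp
      have "finsum (mrec U act) (\<lambda>i. ph i x \<odot>\<^bsub>mrec U act\<^esub> b i) {..<n} = (\<Sum>i<n. ph i x \<odot>\<^bsub>mrec U act\<^esub> b i)"
        using smod_closed[OF U db_closed[OF D _ x] db_elem[OF D]]
        by (intro finsum_eq_sum) (simp_all add: smod_agrp[OF U])
      then show ?thesis using dual_basis_sum[OF D x] by simp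
    qed
  qed (simp_all add: db_elem[OF D] db_closed[OF D] additive_onD[OF slin_additive[OF db_slin[OF D]]] slin_act[OF db_slin[OF D]])
qed

text \<open>The submodule is projective, hence injective, and extending its identity along the
  inclusion is the desired retraction. All test objects live on \<open>nat \<Rightarrow> 'r\<close>,
  as the definitions require.\<close>

lemma self_injective_sinj:
  assumes "self_injective S"
  shows sinj
  unfolding sinj_def
proof (intro allI impI, elim conjE)
  fix U V act assume U: "smod U act" "sproj U act" and V: "smod V act" and sub: "U \<subseteq> (V :: (nat \<Rightarrow> 'r) set)"
  have "injective_module S (mrec U act)" using assms mrec_projective[OF U] by (simp add: self_injective_def)
  moreover have "(\<lambda>x. x) \<in> lmod_hom S (mrec U act) (mrec V act)" using sub by (auto simp: lmod_hom_def)
  moreover have "inj_on (\<lambda>x. x) (carrier (mrec U act))" by simp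
  moreover have "(\<lambda>x. x) \<in> lmod_hom S (mrec U act) (mrec U act)" by (auto simp: lmod_hom_def)
  ultimately obtain g where g: "g \<in> lmod_hom S (mrec V act) (mrec U act)" "\<forall>x\<in>carrier (mrec U act). g x = x"
    using mrec_left_module[OF U(1)] mrec_left_module[OF V] unfolding injective_module_def by blast
  then have "slin V act U act g" by (auto simp: lmod_hom_def slin_def additive_on_def Pi_iff)
  then show "\<exists>\<rho>. slin V act U act \<rho> \<and> (\<forall>u\<in>U. \<rho> u = u)" using g(2) by auto
qed

context
  fixes M :: "('r, 'm, 'y) gmodule_scheme" and h :: "'m \<Rightarrow> nat \<Rightarrow> 'r" and N act
  assumes M: "graded_left_module R M" and G: "generated_in_degree R M (int 0)" and mo: "model M h N act" and N: "gm N act"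
begin

interpretation M: pos_module R M by (rule pos_moduleI[OF M G])

lemma model_cover: "cover 0 M h N act"
  using mo by (simp add: model_def)

lemma h_add: "x \<in> mdeg M d \<Longrightarrow> y \<in> mdeg M d \<Longrightarrow> h (x \<oplus>\<^bsub>M\<^esub> y) = h x + h y"
  using coverD(2)[OF model_cover, of x d y] by simp

lemma h_act: "a \<in> Rd e \<Longrightarrow> x \<in> mdeg M d \<Longrightarrow> h (a \<odot>\<^bsub>M\<^esub> x) = act a (h x)"
  using coverD(3)[OF model_cover, of a e x d] by simp

lemma h_closed: "x \<in> mdeg M d \<Longrightarrow> h x \<in> N d"
  using coverD(1)[OF model_cover, of x d] by simp

lemma h_surj: "y \<in> N d \<Longrightarrow> \<exists>x\<in>mdeg M d. y = h x"
  using coverD(4)[OF model_cover, of y d] by auto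

lemma h_inj: "x \<in> mdeg M d \<Longrightarrow> y \<in> mdeg M d \<Longrightarrow> h x = h y \<Longrightarrow> x = y"
  by (rule model_inj[OF M.pos_module_axioms mo])

lemma h_zero: "h \<zero>\<^bsub>M\<^esub> = 0"
  by (rule cover_zero[OF M.pos_module_axioms model_cover])

lemma mdeg_top: "top \<le> d \<Longrightarrow> x \<in> mdeg M d \<Longrightarrow> x = \<zero>\<^bsub>M\<^esub>"
proof -
  assume d: "top \<le> d" and x: "x \<in> mdeg M d"
  have "mdeg M d \<subseteq> {\<zero>\<^bsub>M\<^esub>}"
  proof (rule generated_piece[OF M G])
    show "a \<odot>\<^bsub>M\<^esub> y \<in> {\<zero>\<^bsub>M\<^esub>}" if "a \<in> Rd (d - 0)" "y \<in> mdeg M 0" for a y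
      using deg_top[OF d, of a] that M.smult_zero_left[OF M.mdeg_sub[OF that(2)]] by (simp add: zero_R)
  qed simp_all
  then show ?thesis using x by blast
qed

text \<open>Scalars from \<open>S\<close> have degree 0, so taking the component of degree
  \<open>d\<close> is linear over \<open>S\<close>; a dual basis of the whole module therefore
  yields one of each component by taking components of its elements.\<close>

lemma sproj_of_projective:
  assumes pr: "projective_module S M"
  shows "sproj (N d) act"
proof -
  interpret SM: left_module S M by (rule left_module_S[OF M.left_module_axioms])
  have "\<forall>e. \<exists>B. finite B \<and> B \<subseteq> mdeg M e \<and>
      (\<forall>v\<in>mdeg M e. \<exists>c :: 'm \<Rightarrow> 'k. v = finsum M (\<lambda>b. scal (c b) \<odot>\<^bsub>M\<^esub> b) B)"
    using M.locally_finite unfolding finite_dimensional_part_def by (rule allI)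
  then obtain Bs where Bs: "\<forall>e. finite (Bs e) \<and> Bs e \<subseteq> mdeg M e \<and>
      (\<forall>v\<in>mdeg M e. \<exists>c :: 'm \<Rightarrow> 'k. v = finsum M (\<lambda>b. scal (c b) \<odot>\<^bsub>M\<^esub> b) (Bs e))"
    by (rule choice[THEN exE])
  \<comment> \<open>Finitely many elements generate \<open>M\<close> over \<open>S\<close>:
    components from degree \<open>top\<close> on vanish, and each of the others is
    finite-dimensional.\<close>
  define B where "B = (\<Union>e<top. Bs e)"
  have fB: "finite B" using Bs by (simp add: B_def)
  have BM: "B \<subseteq> carrier M"
  proof
    fix b assume "b \<in> B"
    then obtain e where "b \<in> Bs e" by (auto simp: B_def)
    then have "b \<in> mdeg M e" using Bs[rule_format, of e] by blast
    then show "b \<in> carrier M" by (rule M.mdeg_sub)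
  qed
  have bc: "b \<in> carrier M" if "b \<in> B" for b using that BM by blast
  let ?T = "{x. \<exists>c. (\<forall>b\<in>B. c b \<in> Rd 0) \<and> x = finsum M (\<lambda>b. c b \<odot>\<^bsub>M\<^esub> b) B}"
  have tc: "c b \<odot>\<^bsub>M\<^esub> b \<in> carrier M" if "\<forall>b\<in>B. c b \<in> Rd 0" "b \<in> B" for c b
    by (rule M.smult_closed[OF deg_sub bc]) (use that in blast)+
  have T0: "\<zero>\<^bsub>M\<^esub> \<in> ?T"
  proof -
    have "finsum M (\<lambda>b. 0 \<odot>\<^bsub>M\<^esub> b) B = \<zero>\<^bsub>M\<^esub>"
      using M.smult_zero_left[OF bc] by (intro M.M.add.finprod_one_eqI) (simp add: zero_R)
    then show ?thesis by (intro CollectI exI[of _ "\<lambda>_. 0"]) (simp add: agrp_zero[OF deg_grp])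
  qed
  have Ta: "x \<oplus>\<^bsub>M\<^esub> y \<in> ?T" if x: "x \<in> ?T" and y: "y \<in> ?T" for x y
  proof -
    from x obtain c where c: "\<forall>b\<in>B. c b \<in> Rd 0" "x = finsum M (\<lambda>b. c b \<odot>\<^bsub>M\<^esub> b) B" by (elim CollectE exE conjE)
    from y obtain e where e: "\<forall>b\<in>B. e b \<in> Rd 0" "y = finsum M (\<lambda>b. e b \<odot>\<^bsub>M\<^esub> b) B" by (elim CollectE exE conjE)
    have "finsum M (\<lambda>b. (c b + e b) \<odot>\<^bsub>M\<^esub> b) B = finsum M (\<lambda>b. c b \<odot>\<^bsub>M\<^esub> b \<oplus>\<^bsub>M\<^esub> e b \<odot>\<^bsub>M\<^esub> b) B"
    proof (rule M.M.finsum_cong'[OF refl])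
      show "(\<lambda>b. c b \<odot>\<^bsub>M\<^esub> b \<oplus>\<^bsub>M\<^esub> e b \<odot>\<^bsub>M\<^esub> b) \<in> B \<rightarrow> carrier M" using tc[OF c(1)] tc[OF e(1)] by simp
      show "(c b + e b) \<odot>\<^bsub>M\<^esub> b = c b \<odot>\<^bsub>M\<^esub> b \<oplus>\<^bsub>M\<^esub> e b \<odot>\<^bsub>M\<^esub> b" if "b \<in> B" for b
        using SM.smult_l_distr[of "c b" "e b" b] c(1) e(1) that bc by simp
    qed
    also have "\<dots> = x \<oplus>\<^bsub>M\<^esub> y" unfolding c(2) e(2) using tc[OF c(1)] tc[OF e(1)] by (intro M.M.finsum_addf) simp_all
    finally show ?thesis using c(1) e(1) by (intro CollectI exI[of _ "\<lambda>b. c b + e b"]) (simp add: agrp_add[OF deg_grp])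
  qed
  have Tp: "v \<in> ?T" if v: "v \<in> mdeg M e" for v e
  proof (cases "e < top")
    case False
    then show ?thesis using mdeg_top[OF _ v] T0 by simp
  next
    case True
    obtain c :: "'m \<Rightarrow> 'k" where c: "v = finsum M (\<lambda>b. scal (c b) \<odot>\<^bsub>M\<^esub> b) (Bs e)"
      using Bs[rule_format, of e, THEN conjunct2, THEN conjunct2, rule_format, OF v] by (elim exE)
    have sub: "Bs e \<subseteq> B" using True by (auto simp: B_def)
    let ?c = "\<lambda>b. if b \<in> Bs e then scal (c b) else 0"
    have cd: "\<forall>b\<in>B. ?c b \<in> Rd 0" using scal_deg agrp_zero[OF deg_grp] by simp
    have "v = finsum M (\<lambda>b. ?c b \<odot>\<^bsub>M\<^esub> b) B" unfolding c
      using fB sub M.smult_zero_left[OF bc] tc[OF cd] M.smult_closed[OF scal_carrier bc]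
      by (intro M.M.add.finprod_mono_neutral_cong_left) (auto simp: zero_R)
    then show ?thesis using cd by (intro CollectI exI[of _ ?c]) simp
  qed
  have "x \<in> ?T" if x: "x \<in> carrier M" for x
  proof -
    have sg: "finsum M f F \<in> ?T" if "finite F" "\<And>i. i \<in> F \<Longrightarrow> f i \<in> ?T \<and> f i \<in> carrier M" for f :: "nat \<Rightarrow> 'm" and F
      using that
    proof (induction F)
      case (insert i F)
      then have "finsum M f (insert i F) = f i \<oplus>\<^bsub>M\<^esub> finsum M f F" by (intro M.M.finsum_insert) auto
      then show ?case using insert Ta by simp
    qed (use T0 in simp)
    have "finsum M (M.mcomp x) {i. M.mcomp x i \<noteq> \<zero>\<^bsub>M\<^esub>} \<in> ?T"
      using Tp[OF M.mcomp_spec[OF x]] M.mcomp_closed[OF x] by (intro sg M.finite_mcomp[OF x]) blast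
    then show ?thesis using M.mcomp_sum[OF x M.finite_mcomp[OF x]] by simp
  qed
  then have gen: "\<forall>x\<in>carrier M. \<exists>c. (\<forall>b\<in>B. c b \<in> carrier S) \<and> x = finsum M (\<lambda>b. c b \<odot>\<^bsub>M\<^esub> b) B" by simp
  obtain ph where ph: "\<forall>b\<in>B. \<forall>x\<in>carrier M. ph b x \<in> carrier S"
    "\<forall>b\<in>B. \<forall>x\<in>carrier M. \<forall>y\<in>carrier M. ph b (x \<oplus>\<^bsub>M\<^esub> y) = ph b x \<oplus>\<^bsub>S\<^esub> ph b y"
    "\<forall>b\<in>B. \<forall>a\<in>carrier S. \<forall>x\<in>carrier M. ph b (a \<odot>\<^bsub>M\<^esub> x) = a \<otimes>\<^bsub>S\<^esub> ph b x"
    "\<forall>x\<in>carrier M. finsum M (\<lambda>b. ph b x \<odot>\<^bsub>M\<^esub> b) B = x"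
    using projective_moduleD[OF pr fB BM gen] by (elim exE conjE)
  define k where "k y = (SOME x. x \<in> mdeg M d \<and> h x = y)" for y
  have k: "k (h x) = x" if "x \<in> mdeg M d" for x
    unfolding k_def using that h_inj by (intro some_equality) blast+
  have "dual_basis (N d) act B (\<lambda>b. h (M.mcomp b d)) (\<lambda>b y. ph b (k y))"
    unfolding dual_basis_def slin_def additive_on_def
  proof (intro conjI ballI fB)
    fix b assume b: "b \<in> B"
    show "h (M.mcomp b d) \<in> N d" by (rule h_closed[OF M.mcomp_spec[OF bc[OF b]]])
    fix y assume "y \<in> N d"
    then obtain x where x: "x \<in> mdeg M d" "y = h x" using h_surj by blast
    show "ph b (k y) \<in> Rd 0" using ph(1) b M.mdeg_sub[OF x(1)] k[OF x(1)] x(2) by simp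
    show "ph b (k (act a y)) = a \<otimes>\<^bsub>R\<^esub> ph b (k y)" if a: "a \<in> Rd 0" for a
      using k[OF x(1)] x(2) h_act[OF a x(1)] k[of "a \<odot>\<^bsub>M\<^esub> x"] M.mdeg_smult[OF a x(1)] ph(3) b a M.mdeg_sub[OF x(1)] by simp
    fix z assume "z \<in> N d"
    then obtain w where w: "w \<in> mdeg M d" "z = h w" using h_surj by blast
    show "ph b (k (y + z)) = ph b (k y) + ph b (k z)"
      using k[OF x(1)] k[OF w(1)] x(2) w(2) h_add[OF x(1) w(1)] k[OF M.mdeg_add[OF x(1) w(1)]]
        ph(2) b M.mdeg_sub[OF x(1)] M.mdeg_sub[OF w(1)] by simp
  next
    fix y assume "y \<in> N d"
    then obtain x where x: "x \<in> mdeg M d" "y = h x" using h_surj by blast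
    have xc: "x \<in> carrier M" by (rule M.mdeg_sub[OF x(1)])
    have pd: "ph b x \<in> Rd 0" if "b \<in> B" for b using ph(1) that xc by simp
    have t1: "ph b x \<odot>\<^bsub>M\<^esub> b \<in> carrier M" if "b \<in> B" for b by (rule M.smult_closed[OF deg_sub[OF pd[OF that]] bc[OF that]])
    have full: "subgroup (carrier M) (add_monoid M)" using group.subgroup_self[OF M.M.a_group] by simp
    have hm: "h (M.mcomp (u \<oplus>\<^bsub>M\<^esub> w) d) = h (M.mcomp u d) + h (M.mcomp w d)" if "u \<in> carrier M" "w \<in> carrier M" for u w
      using M.mcomp_add[OF that] h_add[OF M.mcomp_spec[OF that(1)] M.mcomp_spec[OF that(2)]] by simp
    have "y = h (M.mcomp x d)" using M.mcomp_homogeneous[OF x(1)] x(2) by simp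
    also have "\<dots> = h (M.mcomp (finsum M (\<lambda>b. ph b x \<odot>\<^bsub>M\<^esub> b) B) d)" using ph(4) xc by simp
    also have "\<dots> = (\<Sum>b\<in>B. h (M.mcomp (ph b x \<odot>\<^bsub>M\<^esub> b) d))"
      by (rule M.M.finsum_image_sum(1)[OF full, where f = "\<lambda>u. h (M.mcomp u d)"]) (simp_all add: hm t1)
    also have "\<dots> = (\<Sum>b\<in>B. act (ph b x) (h (M.mcomp b d)))"
    proof (rule sum.cong[OF refl])
      fix b assume b: "b \<in> B"
      have "M.mcomp (ph b x \<odot>\<^bsub>M\<^esub> b) (0 + d) = ph b x \<odot>\<^bsub>M\<^esub> M.mcomp b d"
        by (rule M.mcomp_smult[OF pd[OF b] deg_sub[OF pd[OF b]] bc[OF b]])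
      then show "h (M.mcomp (ph b x \<odot>\<^bsub>M\<^esub> b) d) = act (ph b x) (h (M.mcomp b d))"
        using h_act[OF pd[OF b] M.mcomp_spec[OF bc[OF b], of d]] by simp
    qed
    finally show "y = (\<Sum>b\<in>B. act (ph b (k y)) (h (M.mcomp b d)))" using k[OF x(1)] x(2) by simp
  qed
  then show ?thesis by (rule sprojI)
qed

text \<open>The dual bases of the finitely many components below \<open>top\<close> are put
  together; the resulting expansion is verified one component at a time, through
  \<open>h\<close>.\<close>

lemma projective_of_sproj:
  assumes sp: "\<And>d. sproj (N d) act"
  shows "projective_module S M"
proof -
  interpret SM: left_module S M by (rule left_module_S[OF M.left_module_axioms])
  have "\<forall>d. \<exists>n b ph. dual_basis (N d) act {..<n::nat} b ph" using sp by (simp add: sproj_def)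
  then obtain n :: "nat \<Rightarrow> nat" and b ph where D: "\<And>d. dual_basis (N d) act {..<n d} (b d) (ph d)" by metis
  have "\<forall>d j. \<exists>x. j < n d \<longrightarrow> x \<in> mdeg M d \<and> b d j = h x" using h_surj db_elem[OF D] by blast
  then obtain x where "\<forall>d j. j < n d \<longrightarrow> x d j \<in> mdeg M d \<and> b d j = h (x d j)" by metis
  then have x: "\<And>d j. j < n d \<Longrightarrow> x d j \<in> mdeg M d" "\<And>d j. j < n d \<Longrightarrow> h (x d j) = b d j" by auto
  define I where "I = Sigma {..<top} (\<lambda>d. {..<n d})"
  define xx where "xx p = x (fst p) (snd p)" for p
  define f where "f p m = ph (fst p) (snd p) (h (M.mcomp m (fst p)))" for p m
  have fI: "finite I" by (simp add: I_def)
  have Ip: "snd p < n (fst p)" "fst p < top" if "p \<in> I" for p using that by (auto simp: I_def)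
  have hc: "h (M.mcomp m d) \<in> N d" if "m \<in> carrier M" for m d by (rule h_closed[OF M.mcomp_spec[OF that]])
  have fd: "f p m \<in> Rd 0" if "p \<in> I" "m \<in> carrier M" for p m
    unfolding f_def by (rule db_closed[OF D Ip(1)[OF that(1)] hc[OF that(2)]])
  have xp: "xx p \<in> mdeg M (fst p)" if "p \<in> I" for p unfolding xx_def by (rule x(1)[OF Ip(1)[OF that]])
  have full: "subgroup (carrier M) (add_monoid M)" using group.subgroup_self[OF M.M.a_group] by simp
  show ?thesis
  proof (rule projective_moduleI[OF SM.left_module_axioms, where I = I and b = xx and ph = f])
    show "xx p \<in> carrier M" if "p \<in> I" for p by (rule M.mdeg_sub[OF xp[OF that]])
    show "f p m \<in> carrier S" if "p \<in> I" "m \<in> carrier M" for p m using fd[OF that] by simp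
    show "f p (u \<oplus>\<^bsub>M\<^esub> w) = f p u \<oplus>\<^bsub>S\<^esub> f p w" if p: "p \<in> I" and u: "u \<in> carrier M" and w: "w \<in> carrier M" for p u w
      using M.mcomp_add[OF u w] h_add[OF M.mcomp_spec[OF u] M.mcomp_spec[OF w]]
        additive_onD[OF slin_additive[OF db_slin[OF D Ip(1)[OF p]]] hc[OF u] hc[OF w]]
      by (simp add: f_def)
    show "f p (a \<odot>\<^bsub>M\<^esub> u) = a \<otimes>\<^bsub>S\<^esub> f p u" if p: "p \<in> I" and a: "a \<in> carrier S" and u: "u \<in> carrier M" for p a u
    proof -
      have a0: "a \<in> Rd 0" using a by simp
      have "M.mcomp (a \<odot>\<^bsub>M\<^esub> u) (0 + fst p) = a \<odot>\<^bsub>M\<^esub> M.mcomp u (fst p)" by (rule M.mcomp_smult[OF a0 deg_sub[OF a0] u])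
      then show ?thesis using h_act[OF a0 M.mcomp_spec[OF u]] slin_act[OF db_slin[OF D Ip(1)[OF p]] a0 hc[OF u]]
        by (simp add: f_def)
    qed
    fix m assume m: "m \<in> carrier M"
    have tc: "f p m \<odot>\<^bsub>M\<^esub> xx p \<in> carrier M" if "p \<in> I" for p
      by (rule M.smult_closed[OF deg_sub[OF fd[OF that m]] M.mdeg_sub[OF xp[OF that]]])
    let ?s = "finsum M (\<lambda>p. f p m \<odot>\<^bsub>M\<^esub> xx p) I"
    have sc: "?s \<in> carrier M" using tc by (intro M.M.finsum_closed) simp
    have eq: "M.mcomp ?s e = M.mcomp m e" for e
    proof (cases "e < top")
      case False
      then show ?thesis using mdeg_top[OF _ M.mcomp_spec[OF sc]] mdeg_top[OF _ M.mcomp_spec[OF m]] by simp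
    next
      case True
      have hm: "h (M.mcomp (u \<oplus>\<^bsub>M\<^esub> w) e) = h (M.mcomp u e) + h (M.mcomp w e)" if "u \<in> carrier M" "w \<in> carrier M" for u w
        using M.mcomp_add[OF that] h_add[OF M.mcomp_spec[OF that(1)] M.mcomp_spec[OF that(2)]] by simp
      have "h (M.mcomp ?s e) = (\<Sum>p\<in>I. h (M.mcomp (f p m \<odot>\<^bsub>M\<^esub> xx p) e))"
        by (rule M.M.finsum_image_sum(1)[OF full, where f = "\<lambda>u. h (M.mcomp u e)"]) (simp_all add: hm tc)
      also have "\<dots> = (\<Sum>p\<in>I. if fst p = e then act (f p m) (b e (snd p)) else 0)"
      proof (rule sum.cong[OF refl])
        fix p assume p: "p \<in> I"
        have "f p m \<odot>\<^bsub>M\<^esub> xx p \<in> mdeg M (fst p)" using M.mdeg_smult[OF fd[OF p m] xp[OF p]] by simp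
        then have "M.mcomp (f p m \<odot>\<^bsub>M\<^esub> xx p) e = (if fst p = e then f p m \<odot>\<^bsub>M\<^esub> xx p else \<zero>\<^bsub>M\<^esub>)"
          using M.mcomp_homogeneous by auto
        moreover have "h (f p m \<odot>\<^bsub>M\<^esub> xx p) = act (f p m) (b (fst p) (snd p))"
          using h_act[OF fd[OF p m] xp[OF p]] x(2)[OF Ip(1)[OF p]] by (simp add: xx_def)
        ultimately show "h (M.mcomp (f p m \<odot>\<^bsub>M\<^esub> xx p) e) = (if fst p = e then act (f p m) (b e (snd p)) else 0)"
          using h_zero by auto
      qed
      also have "\<dots> = (\<Sum>d<top. \<Sum>j<n d. if d = e then act (ph d j (h (M.mcomp m d))) (b e j) else 0)"
        unfolding I_def by (subst sum.Sigma) (auto simp: f_def case_prod_beta intro!: sum.cong)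
      also have "\<dots> = (\<Sum>d<top. if d = e then \<Sum>j<n e. act (ph e j (h (M.mcomp m e))) (b e j) else 0)"
        by (intro sum.cong) auto
      also have "\<dots> = h (M.mcomp m e)" using True dual_basis_sum[OF D hc[OF m]] by simp
      finally show ?thesis using h_inj[OF M.mcomp_spec[OF sc] M.mcomp_spec[OF m]] by blast
    qed
    have "?s = finsum M (M.mcomp ?s) {i. M.mcomp ?s i \<noteq> \<zero>\<^bsub>M\<^esub>}"
      using M.mcomp_sum[OF sc M.finite_mcomp[OF sc]] by simp
    also have "\<dots> = m" unfolding ext[of "M.mcomp ?s" "M.mcomp m", OF eq] by (rule M.mcomp_sum[OF m M.finite_mcomp[OF m]]) simp
    finally show "?s = m" .
  qed
qed

end

end

declare of_nat_add [simp]

section \<open>The algebra of a graded linear category\<close>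

context linear_category
begin

abbreviation "R \<equiv> category_algebra C"
abbreviation "RC \<equiv> carrier R"
abbreviation "Rd \<equiv> degree_part R"
abbreviation "scal \<equiv> algebra_scalar R"
abbreviation "Ob \<equiv> cat_obj C"
abbreviation "Hom \<equiv> cat_hom C"
abbreviation "Comp \<equiv> cat_comp C"
abbreviation "Deg \<equiv> cat_degree C"
abbreviation "Scale \<equiv> cat_scale C"
abbreviation "Ident \<equiv> cat_ident C"

lemma R_simps: "RC = families (Ob) (Hom)" "zero R = 0" "add R = (+)"
  "Rd i = families (Ob) (\<lambda>x y. Deg x y i)"
  by (auto simp: category_algebra_def fun_eq_iff)

lemma R_mult: "(b \<otimes>\<^bsub>R\<^esub> a) x z = (if x \<in> Ob \<and> z \<in> Ob then \<Sum>y\<in>Ob. Comp x y z (b y z) (a x y) else 0)"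
  by (simp add: category_algebra_def)

lemma R_one: "\<one>\<^bsub>R\<^esub> x y = (if x = y \<and> x \<in> Ob then Ident x else 0)"
  by (simp add: category_algebra_def)

lemma subspace_agrp: "V.subspace W \<Longrightarrow> agrp W"
  by (auto simp: agrp_def V.subspace_0 V.subspace_add V.subspace_neg)

lemma hom_agrp: "x \<in> Ob \<Longrightarrow> y \<in> Ob \<Longrightarrow> agrp (Hom x y)"
  by (rule subspace_agrp[OF hom_subspace])

lemma families_agrp:
  assumes "\<And>x y. x \<in> X \<Longrightarrow> y \<in> X \<Longrightarrow> agrp (H x y)"
  shows "agrp (families X H)"
  using assms by (auto simp: agrp_def families_def)

lemma families_hom: "a \<in> RC \<Longrightarrow> x \<in> Ob \<Longrightarrow> y \<in> Ob \<Longrightarrow> a x y \<in> Hom x y"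
  by (simp add: R_simps families_def)

lemma families_out: "a \<in> RC \<Longrightarrow> \<not> (x \<in> Ob \<and> y \<in> Ob) \<Longrightarrow> a x y = 0"
  by (simp add: R_simps families_def)

lemma carrierI: "(\<And>x y. x \<in> Ob \<Longrightarrow> y \<in> Ob \<Longrightarrow> a x y \<in> Hom x y) \<Longrightarrow>
    (\<And>x y. \<not> (x \<in> Ob \<and> y \<in> Ob) \<Longrightarrow> a x y = 0) \<Longrightarrow> a \<in> RC"
  by (auto simp: R_simps families_def)

lemma comp_sum_right:
  assumes "x \<in> Ob" "y \<in> Ob" "z \<in> Ob" "g \<in> Hom y z" "\<And>i. i \<in> I \<Longrightarrow> f i \<in> Hom x y"
  shows "Comp x y z g (sum f I) = (\<Sum>i\<in>I. Comp x y z g (f i))"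
  using assms by (intro additive_on_sum[OF hom_agrp[of x y]]) (auto simp: additive_on_def comp_add_right)

lemma comp_sum_left:
  assumes "x \<in> Ob" "y \<in> Ob" "z \<in> Ob" "f \<in> Hom x y" "\<And>i. i \<in> I \<Longrightarrow> g i \<in> Hom y z"
  shows "Comp x y z (sum g I) f = (\<Sum>i\<in>I. Comp x y z (g i) f)"
  using assms by (intro additive_on_sum[OF hom_agrp[of y z], where f = "\<lambda>g. Comp x y z g f"])
    (auto simp: additive_on_def comp_add_left)

lemma comp_zero:
  assumes "x \<in> Ob" "y \<in> Ob" "z \<in> Ob"
  shows "g \<in> Hom y z \<Longrightarrow> Comp x y z g 0 = 0" "f \<in> Hom x y \<Longrightarrow> Comp x y z 0 f = 0"
  using comp_sum_right[OF assms, of g "{}"] comp_sum_left[OF assms, of f "{}"] by simp_all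

lemma mult_closed:
  assumes b: "b \<in> RC" and a: "a \<in> RC"
  shows "b \<otimes>\<^bsub>R\<^esub> a \<in> RC"
  by (rule carrierI) (auto simp: R_mult intro!: agrp_sum[OF hom_agrp] comp_closed families_hom[OF a] families_hom[OF b])

lemma one_closed': "\<one>\<^bsub>R\<^esub> \<in> RC"
  by (rule carrierI) (auto simp: R_one ident_closed agrp_zero[OF hom_agrp])

lemma mult_assoc':
  assumes a: "a \<in> RC" and b: "b \<in> RC" and c: "c \<in> RC"
  shows "(c \<otimes>\<^bsub>R\<^esub> b) \<otimes>\<^bsub>R\<^esub> a = c \<otimes>\<^bsub>R\<^esub> (b \<otimes>\<^bsub>R\<^esub> a)"
proof (intro ext)
  fix w z
  show "((c \<otimes>\<^bsub>R\<^esub> b) \<otimes>\<^bsub>R\<^esub> a) w z = (c \<otimes>\<^bsub>R\<^esub> (b \<otimes>\<^bsub>R\<^esub> a)) w z"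
  proof (cases "w \<in> Ob \<and> z \<in> Ob")
    case True
    then have w: "w \<in> Ob" and z: "z \<in> Ob" by auto
    have "((c \<otimes>\<^bsub>R\<^esub> b) \<otimes>\<^bsub>R\<^esub> a) w z = (\<Sum>x\<in>Ob. \<Sum>y\<in>Ob. Comp w x z (Comp x y z (c y z) (b x y)) (a w x))"
      using w z families_hom[OF a] families_hom[OF b] families_hom[OF c]
      by (auto simp: R_mult intro!: sum.cong comp_sum_left comp_closed)
    also have "\<dots> = (\<Sum>x\<in>Ob. \<Sum>y\<in>Ob. Comp w y z (c y z) (Comp w x y (b x y) (a w x)))"
      using w z families_hom[OF a] families_hom[OF b] families_hom[OF c]
      by (auto intro!: sum.cong comp_assoc[symmetric])
    also have "\<dots> = (\<Sum>y\<in>Ob. \<Sum>x\<in>Ob. Comp w y z (c y z) (Comp w x y (b x y) (a w x)))"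
      by (rule sum.swap)
    also have "\<dots> = (c \<otimes>\<^bsub>R\<^esub> (b \<otimes>\<^bsub>R\<^esub> a)) w z"
      using w z families_hom[OF a] families_hom[OF b] families_hom[OF c]
      by (auto simp: R_mult intro!: sum.cong comp_sum_right[symmetric] comp_closed)
    finally show ?thesis .
  qed (auto simp: R_mult)
qed

lemma mult_one_right: "a \<in> RC \<Longrightarrow> a \<otimes>\<^bsub>R\<^esub> \<one>\<^bsub>R\<^esub> = a"
proof (intro ext)
  fix x z assume a: "a \<in> RC"
  show "(a \<otimes>\<^bsub>R\<^esub> \<one>\<^bsub>R\<^esub>) x z = a x z"
  proof (cases "x \<in> Ob \<and> z \<in> Ob")
    case True
    then have "(a \<otimes>\<^bsub>R\<^esub> \<one>\<^bsub>R\<^esub>) x z = (\<Sum>y\<in>Ob. if y = x then a x z else 0)"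
      using families_hom[OF a] by (auto simp: R_mult R_one comp_ident_right comp_zero intro!: sum.cong)
    then show ?thesis using True finite_obj by simp
  qed (auto simp: R_mult families_out[OF a])
qed

lemma mult_one_left: "a \<in> RC \<Longrightarrow> \<one>\<^bsub>R\<^esub> \<otimes>\<^bsub>R\<^esub> a = a"
proof (intro ext)
  fix x z assume a: "a \<in> RC"
  show "(\<one>\<^bsub>R\<^esub> \<otimes>\<^bsub>R\<^esub> a) x z = a x z"
  proof (cases "x \<in> Ob \<and> z \<in> Ob")
    case True
    then have "(\<one>\<^bsub>R\<^esub> \<otimes>\<^bsub>R\<^esub> a) x z = (\<Sum>y\<in>Ob. if y = z then a x z else 0)"
      using families_hom[OF a] by (auto simp: R_mult R_one comp_ident_left comp_zero intro!: sum.cong)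
    then show ?thesis using True finite_obj by simp
  qed (auto simp: R_mult families_out[OF a])
qed

lemma ring_R: "ring R"
proof (rule ringI)
  show "abelian_group R" by (rule agrp_abelian_group) (auto simp: R_simps intro: families_agrp hom_agrp)
  show "monoid R" by (intro monoidI) (auto simp: mult_closed one_closed' mult_assoc' mult_one_left mult_one_right)
  show "(a \<oplus>\<^bsub>R\<^esub> b) \<otimes>\<^bsub>R\<^esub> c = a \<otimes>\<^bsub>R\<^esub> c \<oplus>\<^bsub>R\<^esub> b \<otimes>\<^bsub>R\<^esub> c" if "a \<in> RC" "b \<in> RC" "c \<in> RC" for a b c
    using that families_hom by (auto simp: fun_eq_iff R_simps(3) R_mult comp_add_left sum.distrib[symmetric] intro!: sum.cong)
  show "c \<otimes>\<^bsub>R\<^esub> (a \<oplus>\<^bsub>R\<^esub> b) = c \<otimes>\<^bsub>R\<^esub> a \<oplus>\<^bsub>R\<^esub> c \<otimes>\<^bsub>R\<^esub> b" if "a \<in> RC" "b \<in> RC" "c \<in> RC" for a b c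
    using that families_hom by (auto simp: fun_eq_iff R_simps(3) R_mult comp_add_right sum.distrib[symmetric] intro!: sum.cong)
qed

lemma scalar_apply: "scal c x y = (if x = y \<and> x \<in> Ob then Scale c (Ident x) else 0)"
  by (auto simp: algebra_scalar_def category_algebra_def)

lemma scalar_mult: "a \<in> RC \<Longrightarrow> (scal c \<otimes>\<^bsub>R\<^esub> a) x z = Scale c (a x z)"
proof -
  assume a: "a \<in> RC"
  show ?thesis
  proof (cases "x \<in> Ob \<and> z \<in> Ob")
    case True
    then have "(scal c \<otimes>\<^bsub>R\<^esub> a) x z = (\<Sum>y\<in>Ob. if y = z then Scale c (a x z) else 0)"
      using families_hom[OF a] ident_closed
      by (auto simp: R_mult scalar_apply comp_scale_left comp_ident_left comp_zero intro!: sum.cong)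
    then show ?thesis using True finite_obj by simp
  qed (auto simp: R_mult families_out[OF a])
qed

text \<open>A matrix unit: the algebra element with \<open>f\<close> as its only component. It
  translates between statements about morphisms and statements about the algebra.\<close>

definition single :: "'o \<Rightarrow> 'o \<Rightarrow> 'a \<Rightarrow> 'o \<Rightarrow> 'o \<Rightarrow> 'a"
  where "single x y f = (\<lambda>x' y'. if x' = x \<and> y' = y then f else 0)"

lemma single_carrier: "x \<in> Ob \<Longrightarrow> y \<in> Ob \<Longrightarrow> f \<in> Hom x y \<Longrightarrow> single x y f \<in> RC"
  by (rule carrierI) (auto simp: single_def agrp_zero[OF hom_agrp])

end

section \<open>Graded linear categories\<close>

text \<open>What the algebra construction uses of a grading, stated for morphisms. Both the given
  category and its subcategory with scalar endomorphisms are shown to be instances.\<close>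

locale gcat = linear_category C
  for C :: "('k::field, 'o, 'a::ab_group_add) graded_category" +
  assumes deg_subspace: "\<lbrakk>x \<in> Ob; y \<in> Ob\<rbrakk> \<Longrightarrow> V.subspace (Deg x y i)"
    and deg_hom: "\<lbrakk>x \<in> Ob; y \<in> Ob; f \<in> Deg x y i\<rbrakk> \<Longrightarrow> f \<in> Hom x y"
    and deg_direct_sum:
      "\<lbrakk>x \<in> Ob; y \<in> Ob; f \<in> Hom x y\<rbrakk> \<Longrightarrow>
        \<exists>!c. (\<forall>i. c i \<in> Deg x y i) \<and> finite {i. c i \<noteq> 0} \<and> f = (\<Sum>i | c i \<noteq> 0. c i)"
    and deg_comp: "\<lbrakk>x \<in> Ob; y \<in> Ob; z \<in> Ob; f \<in> Deg x y i; g \<in> Deg y z j\<rbrakk> \<Longrightarrow>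
        Comp x y z g f \<in> Deg x z (j + i)"
    and ident_deg: "x \<in> Ob \<Longrightarrow> Ident x \<in> Deg x x 0"
begin

definition hcomp :: "'o \<Rightarrow> 'o \<Rightarrow> 'a \<Rightarrow> nat \<Rightarrow> 'a"
  where "hcomp x y f = (THE c. (\<forall>i. c i \<in> Deg x y i) \<and> finite {i. c i \<noteq> 0} \<and> f = (\<Sum>i | c i \<noteq> 0. c i))"

context
  fixes x y assumes x: "x \<in> Ob" and y: "y \<in> Ob"
begin

lemma hcomp_spec:
  assumes "f \<in> Hom x y"
  shows "hcomp x y f i \<in> Deg x y i" "finite {i. hcomp x y f i \<noteq> 0}" "(\<Sum>i | hcomp x y f i \<noteq> 0. hcomp x y f i) = f"
proof -
  note t = theI'[OF deg_direct_sum[OF x y assms], folded hcomp_def]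
  show "hcomp x y f i \<in> Deg x y i" by (rule t[THEN conjunct1, rule_format])
  show "finite {i. hcomp x y f i \<noteq> 0}" by (rule t[THEN conjunct2, THEN conjunct1])
  show "(\<Sum>i | hcomp x y f i \<noteq> 0. hcomp x y f i) = f" by (rule t[THEN conjunct2, THEN conjunct2, symmetric])
qed

lemma hcomp_unique:
  assumes c: "\<And>i. c i \<in> Deg x y i" and F: "finite F" "\<And>i. i \<notin> F \<Longrightarrow> c i = 0" and f: "f = sum c F"
  shows "hcomp x y f = c"
proof -
  have fh: "f \<in> Hom x y" unfolding f using deg_hom[OF x y c] by (intro agrp_sum[OF hom_agrp[OF x y]])
  have sub: "{i. c i \<noteq> 0} \<subseteq> F" using F(2) by blast
  then have "f = (\<Sum>i | c i \<noteq> 0. c i)" unfolding f using F(1) by (intro sum.mono_neutral_right) auto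
  then show ?thesis unfolding hcomp_def using c finite_subset[OF sub F(1)]
    by (intro the1_equality[OF deg_direct_sum[OF x y fh]] conjI allI)
qed

lemma hcomp_sum:
  assumes "f \<in> Hom x y" "finite F" "\<And>i. i \<notin> F \<Longrightarrow> hcomp x y f i = 0"
  shows "sum (hcomp x y f) F = f"
proof -
  have "sum (hcomp x y f) F = (\<Sum>i | hcomp x y f i \<noteq> 0. hcomp x y f i)"
    using assms by (intro sum.mono_neutral_right) auto
  then show ?thesis using hcomp_spec(3)[OF assms(1)] by simp
qed

lemma deg_agrp: "agrp (Deg x y i)"
  by (rule subspace_agrp[OF deg_subspace[OF x y]])

lemma hcomp_deg: "f \<in> Deg x y i \<Longrightarrow> hcomp x y f = (\<lambda>j. if i = j then f else 0)"
  by (rule hcomp_unique[of _ "{i}"]) (auto simp: agrp_zero[OF deg_agrp])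

lemma hcomp_add:
  assumes f: "f \<in> Hom x y" and g: "g \<in> Hom x y"
  shows "hcomp x y (f + g) = (\<lambda>i. hcomp x y f i + hcomp x y g i)"
proof -
  note sf = hcomp_spec[OF f] and sg = hcomp_spec[OF g]
  let ?F = "{i. hcomp x y f i \<noteq> 0} \<union> {i. hcomp x y g i \<noteq> 0}"
  show ?thesis
  proof (rule hcomp_unique[of _ ?F])
    have "sum (hcomp x y f) ?F = f" "sum (hcomp x y g) ?F = g" using sf(2) sg(2) by (intro hcomp_sum f g; simp)+
    then show "f + g = (\<Sum>i\<in>?F. hcomp x y f i + hcomp x y g i)" unfolding sum.distrib by simp
    show "hcomp x y f i + hcomp x y g i \<in> Deg x y i" for i by (rule agrp_add[OF deg_agrp sf(1) sg(1)])
  qed (use sf(2) sg(2) in simp_all)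
qed

lemma hcomp_scale:
  assumes f: "f \<in> Hom x y"
  shows "hcomp x y (Scale c f) = (\<lambda>i. Scale c (hcomp x y f i))"
proof -
  note sf = hcomp_spec[OF f]
  let ?F = "{i. hcomp x y f i \<noteq> 0}"
  show ?thesis
  proof (rule hcomp_unique[of _ ?F])
    show "Scale c f = (\<Sum>i\<in>?F. Scale c (hcomp x y f i))"
      unfolding V.scale_sum_right[symmetric] using sf(3) by simp
    show "Scale c (hcomp x y f i) \<in> Deg x y i" for i by (rule V.subspace_scale[OF deg_subspace[OF x y] sf(1)])
  qed (use sf(2) in simp_all)
qed

text \<open>The components of a finite spanning set are bounded in degree, and the morphisms that
  obey a given bound form a subspace.\<close>

lemma hcomp_bound: "\<exists>n. \<forall>f\<in>Hom x y. \<forall>i\<ge>n. hcomp x y f i = 0"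
proof -
  obtain B where B: "finite B" "Hom x y = V.span B" using hom_finite_dim[OF x y] by blast
  have Bh: "b \<in> Hom x y" if "b \<in> B" for b using B(2) that V.span_superset by blast
  have "finite (\<Union>b\<in>B. {i. hcomp x y b i \<noteq> 0})" using B(1) hcomp_spec(2)[OF Bh] by blast
  then obtain n where n: "\<forall>i\<in>(\<Union>b\<in>B. {i. hcomp x y b i \<noteq> 0}). i < n" using finite_nat_set_iff_bounded by blast
  let ?W = "{f \<in> Hom x y. \<forall>i\<ge>n. hcomp x y f i = 0}"
  have "V.subspace ?W"
  proof (rule V.subspaceI)
    show "0 \<in> ?W" using agrp_zero[OF hom_agrp[OF x y]] hcomp_deg[OF agrp_zero[OF deg_agrp[of 0]]] by simp
    show "f + g \<in> ?W" if "f \<in> ?W" "g \<in> ?W" for f g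
      using that agrp_add[OF hom_agrp[OF x y]] hcomp_add by simp
    show "Scale c f \<in> ?W" if "f \<in> ?W" for c f
      using that V.subspace_scale[OF hom_subspace[OF x y]] hcomp_scale by simp
  qed
  moreover have "B \<subseteq> ?W" using Bh n by (auto simp: not_less[symmetric])
  ultimately have "V.span B \<subseteq> ?W" by (intro V.span_minimal)
  then show ?thesis using B(2) by blast
qed

lemma subspace_finite_basis:
  assumes W: "V.subspace W" "W \<subseteq> Hom x y"
  shows "\<exists>U. finite U \<and> U \<subseteq> W \<and> V.independent U \<and> V.span U = W"
proof -
  obtain B where B: "finite B" "Hom x y = V.span B" using hom_finite_dim[OF x y] by blast
  obtain U where U: "U \<subseteq> W" "V.independent U" "W \<subseteq> V.span U" using V.maximal_independent_subset[of W] by blast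
  have "finite U" using V.independent_span_bound[OF B(1) U(2)] U(1) W(2) B(2) by blast
  moreover have "V.span U = W" using U V.span_minimal[OF U(1) W(1)] by blast
  ultimately show ?thesis using U by blast
qed

end

definition acomp :: "nat \<Rightarrow> ('o \<Rightarrow> 'o \<Rightarrow> 'a) \<Rightarrow> 'o \<Rightarrow> 'o \<Rightarrow> 'a"
  where "acomp i a x y = (if x \<in> Ob \<and> y \<in> Ob then hcomp x y (a x y) i else 0)"

lemma single_degree: "x \<in> Ob \<Longrightarrow> y \<in> Ob \<Longrightarrow> f \<in> Deg x y i \<Longrightarrow> single x y f \<in> Rd i"
  by (auto simp: R_simps families_def single_def agrp_zero[OF deg_agrp])

lemma top_exists: "\<exists>n. \<forall>x\<in>Ob. \<forall>y\<in>Ob. \<forall>f\<in>Hom x y. \<forall>i\<ge>n. hcomp x y f i = 0"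
proof -
  have "\<forall>p\<in>Ob \<times> Ob. \<exists>n. \<forall>f\<in>Hom (fst p) (snd p). \<forall>i\<ge>n. hcomp (fst p) (snd p) f i = 0"
    using hcomp_bound by auto
  then obtain N where N: "\<forall>p\<in>Ob \<times> Ob. \<forall>f\<in>Hom (fst p) (snd p). \<forall>i\<ge>N p. hcomp (fst p) (snd p) f i = 0"
    by (rule bchoice[THEN exE])
  \<comment> \<open>The sum of the bounds for all pairs of objects serves as a common bound.\<close>
  let ?n = "\<Sum>p\<in>Ob \<times> Ob. N p"
  show ?thesis
  proof (intro exI[of _ ?n] ballI allI impI)
    fix x y f i assume x: "x \<in> Ob" and y: "y \<in> Ob" and f: "f \<in> Hom x y" and i: "?n \<le> i"
    have "N (x, y) \<le> ?n" using x y finite_obj by (intro member_le_sum) auto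
    then show "hcomp x y f i = 0" using N[rule_format, of "(x, y)" f i] x y f i by simp
  qed
qed

definition topdeg :: nat
  where "topdeg = (SOME n. \<forall>x\<in>Ob. \<forall>y\<in>Ob. \<forall>f\<in>Hom x y. \<forall>i\<ge>n. hcomp x y f i = 0)"

lemma hcomp_topdeg: "x \<in> Ob \<Longrightarrow> y \<in> Ob \<Longrightarrow> f \<in> Hom x y \<Longrightarrow> topdeg \<le> i \<Longrightarrow> hcomp x y f i = 0"
  using someI_ex[OF top_exists, folded topdeg_def] by blast

lemma degree_part_carrier: "a \<in> Rd i \<Longrightarrow> a \<in> RC"
  by (rule carrierI) (auto simp: R_simps families_def split: if_splits intro: deg_hom)

lemma degree_partD: "a \<in> Rd i \<Longrightarrow> x \<in> Ob \<Longrightarrow> y \<in> Ob \<Longrightarrow> a x y \<in> Deg x y i"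
  by (simp add: R_simps families_def)

lemma degree_partI: "(\<And>x y. x \<in> Ob \<Longrightarrow> y \<in> Ob \<Longrightarrow> a x y \<in> Deg x y i) \<Longrightarrow>
    (\<And>x y. \<not> (x \<in> Ob \<and> y \<in> Ob) \<Longrightarrow> a x y = 0) \<Longrightarrow> a \<in> Rd i"
  by (auto simp: R_simps families_def)

text \<open>The matrix units at basis vectors of the homogeneous hom-spaces span.\<close>

lemma R_fin_dim: "\<exists>U. finite U \<and> U \<subseteq> Rd i \<and>
      (\<forall>a\<in>Rd i. \<exists>c. a = (\<Sum>u\<in>U. scal (c u) \<otimes>\<^bsub>R\<^esub> u))"
proof -
  let ?X = "Ob"
  have "\<forall>p\<in>?X \<times> ?X. \<exists>U. finite U \<and> U \<subseteq> Deg (fst p) (snd p) i \<and> V.independent U \<and> V.span U = Deg (fst p) (snd p) i"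
    using subspace_finite_basis deg_subspace deg_hom by (auto simp: subset_iff)
  then obtain B where B: "\<forall>p\<in>?X \<times> ?X. finite (B p) \<and> B p \<subseteq> Deg (fst p) (snd p) i \<and> V.independent (B p) \<and>
      V.span (B p) = Deg (fst p) (snd p) i" by (rule bchoice[THEN exE])
  define I where "I = Sigma (?X \<times> ?X) B"
  define w where "w q = single (fst (fst q)) (snd (fst q)) (snd q)" for q
  have fI: "finite I" using B finite_obj by (auto simp: I_def)
  have wd: "w q \<in> Rd i" if "q \<in> I" for q
  proof -
    obtain x y u where q: "q = ((x, y), u)" by (metis prod.collapse)
    then have "x \<in> ?X" "y \<in> ?X" "u \<in> B (x, y)" using that by (auto simp: I_def)
    moreover have "B (x, y) \<subseteq> Deg x y i" if "x \<in> ?X" "y \<in> ?X" using B[rule_format, of "(x, y)"] that by simp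
    ultimately show ?thesis unfolding w_def q by (auto intro!: single_degree)
  qed
  have wc: "w q \<in> RC" if "q \<in> I" for q using degree_part_carrier[OF wd[OF that]] .
  have "\<exists>c. a = (\<Sum>u\<in>w ` I. scal (c u) \<otimes>\<^bsub>R\<^esub> u)" if a: "a \<in> Rd i" for a
  proof -
    define c where "c q = V.representation (B (fst q)) (a (fst (fst q)) (snd (fst q))) (snd q)" for q
    have a1: "a = (\<Sum>q\<in>I. scal (c q) \<otimes>\<^bsub>R\<^esub> w q)"
    proof (intro ext)
      fix x y
      show "a x y = (\<Sum>q\<in>I. scal (c q) \<otimes>\<^bsub>R\<^esub> w q) x y"
      proof (cases "x \<in> ?X \<and> y \<in> ?X")
        case True
        have "(\<Sum>q\<in>I. scal (c q) \<otimes>\<^bsub>R\<^esub> w q) x y = (\<Sum>q\<in>I. Scale (c q) (w q x y))"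
          using scalar_mult[OF wc] by (simp add: sum_apply)
        also have "\<dots> = (\<Sum>p\<in>?X \<times> ?X. \<Sum>u\<in>B p. Scale (c (p, u)) (w (p, u) x y))"
          unfolding I_def using B finite_obj by (subst sum.Sigma) (auto simp: case_prod_beta)
        also have "\<dots> = (\<Sum>p\<in>?X \<times> ?X. if p = (x, y) then \<Sum>u\<in>B (x, y). Scale (c ((x, y), u)) u else 0)"
          by (intro sum.cong refl) (auto simp: w_def single_def intro!: sum.neutral split: if_splits)
        also have "\<dots> = (\<Sum>u\<in>B (x, y). Scale (c ((x, y), u)) u)" using True finite_obj by simp
        also have "\<dots> = a x y"
          unfolding c_def using B[rule_format, of "(x, y)"] True degree_partD[OF a, of x y]
          by simp (intro V.sum_representation_eq, auto)
        finally show ?thesis by simp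
      next
        case False
        have "w q x y = 0" if "q \<in> I" for q using False that by (auto simp: w_def single_def I_def)
        then have "(\<Sum>q\<in>I. scal (c q) \<otimes>\<^bsub>R\<^esub> w q) x y = 0" using scalar_mult[OF wc] by (simp add: sum_apply)
        then show ?thesis using families_out[OF degree_part_carrier[OF a] False] by simp
      qed
    qed
    \<comment> \<open>Coefficients are collected over equal values of \<open>w\<close>, so the
      argument works without comparing the matrix units with each other.\<close>
    define c' where "c' u = (\<Sum>q\<in>{q \<in> I. w q = u}. c q)" for u
    have "a = (\<Sum>u\<in>w ` I. \<Sum>q\<in>{q \<in> I. w q = u}. scal (c q) \<otimes>\<^bsub>R\<^esub> w q)"
      using sum.image_gen[OF fI, of "\<lambda>q. scal (c q) \<otimes>\<^bsub>R\<^esub> w q" w] a1 by simp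
    also have "\<dots> = (\<Sum>u\<in>w ` I. scal (c' u) \<otimes>\<^bsub>R\<^esub> u)"
    proof (intro sum.cong refl ext)
      fix u x y assume "u \<in> w ` I"
      then have uc: "u \<in> RC" using wc by blast
      have "(\<Sum>q\<in>{q \<in> I. w q = u}. scal (c q) \<otimes>\<^bsub>R\<^esub> w q) x y = (\<Sum>q\<in>{q \<in> I. w q = u}. Scale (c q) (u x y))"
        unfolding sum_apply using scalar_mult[OF uc] by (intro sum.cong) auto
      also have "\<dots> = (scal (c' u) \<otimes>\<^bsub>R\<^esub> u) x y"
        unfolding scalar_mult[OF uc] c'_def V.scale_sum_left ..
      finally show "(\<Sum>q\<in>{q \<in> I. w q = u}. scal (c q) \<otimes>\<^bsub>R\<^esub> w q) x y = (scal (c' u) \<otimes>\<^bsub>R\<^esub> u) x y" .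
    qed
    finally show ?thesis by (rule exI[of _ c'])
  qed
  then show ?thesis using fI wd by (intro exI[of _ "w ` I"]) auto
qed

lemma galgebra_R: "galgebra R acomp topdeg"
proof (rule galgebra.intro)
  show "ring R" by (rule ring_R)
  show "add R = (+)" "zero R = 0" by (simp_all add: R_simps)
  show "a \<in> RC" if "a \<in> Rd i" for a i by (rule degree_part_carrier[OF that])
  show "agrp (Rd i)" for i by (simp add: R_simps families_agrp deg_agrp)
  show "a \<otimes>\<^bsub>R\<^esub> b \<in> Rd (i + j)" if a: "a \<in> Rd i" and b: "b \<in> Rd j" for a b i j
    by (rule degree_partI) (auto simp: R_mult intro!: agrp_sum[OF deg_agrp] deg_comp degree_partD[OF a] degree_partD[OF b])
  show "\<one>\<^bsub>R\<^esub> \<in> Rd 0"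
    by (rule degree_partI) (auto simp: R_one ident_deg agrp_zero[OF deg_agrp])
  show "acomp i a \<in> Rd i" if "a \<in> RC" for a i
    by (rule degree_partI) (auto simp: acomp_def intro!: hcomp_spec families_hom[OF that])
  show "acomp i (a + b) = acomp i a + acomp i b" if "a \<in> RC" "b \<in> RC" for a b i
    using hcomp_add families_hom[OF that(1)] families_hom[OF that(2)] by (auto simp: acomp_def fun_eq_iff)
  show "acomp j a = (if i = j then a else 0)" if "a \<in> Rd i" for a i j
    using hcomp_deg[OF _ _ degree_partD[OF that]] families_out[OF degree_part_carrier[OF that]]
    by (auto simp: acomp_def fun_eq_iff)
  show "(\<Sum>i<topdeg. acomp i a) = a" if a: "a \<in> RC" for a
  proof (intro ext)
    fix x y show "(\<Sum>i<topdeg. acomp i a) x y = a x y"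
    proof (cases "x \<in> Ob \<and> y \<in> Ob")
      case True
      then have "(\<Sum>i<topdeg. hcomp x y (a x y) i) = a x y"
        using hcomp_topdeg families_hom[OF a] by (intro hcomp_sum) auto
      then show ?thesis using True by (simp add: sum_apply acomp_def)
    next
      case False
      then have "(\<Sum>i<topdeg. acomp i a x y) = 0" by (intro sum.neutral) (auto simp: acomp_def)
      then show ?thesis using families_out[OF a False] by (simp add: sum_apply)
    qed
  qed
  show "scal (c + d) = scal c + scal d" for c d
    by (auto simp: fun_eq_iff scalar_apply V.scale_left_distrib)
  have sd: "scal c \<in> Rd 0" for c
    by (rule degree_partI) (auto simp: scalar_apply agrp_zero[OF deg_agrp] intro!: V.subspace_scale[OF deg_subspace] ident_deg)
  then show "scal c \<in> Rd 0" for c .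
  show "scal (c * d) = scal c \<otimes>\<^bsub>R\<^esub> scal d" for c d
    by (auto simp: fun_eq_iff scalar_mult[OF degree_part_carrier[OF sd]] scalar_apply)
  show "scal 1 = \<one>\<^bsub>R\<^esub>" by (auto simp: fun_eq_iff scalar_apply R_one)
  show "\<exists>U. finite U \<and> U \<subseteq> Rd i \<and> (\<forall>a\<in>Rd i. \<exists>c. a = (\<Sum>u\<in>U. scal (c u) \<otimes>\<^bsub>R\<^esub> u))" for i
    by (rule R_fin_dim)
qed

sublocale G: galgebra R acomp topdeg
  by (rule galgebra_R)

end

section \<open>Passing to scalar endomorphisms\<close>

context graded_directed_category
begin

lemma single_degree':
  assumes "x \<in> Ob" "y \<in> Ob" "f \<in> Deg x y i"
  shows "single x y f \<in> Rd i"
  using assms V.subspace_0 cat_degree_subspace by (auto simp: R_simps families_def single_def)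

lemma single_mult:
  assumes x: "x \<in> Ob" and y: "y \<in> Ob" and z: "z \<in> Ob" and f: "f \<in> Hom x y" and g: "g \<in> Hom y z"
  shows "single y z g \<otimes>\<^bsub>R\<^esub> single x y f = single x z (Comp x y z g f)"
proof (intro ext)
  fix x' z'
  show "(single y z g \<otimes>\<^bsub>R\<^esub> single x y f) x' z' = single x z (Comp x y z g f) x' z'"
  proof (cases "x' \<in> Ob \<and> z' \<in> Ob")
    case True
    have "(single y z g \<otimes>\<^bsub>R\<^esub> single x y f) x' z' =
        (\<Sum>y'\<in>Ob. if y' = y then (if x' = x \<and> z' = z then Comp x y z g f else 0) else 0)"
      using True x y z f g agrp_zero[OF hom_agrp] by (auto simp: R_mult single_def comp_zero intro!: sum.cong)
    then show ?thesis using True y finite_obj by (simp add: single_def)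
  qed (use x z in \<open>auto simp: R_mult single_def\<close>)
qed

text \<open>The grading axiom concerns products in the algebra; multiplying two matrix units
  extracts the statement about a single composition.\<close>

lemma degree_comp:
  assumes x: "x \<in> Ob" and y: "y \<in> Ob" and z: "z \<in> Ob"
    and f: "f \<in> Deg x y i" and g: "g \<in> Deg y z j"
  shows "Comp x y z g f \<in> Deg x z (j + i)"
proof -
  have "single y z g \<otimes>\<^bsub>R\<^esub> single x y f \<in> generate (add_monoid R) {b \<otimes>\<^bsub>R\<^esub> a | a b. b \<in> Rd j \<and> a \<in> Rd i}"
    using single_degree'[OF x y f] single_degree'[OF y z g] by (intro generate.incl) blast
  then have "single x z (Comp x y z g f) \<in> Rd (j + i)"
    using single_mult[OF x y z] f g cat_degree_subspace x y z unfolding degree_part_mult by (metis subsetD)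
  then show ?thesis using x z by (simp add: R_simps families_def single_def) (metis (full_types))
qed

lemma endo_degree_zero:
  assumes x: "x \<in> Ob"
  shows "Deg x x 0 = Hom x x"
proof
  show "Hom x x \<subseteq> Deg x x 0"
  proof
    fix f assume "f \<in> Hom x x"
    then have "single x x f \<in> Rd 0" unfolding degree_part_zero using single_carrier[OF x x] by (simp add: single_def)
    then show "f \<in> Deg x x 0" using x by (simp add: R_simps families_def single_def) (metis (full_types))
  qed
qed (use cat_degree_subspace[OF x x] in blast)

end

sublocale graded_directed_category \<subseteq> gcat C
proof
  show "Ident x \<in> Deg x x 0" if "x \<in> Ob" for x
    using ident_closed[OF that] endo_degree_zero[OF that] by simp
  show "f \<in> Hom x y" if "x \<in> Ob" "y \<in> Ob" "f \<in> Deg x y i" for x y f i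
    using that cat_degree_subspace by blast
qed (use cat_degree_subspace cat_degree_direct_sum degree_comp in simp_all)

context graded_directed_category
begin

lemma endo_degree_Suc:
  assumes x: "x \<in> Ob"
  shows "Deg x x (Suc i) = {0}"
proof -
  have "f = 0" if f: "f \<in> Deg x x (Suc i)" for f
  proof -
    have "f \<in> Deg x x 0" using deg_hom[OF x x f] endo_degree_zero[OF x] by simp
    then have "hcomp x x f 0 = f" using hcomp_deg[OF x x, of f 0] by simp
    moreover have "hcomp x x f 0 = 0" using hcomp_deg[OF x x f] by simp
    ultimately show ?thesis by simp
  qed
  then show ?thesis using agrp_zero[OF deg_agrp[OF x x]] by blast
qed

lemma hom_cycle:
  assumes "x \<in> Ob" "y \<in> Ob" "x \<noteq> y"
  shows "Hom x y = {0} \<or> Hom y x = {0}"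
  using assms directed[of x y] directed[of y x] partial_order by (auto simp: partial_order_on_def antisym_def)

section \<open>The subcategory with scalar endomorphisms\<close>

abbreviation "D \<equiv> scalar_endo_subcategory C"

lemma D_simps [simp]: "cat_obj D = Ob" "cat_scale D = Scale" "cat_comp D = Comp" "cat_ident D = Ident"
  by (simp_all add: scalar_endo_subcategory_def)

lemma D_hom: "cat_hom D x y = (if x = y then V.span {Ident x} else Hom x y)"
  and D_degree: "cat_degree D x y i = (if x = y \<and> i = 0 then V.span {Ident x} else Deg x y i)"
  by (simp_all add: scalar_endo_subcategory_def identity_span_def V.span_singleton)

lemma ident_span: "x \<in> Ob \<Longrightarrow> V.span {Ident x} \<subseteq> Hom x x"
  using V.span_minimal[of "{Ident x}", OF _ hom_subspace] ident_closed by simp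

lemma D_hom_sub: "x \<in> Ob \<Longrightarrow> y \<in> Ob \<Longrightarrow> f \<in> cat_hom D x y \<Longrightarrow> f \<in> Hom x y"
  using ident_span by (auto simp: D_hom split: if_splits)

lemma D_degree_sub: "x \<in> Ob \<Longrightarrow> y \<in> Ob \<Longrightarrow> f \<in> cat_degree D x y i \<Longrightarrow> f \<in> Deg x y i"
  using ident_span endo_degree_zero by (auto simp: D_degree split: if_splits)

lemma ident_span_comp:
  assumes x: "x \<in> Ob" and f: "f \<in> V.span {Ident x}" and g: "g \<in> V.span {Ident x}"
  shows "Comp x x x g f \<in> V.span {Ident x}"
proof -
  obtain c where c: "g = Scale c (Ident x)" using g by (auto simp: V.span_singleton)
  have fh: "f \<in> Hom x x" using f ident_span[OF x] by blast
  show ?thesis using comp_scale_left[OF x x x fh ident_closed[OF x]] comp_ident_left[OF x x fh] V.span_scale[OF f] by (simp add: c)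
qed

text \<open>Here directedness enters: a composite that leaves \<open>x\<close> and returns is zero,
  in particular a scalar multiple of the identity, so the smaller hom-spaces are closed under
  composition.\<close>

lemma cycle_comp_zero:
  assumes x: "x \<in> Ob" and y: "y \<in> Ob" and n: "x \<noteq> y" and f: "f \<in> Hom x y" and g: "g \<in> Hom y x"
  shows "Comp x y x g f = 0"
  using hom_cycle[OF x y n]
proof
  assume "Hom x y = {0}" then show ?thesis using comp_zero(1)[OF x y x g] f by simp
next
  assume "Hom y x = {0}" then show ?thesis using comp_zero(2)[OF x y x f] g by simp
qed

lemma linear_category_D: "linear_category D"
proof (intro linear_category.intro linear_category_axioms.intro)
  show "vector_space (cat_scale D)" by simp (rule V.vector_space_axioms)
  show "finite (cat_obj D)" by (simp add: finite_obj)
  show "module.subspace (cat_scale D) (cat_hom D x y)" if "x \<in> cat_obj D" "y \<in> cat_obj D" for x y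
    using that hom_subspace by (simp add: D_hom V.subspace_span)
  show "\<exists>B. finite B \<and> cat_hom D x y = module.span (cat_scale D) B" if "x \<in> cat_obj D" "y \<in> cat_obj D" for x y
    using that hom_finite_dim by (auto simp: D_hom)
  show "cat_ident D x \<in> cat_hom D x x" if "x \<in> cat_obj D" for x
    by (simp add: D_hom V.span_base)
  show "cat_comp D x y z g f \<in> cat_hom D x z"
    if x: "x \<in> cat_obj D" and y: "y \<in> cat_obj D" and z: "z \<in> cat_obj D" and f: "f \<in> cat_hom D x y" and g: "g \<in> cat_hom D y z" for x y z f g
  proof -
    have fg: "f \<in> Hom x y" "g \<in> Hom y z" using D_hom_sub f g x y z by auto
    consider "x \<noteq> z" | "x = z" "x \<noteq> y" | "x = z" "x = y" by blast
    then show ?thesis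
    proof cases
      case 1 then show ?thesis using comp_closed[OF _ _ _ fg] x y z by (simp add: D_hom)
    next
      case 2 then show ?thesis using cycle_comp_zero[of x y f g] fg x y by (simp add: D_hom V.span_zero)
    next
      case 3 then show ?thesis using ident_span_comp f g x by (simp add: D_hom)
    qed
  qed
  show "x = y" if "x \<in> cat_obj D" "y \<in> cat_obj D" "f \<in> cat_hom D x y" "g \<in> cat_hom D y x"
    "cat_comp D x y x g f = cat_ident D x" "cat_comp D y x y f g = cat_ident D y" for x y f g
    using that D_hom_sub by (intro skeletal[of x y f g]) auto
qed (use D_hom_sub comp_add_right comp_add_left comp_scale_right comp_scale_left comp_assoc comp_ident_right comp_ident_left in simp_all)

lemma gcat_D: "gcat D"
proof (intro gcat.intro gcat_axioms.intro linear_category_D)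
  show "module.subspace (cat_scale D) (cat_degree D x y i)" if "x \<in> cat_obj D" "y \<in> cat_obj D" for x y i
    using that deg_subspace by (simp add: D_degree V.subspace_span)
  show "f \<in> cat_hom D x y" if x: "x \<in> cat_obj D" and y: "y \<in> cat_obj D" and f: "f \<in> cat_degree D x y i" for x y f i
    using x y f deg_hom[of x y f i] endo_degree_Suc[of x "i - 1"] by (auto simp: D_degree D_hom V.span_zero split: if_splits)
  show "\<exists>!c. (\<forall>i. c i \<in> cat_degree D x y i) \<and> finite {i. c i \<noteq> 0} \<and> f = (\<Sum>i | c i \<noteq> 0. c i)"
    if x: "x \<in> cat_obj D" and y: "y \<in> cat_obj D" and f: "f \<in> cat_hom D x y" for x y f
  proof (cases "x = y")
    case False
    then show ?thesis using deg_direct_sum[of x y f] x y f by (simp add: D_degree D_hom)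
  next
    case True
    show ?thesis
    proof (rule ex1I[of _ "\<lambda>i. if i = 0 then f else 0"])
      have "{i. (if i = 0 then f else 0) \<noteq> 0} = (if f = 0 then {} else {0::nat})" by auto
      then show "(\<forall>i. (if i = 0 then f else 0) \<in> cat_degree D x y i) \<and> finite {i. (if i = 0 then f else 0) \<noteq> 0} \<and>
          f = (\<Sum>i | (if i = 0 then f else 0) \<noteq> 0. if i = 0 then f else 0)"
        using f True x agrp_zero[OF deg_agrp] by (auto simp: D_degree D_hom)
      fix c assume c: "(\<forall>i. c i \<in> cat_degree D x y i) \<and> finite {i. c i \<noteq> 0} \<and> f = (\<Sum>i | c i \<noteq> 0. c i)"
      have c0: "c i = 0" if "i \<noteq> 0" for i
        using c[THEN conjunct1, rule_format, of i] endo_degree_Suc[of x "i - 1"] x True that by (simp add: D_degree)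
      have "f = (\<Sum>i | c i \<noteq> 0. c i)" using c by blast
      also have "\<dots> = (\<Sum>i\<in>{0}. c i)" using c0 c by (intro sum.mono_neutral_left) auto
      finally show "c = (\<lambda>i. if i = 0 then f else 0)" using c0 by auto
    qed
  qed
  show "cat_comp D x y z g f \<in> cat_degree D x z (j + i)"
    if x: "x \<in> cat_obj D" and y: "y \<in> cat_obj D" and z: "z \<in> cat_obj D" and f: "f \<in> cat_degree D x y i" and g: "g \<in> cat_degree D y z j" for x y z f i g j
  proof -
    have xyz: "x \<in> Ob" "y \<in> Ob" "z \<in> Ob" using x y z by auto
    have fg: "f \<in> Deg x y i" "g \<in> Deg y z j" using D_degree_sub f g x y z by auto
    have h: "Comp x y z g f \<in> Deg x z (j + i)" by (rule deg_comp[OF xyz fg])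
    consider "x \<noteq> z \<or> j + i \<noteq> 0" | "x = z" "x \<noteq> y" "j = 0" "i = 0" | "x = z" "x = y" "j = 0" "i = 0" by auto
    then show ?thesis
    proof cases
      case 1 then show ?thesis using h by (auto simp: D_degree)
    next
      case 2 then show ?thesis using cycle_comp_zero[of x y f g] deg_hom[OF _ _ fg(1)] deg_hom[OF _ _ fg(2)] x y
        by (simp add: D_degree V.span_zero)
    next
      case 3 then show ?thesis using ident_span_comp f g x by (simp add: D_degree)
    qed
  qed
  show "cat_ident D x \<in> cat_degree D x x 0" if "x \<in> cat_obj D" for x
    by (simp add: D_degree V.span_base)
qed

sublocale D: gcat D
  by (rule gcat_D)

lemma D_ops: "mult D.R = mult R" "one D.R = one R" "zero D.R = zero R" "add D.R = add R" "smult D.R = smult R"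
  by (auto simp: category_algebra_def fun_eq_iff)

lemma D_scalar: "algebra_scalar D.R = scal"
  by (simp add: fun_eq_iff algebra_scalar_def D_ops)

lemma D_part_sub: "a \<in> degree_part D.R i \<Longrightarrow> a \<in> Rd i"
  using D_degree_sub by (simp add: R_simps D.R_simps families_def)

lemma D_carrier_sub: "a \<in> carrier D.R \<Longrightarrow> a \<in> RC"
  using D_hom_sub by (simp add: R_simps D.R_simps families_def)

lemma D_part_Suc: "degree_part D.R (Suc i) = Rd (Suc i)"
  by (simp add: R_simps D.R_simps D_degree)

lemma part_zero_off: "a \<in> Rd 0 \<Longrightarrow> x \<noteq> y \<Longrightarrow> a x y = 0"
  unfolding degree_part_zero by blast

section \<open>Comparison of the two algebras\<close>

lemma zero_part_mult:
  assumes t: "t \<in> Rd 0" and a: "a \<in> RC"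
  shows "(t \<otimes>\<^bsub>R\<^esub> a) x z = (if x \<in> Ob \<and> z \<in> Ob then Comp x z z (t z z) (a x z) else 0)"
proof (cases "x \<in> Ob \<and> z \<in> Ob")
  case True
  then have "(t \<otimes>\<^bsub>R\<^esub> a) x z = (\<Sum>y\<in>Ob. if y = z then Comp x z z (t z z) (a x z) else 0)"
    using families_hom[OF a] part_zero_off[OF t] by (auto simp: R_mult comp_zero intro!: sum.cong)
  then show ?thesis using True finite_obj by simp
qed (auto simp: R_mult)

lemma zero_part_single:
  assumes t: "t \<in> Rd 0" and x: "x \<in> Ob" and y: "y \<in> Ob" and u: "u \<in> Hom x y"
  shows "t \<otimes>\<^bsub>R\<^esub> single x y u = single x y (Comp x y y (t y y) u)"
proof (intro ext)
  fix x' y'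
  have "Comp x' y' y' (t y' y') 0 = 0" if "x' \<in> Ob" "y' \<in> Ob"
    using comp_zero(1)[OF that that(2) families_hom[OF degree_part_carrier[OF t] that(2) that(2)]] .
  then show "(t \<otimes>\<^bsub>R\<^esub> single x y u) x' y' = single x y (Comp x y y (t y y) u) x' y'"
    using zero_part_mult[OF t single_carrier[OF x y u], of x' y'] x y by (auto simp: single_def)
qed

text \<open>The degree zero part of the subcategory acts on each endomorphism space through scalars,
  so vector space bases of these spaces form a dual basis: the functional at \<open>(x, u)\<close>
  gives the coefficient of \<open>u\<close>, times the identity of \<open>x\<close>.\<close>

lemma D_sproj_zero: "D.G.sproj (Rd 0) (mult R)"
proof -
  let ?X = "Ob"
  have "\<forall>x\<in>?X. \<exists>U. finite U \<and> U \<subseteq> Hom x x \<and> V.independent U \<and> V.span U = Hom x x"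
    using subspace_finite_basis hom_subspace by simp
  then obtain B where B: "\<forall>x\<in>?X. finite (B x) \<and> B x \<subseteq> Hom x x \<and> V.independent (B x) \<and> V.span (B x) = Hom x x"
    by (rule bchoice[THEN exE])
  define I where "I = Sigma ?X B"
  define b where "b q = single (fst q) (fst q) (snd q)" for q :: "'o \<times> 'a"
  define ph where "ph q a = single (fst q) (fst q) (Scale (V.representation (B (fst q)) (a (fst q) (fst q)) (snd q)) (Ident (fst q)))"
    for q and a :: "'o \<Rightarrow> 'o \<Rightarrow> 'a"
  have I: "fst q \<in> ?X" "snd q \<in> Hom (fst q) (fst q)" "snd q \<in> B (fst q)" if "q \<in> I" for q
    using that B by (fastforce simp: I_def)+
  have ax: "a (fst q) (fst q) \<in> Hom (fst q) (fst q)" if "a \<in> Rd 0" "q \<in> I" for a q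
    using families_hom[OF degree_part_carrier[OF that(1)] I(1)[OF that(2)] I(1)[OF that(2)]] .
  have ph: "ph q a \<in> degree_part D.R 0" if "q \<in> I" for q a
    unfolding ph_def using I(1)[OF that] D.single_degree[of "fst q" "fst q" _ 0] V.span_scale[OF V.span_base]
    by (simp add: D_degree D.single_def single_def)
  have "D.G.dual_basis (Rd 0) (mult R) I b ph"
    unfolding D.G.dual_basis_def D.G.slin_def additive_on_def
  proof (intro conjI ballI)
    show "finite I" using B finite_obj by (auto simp: I_def)
    fix q assume q: "q \<in> I"
    show "b q \<in> Rd 0" unfolding b_def using I[OF q] endo_degree_zero by (intro single_degree) auto
    fix a assume a: "a \<in> Rd 0"
    show "ph q a \<in> degree_part D.R 0" by (rule ph[OF q])
    have Bq: "V.independent (B (fst q))" "V.span (B (fst q)) = Hom (fst q) (fst q)" using B I(1)[OF q] by auto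
    show "ph q (a + a') = ph q a + ph q a'" if a': "a' \<in> Rd 0" for a'
    proof -
      have "V.representation (B (fst q)) (a (fst q) (fst q) + a' (fst q) (fst q)) =
          (\<lambda>b. V.representation (B (fst q)) (a (fst q) (fst q)) b + V.representation (B (fst q)) (a' (fst q) (fst q)) b)"
        using ax[OF a q] ax[OF a' q] Bq by (intro V.representation_add) auto
      then show ?thesis by (auto simp: ph_def single_def fun_eq_iff V.scale_left_distrib)
    qed
    show "ph q (t \<otimes>\<^bsub>R\<^esub> a) = t \<otimes>\<^bsub>D.R\<^esub> ph q a" if t: "t \<in> degree_part D.R 0" for t
    proof -
      let ?x = "fst q"
      have x: "?x \<in> ?X" by (rule I(1)[OF q])
      have "t ?x ?x \<in> V.span {Ident ?x}" using D.degree_partD[OF t, of ?x ?x] x by (simp add: D_degree)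
      then obtain c where c: "t ?x ?x = Scale c (Ident ?x)" by (auto simp: V.span_singleton)
      have e: "(t \<otimes>\<^bsub>R\<^esub> a) ?x ?x = Scale c (a ?x ?x)"
        using zero_part_mult[OF D_part_sub[OF t] degree_part_carrier[OF a], of ?x ?x] x
          comp_scale_left[OF x x x ax[OF a q] ident_closed[OF x]] comp_ident_left[OF x x ax[OF a q]] by (simp add: c)
      have ih: "Scale d (Ident ?x) \<in> Hom ?x ?x" for d using V.subspace_scale[OF hom_subspace[OF x x] ident_closed[OF x]] .
      have "t \<otimes>\<^bsub>R\<^esub> ph q a = single ?x ?x (Scale (c * V.representation (B ?x) (a ?x ?x) (snd q)) (Ident ?x))"
        unfolding ph_def zero_part_single[OF D_part_sub[OF t] x x ih] c
        using comp_scale_left[OF x x x ih ident_closed[OF x]] comp_ident_left[OF x x ih] by simp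
      then show ?thesis unfolding D_ops ph_def e
        using V.representation_scale[OF Bq(1), of "a ?x ?x" c] ax[OF a q] Bq(2) by simp
    qed
  next
    fix a assume a: "a \<in> Rd 0"
    show "a = (\<Sum>q\<in>I. ph q a \<otimes>\<^bsub>R\<^esub> b q)"
    proof (intro ext)
      fix x y
      have pb: "ph q a \<otimes>\<^bsub>R\<^esub> b q = single (fst q) (fst q) (Scale (V.representation (B (fst q)) (a (fst q) (fst q)) (snd q)) (snd q))"
        if q: "q \<in> I" for q
        unfolding ph_def b_def using I(1,2)[OF q] V.subspace_scale[OF hom_subspace] ident_closed
        by (subst single_mult) (auto simp: comp_scale_left comp_ident_left)
      have "(\<Sum>q\<in>I. ph q a \<otimes>\<^bsub>R\<^esub> b q) x y =
          (\<Sum>q\<in>I. if x = fst q \<and> y = fst q then Scale (V.representation (B (fst q)) (a (fst q) (fst q)) (snd q)) (snd q) else 0)"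
        unfolding sum_apply by (intro sum.cong refl) (simp add: pb single_def)
      also have "\<dots> = (\<Sum>z\<in>?X. \<Sum>u\<in>B z. if x = z \<and> y = z then Scale (V.representation (B z) (a z z) u) u else 0)"
        unfolding I_def using B finite_obj by (subst sum.Sigma) (auto simp: case_prod_beta)
      also have "\<dots> = (\<Sum>z\<in>?X. if z = x then (if x = y then \<Sum>u\<in>B x. Scale (V.representation (B x) (a x x) u) u else 0) else 0)"
        by (intro sum.cong refl) (auto intro!: sum.neutral)
      also have "\<dots> = a x y"
      proof (cases "x \<in> ?X \<and> x = y")
        case True
        then have "(\<Sum>u\<in>B x. Scale (V.representation (B x) (a x x) u) u) = a x x"
          using B[rule_format, of x] families_hom[OF degree_part_carrier[OF a], of x x] by (intro V.sum_representation_eq) auto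
        then show ?thesis using True finite_obj by auto
      next
        case False
        then have "a x y = 0" using part_zero_off[OF a, of x y] families_out[OF degree_part_carrier[OF a], of x y] by blast
        then show ?thesis using False finite_obj by auto
      qed
      finally show "a x y = (\<Sum>q\<in>I. ph q a \<otimes>\<^bsub>R\<^esub> b q) x y" by simp
    qed
  qed
  then show ?thesis by (rule D.G.sprojI)
qed

lemma gpair_D: "gpair (Rd) (degree_part D.R) (mult R) (one R)"
proof (intro gpair.intro gpair_axioms.intro G.gring_axioms)
  show g: "gring (degree_part D.R) (mult R) \<one>\<^bsub>R\<^esub>" using D.G.gring_axioms by (simp add: D_ops)
  show "degree_part D.R 0 \<subseteq> Rd 0" using D_part_sub by blast
  show "degree_part D.R (Suc d) = Rd (Suc d)" for d by (rule D_part_Suc)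
  show "gring.sproj (degree_part D.R) (mult R) (Rd 0) (mult R)" using D_sproj_zero by (simp add: D_ops)
qed

interpretation pair: gpair "Rd" "degree_part D.R" "mult R" "one R"
  by (rule gpair_D)

theorem koszul_category_iff:
  assumes "self_injective (degree_zero_algebra R)"
  shows "koszul_category C \<longleftrightarrow> (\<forall>d. G.sproj (Rd d) (mult R)) \<and> koszul_category D"
  using pair.koszul_zmod_pair[OF G.self_injective_sinj[OF assms]] G.koszul_degree_zero_iff D.G.koszul_degree_zero_iff
  by (simp add: koszul_category_def D_ops)

lemma D_graded_left_module:
  assumes M: "graded_left_module R M"
  shows "graded_left_module D.R M"
proof -
  interpret M: graded_left_module R M by fact
  show ?thesis
  proof (intro graded_left_module.intro left_module.intro left_module_axioms.intro graded_left_module_axioms.intro D.ring_R M.M.abelian_group_axioms)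
    show "finite_dimensional_part D.R M (mdegree_part M (int i))" for i :: nat
      using M.locally_finite[of i] by (simp add: finite_dimensional_part_def D_scalar)
  qed (auto simp: D_ops M.smult_one M.mdegree_subgroup M.mdegree_direct_sum
       intro: D_carrier_sub D_part_sub M.smult_closed M.smult_l_distr M.smult_r_distr M.smult_assoc1 M.mdegree_smult)
qed

text \<open>One model of \<open>M\<close> serves both algebras, since the restriction is the same
  record. A model needs generation in degree 0, which each side of the equivalence supplies.\<close>

theorem koszul_module_iff:
  assumes si: "self_injective (degree_zero_algebra R)" and K: "koszul_category C" and M: "graded_left_module R M"
  shows "koszul_module R M \<longleftrightarrow> projective_module (degree_zero_algebra R) M \<and> koszul_module D.R M"
proof -
  \<comment> \<open>On the right-hand side generation is known over the subcategory only, but more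
    scalars generate at least as much.\<close>
  have GD: "generated_in_degree R M (int 0)" if "generated_in_degree D.R M (int 0)"
  proof -
    interpret M: graded_left_module R M by fact
    have c: "a \<odot>\<^bsub>M\<^esub> m \<in> carrier M" if "a \<in> RC" "m \<in> mdegree_part M (int 0)" for a m
      using M.smult_closed[OF that(1)] subgroup.subset[OF M.mdegree_subgroup[of 0]] that(2) by auto
    have "carrier M \<subseteq> generate (add_monoid M) {a \<odot>\<^bsub>M\<^esub> m | a m. a \<in> RC \<and> m \<in> mdegree_part M (int 0)}"
      using D_carrier_sub by (intro subset_trans[OF equalityD1[OF that[unfolded generated_in_degree_def]]] group.mono_generate[OF M.M.a_group]) blast
    moreover have "{a \<odot>\<^bsub>M\<^esub> m | a m. a \<in> RC \<and> m \<in> mdegree_part M (int 0)} \<subseteq> carrier (add_monoid M)"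
      using c by auto
    then have "generate (add_monoid M) {a \<odot>\<^bsub>M\<^esub> m | a m. a \<in> RC \<and> m \<in> mdegree_part M (int 0)} \<subseteq> carrier M"
      using group.generate_incl[OF M.M.a_group] by simp
    ultimately show ?thesis unfolding generated_in_degree_def by blast
  qed
  have main: "koszul_module R M \<longleftrightarrow> projective_module (degree_zero_algebra R) M \<and> koszul_module D.R M" if g: "generated_in_degree R M (int 0)"
  proof -
    have p: "pos_module R M" by (rule G.pos_moduleI[OF M g])
    obtain h :: "_ \<Rightarrow> nat \<Rightarrow> 'o \<Rightarrow> 'o \<Rightarrow> 'a" and N act where mo: "G.model M h N act" and N: "G.gm N act" using G.model_exists[OF p] by blast
    interpret M: pos_module R M by (rule p)
    have pD: "pos_module D.R M"
      by (intro pos_module.intro D_graded_left_module M pos_module_axioms.intro M.decomp) (simp_all add: D.R_simps(2) agrp_zero[OF D.G.deg_grp])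
    have moD: "D.G.model M h N act"
      using mo unfolding G.model_def D.G.model_def G.cover_def D.G.cover_def by (auto dest: D_part_sub)
    have ND: "D.G.gm N act" using pair.B_gm[OF N] by (simp add: D_ops)
    have a: "koszul_module R M \<longleftrightarrow> G.koszul N act"
      using G.koszul_module_model[OF _ mo N] G.koszul_module_of_model[OF p mo] by blast
    have b: "koszul_module D.R M \<longleftrightarrow> D.G.koszul N act"
      using D.G.koszul_module_model[OF _ moD ND] D.G.koszul_module_of_model[OF pD moD] by blast
    have c: "projective_module (degree_zero_algebra R) M \<longleftrightarrow> (\<forall>d. G.sproj (N d) act)"
      using G.sproj_of_projective[OF M g mo N] G.projective_of_sproj[OF M g mo N] by blast
    have "G.koszul G.zmod G.zact" using K G.koszul_degree_zero_iff by (simp add: koszul_category_def)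
    from pair.koszul_module_pair[OF G.self_injective_sinj[OF si] this N]
    show ?thesis unfolding a b c by (simp add: D_ops)
  qed
  show ?thesis using main GD unfolding koszul_module_def by (metis of_nat_0)
qed

end

section \<open>Standard modules\<close>

lemma lmod_isomorphic_trans:
  assumes "lmod_isomorphic R L M" "lmod_isomorphic R M N"
  shows "lmod_isomorphic R L N"
proof -
  obtain f g where f: "f \<in> lmod_hom R L M" "bij_betw f (carrier L) (carrier M)"
    and g: "g \<in> lmod_hom R M N" "bij_betw g (carrier M) (carrier N)"
    using assms by (auto simp: lmod_isomorphic_def)
  have "g \<circ> f \<in> lmod_hom R L N" using f(1) g(1) by (auto simp: lmod_hom_def Pi_iff)
  then show ?thesis using bij_betw_trans[OF f(2) g(2)] by (auto simp: lmod_isomorphic_def)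
qed

text \<open>Quotients of submodules of one type, so that a quotient record can be compared with a
  concrete set through an additive map with kernel \<open>F\<close>.\<close>

locale quotient_data =
  fixes R :: "('r, 'x) ring_scheme" and U :: "'m::ab_group_add set" and act :: "'r \<Rightarrow> 'm \<Rightarrow> 'm" and F :: "'m set"
  assumes U: "agrp U" and F: "agrp F" and FU: "F \<subseteq> U"
    and act_closed: "a \<in> carrier R \<Longrightarrow> u \<in> U \<Longrightarrow> act a u \<in> U"
    and act_F: "a \<in> carrier R \<Longrightarrow> u \<in> F \<Longrightarrow> act a u \<in> F"
    and act_add: "a \<in> carrier R \<Longrightarrow> u \<in> U \<Longrightarrow> v \<in> U \<Longrightarrow> act a (u + v) = act a u + act a v"
begin

definition cos :: "'m \<Rightarrow> 'm set"
  where "cos u = (\<lambda>h. h + u) ` F"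

lemma mem_cos: "x \<in> cos u \<longleftrightarrow> x - u \<in> F"
proof
  assume "x - u \<in> F"
  then have "(x - u) + u \<in> cos u" unfolding cos_def by (rule imageI)
  then show "x \<in> cos u" by simp
qed (auto simp: cos_def)

lemma cos_eq: "cos u = cos v \<longleftrightarrow> u - v \<in> F"
proof
  assume "cos u = cos v"
  moreover have "u \<in> cos u" using agrp_zero[OF F] by (simp add: mem_cos)
  ultimately show "u - v \<in> F" by (simp add: mem_cos)
next
  assume d: "u - v \<in> F"
  have "x - u \<in> F \<longleftrightarrow> x - v \<in> F" for x
    using agrp_add[OF F _ d, of "x - u"] agrp_diff[OF F _ d, of "x - v"] by (auto simp: algebra_simps)
  then show "cos u = cos v" by (auto simp: mem_cos)
qed

lemma cos_add: "set_add (mrec U act) (cos u) (cos v) = cos (u + v)"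
proof
  show "set_add (mrec U act) (cos u) (cos v) \<subseteq> cos (u + v)"
  proof
    fix x assume "x \<in> set_add (mrec U act) (cos u) (cos v)"
    then obtain h k where "h \<in> cos u" "k \<in> cos v" "x = h + k" by (auto simp: set_add_def')
    then show "x \<in> cos (u + v)" using agrp_add[OF F, of "h - u" "k - v"] by (simp add: mem_cos algebra_simps)
  qed
  show "cos (u + v) \<subseteq> set_add (mrec U act) (cos u) (cos v)"
  proof
    fix x assume "x \<in> cos (u + v)"
    then have "x - v \<in> cos u" "v \<in> cos v" using agrp_zero[OF F] by (simp_all add: mem_cos algebra_simps)
    then show "x \<in> set_add (mrec U act) (cos u) (cos v)" unfolding set_add_def' mrec_simps by force
  qed
qed

lemma cos_carrier: "carrier (quotient_module (mrec U act) F) = cos ` U"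
  by (auto simp: quotient_module_def A_RCOSETS_def' a_r_coset_def' cos_def)

lemma cos_smult:
  assumes a: "a \<in> carrier R" and u: "u \<in> U"
  shows "smult (quotient_module (mrec U act) F) a (cos u) = cos (act a u)"
proof -
  have "smult (quotient_module (mrec U act) F) a (cos u) = (\<Union>x\<in>cos u. cos (act a x))"
    by (auto simp: quotient_module_def a_r_coset_def' cos_def)
  also have "\<dots> = (\<Union>x\<in>cos u. cos (act a u))"
  proof (rule SUP_cong[OF refl])
    fix x assume "x \<in> cos u"
    then obtain h where h: "h \<in> F" "x = h + u" by (auto simp: cos_def)
    have "act a x = act a h + act a u" using act_add[OF a _ u, of h] h FU by auto
    then show "cos (act a x) = cos (act a u)" using act_F[OF a h(1)] by (simp add: cos_eq)
  qed
  also have "\<dots> = cos (act a u)" using agrp_zero[OF F] by (auto simp: cos_def)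
  finally show ?thesis .
qed

lemma quotient_simps: "add (quotient_module (mrec U act) F) = set_add (mrec U act)"
  by (simp add: quotient_module_def)

context
  fixes f :: "'m \<Rightarrow> 'n::ab_group_add" and act' :: "'r \<Rightarrow> 'n \<Rightarrow> 'n"
  assumes f: "additive_on U f" "\<And>u. u \<in> U \<Longrightarrow> f u = 0 \<longleftrightarrow> u \<in> F"
    and f_act: "\<And>a u. a \<in> carrier R \<Longrightarrow> u \<in> U \<Longrightarrow> f (act a u) = act' a (f u)"
begin

lemma f_eq: "u \<in> U \<Longrightarrow> v \<in> U \<Longrightarrow> f u = f v \<longleftrightarrow> cos u = cos v"
  using f(2)[OF agrp_diff[OF U, of u v]] additive_on_diff[OF U f(1), of u v] by (simp add: cos_eq)

lemma quotient_iso: "lmod_isomorphic R (quotient_module (mrec U act) F) (mrec (f ` U) act')"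
proof -
  define g where "g X = f (SOME u. u \<in> U \<and> X = cos u)" for X
  have g: "g (cos u) = f u" if "u \<in> U" for u
  proof -
    have "(SOME v. v \<in> U \<and> cos u = cos v) \<in> U \<and> cos u = cos (SOME v. v \<in> U \<and> cos u = cos v)"
      using that by (intro someI_ex[of "\<lambda>v. v \<in> U \<and> cos u = cos v"]) blast
    then show ?thesis unfolding g_def using f_eq[OF that] by metis
  qed
  have "g \<in> lmod_hom R (quotient_module (mrec U act) F) (mrec (f ` U) act')"
    unfolding lmod_hom_def cos_carrier quotient_simps
    by (auto simp: g cos_add cos_smult agrp_add[OF U] act_closed f_act additive_onD[OF f(1)])
  moreover have "bij_betw g (cos ` U) (f ` U)" unfolding bij_betw_def inj_on_def using g f_eq by force
  ultimately show ?thesis unfolding lmod_isomorphic_def cos_carrier by auto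
qed

text \<open>The relation \<open>lmod_isomorphic\<close> has a direction. Building a filtration
  requires a map into a standard module, analysing one requires a map out of it.\<close>

lemma quotient_iso': "lmod_isomorphic R (mrec (f ` U) act') (quotient_module (mrec U act) F)"
proof -
  define g where "g y = cos (SOME u. u \<in> U \<and> y = f u)" for y
  have g: "g (f u) = cos u" if "u \<in> U" for u
  proof -
    have "(SOME v. v \<in> U \<and> f u = f v) \<in> U \<and> f u = f (SOME v. v \<in> U \<and> f u = f v)"
      using that by (intro someI_ex[of "\<lambda>v. v \<in> U \<and> f u = f v"]) blast
    then show ?thesis unfolding g_def using f_eq[OF that] by metis
  qed
  have "g \<in> lmod_hom R (mrec (f ` U) act') (quotient_module (mrec U act) F)"
    unfolding lmod_hom_def cos_carrier quotient_simps
    by (auto simp: g cos_add cos_smult agrp_add[OF U] act_closed f_act[symmetric] additive_onD[OF f(1), symmetric])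
  moreover have "bij_betw g (f ` U) (cos ` U)" unfolding bij_betw_def inj_on_def using g f_eq by force
  ultimately show ?thesis unfolding lmod_isomorphic_def cos_carrier by auto
qed

end

lemma quotient_iso_linear:
  fixes Q :: "'n::ab_group_add set"
  assumes "lmod_isomorphic R (quotient_module (mrec U act) F) (mrec Q act')"
  obtains f where "additive_on U f" "f ` U = Q" "\<And>u. u \<in> U \<Longrightarrow> f u = 0 \<longleftrightarrow> u \<in> F"
    "\<And>a u. a \<in> carrier R \<Longrightarrow> u \<in> U \<Longrightarrow> f (act a u) = act' a (f u)"
proof -
  obtain g where g: "g \<in> lmod_hom R (quotient_module (mrec U act) F) (mrec Q act')" "bij_betw g (cos ` U) Q"
    using assms(1) by (auto simp: lmod_isomorphic_def cos_carrier)
  note h = g(1)[unfolded lmod_hom_def cos_carrier quotient_simps mem_Collect_eq]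
  have ga: "g (cos (u + v)) = g (cos u) + g (cos v)" if "u \<in> U" "v \<in> U" for u v
    using h that by (simp add: cos_add[symmetric])
  have add: "additive_on U (\<lambda>u. g (cos u))" by (simp add: additive_on_def ga)
  have "g (cos u) = 0 \<longleftrightarrow> u \<in> F" if "u \<in> U" for u
    using inj_on_eq_iff[OF bij_betw_imp_inj_on[OF g(2)], of "cos u" "cos 0"] that agrp_zero[OF U] additive_on_zero[OF U add] cos_eq[of u 0] by simp
  moreover have "g (cos (act a u)) = act' a (g (cos u))" if "a \<in> carrier R" "u \<in> U" for a u
    using h that by (simp add: cos_smult[symmetric])
  moreover have "(\<lambda>u. g (cos u)) ` U = Q" using g(2) by (auto simp: bij_betw_def)
  ultimately show ?thesis using that[of "\<lambda>u. g (cos u)"] add by blast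
qed

end

text \<open>A substitute for the dimension: the largest size of an independent subset. It strictly
  increases because an independent subset of the subspace \<open>U\<close> stays independent after
  adding a vector outside \<open>U\<close>.\<close>

lemma (in vector_space) subspace_rank:
  assumes T: "finite T"
  shows "\<exists>\<mu>::'b set \<Rightarrow> nat. \<forall>U U'. subspace U \<and> U \<subset> U' \<and> U' \<subseteq> span T \<longrightarrow> \<mu> U < \<mu> U'"
proof -
  define K where "K U = card ` {B. B \<subseteq> U \<and> independent B}" for U
  have fin: "finite (K U)" "K U \<noteq> {}" if "U \<subseteq> span T" for U
  proof -
    have "K U \<subseteq> {..card T}" using independent_span_bound[OF T] that by (auto simp: K_def)
    then show "finite (K U)" by (rule finite_subset) simp
    show "K U \<noteq> {}" using independent_empty by (auto simp: K_def)
  qed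
  have "Max (K U) < Max (K U')" if s: "subspace U" and p: "U \<subset> U'" and t: "U' \<subseteq> span T" for U U'
  proof -
    have "U \<subseteq> span T" using p t by blast
    then have "Max (K U) \<in> K U" using fin by (intro Max_in) blast+
    then obtain B where B: "B \<subseteq> U" "independent B" "Max (K U) = card B" by (auto simp: K_def)
    obtain u where u: "u \<in> U'" "u \<notin> U" using p by blast
    have nu: "u \<notin> span B" using span_minimal[OF B(1) s] u(2) by blast
    have fB: "finite B" using independent_span_bound[OF T B(2)] B(1) \<open>U \<subseteq> span T\<close> by blast
    have "card (insert u B) \<in> K U'" using B p u independent_insertI[OF nu B(2)] by (auto simp: K_def)
    then have "card (insert u B) \<le> Max (K U')" using fin[OF t] by simp
    moreover have "card (insert u B) = Suc (card B)" using fB B(1) u(2) by (subst card_insert_disjoint) auto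
    ultimately show ?thesis using B(3) by simp
  qed
  then show ?thesis by (intro exI[of _ "\<lambda>U. Max (K U)"]) blast
qed

section \<open>Indecomposable projectives, traces and standard modules\<close>

locale stratification = graded_directed_category C r
  for C :: "('k::field, 'o, 'a::ab_group_add) graded_category" and r +
  fixes E :: "'o \<Rightarrow> 'a set"
  assumes E: "complete_primitive_idempotents C E"
begin

abbreviation mm (infixl "\<cdot>" 70) where "a \<cdot> b \<equiv> a \<otimes>\<^bsub>R\<^esub> b"
abbreviation "A \<equiv> RC"
abbreviation "S \<equiv> Rd 0"
abbreviation "Slin U Q \<equiv> G.slin U (mult R) Q (mult R)"
abbreviation "Sproj U \<equiv> G.sproj U (mult R)"
abbreviation "Smod U \<equiv> G.smod U (mult R)"
abbreviation "Arec U \<equiv> mrec U (mult R)"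
abbreviation "Lam \<equiv> strat_index C E"

lemma Lam: "l \<in> Lam \<Longrightarrow> fst l \<in> Ob \<and> snd l \<in> E (fst l)"
  by (auto simp: strat_index_def)

lemma finite_Lam: "finite Lam"
  using E finite_obj by (auto simp: strat_index_def complete_primitive_idempotents_def)

lemma idem_single: "index_idempotent l = single (fst l) (fst l) (snd l)"
  by (auto simp: index_idempotent_def single_def)

lemma Lam_prim: "l \<in> Lam \<Longrightarrow> primitive_idempotent C (fst l) (snd l)"
  using Lam E by (auto simp: complete_primitive_idempotents_def)

lemma Lam_hom:
  assumes "l \<in> Lam"
  shows "snd l \<in> Hom (fst l) (fst l)" "Comp (fst l) (fst l) (fst l) (snd l) (snd l) = snd l"
  using Lam_prim[OF assms] by (auto simp: primitive_idempotent_def idempotent_endo_def)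

lemma S_sub: "s \<in> S \<Longrightarrow> s \<in> A"
  by (rule degree_part_carrier)

lemma single_S: "x \<in> Ob \<Longrightarrow> u \<in> Hom x x \<Longrightarrow> single x x u \<in> S"
  by (rule single_degree) (simp_all add: endo_degree_zero)

lemma idem_S: "l \<in> Lam \<Longrightarrow> index_idempotent l \<in> S"
  using single_S Lam Lam_hom(1) by (simp add: idem_single)

lemma idem_A: "l \<in> Lam \<Longrightarrow> index_idempotent l \<in> A"
  by (rule S_sub[OF idem_S])

lemma idem_idem: "l \<in> Lam \<Longrightarrow> index_idempotent l \<cdot> index_idempotent l = index_idempotent l"
  using Lam Lam_hom by (simp add: idem_single single_mult)

lemma idem_sum_at: "y \<in> Ob \<Longrightarrow> (\<Sum>e\<in>E y. index_idempotent (y, e)) = single y y (Ident y)"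
proof (intro ext)
  fix x z assume y: "y \<in> Ob"
  have "\<Sum>(E y) = Ident y" using E y by (simp add: complete_primitive_idempotents_def)
  then show "(\<Sum>e\<in>E y. index_idempotent (y, e)) x z = single y y (Ident y) x z"
    by (auto simp: sum_apply idem_single single_def)
qed

lemma idem_sum: "(\<Sum>l\<in>Lam. index_idempotent l) = \<one>\<^bsub>R\<^esub>"
proof -
  have "(\<Sum>l\<in>Lam. index_idempotent l) = (\<Sum>y\<in>Ob. \<Sum>e\<in>E y. index_idempotent (y, e))"
    unfolding strat_index_def using E finite_obj
    by (subst sum.Sigma) (auto simp: complete_primitive_idempotents_def)
  also have "\<dots> = (\<Sum>y\<in>Ob. single y y (Ident y))" by (intro sum.cong refl idem_sum_at)
  also have "\<dots> = \<one>\<^bsub>R\<^esub>"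
  proof (intro ext)
    fix x z
    have "(\<Sum>y\<in>Ob. single y y (Ident y)) x z = (\<Sum>y\<in>Ob. if y = x then (if x = z then Ident x else 0) else 0)"
      unfolding sum_apply by (intro sum.cong refl) (auto simp: single_def)
    then show "(\<Sum>y\<in>Ob. single y y (Ident y)) x z = \<one>\<^bsub>R\<^esub> x z" using finite_obj by (auto simp: R_one)
  qed
  finally show ?thesis .
qed

definition "P l = {a \<in> A. a \<cdot> index_idempotent l = a}"
definition "Se l = {s \<in> S. s \<cdot> index_idempotent l = s}"
text \<open>By \<open>trace_eq\<close>, the trace submodule that is divided out of
  \<open>P l\<close> to obtain the standard module.\<close>

definition "T l = {a \<in> P l. a (fst l) (fst l) = 0}"
definition "diag x a = single x x (a x x :: 'a)" for x :: 'o
definition "asub U \<longleftrightarrow> agrp U \<and> U \<subseteq> A \<and> (\<forall>a\<in>A. \<forall>u\<in>U. a \<cdot> u \<in> U)"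

lemma asubD: "asub U \<Longrightarrow> agrp U" "asub U \<Longrightarrow> u \<in> U \<Longrightarrow> u \<in> A" "asub U \<Longrightarrow> a \<in> A \<Longrightarrow> u \<in> U \<Longrightarrow> a \<cdot> u \<in> U"
  by (auto simp: asub_def)

lemma smodI: "agrp U \<Longrightarrow> U \<subseteq> A \<Longrightarrow> (\<And>a u. a \<in> S \<Longrightarrow> u \<in> U \<Longrightarrow> a \<cdot> u \<in> U) \<Longrightarrow> Smod U"
  unfolding G.smod_def using S_sub
  by (auto simp: G.R_distrib_left G.R_distrib_right G.R.m_assoc subset_iff)

lemma asub_smod: "asub U \<Longrightarrow> Smod U"
  using S_sub by (intro smodI) (auto simp: asub_def)

lemma asub_A: "asub A"
  by (auto simp: asub_def G.R_agrp)

lemma P_asub: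
  assumes l: "l \<in> Lam"
  shows "asub (P l)"
  unfolding asub_def agrp_def P_def using idem_A[OF l] G.R_agrp
  by (auto simp: agrp_zero agrp_add agrp_minus G.R_distrib_left G.R.m_assoc additive_on_minus[of A "\<lambda>a. a \<cdot> index_idempotent l"] additive_on_def)

lemma Se_smod:
  assumes l: "l \<in> Lam"
  shows "Smod (Se l)"
proof (rule smodI)
  have "Se l = S \<inter> P l" by (auto simp: Se_def P_def S_sub)
  then show "agrp (Se l)" using agrp_Int[OF G.deg_grp asubD(1)[OF P_asub[OF l]]] by simp
  show "a \<cdot> u \<in> Se l" if "a \<in> S" "u \<in> Se l" for a u
    using that G.deg_mult[of a 0 u 0] idem_A[OF l] S_sub by (simp add: Se_def G.R.m_assoc)
qed (auto simp: Se_def S_sub)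

lemma S_smod: "Smod S"
  by (rule G.gm_smod[OF G.gm_A])

lemma mult_idem: "l \<in> Lam \<Longrightarrow> a \<in> A \<Longrightarrow> a \<cdot> index_idempotent l \<in> P l"
  using idem_A idem_idem by (simp add: P_def G.R.m_assoc)

lemma mult_idem_Se: "l \<in> Lam \<Longrightarrow> a \<in> S \<Longrightarrow> a \<cdot> index_idempotent l \<in> Se l"
  using idem_A idem_S[of l] idem_idem G.deg_mult[of a 0 "index_idempotent l" 0] S_sub by (simp add: Se_def G.R.m_assoc)

lemma right_mult_slin:
  assumes "c \<in> A" "U \<subseteq> A" "\<And>u. u \<in> U \<Longrightarrow> u \<cdot> c \<in> Q"
  shows "Slin U Q (\<lambda>u. u \<cdot> c)"
  using assms S_sub by (auto simp: G.slin_def additive_on_def G.R_distrib_left G.R.m_assoc subset_iff)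

lemma incl_slin: "U \<subseteq> Q \<Longrightarrow> Slin U Q (\<lambda>u. u)"
  by (auto simp: G.slin_def additive_on_def)

lemma Se_sproj:
  assumes l: "l \<in> Lam"
  shows "Sproj (Se l)"
proof (rule G.sproj_retract[OF Se_smod[OF l] S_smod G.sproj_A0 incl_slin right_mult_slin[of "index_idempotent l"]])
  show "u \<cdot> index_idempotent l \<in> Se l" if "u \<in> S" for u by (rule mult_idem_Se[OF l that])
qed (auto simp: Se_def S_sub idem_A[OF l])

lemma diag_S: "x \<in> Ob \<Longrightarrow> a \<in> A \<Longrightarrow> diag x a \<in> S"
  unfolding diag_def by (intro single_S families_hom)

lemma diag_add: "diag x (a + b) = diag x a + diag x b"
  by (auto simp: diag_def single_def fun_eq_iff)

lemma P_off:
  assumes l: "l \<in> Lam" and a: "a \<in> P l" and n: "x \<noteq> fst l"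
  shows "a x y = 0"
proof (cases "x \<in> Ob \<and> y \<in> Ob")
  case True
  have aA: "a \<in> A" using a by (simp add: P_def)
  have "a x y = (a \<cdot> index_idempotent l) x y" using a by (simp add: P_def)
  also have "\<dots> = 0" using True n families_hom[OF aA] by (auto simp: R_mult idem_single single_def comp_zero intro!: sum.neutral)
  finally show ?thesis .
qed (use a families_out in \<open>auto simp: P_def\<close>)

text \<open>Entries of \<open>a\<close> leading to \<open>x\<close> start at objects below
  \<open>x\<close>, and \<open>u\<close> vanishes at those strictly below, so a single summand
  remains. It is applied to the columns \<open>P l\<close>, and to a submodule whose support has
  \<open>x\<close> as a minimal object.\<close>

lemma mult_diag:
  assumes x: "x \<in> Ob" and a: "a \<in> A" and u: "u \<in> A" and z: "\<And>y. y \<in> Ob \<Longrightarrow> (y, x) \<in> r \<Longrightarrow> y \<noteq> x \<Longrightarrow> u w y = 0" and w: "w \<in> Ob"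
  shows "(a \<cdot> u) w x = Comp w x x (a x x) (u w x)"
proof -
  have "Comp w y x (a y x) (u w y) = (if y = x then Comp w x x (a x x) (u w x) else 0)" if y: "y \<in> Ob" for y
  proof (cases "y = x")
    case False
    show ?thesis
    proof (cases "(y, x) \<in> r")
      case True
      then show ?thesis using z[OF y True False] comp_zero(1)[OF w y x families_hom[OF a y x]] False by simp
    next
      case f: False
      then have "a y x = 0" using directed[OF y x] families_hom[OF a y x] by blast
      then show ?thesis using comp_zero(2)[OF w y x families_hom[OF u w y]] False by simp
    qed
  qed simp
  then have "(a \<cdot> u) w x = (\<Sum>y\<in>Ob. if y = x then Comp w x x (a x x) (u w x) else 0)"
    unfolding R_mult using w x by simp
  then show ?thesis using x finite_obj by simp
qed

text \<open>Elements of \<open>P l\<close> are morphisms out of \<open>fst l\<close>, so by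
  directedness they vanish at objects strictly below it. Consequently the diagonal component carries
  an action of the whole algebra.\<close>

lemma P_diag_mult:
  assumes l: "l \<in> Lam" and a: "a \<in> A" and u: "u \<in> P l"
  shows "diag (fst l) (a \<cdot> u) = diag (fst l) a \<cdot> diag (fst l) u"
proof -
  let ?x = "fst l"
  have x: "?x \<in> Ob" using Lam[OF l] by blast
  have uA: "u \<in> A" using u by (simp add: P_def)
  have "u ?x y = 0" if y: "y \<in> Ob" and "(y, ?x) \<in> r" "y \<noteq> ?x" for y
  proof -
    have "(?x, y) \<notin> r" using partial_order that by (auto simp: partial_order_on_def antisym_def)
    then show ?thesis using directed[OF x y] families_hom[OF uA x y] by blast
  qed
  from mult_diag[OF x a uA this x]
  show ?thesis unfolding diag_def single_mult[OF x x x families_hom[OF uA x x] families_hom[OF a x x]] by simp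
qed

lemma Se_diag:
  assumes l: "l \<in> Lam" and s: "s \<in> Se l"
  shows "diag (fst l) s = s"
proof (intro ext)
  fix x y
  have "s \<in> P l" "s \<in> S" using s S_sub by (auto simp: Se_def P_def)
  then show "diag (fst l) s x y = s x y"
    using P_off[OF l, of s x y] part_zero_off[of s x y] by (auto simp: diag_def single_def)
qed

lemma diag_Se:
  assumes l: "l \<in> Lam" and a: "a \<in> P l"
  shows "diag (fst l) a \<in> Se l"
proof -
  have x: "fst l \<in> Ob" using Lam[OF l] by blast
  have aA: "a \<in> A" using a by (simp add: P_def)
  have "index_idempotent l \<in> Se l" using idem_S[OF l] idem_idem[OF l] by (simp add: Se_def)
  then have "diag (fst l) (index_idempotent l) = index_idempotent l" by (rule Se_diag[OF l])
  moreover have "index_idempotent l \<in> P l" using idem_A[OF l] idem_idem[OF l] by (simp add: P_def)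
  ultimately have "diag (fst l) a = diag (fst l) a \<cdot> index_idempotent l" using P_diag_mult[OF l aA, of "index_idempotent l"] a by (simp add: P_def)
  then show ?thesis using diag_S[OF x aA] by (simp add: Se_def)
qed

lemma diag_zero_iff: "diag x a = 0 \<longleftrightarrow> a x x = 0"
  by (auto simp: diag_def single_def fun_eq_iff)

lemma T_asub:
  assumes l: "l \<in> Lam"
  shows "asub (T l)"
proof -
  note p = P_asub[OF l]
  have z: "(a \<cdot> u) (fst l) (fst l) = 0" if "a \<in> A" "u \<in> P l" "u (fst l) (fst l) = 0" for a u
  proof -
    have "diag (fst l) (a \<cdot> u) = 0"
      using P_diag_mult[OF l that(1,2)] that(3) S_sub[OF diag_S[of "fst l" a]] Lam[OF l] that(1)
      by (simp add: diag_zero_iff[symmetric])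
    then show ?thesis by (simp add: diag_zero_iff)
  qed
  show ?thesis unfolding asub_def agrp_def T_def
  proof (intro conjI ballI)
    show "a \<cdot> u \<in> {a \<in> P l. a (fst l) (fst l) = 0}" if "a \<in> A" "u \<in> {a \<in> P l. a (fst l) (fst l) = 0}" for a u
      using that z asubD(3)[OF p] by simp
  qed (use asubD(2)[OF p] in \<open>auto simp: agrp_zero[OF asubD(1)[OF p]] agrp_add[OF asubD(1)[OF p]] agrp_minus[OF asubD(1)[OF p]]\<close>)
qed

lemma strat_projective_eq:
  assumes l: "l \<in> Lam"
  shows "strat_projective C l = Arec (P l)"
proof -
  have "(\<lambda>a. a \<cdot> index_idempotent l) ` A = P l"
    using mult_idem[OF l] by (auto simp: P_def image_iff) metis
  then show ?thesis by (simp add: strat_projective_def regular_module_def mrec_def R_simps(2,3))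
qed

text \<open>A homomorphism from \<open>P m\<close> is right multiplication by the image of the
  idempotent, which reduces both inclusions to entries of products.\<close>

lemma trace_eq:
  assumes l: "l \<in> Lam"
  shows "generate (add_monoid (strat_projective C l))
        (\<Union>m\<in>{m \<in> Lam. \<not> canonical_le r m l}. trace_submodule R (strat_projective C m) (strat_projective C l)) = T l"
    (is "generate ?M ?H = _")
proof
  let ?x = "fst l"
  have x: "?x \<in> Ob" using Lam[OF l] by blast
  have gs: "generate (add_monoid (Arec (P l))) H \<subseteq> T l" if "H \<subseteq> T l" for H
    using that asubD(1)[OF P_asub[OF l]] asubD(1)[OF T_asub[OF l]] by (intro generate_subset_agrp) (auto simp: T_def)
  note ag = agrp_generate[of "Arec (P l)", simplified, OF asubD(1)[OF P_asub[OF l]]]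
  have im: "f p \<in> T l" if m: "m \<in> Lam" "(fst m, ?x) \<notin> r" and f: "f \<in> lmod_hom R (Arec (P m)) (Arec (P l))" and p: "p \<in> P m" for m f p
  proof -
    have pA: "p \<in> A" using p by (simp add: P_def)
    have i: "index_idempotent m \<in> P m" using idem_A[OF m(1)] idem_idem[OF m(1)] by (simp add: P_def)
    have w: "f (index_idempotent m) \<in> P l" using f i by (auto simp: lmod_hom_def)
    have fp: "f p = p \<cdot> f (index_idempotent m)" 
    proof -
      have "f (p \<cdot> index_idempotent m) = p \<cdot> f (index_idempotent m)" using f i pA by (simp add: lmod_hom_def)
      then show ?thesis using p by (simp add: P_def)
    qed
    \<comment> \<open>The only entries of \<open>p\<close> start at \<open>fst m\<close>, and no
      nonzero morphism leads from there to \<open>?x\<close>. So the product has no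
      \<open>(?x, ?x)\<close> entry.\<close>
    have "p y ?x = 0" if "y \<in> Ob" for y
    proof (cases "y = fst m")
      case True
      then show ?thesis using directed[OF that x] families_hom[OF pA that x] m(2) by blast
    qed (rule P_off[OF m(1) p])
    moreover have wA: "f (index_idempotent m) \<in> A" using w by (simp add: P_def)
    ultimately have "f p ?x ?x = 0" unfolding fp using comp_zero(2)[OF x _ x families_hom[OF wA x]] by (simp add: R_mult)
    then show ?thesis using f p by (auto simp: T_def lmod_hom_def)
  qed
  have tr: "trace_submodule R (strat_projective C m) (strat_projective C l) \<subseteq> T l" if m: "m \<in> Lam" "(fst m, ?x) \<notin> r" for m
    unfolding trace_submodule_def strat_projective_eq[OF l] strat_projective_eq[OF m(1)]
    using im[OF m] by (intro gs) auto
  have H: "?H \<subseteq> T l" using tr by (auto simp: canonical_le_def)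
  then show "generate ?M ?H \<subseteq> T l" unfolding strat_projective_eq[OF l] by (rule gs)
  have HP: "?H \<subseteq> P l" using H by (auto simp: T_def)
  have gg: "agrp (generate ?M ?H)" "?H \<subseteq> generate ?M ?H" using ag[OF HP] unfolding strat_projective_eq[OF l] by auto
  show "T l \<subseteq> generate ?M ?H"
  proof
    fix a assume a: "a \<in> T l"
    then have aP: "a \<in> P l" and aA: "a \<in> A" and a0: "a ?x ?x = 0" by (auto simp: T_def P_def)
    \<comment> \<open>Splitting by the idempotents on the left: a summand at an object below
      \<open>?x\<close> vanishes, any other one is the value of a right multiplication by
      \<open>a\<close> and thus lies in a trace.\<close>
    have "a = (\<Sum>m\<in>Lam. index_idempotent m \<cdot> a)"
      using G.R_sum_left[OF aA, of Lam index_idempotent] idem_A idem_sum G.R.l_one[OF aA] by simp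
    also have "\<dots> \<in> generate ?M ?H"
    proof (rule agrp_sum[OF gg(1)])
      fix m assume m: "m \<in> Lam"
      let ?y = "fst m"
      have y: "?y \<in> Ob" using Lam[OF m] by blast
      show "index_idempotent m \<cdot> a \<in> generate ?M ?H"
      proof (cases "(?y, ?x) \<in> r")
        case True
        have ay: "a x' ?y = 0" for x'
        proof (cases "x' = ?x \<and> ?y \<noteq> ?x")
          case c: True
          then have "(?x, ?y) \<notin> r" using True partial_order by (auto simp: partial_order_on_def antisym_def)
          then show ?thesis using directed[OF x y] families_hom[OF aA x y] c by blast
        next
          case False
          then show ?thesis using a0 P_off[OF l aP, of x' ?y] by (cases "x' = ?x") auto
        qed
        have "index_idempotent m \<cdot> a = 0"
        proof (intro ext)
          fix x' z
          have "index_idempotent m z z = 0 \<or> z = ?y" by (auto simp: idem_single single_def)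
          then show "(index_idempotent m \<cdot> a) x' z = 0 x' z"
            using zero_part_mult[OF idem_S[OF m] aA, of x' z] ay[of x'] comp_zero[of x' z z] families_hom[OF aA, of x' z]
              families_hom[OF idem_A[OF m], of z z] by auto
        qed
        then show ?thesis using agrp_zero[OF gg(1)] by simp
      next
        case False
        have i: "index_idempotent m \<in> P m" using idem_A[OF m] idem_idem[OF m] by (simp add: P_def)
        have "(\<lambda>p. p \<cdot> a) \<in> lmod_hom R (Arec (P m)) (Arec (P l))"
          using aA aP asubD(3)[OF P_asub[OF l]] by (auto simp: lmod_hom_def P_def G.R_distrib_left G.R.m_assoc idem_A[OF l])
        then have "index_idempotent m \<cdot> a \<in> trace_submodule R (strat_projective C m) (strat_projective C l)"
          unfolding trace_submodule_def strat_projective_eq[OF l] strat_projective_eq[OF m]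
          using i by (intro generate.incl) auto
        then have "index_idempotent m \<cdot> a \<in> ?H" using m False by (intro UN_I[of m]) (simp_all add: canonical_le_def)
        then show ?thesis using gg(2) by blast
      qed
    qed
    finally show "a \<in> generate ?M ?H" .
  qed
qed

text \<open>The standard module is \<open>Se l\<close> on which the algebra acts through its
  \<open>(x, x)\<close> component.\<close>

definition "sact x a s = diag x a \<cdot> s"

lemma quotient_data:
  assumes "asub U" "asub F" "F \<subseteq> U"
  shows "quotient_data R U (mult R) F"
  using assms asubD by unfold_locales (auto simp: G.R_distrib_right)

lemma standard_module_iso:
  assumes l: "l \<in> Lam"
  shows "lmod_isomorphic R (standard_module C r E l) (mrec (Se l) (sact (fst l)))"
    "lmod_isomorphic R (mrec (Se l) (sact (fst l))) (standard_module C r E l)"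
proof -
  interpret q: quotient_data R "P l" "mult R" "T l"
    by (rule quotient_data[OF P_asub[OF l] T_asub[OF l]]) (auto simp: T_def)
  have im: "diag (fst l) ` P l = Se l"
  proof
    show "Se l \<subseteq> diag (fst l) ` P l"
    proof
      fix s assume s: "s \<in> Se l"
      then have "s \<in> P l" using S_sub by (auto simp: Se_def P_def)
      then show "s \<in> diag (fst l) ` P l" using Se_diag[OF l s] by (metis imageI)
    qed
  qed (use diag_Se[OF l] in blast)
  have d: "additive_on (P l) (diag (fst l))" "\<And>u. u \<in> P l \<Longrightarrow> diag (fst l) u = 0 \<longleftrightarrow> u \<in> T l"
    "\<And>a u. a \<in> A \<Longrightarrow> u \<in> P l \<Longrightarrow> diag (fst l) (a \<cdot> u) = sact (fst l) a (diag (fst l) u)"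
    using P_diag_mult[OF l] by (auto simp: additive_on_def diag_add diag_zero_iff T_def sact_def)
  have s: "standard_module C r E l = quotient_module (Arec (P l)) (T l)"
    unfolding standard_module_def trace_eq[OF l] unfolding strat_projective_eq[OF l] ..
  show "lmod_isomorphic R (standard_module C r E l) (mrec (Se l) (sact (fst l)))"
    "lmod_isomorphic R (mrec (Se l) (sact (fst l))) (standard_module C r E l)"
    unfolding s using q.quotient_iso[OF d] q.quotient_iso'[OF d] by (simp_all add: im)
qed

lemma standard_quotientI:
  assumes "asub U" "asub F" "F \<subseteq> U" and l: "l \<in> Lam" and f: "additive_on U f" "f ` U = Se l" "\<And>u. u \<in> U \<Longrightarrow> f u = 0 \<longleftrightarrow> u \<in> F"
    "\<And>a u. a \<in> A \<Longrightarrow> u \<in> U \<Longrightarrow> f (a \<cdot> u) = diag (fst l) a \<cdot> f u"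
  shows "lmod_isomorphic R (quotient_module (Arec U) F) (standard_module C r E l)"
proof -
  interpret q: quotient_data R U "mult R" F by (rule quotient_data[OF assms(1-3)])
  show ?thesis
    using lmod_isomorphic_trans[OF q.quotient_iso[OF f(1,3), of "sact (fst l)"] _] standard_module_iso(2)[OF l] f(2,4)
    by (simp add: sact_def)
qed

text \<open>On \<open>Se l\<close>, elements of \<open>S\<close> act through \<open>sact\<close> as
  by ordinary multiplication, so the isomorphism yields a map that is linear over \<open>S\<close>
  for the structure in which \<open>Se l\<close> is projective.\<close>

lemma standard_quotientD:
  assumes "asub U" "asub F" "F \<subseteq> U" and l: "l \<in> Lam"
    and iso: "lmod_isomorphic R (quotient_module (Arec U) F) (standard_module C r E l)"
  obtains f where "Slin U (Se l) f" "f ` U = Se l" "\<And>u. u \<in> U \<Longrightarrow> f u = 0 \<longleftrightarrow> u \<in> F"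
proof -
  interpret q: quotient_data R U "mult R" F by (rule quotient_data[OF assms(1-3)])
  have x: "fst l \<in> Ob" using Lam[OF l] by blast
  obtain f where f: "additive_on U f" "f ` U = Se l" "\<And>u. u \<in> U \<Longrightarrow> f u = 0 \<longleftrightarrow> u \<in> F"
    "\<And>a u. a \<in> A \<Longrightarrow> u \<in> U \<Longrightarrow> f (a \<cdot> u) = sact (fst l) a (f u)"
    using q.quotient_iso_linear[OF lmod_isomorphic_trans[OF iso standard_module_iso(1)[OF l]]] by blast
  have "sact (fst l) a s = a \<cdot> s" if a: "a \<in> S" and s: "s \<in> Se l" for a s
  proof -
    have "s \<in> P l" using s S_sub by (auto simp: Se_def P_def)
    from P_diag_mult[OF l S_sub[OF a] this] show ?thesis
      using Se_diag[OF l s] Se_diag[OF l G.smod_closed[OF Se_smod[OF l] a s]] by (simp add: sact_def)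
  qed
  then have "Slin U (Se l) f" using f S_sub by (auto simp: G.slin_def)
  then show ?thesis using that f(2,3) by blast
qed

section \<open>Standard filtrations yield projectivity over the degree zero part\<close>

text \<open>A section of \<open>f\<close> writes each \<open>u\<close> as a kernel part plus the
  image of \<open>f u\<close>; the two boolean indices of \<open>sproj_sum_retract\<close> stand for
  kernel and quotient.\<close>

lemma sproj_extension:
  assumes U: "Smod U" and F: "Smod F" "Sproj F" and Q: "Smod Q" "Sproj Q"
    and f: "Slin U Q f" "f ` U = Q" and FU: "F \<subseteq> U" and k: "\<And>u. u \<in> U \<Longrightarrow> f u = 0 \<longleftrightarrow> u \<in> F"
  shows "Sproj U"
proof -
  obtain \<sigma> where s: "Slin Q U \<sigma>" "\<forall>q\<in>Q. f (\<sigma> q) = q"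
    using G.sproj_lift[OF Q U f(1)] f(2) by blast
  note g = G.smod_agrp[OF U]
  have fs: "f u \<in> Q" "\<sigma> (f u) \<in> U" if "u \<in> U" for u using G.slin_closed[OF f(1) that] G.slin_closed[OF s(1)] by auto
  have d: "u - \<sigma> (f u) \<in> F" if u: "u \<in> U" for u
    using k[OF agrp_diff[OF g u fs(2)[OF u]]] additive_on_diff[OF g G.slin_additive[OF f(1)] u fs(2)[OF u]] s(2) fs(1)[OF u] by simp
  have sl: "Slin U F (\<lambda>u. u - \<sigma> (f u))"
    unfolding G.slin_def additive_on_def
  proof (intro conjI ballI)
    fix u assume u: "u \<in> U"
    show "u - \<sigma> (f u) \<in> F" by (rule d[OF u])
    show "u + v - \<sigma> (f (u + v)) = u - \<sigma> (f u) + (v - \<sigma> (f v))" if v: "v \<in> U" for v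
      using additive_onD[OF G.slin_additive[OF f(1)] u v] additive_onD[OF G.slin_additive[OF s(1)] fs(1)[OF u] fs(1)[OF v]] by simp
    show "a \<cdot> u - \<sigma> (f (a \<cdot> u)) = a \<cdot> (u - \<sigma> (f u))" if a: "a \<in> S" for a
    proof -
      have "additive_on U (\<lambda>u. a \<cdot> u)" using G.smod_add_right[OF U a] by (simp add: additive_on_def)
      from additive_on_diff[OF g this u fs(2)[OF u]]
      show ?thesis using G.slin_act[OF f(1) a u] G.slin_act[OF s(1) a fs(1)[OF u]] by simp
    qed
  qed
  show ?thesis
  proof (rule G.sproj_sum_retract[of "UNIV :: bool set" _ _ "\<lambda>t. if t then F else Q" "\<lambda>_. mult R"
        "\<lambda>t u. if t then u - \<sigma> (f u) else f u" "\<lambda>t u. if t then u else \<sigma> u"])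
    show "m = (\<Sum>t\<in>UNIV. if t then if t then m - \<sigma> (f m) else f m else \<sigma> (if t then m - \<sigma> (f m) else f m))" for m
      by (simp add: UNIV_bool)
  qed (use U F Q f s sl incl_slin[OF FU] in auto)
qed

text \<open>Over \<open>S\<close> the algebra is the direct sum of its graded parts and also the
  direct sum of the modules \<open>P l\<close>; both sides are equivalent to its being
  projective.\<close>

lemma sproj_parts_iff: "(\<forall>d. Sproj (Rd d)) \<longleftrightarrow> (\<forall>l\<in>Lam. Sproj (P l))"
proof -
  have sm: "Smod (Rd d)" for d by (rule G.gm_smod[OF G.gm_A])
  have ac: "Slin A (Rd d) (acomp d)" for d
    using G.cmp_mult[of _ 0] by (auto simp: G.slin_def additive_on_def G.cmp_closed G.cmp_add)
  have a: "Sproj A" if "\<forall>d. Sproj (Rd d)"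
    using that sm ac G.cmp_sum
    by (intro G.sproj_sum_retract[of "{..<topdeg}" A "mult R" "Rd" "\<lambda>_. mult R" acomp "\<lambda>_ u. u"]
        asub_smod[OF asub_A] incl_slin) (auto simp: G.deg_sub)
  have b: "Sproj (Rd d)" if "Sproj A" for d
    by (rule G.sproj_retract[OF sm asub_smod[OF asub_A] that incl_slin ac]) (auto simp: G.deg_sub G.cmp_deg)
  have c: "Sproj (P l)" if "Sproj A" "l \<in> Lam" for l
  proof (rule G.sproj_retract[OF asub_smod[OF P_asub[OF that(2)]] asub_smod[OF asub_A] that(1) incl_slin right_mult_slin[of "index_idempotent l"]])
    show "u \<cdot> index_idempotent l \<in> P l" if "u \<in> A" for u by (rule mult_idem[OF \<open>l \<in> Lam\<close> that])
  qed (auto simp: P_def idem_A[OF that(2)])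
  have d: "Sproj A" if "\<forall>l\<in>Lam. Sproj (P l)"
  proof (rule G.sproj_sum_retract[of Lam A "mult R" P "\<lambda>_. mult R" "\<lambda>l a. a \<cdot> index_idempotent l" "\<lambda>_ u. u"])
    show "m = (\<Sum>t\<in>Lam. m \<cdot> index_idempotent t)" if "m \<in> A" for m
      using G.R_sum_right[OF that, of Lam index_idempotent] idem_A idem_sum G.R.r_one[OF that] by simp
    show "Slin A (P t) (\<lambda>a. a \<cdot> index_idempotent t)" if "t \<in> Lam" for t
      using mult_idem[OF that] by (intro right_mult_slin idem_A[OF that]) auto
    show "Slin (P t) A (\<lambda>u. u)" for t by (rule incl_slin) (auto simp: P_def)
  qed (use that finite_Lam asub_smod[OF asub_A] asub_smod[OF P_asub] in auto)
  show ?thesis using a b c d by blast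
qed

lemma submodule_iff:
  assumes P: "asub Q"
  shows "submodule F R (Arec Q) \<longleftrightarrow> asub F \<and> F \<subseteq> Q"
proof -
  have g: "subgroup F (add_monoid (Arec Q)) \<longleftrightarrow> agrp F \<and> F \<subseteq> Q"
    using subgroup_iff_agrp[of "Arec Q" F] asubD(1)[OF P] subgroup.subset[of F "add_monoid (Arec Q)"] by auto
  show ?thesis unfolding submodule_def g submodule_axioms_def using P by (auto simp: asub_def)
qed

lemma standard_filtration_sproj:
  assumes l: "l \<in> Lam" and h: "has_standard_filtration C r E (strat_projective C l)"
  shows "Sproj (P l)"
proof -
  obtain n F where F: "F 0 = {0}" "F n = P l" "\<forall>j\<le>n. submodule (F j) R (Arec (P l))"
    "\<forall>j<n. F j \<subseteq> F (Suc j) \<and> (\<exists>m\<in>Lam. lmod_isomorphic R (quotient_module (Arec (F (Suc j))) (F j)) (standard_module C r E m))"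
    using h unfolding has_standard_filtration_def strat_projective_eq[OF l] by auto
  have as: "asub (F j)" if "j \<le> n" for j using F(3) that submodule_iff[OF P_asub[OF l]] by blast
  have "j \<le> n \<Longrightarrow> Sproj (F j)" for j
  proof (induction j)
    case 0
    show ?case unfolding F(1) by (rule G.sprojI[of _ _ "{}"]) (simp add: G.dual_basis_def)
  next
    case (Suc j)
    then obtain m where m: "m \<in> Lam" "lmod_isomorphic R (quotient_module (Arec (F (Suc j))) (F j)) (standard_module C r E m)"
      and sub: "F j \<subseteq> F (Suc j)" using F(4) by (meson Suc_le_lessD)
    note a = as[OF Suc.prems] and b = as[of j]
    obtain f where f: "Slin (F (Suc j)) (Se m) f" "f ` F (Suc j) = Se m" "\<And>u. u \<in> F (Suc j) \<Longrightarrow> f u = 0 \<longleftrightarrow> u \<in> F j"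
      using standard_quotientD[OF a b sub m] Suc.prems by auto
    show ?case
      using sproj_extension[OF asub_smod[OF a] asub_smod[OF b] _ Se_smod[OF m(1)] Se_sproj[OF m(1)] f(1,2) sub f(3)] Suc by simp
  qed
  from this[of n] show ?thesis by (simp add: F(2))
qed

section \<open>Constructing standard filtrations\<close>

lemma scalar_mult_right: "a \<in> A \<Longrightarrow> a \<cdot> scal c = scal c \<cdot> a"
proof (intro ext)
  fix x z assume a: "a \<in> A"
  show "(a \<cdot> scal c) x z = (scal c \<cdot> a) x z"
  proof (cases "x \<in> Ob \<and> z \<in> Ob")
    case True
    then have "(a \<cdot> scal c) x z = (\<Sum>y\<in>Ob. if y = x then Scale c (a x z) else 0)"
      using families_hom[OF a] ident_closed
      by (auto simp: R_mult scalar_apply comp_scale_right comp_ident_right comp_zero intro!: sum.cong)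
    then show ?thesis using True finite_obj by (simp add: scalar_mult[OF a])
  qed (auto simp: R_mult)
qed

lemma smult_apply: "smult R c a x y = Scale c (a x y)"
  by (simp add: category_algebra_def)

lemma smult_scalar: "a \<in> A \<Longrightarrow> smult R c a = scal c \<cdot> a"
  by (auto simp: fun_eq_iff smult_apply scalar_mult)

lemma vector_space_R: "vector_space (smult R)"
  by unfold_locales (auto simp: fun_eq_iff smult_apply V.scale_right_distrib V.scale_left_distrib)

interpretation W: vector_space "smult R"
  by (rule vector_space_R)

text \<open>The algebra is finite-dimensional over the ground field. The rank stops the descending
  chain in Fitting's lemma and measures submodules in the construction of filtrations.\<close>

lemma rank_exists: "\<exists>\<mu>::('o \<Rightarrow> 'o \<Rightarrow> 'a) set \<Rightarrow> nat. \<forall>U U'. W.subspace U \<and> U \<subset> U' \<and> U' \<subseteq> A \<longrightarrow> \<mu> U < \<mu> U'"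
proof -
  have "\<forall>i. \<exists>B. finite B \<and> B \<subseteq> Rd i \<and> (\<forall>a\<in>Rd i. \<exists>c. a = (\<Sum>u\<in>B. scal (c u) \<cdot> u))"
    using R_fin_dim by (rule allI)
  then obtain B where B: "\<forall>i. finite (B i) \<and> B i \<subseteq> Rd i \<and> (\<forall>a\<in>Rd i. \<exists>c. a = (\<Sum>u\<in>B i. scal (c u) \<cdot> u))"
    by (rule choice[THEN exE])
  define T where "T = (\<Union>i<topdeg. B i)"
  have "a \<in> W.span T" if a: "a \<in> A" for a
  proof -
    have "acomp i a \<in> W.span T" if i: "i < topdeg" for i
    proof -
      obtain c where c: "acomp i a = (\<Sum>u\<in>B i. scal (c u) \<cdot> u)"
        using B[rule_format, of i, THEN conjunct2, THEN conjunct2, rule_format, OF G.cmp_closed[OF a]] by (elim exE)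
      have BA: "u \<in> A" if "u \<in> B i" for u using B[rule_format, of i] that by (auto intro: G.deg_sub)
      have "u \<in> W.span T" if "u \<in> B i" for u using i that by (intro W.span_base) (auto simp: T_def)
      then have "(\<Sum>u\<in>B i. smult R (c u) u) \<in> W.span T" by (intro W.span_sum W.span_scale)
      moreover have "acomp i a = (\<Sum>u\<in>B i. smult R (c u) u)" unfolding c by (intro sum.cong refl) (simp add: smult_scalar BA)
      ultimately show ?thesis by simp
    qed
    then have "(\<Sum>i<topdeg. acomp i a) \<in> W.span T" by (intro W.span_sum) simp
    then show ?thesis by (simp add: G.cmp_sum[OF a])
  qed
  then have AT: "A \<subseteq> W.span T" by blast
  have "finite T" using B by (simp add: T_def)
  from W.subspace_rank[OF this] obtain \<mu> :: "('o \<Rightarrow> 'o \<Rightarrow> 'a) set \<Rightarrow> nat"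
    where m: "\<forall>U U'. W.subspace U \<and> U \<subset> U' \<and> U' \<subseteq> W.span T \<longrightarrow> \<mu> U < \<mu> U'" by (elim exE)
  show ?thesis
    by (intro exI[of _ \<mu>] allI impI) (use AT m in \<open>meson subset_trans\<close>)
qed

lemma asub_subspace: "asub U \<Longrightarrow> W.subspace U"
  using G.scal_carrier by (auto simp: W.subspace_def asubD smult_scalar agrp_zero agrp_add)

abbreviation pw (infixr "\<up>" 75) where "a \<up> n \<equiv> a [^]\<^bsub>R\<^esub> (n::nat)"

lemma pow_comm:
  assumes "x \<in> A" "y \<in> A" "x \<cdot> y = y \<cdot> x"
  shows "x \<up> (n::nat) \<cdot> y = y \<cdot> x \<up> n"
proof (induction n)
  case (Suc n)
  have "x \<up> Suc n \<cdot> y = x \<up> n \<cdot> (y \<cdot> x)" using assms by (simp add: G.R.m_assoc)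
  also have "\<dots> = (x \<up> n \<cdot> y) \<cdot> x" using assms by (simp add: G.R.m_assoc)
  finally show ?case using assms Suc by (simp add: G.R.m_assoc)
qed (use assms in simp)

lemma S_mult: "a \<in> S \<Longrightarrow> b \<in> S \<Longrightarrow> a \<cdot> b \<in> S"
  using G.deg_mult[of a 0 b 0] by simp

lemma S_pow: "a \<in> S \<Longrightarrow> a \<up> (n::nat) \<in> S"
  by (induction n) (auto simp: S_mult G.one_deg)

lemma S_mult_at:
  assumes "x \<in> Ob" "s \<in> S" "t \<in> S"
  shows "(s \<cdot> t) x x = Comp x x x (s x x) (t x x)"
  using zero_part_mult[OF assms(2) S_sub[OF assms(3)], of x x] assms(1) by simp

section \<open>Local endomorphism algebras and surjections onto indecomposable projectives\<close>

text \<open>Together with its complement \<open>f\<close> splits the idempotent into two orthogonal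
  ones. Primitivity is stated for endomorphisms of the object, so both are evaluated there; an
  element of \<open>Se l\<close> is determined by that entry.\<close>

lemma primitive_corner:
  assumes l: "l \<in> Lam" and f: "f \<in> Se l" "f \<cdot> f = f" "index_idempotent l \<cdot> f = f"
  shows "f = 0 \<or> f = index_idempotent l"
proof -
  let ?x = "fst l" and ?e = "index_idempotent l"
  have x: "?x \<in> Ob" using Lam[OF l] by blast
  have fS: "f \<in> S" and fe: "f \<cdot> ?e = f" using f(1) by (auto simp: Se_def)
  have eS: "?e \<in> S" by (rule idem_S[OF l])
  have dS: "?e - f \<in> S" by (rule agrp_diff[OF G.deg_grp eS fS])
  have ex: "?e ?x ?x = snd l" by (simp add: idem_single single_def)
  have dist: "(?e - f) \<cdot> c = ?e \<cdot> c - f \<cdot> c" "c \<cdot> (?e - f) = c \<cdot> ?e - c \<cdot> f" if "c \<in> S" for c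
    using additive_on_diff[OF G.R_agrp _ S_sub[OF eS] S_sub[OF fS], of "\<lambda>u. u \<cdot> c"]
      additive_on_diff[OF G.R_agrp _ S_sub[OF eS] S_sub[OF fS], of "\<lambda>u. c \<cdot> u"] S_sub[OF that]
    by (auto simp: additive_on_def G.R_distrib_left G.R_distrib_right)
  have p1: "(?e - f) \<cdot> (?e - f) = ?e - f" using dist(1)[OF dS] dist(2)[OF eS] dist(2)[OF fS] f fe idem_idem[OF l] by simp
  have p2: "f \<cdot> (?e - f) = 0" "(?e - f) \<cdot> f = 0" using dist(1)[OF fS] dist(2)[OF fS] f fe by simp_all
  have dx: "(?e - f) ?x ?x = snd l - f ?x ?x" using ex by simp
  have i1: "idempotent_endo C ?x (f ?x ?x)"
    using S_mult_at[OF x fS fS] f(2) families_hom[OF S_sub[OF fS] x x] by (simp add: idempotent_endo_def)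
  have i2: "idempotent_endo C ?x (snd l - f ?x ?x)"
    using S_mult_at[OF x dS dS] families_hom[OF S_sub[OF dS] x x] unfolding p1 dx by (simp add: idempotent_endo_def)
  have o: "orthogonal_endos C ?x (f ?x ?x) (snd l - f ?x ?x)"
    using S_mult_at[OF x fS dS] S_mult_at[OF x dS fS] unfolding p2 dx by (simp add: orthogonal_endos_def)
  have "f ?x ?x = 0 \<or> snd l - f ?x ?x = 0"
    using Lam_prim[OF l] i1 i2 o unfolding primitive_idempotent_def by (metis add_diff_cancel_left' diff_add_cancel add.commute)
  then show ?thesis
  proof
    assume "f ?x ?x = 0"
    then show ?thesis using Se_diag[OF l f(1)] diag_zero_iff[of ?x f] by simp
  next
    assume "snd l - f ?x ?x = 0"
    then have "diag ?x f = ?e" by (simp add: diag_def idem_single)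
    then show ?thesis using Se_diag[OF l f(1)] by simp
  qed
qed

text \<open>Fitting's lemma: the endomorphism algebra of the indecomposable module \<open>S e\<close> is local.\<close>

lemma nilpotent_or_invertible:
  assumes l: "l \<in> Lam" and a: "a \<in> S" "index_idempotent l \<cdot> a = a" "a \<cdot> index_idempotent l = a"
  shows "(\<exists>n::nat. a \<up> n \<cdot> index_idempotent l = 0) \<or> (\<exists>c\<in>S. c \<cdot> a = index_idempotent l)"
proof -
  let ?e = "index_idempotent l"
  have eS: "?e \<in> S" and eA: "?e \<in> A" and ee: "?e \<cdot> ?e = ?e" using idem_S[OF l] idem_A[OF l] idem_idem[OF l] by auto
  have aA: "a \<in> A" by (rule S_sub[OF a(1)])
  \<comment> \<open>The centraliser of \<open>a\<close> in the corner algebra. Restricting to it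
    makes the witness found below commute with \<open>a\<close>.\<close>
  define Z where "Z = {b \<in> S. ?e \<cdot> b = b \<and> b \<cdot> ?e = b \<and> a \<cdot> b = b \<cdot> a}"
  define J where "J n = (\<lambda>b. a \<up> (n::nat) \<cdot> b) ` Z" for n
  have ZA: "b \<in> A" if "b \<in> Z" for b using that S_sub by (simp add: Z_def)
  have pA: "a \<up> (n::nat) \<in> A" for n using aA by simp
  have scZ: "scal c \<cdot> b \<in> Z" if b: "b \<in> Z" for c b
  proof -
    have k: "u \<cdot> (scal c \<cdot> b) = scal c \<cdot> (u \<cdot> b)" if "u \<in> A" for u
      using scalar_mult_right[OF that, of c] that ZA[OF b] G.scal_carrier[of c] by (simp add: G.R.m_assoc[symmetric])
    show ?thesis using b k[OF eA] k[OF aA] G.scal_carrier[of c] eA aA ZA[OF b] S_mult[OF G.scal_deg]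
      by (simp add: Z_def G.R.m_assoc)
  qed
  have subJ: "W.subspace (J n)" for n
  proof (rule W.subspaceI)
    have "0 \<in> Z" using agrp_zero[OF G.deg_grp] eA aA by (simp add: Z_def)
    then have "a \<up> n \<cdot> 0 \<in> J n" unfolding J_def by (rule imageI)
    then show "0 \<in> J n" using pA by simp
    show "u + v \<in> J n" if uv: "u \<in> J n" "v \<in> J n" for u v
    proof -
      obtain b c where bc: "b \<in> Z" "c \<in> Z" "u = a \<up> n \<cdot> b" "v = a \<up> n \<cdot> c" using uv by (auto simp: J_def)
      have "b + c \<in> Z" using bc(1,2) ZA[OF bc(1)] ZA[OF bc(2)] agrp_add[OF G.deg_grp] eA aA
        by (simp add: Z_def G.R_distrib_left G.R_distrib_right)
      moreover have "u + v = a \<up> n \<cdot> (b + c)" using bc(3,4) G.R_distrib_right[OF pA ZA[OF bc(1)] ZA[OF bc(2)]] by simp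
      ultimately show ?thesis by (auto simp: J_def)
    qed
    show "smult R c u \<in> J n" if u: "u \<in> J n" for c u
    proof -
      obtain b where b: "b \<in> Z" "u = a \<up> n \<cdot> b" using u by (auto simp: J_def)
      have "smult R c u = scal c \<cdot> (a \<up> n \<cdot> b)" using b pA ZA by (simp add: smult_scalar)
      also have "\<dots> = a \<up> n \<cdot> (scal c \<cdot> b)"
        using scalar_mult_right[OF pA, of n c] pA ZA[OF b(1)] G.scal_carrier[of c] by (simp add: G.R.m_assoc[symmetric])
      finally show ?thesis using scZ[OF b(1)] by (auto simp: J_def)
    qed
  qed
  have dec: "J (Suc n) \<subseteq> J n" for n
  proof
    fix u assume "u \<in> J (Suc n)"
    then obtain b where b: "b \<in> Z" "u = a \<up> Suc n \<cdot> b" by (auto simp: J_def)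
    have bc: "a \<cdot> b = b \<cdot> a" "?e \<cdot> b = b" "b \<cdot> ?e = b" "b \<in> S" using b(1) by (auto simp: Z_def)
    have "?e \<cdot> (a \<cdot> b) = a \<cdot> b" using a(2) aA ZA[OF b(1)] eA by (simp add: G.R.m_assoc[symmetric])
    moreover have "(a \<cdot> b) \<cdot> ?e = a \<cdot> b" using bc(3) aA ZA[OF b(1)] eA by (simp add: G.R.m_assoc)
    moreover have "a \<cdot> (a \<cdot> b) = (a \<cdot> b) \<cdot> a"
      using arg_cong[OF bc(1), of "\<lambda>u. a \<cdot> u"] G.R.m_assoc[OF aA ZA[OF b(1)] aA] by simp
    ultimately have "a \<cdot> b \<in> Z" using S_mult[OF a(1) bc(4)] by (simp add: Z_def)
    moreover have "u = a \<up> n \<cdot> (a \<cdot> b)" using b(2) aA ZA[OF b(1)] by (simp add: G.R.m_assoc)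
    ultimately show "u \<in> J n" by (auto simp: J_def)
  qed
  \<comment> \<open>A strictly descending chain of subspaces would lower the rank forever.\<close>
  have "\<exists>n. J n = J (Suc n)"
  proof (rule ccontr)
    assume n: "\<nexists>n. J n = J (Suc n)"
    obtain \<mu> :: "('o \<Rightarrow> 'o \<Rightarrow> 'a) set \<Rightarrow> nat" where m: "\<forall>U U'. W.subspace U \<and> U \<subset> U' \<and> U' \<subseteq> A \<longrightarrow> \<mu> U < \<mu> U'"
      using rank_exists by (elim exE)
    have JA: "J n \<subseteq> A" for n using pA ZA by (auto simp: J_def)
    have lt: "\<mu> (J (Suc n)) < \<mu> (J n)" for n using m[rule_format, of "J (Suc n)" "J n"] subJ dec[of n] n JA by blast
    have "\<mu> (J k) + k \<le> \<mu> (J 0)" for k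
    proof (induction k)
      case (Suc k) then show ?case using lt[of k] by simp
    qed simp
    from this[of "Suc (\<mu> (J 0))"] show False by simp
  qed
  then obtain n where n: "J n = J (Suc n)" by blast
  have "?e \<in> Z" using eS ee a by (simp add: Z_def)
  then have "a \<up> n \<cdot> ?e \<in> J n" unfolding J_def by (rule imageI)
  then have "a \<up> n \<cdot> ?e \<in> J (Suc n)" unfolding n .
  then obtain b where b: "b \<in> Z" "a \<up> n \<cdot> ?e = a \<up> Suc n \<cdot> b" by (auto simp: J_def)
  have bA: "b \<in> A" by (rule ZA[OF b(1)])
  have bc: "a \<cdot> b = b \<cdot> a" "?e \<cdot> b = b" "b \<cdot> ?e = b" "b \<in> S" using b(1) by (auto simp: Z_def)
  define g where "g = b \<cdot> a"
  have gS: "g \<in> S" using S_mult[OF bc(4) a(1)] by (simp add: g_def)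
  have gA: "g \<in> A" by (rule S_sub[OF gS])
  have eg: "?e \<cdot> g = g" "g \<cdot> ?e = g" using bc(2) a(3) eA aA bA by (simp_all add: g_def G.R.m_assoc[symmetric], simp add: G.R.m_assoc)
  have h1: "a \<up> n \<cdot> ?e \<cdot> g = a \<up> n \<cdot> ?e"
  proof -
    have "a \<up> n \<cdot> ?e \<cdot> g = a \<up> n \<cdot> (a \<cdot> b)" using eg eA gA aA by (simp add: G.R.m_assoc bc(1) g_def)
    then show ?thesis using b(2) aA bA by (simp add: G.R.m_assoc)
  qed
  have h: "a \<up> n \<cdot> ?e \<cdot> g \<up> (k::nat) = a \<up> n \<cdot> ?e" for k
  proof (induction k)
    case (Suc k)
    have "a \<up> n \<cdot> ?e \<cdot> g \<up> Suc k = (a \<up> n \<cdot> ?e \<cdot> g \<up> k) \<cdot> g" using eA gA aA by (simp add: G.R.m_assoc)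
    then show ?case using Suc h1 by simp
  qed (use eA aA in simp)
  \<comment> \<open>Since \<open>a \<up> n \<cdot> ?e\<close> absorbs powers of \<open>g\<close>,
    and \<open>f\<close> equals \<open>b \<up> n\<close> times it, \<open>f\<close> is the
    idempotent of the Fitting decomposition. If it is 0, then \<open>a\<close> is nilpotent; if it
    is the identity of the corner, then \<open>g = b \<cdot> a\<close> is invertible there.\<close>
  define f where "f = g \<up> n \<cdot> ?e"
  have fS: "f \<in> S" using S_mult[OF S_pow[OF gS] eS] by (simp add: f_def)
  have fA: "f \<in> A" by (rule S_sub[OF fS])
  have fe: "f \<cdot> ?e = f" using ee eA gA by (simp add: f_def G.R.m_assoc)
  have ge: "g \<up> n \<cdot> ?e = ?e \<cdot> g \<up> n" by (rule pow_comm[OF gA eA]) (simp add: eg)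
  have ef: "?e \<cdot> f = f" using ge ee eA gA by (simp add: f_def G.R.m_assoc[symmetric])
  have fb: "f = b \<up> n \<cdot> (a \<up> n \<cdot> ?e)"
    using G.R.pow_mult_distrib[OF bc(1)[symmetric] bA aA, of n] aA bA eA by (simp add: f_def g_def G.R.m_assoc)
  have fg: "f \<cdot> g \<up> n = f"
  proof -
    have "f \<cdot> g \<up> n = b \<up> n \<cdot> (a \<up> n \<cdot> ?e \<cdot> g \<up> n)" unfolding fb using aA bA eA gA by (simp add: G.R.m_assoc)
    then show ?thesis unfolding h fb .
  qed
  have ff: "f \<cdot> f = f"
  proof -
    have "f \<cdot> f = f \<cdot> g \<up> n \<cdot> ?e" using fA gA eA by (simp add: f_def G.R.m_assoc)
    then show ?thesis by (simp add: fg fe)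
  qed
  have "f \<in> Se l" using fS fe by (simp add: Se_def)
  from primitive_corner[OF l this ff ef] show ?thesis
  proof
    assume f0: "f = 0"
    have "a \<up> n \<cdot> ?e = a \<up> n \<cdot> f" using h[of n] ge aA eA gA by (simp add: f_def G.R.m_assoc)
    then have "a \<up> n \<cdot> ?e = 0" using f0 pA by simp
    then show ?thesis by blast
  next
    assume fe1: "f = ?e"
    have "\<exists>c\<in>S. c \<cdot> a = ?e"
    proof (cases n)
      case 0
      then have "?e = g" using h1 eA eg by simp
      then show ?thesis using bc(4) by (auto simp: g_def)
    next
      case (Suc k)
      have "?e = g \<up> k \<cdot> g \<cdot> ?e" using fe1 by (simp add: f_def Suc)
      also have "\<dots> = g \<up> k \<cdot> b \<cdot> a" using eg gA eA bA aA by (simp add: G.R.m_assoc) (simp add: g_def)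
      finally show ?thesis using S_mult[OF S_pow[OF gS] bc(4)] by metis
    qed
    then show ?thesis by blast
  qed
qed

text \<open>The geometric series inverts \<open>1 - a\<close> in the corner at \<open>e\<close>; the
  sums telescope.\<close>

lemma nilpotent_elim:
  assumes b: "b \<in> A" "e \<cdot> b = b" and e: "e \<in> A" and a: "a \<in> A" "e \<cdot> a = a" and n: "a \<up> (n::nat) \<cdot> e = 0"
  shows "(\<Sum>k<n. a \<up> k \<cdot> e) \<cdot> (b - a \<cdot> b) = b"
proof -
  have t: "a \<up> k \<cdot> e \<cdot> (b - a \<cdot> b) = a \<up> k \<cdot> b - a \<up> Suc k \<cdot> b" for k :: nat
  proof -
    have ad: "additive_on A (\<lambda>u. a \<up> k \<cdot> e \<cdot> u)" using a e by (simp add: additive_on_def G.R_distrib_right)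
    have "a \<up> k \<cdot> e \<cdot> (b - a \<cdot> b) = a \<up> k \<cdot> e \<cdot> b - a \<up> k \<cdot> e \<cdot> (a \<cdot> b)"
      using additive_on_diff[OF G.R_agrp ad b(1), of "a \<cdot> b"] a b by simp
    moreover have "e \<cdot> (a \<cdot> b) = a \<cdot> b" using a b e by (simp add: G.R.m_assoc[symmetric])
    ultimately show ?thesis using a b e by (simp add: G.R.m_assoc)
  qed
  have "(\<Sum>k<n. a \<up> k \<cdot> e) \<cdot> (b - a \<cdot> b) = (\<Sum>k<n. a \<up> k \<cdot> e \<cdot> (b - a \<cdot> b))"
    using a b e agrp_diff[OF G.R_agrp] by (intro G.R_sum_left) auto
  also have "\<dots> = a \<up> (0::nat) \<cdot> b - a \<up> n \<cdot> b" unfolding t by (rule sum_lessThan_telescope')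
  also have "a \<up> n \<cdot> b = a \<up> n \<cdot> e \<cdot> b" using a b e by (simp add: G.R.m_assoc)
  also have "a \<up> (0::nat) \<cdot> b - a \<up> n \<cdot> e \<cdot> b = b" using n b by simp
  finally show ?thesis .
qed

text \<open>If all \<open>ph i\<close> fail to be surjective, then each \<open>ph i (b i)\<close> is nilpotent, and the elements \<open>b i\<close> can be
  eliminated from the dual basis one at a time.\<close>

lemma dual_basis_surjection:
  assumes W: "Smod W" "W \<subseteq> A" "W \<noteq> {0}" and I: "finite I"
    and lam: "\<And>i. i \<in> I \<Longrightarrow> lam i \<in> Lam" and b: "\<And>i. i \<in> I \<Longrightarrow> b i \<in> W" "\<And>i. i \<in> I \<Longrightarrow> index_idempotent (lam i) \<cdot> b i = b i"
    and phi: "\<And>i. i \<in> I \<Longrightarrow> Slin W (Se (lam i)) (ph i)"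
    and sum: "\<And>w. w \<in> W \<Longrightarrow> w = (\<Sum>i\<in>I. ph i w \<cdot> b i)"
  shows "\<exists>i\<in>I. \<exists>\<rho>. Slin W (Se (lam i)) \<rho> \<and> \<rho> ` W = Se (lam i)"
  using I lam b phi sum
proof (induction I arbitrary: ph)
  case empty
  have "w = 0" if "w \<in> W" for w using empty.prems(5)[OF that] by (simp only: sum.empty)
  then have "W \<subseteq> {0}" by blast
  then show ?case using W(3) agrp_zero[OF G.smod_agrp[OF W(1)]] by blast
next
  case (insert t I)
  let ?e = "index_idempotent (lam t)"
  have l: "lam t \<in> Lam" and bt: "b t \<in> W" "?e \<cdot> b t = b t" and ft: "Slin W (Se (lam t)) (ph t)"
    using insert.prems by auto
  have btA: "b t \<in> A" using bt W(2) by blast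
  have SeS: "s \<in> S" if "s \<in> Se m" for s m using that by (simp add: Se_def)
  define a where "a = ph t (b t)"
  have aSe: "a \<in> Se (lam t)" unfolding a_def by (rule G.slin_closed[OF ft bt(1)])
  have aS: "a \<in> S" and ae: "a \<cdot> ?e = a" using aSe by (auto simp: Se_def)
  have ea: "?e \<cdot> a = a" unfolding a_def using G.slin_act[OF ft idem_S[OF l] bt(1)] bt(2) by simp
  from nilpotent_or_invertible[OF l aS ea ae] show ?case
  proof (elim disjE exE bexE)
    \<comment> \<open>A left inverse \<open>c\<close> of \<open>a\<close> exhibits every
      \<open>s\<close> in \<open>Se (lam t)\<close> as the value of \<open>ph t\<close> at
      \<open>(s \<cdot> c) \<cdot> b t\<close>.\<close>
    fix c assume c: "c \<in> S" "c \<cdot> a = ?e"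
    have "s \<in> ph t ` W" if s: "s \<in> Se (lam t)" for s
    proof -
      have "ph t ((s \<cdot> c) \<cdot> b t) = (s \<cdot> c) \<cdot> a" unfolding a_def by (rule G.slin_act[OF ft S_mult[OF SeS[OF s] c(1)] bt(1)])
      also have "\<dots> = s" using s c S_sub aS by (simp add: G.R.m_assoc Se_def)
      finally show ?thesis using G.smod_closed[OF W(1) S_mult[OF SeS[OF s] c(1)] bt(1)] by (metis imageI)
    qed
    then have "ph t ` W = Se (lam t)" using G.slin_closed[OF ft] by blast
    then show ?case using ft by blast
  next
    fix n :: nat assume n: "a \<up> n \<cdot> ?e = 0"
    define c where "c = (\<Sum>k<n. a \<up> k \<cdot> ?e)"
    have cS: "c \<in> S" unfolding c_def by (intro agrp_sum[OF G.deg_grp] S_mult S_pow aS idem_S[OF l])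
    have cA: "c \<in> A" by (rule S_sub[OF cS])
    have f: "ph i w \<in> Se (lam i)" "ph i w \<in> S" "ph i w \<in> A" if "i \<in> insert t I" "w \<in> W" for i w
      using G.slin_closed[OF insert.prems(4)[OF that(1)] that(2)] SeS S_sub by auto
    have bA: "b i \<in> A" if "i \<in> I" for i using insert.prems(2)[of i] that W(2) by blast
    have tA: "ph i w \<cdot> b i \<in> A" if "i \<in> I" "w \<in> W" for i w using f(3) bA that by simp
    have split: "w = ph t w \<cdot> b t + (\<Sum>i\<in>I. ph i w \<cdot> b i)" if "w \<in> W" for w
      by (rule trans[OF insert.prems(5)[OF that]]) (rule sum.insert[OF insert.hyps])
    \<comment> \<open>The expansion of \<open>b t\<close> itself, with the term at \<open>t\<close>
      moved to the other side: applying the geometric series \<open>c\<close> then expresses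
      \<open>b t\<close> through the remaining elements.\<close>
    have "(\<Sum>i\<in>I. ph i (b t) \<cdot> b i) = b t - a \<cdot> b t"
      unfolding eq_diff_eq using split[OF bt(1), folded a_def, symmetric] by (simp only: add.commute)
    then have cb: "c \<cdot> (\<Sum>i\<in>I. ph i (b t) \<cdot> b i) = b t"
      unfolding c_def using nilpotent_elim[OF btA bt(2) idem_A[OF l] S_sub[OF aS] ea n] by simp
    \<comment> \<open>The functionals after substituting that expression for \<open>b t\<close> in
      the expansion of an arbitrary \<open>w\<close>.\<close>
    define \<psi> where "\<psi> i w = ph i w + ph t w \<cdot> c \<cdot> ph i (b t)" for i w
    have "\<exists>i\<in>I. \<exists>\<rho>. Slin W (Se (lam i)) \<rho> \<and> \<rho> ` W = Se (lam i)"
    proof (rule insert.IH)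
      show "w = (\<Sum>i\<in>I. \<psi> i w \<cdot> b i)" if w: "w \<in> W" for w
      proof -
        have "w = ph t w \<cdot> b t + (\<Sum>i\<in>I. ph i w \<cdot> b i)" by (rule split[OF w])
        also have "ph t w \<cdot> b t = ph t w \<cdot> c \<cdot> (\<Sum>i\<in>I. ph i (b t) \<cdot> b i)"
        proof -
          have "(\<Sum>i\<in>I. ph i (b t) \<cdot> b i) \<in> A" using tA[OF _ bt(1)] by (intro agrp_sum[OF G.R_agrp])
          then show ?thesis using cb cA f(3)[OF _ w] by (simp add: G.R.m_assoc)
        qed
        also have "\<dots> = (\<Sum>i\<in>I. ph t w \<cdot> c \<cdot> (ph i (b t) \<cdot> b i))"
          using f(3)[OF _ w] cA tA[OF _ bt(1)] by (intro G.R_sum_right) auto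
        also have "(\<Sum>i\<in>I. ph t w \<cdot> c \<cdot> (ph i (b t) \<cdot> b i)) + (\<Sum>i\<in>I. ph i w \<cdot> b i) = (\<Sum>i\<in>I. \<psi> i w \<cdot> b i)"
          unfolding sum.distrib[symmetric] using f(3)[OF _ w] f(3)[OF _ bt(1)] cA bA
          by (intro sum.cong refl) (simp add: \<psi>_def G.R_distrib_left G.R.m_assoc add.commute)
        finally show ?thesis .
      qed
      fix i assume i: "i \<in> I"
      note fi = insert.prems(4)[OF insertI2[OF i]] and Sm = Se_smod[OF insert.prems(1)[OF insertI2[OF i]]]
      show "Slin W (Se (lam i)) (\<psi> i)"
        unfolding G.slin_def additive_on_def
      proof (intro conjI ballI)
        fix w assume w: "w \<in> W"
        have q: "ph t w \<cdot> c \<cdot> ph i (b t) \<in> Se (lam i)" using G.smod_closed[OF Sm S_mult[OF f(2)[OF insertI1 w] cS] f(1)[OF insertI2[OF i] bt(1)]] .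
        show "\<psi> i w \<in> Se (lam i)" unfolding \<psi>_def by (rule agrp_add[OF G.smod_agrp[OF Sm] f(1)[OF insertI2[OF i] w] q])
        note A = f(3)[OF insertI1 w] f(3)[OF insertI2[OF i] w] cA f(3)[OF insertI2[OF i] bt(1)]
        show "\<psi> i (w + v) = \<psi> i w + \<psi> i v" if v: "v \<in> W" for v
          unfolding \<psi>_def additive_onD[OF G.slin_additive[OF fi] w v] additive_onD[OF G.slin_additive[OF ft] w v]
          using A f(3)[OF insertI1 v] by (simp add: G.R_distrib_left)
        show "\<psi> i (s \<cdot> w) = s \<cdot> \<psi> i w" if s: "s \<in> S" for s
          using G.slin_act[OF fi s w] G.slin_act[OF ft s w] A S_sub[OF s] by (simp add: \<psi>_def G.R_distrib_right G.R.m_assoc)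
      qed
    qed (use insert.prems in auto)
    then show ?case by blast
  qed
qed

text \<open>A dual basis over \<open>S\<close> has functionals into \<open>S\<close> only. Splitting
  the identity of \<open>y\<close> into primitive idempotents refines it to pairs, whose functionals
  take values in the modules \<open>Se l\<close>, as \<open>dual_basis_surjection\<close>
  requires.\<close>

lemma corner_surjection:
  assumes W: "Smod W" "W \<subseteq> A" "W \<noteq> {0}" and sp: "Sproj W" and y: "y \<in> Ob"
    and u: "\<And>w. w \<in> W \<Longrightarrow> single y y (Ident y) \<cdot> w = w"
  shows "\<exists>l\<in>Lam. fst l = y \<and> (\<exists>\<rho>. Slin W (Se l) \<rho> \<and> \<rho> ` W = Se l)"
proof -
  obtain n :: nat and b ph where D: "G.dual_basis W (mult R) {..<n} b ph" using sp by (auto simp: G.sproj_def)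
  have Ey: "(y, e) \<in> Lam" if "e \<in> E y" for e using that y by (simp add: strat_index_def)
  have fE: "finite (E y)" using E y by (simp add: complete_primitive_idempotents_def)
  define I where "I = {..<n} \<times> E y"
  define e where "e p = index_idempotent (y, snd p)" for p :: "nat \<times> 'a"
  have lam: "(y, snd p) \<in> Lam" if "p \<in> I" for p using that Ey by (auto simp: I_def)
  have eS: "e p \<in> S" and eA: "e p \<in> A" and ee: "e p \<cdot> e p = e p" if "p \<in> I" for p
    using idem_S[OF lam[OF that]] idem_A[OF lam[OF that]] idem_idem[OF lam[OF that]] by (simp_all add: e_def)
  have bW: "b (fst p) \<in> W" and fl: "Slin W S (ph (fst p))" if "p \<in> I" for p
    using that G.dual_basis_elem[OF D] G.dual_basis_slin[OF D] by (auto simp: I_def)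
  have "\<exists>p\<in>I. \<exists>\<rho>. Slin W (Se (y, snd p)) \<rho> \<and> \<rho> ` W = Se (y, snd p)"
  proof (rule dual_basis_surjection[OF W, where b = "\<lambda>p. e p \<cdot> b (fst p)" and ph = "\<lambda>p w. ph (fst p) w \<cdot> e p"])
    show "finite I" using fE by (simp add: I_def)
    show "w = (\<Sum>p\<in>I. ph (fst p) w \<cdot> e p \<cdot> (e p \<cdot> b (fst p)))" if w: "w \<in> W" for w
    proof -
      have "(\<Sum>p\<in>I. ph (fst p) w \<cdot> e p \<cdot> (e p \<cdot> b (fst p))) = (\<Sum>p\<in>I. ph (fst p) w \<cdot> (e p \<cdot> b (fst p)))"
      proof (intro sum.cong refl)
        fix p assume p: "p \<in> I"
        have "ph (fst p) w \<in> A" "b (fst p) \<in> A" using S_sub[OF G.slin_closed[OF fl[OF p] w]] bW[OF p] W(2) by auto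
        then show "ph (fst p) w \<cdot> e p \<cdot> (e p \<cdot> b (fst p)) = ph (fst p) w \<cdot> (e p \<cdot> b (fst p))"
          using eA[OF p] ee[OF p] by (simp add: G.R.m_assoc G.R.m_assoc[of "e p" "e p", symmetric])
      qed
      also have "\<dots> = (\<Sum>i<n. \<Sum>f\<in>E y. ph i w \<cdot> (index_idempotent (y, f) \<cdot> b i))"
        unfolding I_def e_def by (simp add: sum.cartesian_product case_prod_beta)
      also have "\<dots> = (\<Sum>i<n. ph i w \<cdot> b i)"
      proof (intro sum.cong refl)
        fix i assume i: "i \<in> {..<n}"
        have A: "ph i w \<in> A" "b i \<in> A" using S_sub[OF G.dual_basis_closed[OF D i w]] G.dual_basis_elem[OF D i] W(2) by auto
        have "(\<Sum>f\<in>E y. ph i w \<cdot> (index_idempotent (y, f) \<cdot> b i)) = ph i w \<cdot> (\<Sum>f\<in>E y. index_idempotent (y, f) \<cdot> b i)"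
          using A idem_A[OF Ey] by (intro G.R_sum_right[symmetric]) auto
        also have "(\<Sum>f\<in>E y. index_idempotent (y, f) \<cdot> b i) = (\<Sum>f\<in>E y. index_idempotent (y, f)) \<cdot> b i"
          using A idem_A[OF Ey] by (intro G.R_sum_left[symmetric]) auto
        finally show "(\<Sum>f\<in>E y. ph i w \<cdot> (index_idempotent (y, f) \<cdot> b i)) = ph i w \<cdot> b i"
          using u[OF G.dual_basis_elem[OF D i]] by (simp add: idem_sum_at[OF y])
      qed
      also have "\<dots> = w" by (rule G.dual_basis_sum[OF D w])
      finally show ?thesis by simp
    qed
    fix p assume p: "p \<in> I"
    show "(y, snd p) \<in> Lam" by (rule lam[OF p])
    show "e p \<cdot> b (fst p) \<in> W" by (rule G.smod_closed[OF W(1) eS[OF p] bW[OF p]])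
    show "index_idempotent (y, snd p) \<cdot> (e p \<cdot> b (fst p)) = e p \<cdot> b (fst p)"
      using ee[OF p] eA[OF p] bW[OF p] W(2) unfolding e_def[symmetric] by (auto simp: G.R.m_assoc[symmetric])
    show "Slin W (Se (y, snd p)) (\<lambda>w. ph (fst p) w \<cdot> e p)"
      by (rule G.slin_compose[OF fl[OF p] right_mult_slin[OF eA[OF p]]])
        (auto simp: S_sub e_def mult_idem_Se[OF lam[OF p]])
  qed
  then obtain p \<rho> where p: "p \<in> I" "Slin W (Se (y, snd p)) \<rho>" "\<rho> ` W = Se (y, snd p)" by blast
  then show ?thesis using lam[OF p(1)] by (intro bexI[of _ "(y, snd p)"]) auto
qed

section \<open>Splitting off standard modules\<close>

lemma unit_mult:
  assumes y: "y \<in> Ob" and u: "u \<in> A"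
  shows "(single y y (Ident y) \<cdot> u) x z = (if z = y then u x z else 0)"
proof -
  have iS: "single y y (Ident y) \<in> S" by (rule single_S[OF y ident_closed[OF y]])
  show ?thesis
    using zero_part_mult[OF iS u, of x z] y comp_ident_left[of x y] comp_zero(2)[of x z z] families_hom[OF u, of x z]
      families_out[OF u, of x z] by (auto simp: single_def)
qed

text \<open>Elements of \<open>S\<close> have entries on the diagonal only, so the identity of an
  object commutes with them, and multiplication by it is linear over \<open>S\<close>.\<close>

lemma unit_central:
  assumes y: "y \<in> Ob" and s: "s \<in> S" and u: "u \<in> A"
  shows "single y y (Ident y) \<cdot> (s \<cdot> u) = s \<cdot> (single y y (Ident y) \<cdot> u)"
proof (intro ext)
  fix x z
  have iA: "single y y (Ident y) \<in> A" by (rule single_carrier[OF y y ident_closed[OF y]])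
  show "(single y y (Ident y) \<cdot> (s \<cdot> u)) x z = (s \<cdot> (single y y (Ident y) \<cdot> u)) x z"
    using unit_mult[OF y, of "s \<cdot> u" x z] unit_mult[OF y u, of x z] zero_part_mult[OF s u, of x z]
      zero_part_mult[OF s, of "single y y (Ident y) \<cdot> u" x z] comp_zero(1)[of x z z "s z z"] families_hom[OF S_sub[OF s], of z z]
      S_sub[OF s] u iA by auto
qed

lemma standard_top:
  assumes U: "asub U" and sp: "Sproj U" and n: "U \<noteq> {0}"
  shows "\<exists>F l. asub F \<and> F \<subset> U \<and> Sproj F \<and> l \<in> Lam \<and>
    lmod_isomorphic R (quotient_module (Arec U) F) (standard_module C r E l)"
proof -
  let ?X = "Ob"
  \<comment> \<open>The objects at which some element of \<open>U\<close> has a nonzero entry, that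
    is, where the identity does not annihilate \<open>U\<close>.\<close>
  define Y where "Y = {y \<in> ?X. \<exists>u\<in>U. \<exists>x. u x y \<noteq> 0}"
  have UA: "u \<in> A" if "u \<in> U" for u by (rule asubD(2)[OF U that])
  obtain u0 where u0: "u0 \<in> U" "u0 \<noteq> 0" using n agrp_zero[OF asubD(1)[OF U]] by blast
  then obtain x0 y0 where "u0 x0 y0 \<noteq> 0" by (auto simp: fun_eq_iff)
  then have "y0 \<in> Y" using families_out[OF UA[OF u0(1)], of x0 y0] u0(1) by (auto simp: Y_def)
  moreover have "finite Y" using finite_obj by (simp add: Y_def)
  moreover have "asymp_on Y (\<lambda>a b. (a, b) \<in> r \<and> a \<noteq> b)" "transp_on Y (\<lambda>a b. (a, b) \<in> r \<and> a \<noteq> b)"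
    using partial_order unfolding partial_order_on_def preorder_on_def antisym_def trans_def
    by (auto intro!: asymp_onI transp_onI; blast)+
  ultimately obtain y where y: "y \<in> Y" "\<forall>x\<in>Y. x \<noteq> y \<longrightarrow> \<not> ((x, y) \<in> r \<and> x \<noteq> y)"
    using Finite_Set.bex_min_element[of Y "\<lambda>a b. (a, b) \<in> r \<and> a \<noteq> b"] by blast
  have yX: "y \<in> ?X" using y(1) by (simp add: Y_def)
  have low: "u x z = 0" if "u \<in> U" "z \<in> ?X" "(z, y) \<in> r" "z \<noteq> y" for u x z
    using y(2) that by (auto simp: Y_def)
  define i where "i = single y y (Ident y)"
  have iS: "i \<in> S" and iA: "i \<in> A" unfolding i_def using single_S[OF yX ident_closed[OF yX]] S_sub by auto
  have iu: "(i \<cdot> u) x z = (if z = y then u x z else 0)" if "u \<in> A" for u x z unfolding i_def by (rule unit_mult[OF yX that])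
  have ii: "i \<cdot> (i \<cdot> u) = i \<cdot> u" if "u \<in> A" for u using iu that iA by (simp add: fun_eq_iff)
  define W where "W = (\<lambda>u. i \<cdot> u) ` U"
  have WU: "W \<subseteq> U" using asubD(3)[OF U iA] by (auto simp: W_def)
  have iW: "i \<cdot> w = w" if "w \<in> W" for w using that ii UA by (auto simp: W_def)
  have il: "Slin U W (\<lambda>u. i \<cdot> u)"
    using unit_central[OF yX] UA iA by (auto simp: G.slin_def additive_on_def G.R_distrib_right W_def i_def)
  have gW: "agrp W" unfolding W_def by (rule agrp_image[OF asubD(1)[OF U] G.slin_additive[OF il]])
  have sW: "Smod W"
  proof (rule smodI[OF gW])
    show "W \<subseteq> A" using WU UA by blast
    show "a \<cdot> w \<in> W" if "a \<in> S" "w \<in> W" for a w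
    proof -
      obtain v where v: "v \<in> U" "w = i \<cdot> v" using \<open>w \<in> W\<close> by (auto simp: W_def)
      have "a \<cdot> w = i \<cdot> (a \<cdot> v)" using unit_central[OF yX \<open>a \<in> S\<close> UA[OF v(1)]] v(2) by (simp add: i_def)
      then show ?thesis using asubD(3)[OF U S_sub[OF \<open>a \<in> S\<close>] v(1)] by (simp add: W_def)
    qed
  qed
  have pW: "Sproj W" 
    by (rule G.sproj_retract[OF sW asub_smod[OF U] sp incl_slin[OF WU] il]) (rule iW)
  have nW: "W \<noteq> {0}"
  proof -
    obtain u x where u: "u \<in> U" "u x y \<noteq> 0" using y(1) by (auto simp: Y_def)
    then have "(i \<cdot> u) x y \<noteq> 0" using iu[OF UA[OF u(1)]] by simp
    then have "i \<cdot> u \<noteq> 0" by auto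
    then show ?thesis using u(1) by (auto simp: W_def)
  qed
  obtain l \<rho> where l: "l \<in> Lam" "fst l = y" and rho: "Slin W (Se l) \<rho>" "\<rho> ` W = Se l"
    using corner_surjection[OF sW _ nW pW yX] WU UA iW unfolding i_def by blast
  define \<Psi> where "\<Psi> u = \<rho> (i \<cdot> u)" for u
  have Pl: "Slin U (Se l) \<Psi>" unfolding \<Psi>_def by (rule G.slin_compose[OF il rho(1)])
  have Ps: "\<Psi> ` U = Se l" using rho(2) by (simp add: \<Psi>_def W_def image_image)
  have Pa: "\<Psi> (a \<cdot> u) = diag (fst l) a \<cdot> \<Psi> u" if a: "a \<in> A" and u: "u \<in> U" for a u
  proof -
    have dS: "diag y a \<in> S" by (rule diag_S[OF yX a])
    \<comment> \<open>Minimality of \<open>y\<close> enters here: the part of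
      \<open>a \<cdot> u\<close> at \<open>y\<close> comes only from the part of \<open>u\<close> at
      \<open>y\<close>, because \<open>u\<close> vanishes at all smaller objects.\<close>
    have "i \<cdot> (a \<cdot> u) = diag y a \<cdot> (i \<cdot> u)"
    proof (intro ext)
      fix x z
      have uA: "u \<in> A" "a \<cdot> u \<in> A" "i \<cdot> u \<in> A" using UA[OF u] a iA by auto
      show "(i \<cdot> (a \<cdot> u)) x z = (diag y a \<cdot> (i \<cdot> u)) x z"
      proof (cases "x \<in> ?X \<and> z \<in> ?X")
        case True
        have "(a \<cdot> u) x y = Comp x y y (a y y) (u x y)"
          by (rule mult_diag[OF yX a uA(1) low[OF u]]) (use True in auto)
        then show ?thesis
          using True iu[OF uA(2), of x z] iu[OF uA(1), of x z] zero_part_mult[OF dS uA(3), of x z]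
            comp_zero(2)[of x z z 0] agrp_zero[OF hom_agrp[of x z]] by (auto simp: diag_def single_def)
      qed (auto simp: R_mult)
    qed
    then show ?thesis using G.slin_act[OF rho(1) dS G.slin_closed[OF il u]] l(2) by (simp add: \<Psi>_def)
  qed
  define F where "F = {u \<in> U. \<Psi> u = 0}"
  note gU = asubD(1)[OF U] and ad = G.slin_additive[OF Pl]
  have FU: "F \<subseteq> U" by (auto simp: F_def)
  have "asub F"
    unfolding asub_def agrp_def
  proof (intro conjI ballI)
    show "0 \<in> F" using agrp_zero[OF gU] additive_on_zero[OF gU ad] by (simp add: F_def)
    show "u + v \<in> F" if "u \<in> F" "v \<in> F" for u v using that agrp_add[OF gU] additive_onD[OF ad] by (simp add: F_def)
    show "- u \<in> F" if "u \<in> F" for u using that agrp_minus[OF gU] additive_on_minus[OF gU ad] by (simp add: F_def)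
    show "F \<subseteq> A" using UA FU by blast
    show "a \<cdot> u \<in> F" if "a \<in> A" "u \<in> F" for a u
      using that Pa asubD(3)[OF U] S_sub[OF diag_S] Lam[OF l(1)] by (simp add: F_def)
  qed
  \<comment> \<open>Properness ensures that the rank drops; it holds because the nonzero idempotent
    lies in the image of \<open>\<Psi>\<close>.\<close>
  moreover have "F \<noteq> U"
  proof
    assume "F = U"
    then have "Se l \<subseteq> {0}" unfolding Ps[symmetric] by (auto simp: F_def)
    moreover have "index_idempotent l \<in> Se l" using idem_S[OF l(1)] idem_idem[OF l(1)] by (simp add: Se_def)
    ultimately have "index_idempotent l (fst l) (fst l) = 0" by auto
    then show False using Lam_prim[OF l(1)] by (simp add: idem_single single_def primitive_idempotent_def)
  qed
  moreover have "Sproj F" unfolding F_def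
    by (rule G.sproj_kernel[OF asub_smod[OF U] sp Se_smod[OF l(1)] Se_sproj[OF l(1)] Pl]) (unfold Ps[symmetric], blast)
  moreover have "lmod_isomorphic R (quotient_module (Arec U) F) (standard_module C r E l)"
    by (rule standard_quotientI[OF U \<open>asub F\<close> FU l(1) ad Ps _ Pa]) (auto simp: F_def)
  ultimately show ?thesis using FU l(1) by blast
qed

text \<open>Peel off a standard quotient from the top and recurse into its kernel, which is again an
  \<open>A\<close>-submodule, projective over \<open>S\<close> and of smaller rank.\<close>

lemma standard_filtration_exists:
  assumes "asub U" "Sproj U"
  shows "\<exists>(n::nat) F. F 0 = {0} \<and> F n = U \<and> (\<forall>j\<le>n. asub (F j) \<and> F j \<subseteq> U) \<and>
    (\<forall>j<n. F j \<subseteq> F (Suc j) \<and> (\<exists>m\<in>Lam. lmod_isomorphic R (quotient_module (Arec (F (Suc j))) (F j)) (standard_module C r E m)))"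
proof -
  obtain \<mu> :: "('o \<Rightarrow> 'o \<Rightarrow> 'a) set \<Rightarrow> nat" where m: "\<forall>U U'. W.subspace U \<and> U \<subset> U' \<and> U' \<subseteq> A \<longrightarrow> \<mu> U < \<mu> U'"
    using rank_exists by (elim exE)
  show ?thesis using assms
  proof (induction "\<mu> U" arbitrary: U rule: less_induct)
    case less
    show ?case
    proof (cases "U = {0}")
      case True
      then show ?thesis using less.prems(1) by (intro exI[of _ 0] exI[of _ "\<lambda>_. {0}"]) simp
    next
      case False
      obtain F' l where F': "asub F'" "F' \<subset> U" "Sproj F'" "l \<in> Lam"
        "lmod_isomorphic R (quotient_module (Arec U) F') (standard_module C r E l)"
        using standard_top[OF less.prems False] by (elim exE conjE)
      have "U \<subseteq> A" using asubD(2)[OF less.prems(1)] by blast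
      then have "\<mu> F' < \<mu> U" using m[rule_format, of F' U] asub_subspace[OF F'(1)] F'(2) by blast
      from less.hyps[OF this F'(1,3)] obtain n :: nat and F where F: "F 0 = {0}" "F n = F'" "\<forall>j\<le>n. asub (F j) \<and> F j \<subseteq> F'"
        "\<forall>j<n. F j \<subseteq> F (Suc j) \<and> (\<exists>m\<in>Lam. lmod_isomorphic R (quotient_module (Arec (F (Suc j))) (F j)) (standard_module C r E m))"
        by (elim exE conjE)
      \<comment> \<open>The filtration of the kernel, with \<open>U\<close> appended as the last
        term.\<close>
      let ?F = "\<lambda>j. if j \<le> n then F j else U"
      have c1: "asub (?F j) \<and> ?F j \<subseteq> U" for j using F(3) F'(2) less.prems(1) by auto
      have c2: "?F j \<subseteq> ?F (Suc j) \<and> (\<exists>m\<in>Lam. lmod_isomorphic R (quotient_module (Arec (?F (Suc j))) (?F j)) (standard_module C r E m))"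
        if "j < Suc n" for j
      proof (cases "j < n")
        case True then show ?thesis using F(4)[rule_format, of j] by simp
      next
        case f: False
        then have "j = n" using that by simp
        then show ?thesis using F(2) F'(2,4,5) by auto
      qed
      show ?thesis using c1 c2 F(1) by (intro exI[of _ "Suc n"] exI[of _ ?F] conjI allI impI) auto
    qed
  qed
qed

theorem standardly_stratified_iff: "standardly_stratified C r E \<longleftrightarrow> (\<forall>d. Sproj (Rd d))"
  unfolding sproj_parts_iff
proof
  assume "standardly_stratified C r E"
  then show "\<forall>l\<in>Lam. Sproj (P l)" using standard_filtration_sproj by (simp add: standardly_stratified_def)
next
  assume s: "\<forall>l\<in>Lam. Sproj (P l)"
  show "standardly_stratified C r E" unfolding standardly_stratified_def
  proof
    fix l assume l: "l \<in> Lam"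
    obtain n :: nat and F where F: "F 0 = {0}" "F n = P l" "\<forall>j\<le>n. asub (F j) \<and> F j \<subseteq> P l"
      "\<forall>j<n. F j \<subseteq> F (Suc j) \<and> (\<exists>m\<in>Lam. lmod_isomorphic R (quotient_module (Arec (F (Suc j))) (F j)) (standard_module C r E m))"
      using standard_filtration_exists[OF P_asub[OF l] s[rule_format, OF l]] by (elim exE conjE)
    show "has_standard_filtration C r E (strat_projective C l)"
      unfolding has_standard_filtration_def strat_projective_eq[OF l]
      using F submodule_iff[OF P_asub[OF l]] by (intro exI[of _ n] exI[of _ F]) simp
  qed
qed

end

theorem theorem1p3:
  fixes C D :: "('k::alg_closed_field, 'o, 'a::ab_group_add) graded_category"
    and r :: "'o rel"
  assumes "graded_directed_category C r"
    and "self_injective (degree_zero_algebra (category_algebra C))"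
    and "D = scalar_endo_subcategory C"
  shows "(\<forall>E. complete_primitive_idempotents C E \<longrightarrow>
           (koszul_category C \<longleftrightarrow> standardly_stratified C r E \<and> koszul_category D)) \<and>
         (koszul_category C \<longrightarrow>
           (\<forall>M :: ('o \<Rightarrow> 'o \<Rightarrow> 'a, 'm) gmodule.
             graded_left_module (category_algebra C) M \<longrightarrow>
             (koszul_module (category_algebra C) M \<longleftrightarrow>
               projective_module (degree_zero_algebra (category_algebra C)) M \<and>
               koszul_module (category_algebra D) M)))"
proof -
  interpret graded_directed_category C r by fact
  have "koszul_category C \<longleftrightarrow> standardly_stratified C r E \<and> koszul_category (scalar_endo_subcategory C)"
    if E: "complete_primitive_idempotents C E" for E
  proof -
    interpret stratification C r E by unfold_locales (rule E)
    show ?thesis using koszul_category_iff[OF assms(2)] standardly_stratified_iff by blast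
  qed
  then show ?thesis using koszul_module_iff[OF assms(2)] unfolding assms(3) by blast
qed

end
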